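(* Let $1\le l\le L-1$, let $l'$ be an odd integer with $l'\equiv l\bmod L$, and let $k\in\mathbb{Z}$. Then on the Fock space $\mathcal{F}_{l',k}$ the BRST charges satisfy $$Q_l\,Q_{L-l}=0 .$$
   Context: Fix an odd integer $L\ge 3$ and $0<x<1$; put $r=2\frac{L+1}{L+2}$ (so $r-1=\frac{L}{L+2}$). Multiplicative and additive variables are related by $z=x^{2u}$, $z_j=x^{2u_j}$, and $\underline{dz}=\frac{dz}{2\pi i z}$. Set $(z;p)_\infty=\prod_{n\ge0}(1-p^nz)$, $\Theta_p(z)=(z;p)_\infty(pz^{-1};p)_\infty(p;p)_\infty$, $[n]_x=\frac{x^n-x^{-n}}{x-x^{-1}}$, and $$[u]^*=x^{\frac{u^2}{r-1}-u}\,\Theta_{x^{2r-2}}(x^{2u}).$$ Bosons: oscillators $\alpha_n$ ($n\neq0$) and $P,Q$ with $[\alpha_n,\alpha_m]=\frac{[n]_x([2n]_x-[n]_x)}{n}\frac{[rn]_x}{[(r-1)n]_x}\delta_{n+m,0}$, $[P,iQ]=1$, and $P,Q$ commuting with the $\alpha_n$. For integers $l,k$ the Fock space is $\mathcal{F}_{l,k}=\mathbb{C}[\alpha_{-1},\alpha_{-2},\dots]|l,k\rangle$, where $\alpha_n|l,k\rangle=0$ for $n>0$, $|l,k\rangle=e^{p_{l,k}iQ}|0,0\rangle$, $P|l,k\rangle=p_{l,k}|l,k\rangle$, $p_{l,k}=-\frac l2\sqrt{\frac r{r-1}}+k\sqrt{\frac{r-1}r}$. The operator $\hat l$ acts on $\mathcal{F}_{l,k}$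 as the scalar $l$. The colons $:\ :$ denote normal ordering ($\alpha_n$, $n>0$, to the right). Current: $x_+(z):\mathcal{F}_{l,k}\to\mathcal{F}_{l-2,k}$, $$x_+(z)=\;:\exp\Bigl(-\sum_{n\ne0}\frac{\alpha_n}{[n]_x}z^{-n}\Bigr):\;e^{\sqrt{\frac r{r-1}}\,iQ}\,z^{\sqrt{\frac r{r-1}}P+\frac{r}{2(r-1)}}.$$ Products $x_+(z_1)\cdots x_+(z_n)$ are understood as the meromorphic continuation (of matrix elements) from the region $|z_1|\gg|z_2|\gg\cdots$. BRST charges: define $$Q_1=\oint_{|z|=1}\underline{dz}\;x_+(z)\frac{[u+\hat l/2]^*}{[u+1/2]^*},$$ $$Q_2^{(a)}=\oint\oint_{|z_1|=|z_2|=1}\underline{dz}_1\underline{dz}_2\;x_+(z_1)x_+(z_2)\frac{1}{[u_1+\frac12]^*[u_2+\frac12]^*}\,\frac{[u_1-u_2]^*}{[u_1-u_2+1]^*[u_1-u_2-\frac12]^*}\,f_2^{(a)}\bigl(u_1+\tfrac{\hat l}2,u_2+\tfrac{\hat l}2\bigr),$$ where $$f_2^{(a)}(u_1,u_2)=[2a+1]^*[a-\tfrac12]^*[u_1-a]^*[u_2+a-1]^*[u_1-u_2+a-\tfrac12]^*-[2a-1]^*[a+\tfrac12]^*[u_1+a]^*[u_2-a-1]^*[u_1-u_2-a-\tfrac12]^*.$$ In products of such operators (in particular in $Q_lQ_{L-l}$), the integrand is the meromorphic continuation of the product of integrands and all variables are integrated over the unit circle; these operators mutually commute. For $1\le l\le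 L-1$, $$Q_l=Q_1Q_2^{(1)}\cdots Q_2^{(m)}\ \ (l=2m+1),\qquad Q_l=Q_2^{((L+1)/2-m)}\cdots Q_2^{((L-3)/2)}Q_2^{((L-1)/2)}\ \ (l=2m).$$ *)

theory Defs
  imports
    "HOL-Analysis.Analysis"
    "HOL-Library.Poly_Mapping"
    "HOL-Number_Theory.Cong"
begin

definition rpar :: "nat \<Rightarrow> real" where
  "rpar L = 2 * (real L + 1) / (real L + 2)"

subsection \<open>Theta functions in the additive variable\<close>

text \<open>
  All functions are written in the additive variable \<open>u\<close>, where \<open>z = x\<^sup>2\<^sup>u\<close>, so that
  \<open>z\<^sup>s\<close> means \<open>x\<^sup>2\<^sup>u\<^sup>s\<close> and no branch of a logarithm has to be chosen.
\<close>

definition xpow :: "real \<Rightarrow> complex \<Rightarrow> complex" where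
  "xpow x u = complex_of_real x powr u"

definition zpow :: "real \<Rightarrow> complex \<Rightarrow> real \<Rightarrow> complex" where
  "zpow x u s = xpow x (2 * u * of_real s)"

definition qpoch :: "complex \<Rightarrow> complex \<Rightarrow> complex" where
  "qpoch p z = prodinf (\<lambda>n. 1 - p ^ n * z)"

definition Theta :: "complex \<Rightarrow> complex \<Rightarrow> complex" where
  "Theta p z = qpoch p z * qpoch p (p / z) * qpoch p p"

definition qnum :: "real \<Rightarrow> real \<Rightarrow> real" where
  "qnum x a = (x powr a - x powr (- a)) / (x - inverse x)"

definition br :: "nat \<Rightarrow> real \<Rightarrow> complex \<Rightarrow> complex" where
  "br L x u =
     xpow x (u\<^sup>2 / of_real (rpar L - 1) - u)
       * Theta (of_real (x powr (2 * rpar L - 2))) (zpow x u 1)"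

subsection \<open>Fock spaces\<close>

text \<open>
  A monomial records occupation numbers: \<open>Poly_Mapping.lookup \<mu> i\<close> is the exponent of
  \<open>\<alpha>\<^sub>-\<^sub>(\<^sub>i\<^sub>+\<^sub>1\<^sub>)\<close>. Every \<open>\<F>\<^sub>l\<^sub>,\<^sub>k\<close> is a copy of the polynomial ring \<open>fock\<close>
  over the vacuum \<open>|l,k\<rangle>\<close>; the labels \<open>l, k\<close> are passed to the operators that depend on
  them. The modes of \<open>x\<^sub>+(z)\<close> have unbounded degree, so \<open>x\<^sub>+(z)\<close> takes values in the
  completion \<open>cfock\<close>, whose elements are arbitrary families of monomial coefficients.
\<close>

type_synonym mono = "nat \<Rightarrow>\<^sub>0 nat"
type_synonym fock = "mono \<Rightarrow>\<^sub>0 complex"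
type_synonym cfock = "mono \<Rightarrow> complex"

definition osc_coeff :: "nat \<Rightarrow> real \<Rightarrow> int \<Rightarrow> real" where
  "osc_coeff L x n =
     qnum x (of_int n) * (qnum x (2 * of_int n) - qnum x (of_int n)) / of_int n
       * (qnum x (rpar L * of_int n) / qnum x ((rpar L - 1) * of_int n))"

text \<open>
  For \<open>n < 0\<close>, \<open>\<alpha>\<^sub>n\<close> is multiplication by a variable; for \<open>n > 0\<close> it is the multiple of
  the partial derivative by \<open>\<alpha>\<^sub>-\<^sub>n\<close> that the commutation relation dictates. The value at
  \<open>n = 0\<close> is never used.
\<close>

definition alpha :: "nat \<Rightarrow> real \<Rightarrow> int \<Rightarrow> cfock \<Rightarrow> cfock" where
  "alpha L x n \<phi> =
     (if n < 0 then
        (\<lambda>\<mu>. let i = nat (- n) - 1 in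
           if Poly_Mapping.lookup \<mu> i = 0 then 0 else \<phi> (\<mu> - Poly_Mapping.single i 1))
      else if n > 0 then
        (\<lambda>\<mu>. let i = nat n - 1 in
           of_real (osc_coeff L x n) * of_nat (Poly_Mapping.lookup \<mu> i + 1)
             * \<phi> (\<mu> + Poly_Mapping.single i 1))
      else (\<lambda>_. 0))"

lemma alpha_commutator:
  assumes "n > 0" "m < 0"
  shows "alpha L x n (alpha L x m \<phi>) \<mu> - alpha L x m (alpha L x n \<phi>) \<mu> =
    (if n + m = 0 then of_real (osc_coeff L x n) * \<phi> \<mu> else 0)"
proof -
  define i j where "i = nat n - 1" and "j = nat (- m) - 1"
  have ij: "i = j \<longleftrightarrow> n + m = 0" using assms unfolding i_def j_def by auto
  let ?c = "complex_of_real (osc_coeff L x n)"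
  have 1: "alpha L x n (alpha L x m \<phi>) \<mu> =
     ?c * of_nat (Poly_Mapping.lookup \<mu> i + 1) *
     (if Poly_Mapping.lookup (\<mu> + Poly_Mapping.single i 1) j = 0 then 0
      else \<phi> (\<mu> + Poly_Mapping.single i 1 - Poly_Mapping.single j 1))"
    using assms by (simp add: alpha_def i_def j_def Let_def)
  have 2: "alpha L x m (alpha L x n \<phi>) \<mu> =
     (if Poly_Mapping.lookup \<mu> j = 0 then 0 else
      ?c * of_nat (Poly_Mapping.lookup (\<mu> - Poly_Mapping.single j 1) i + 1) *
        \<phi> (\<mu> - Poly_Mapping.single j 1 + Poly_Mapping.single i 1))"
    using assms by (simp add: alpha_def i_def j_def Let_def)
  show ?thesis
  proof (cases "i = j")
    case True
    have "Poly_Mapping.lookup \<mu> i \<noteq> 0 \<Longrightarrow>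
        \<mu> - Poly_Mapping.single i 1 + Poly_Mapping.single i 1 = \<mu>"
      by (rule poly_mapping_eqI) (auto simp: lookup_add lookup_minus lookup_single when_def)
    then show ?thesis using True ij 1 2
      by (auto simp: lookup_add lookup_minus lookup_single algebra_simps of_nat_diff)
  next
    case False
    have "Poly_Mapping.lookup \<mu> j \<noteq> 0 \<Longrightarrow>
        \<mu> - Poly_Mapping.single j 1 + Poly_Mapping.single i 1 =
        \<mu> + Poly_Mapping.single i 1 - Poly_Mapping.single j 1"
      using False
      by (intro poly_mapping_eqI) (auto simp: lookup_add lookup_minus lookup_single when_def)
    then show ?thesis using False ij 1 2
      by (auto simp: lookup_add lookup_minus lookup_single when_def)
  qed
qed

definition momentum :: "nat \<Rightarrow> int \<Rightarrow> int \<Rightarrow> real" where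
  "momentum L l k =
     - (of_int l / 2) * sqrt (rpar L / (rpar L - 1))
       + of_int k * sqrt ((rpar L - 1) / rpar L)"

text \<open>The factor \<open>e\<^bsup>\<surd>(r/(r-1)) iQ\<^esup>\<close> maps \<open>|l,k\<rangle>\<close> to \<open>|l-2,k\<rangle>\<close>.\<close>

lemma momentum_shift:
  "momentum L (l - 2) k = momentum L l k + sqrt (rpar L / (rpar L - 1))"
  by (simp add: momentum_def algebra_simps diff_divide_distrib)

subsection \<open>The current\<close>

definition op_exp :: "(cfock \<Rightarrow> cfock) \<Rightarrow> cfock \<Rightarrow> cfock" where
  "op_exp T \<phi> = (\<lambda>\<mu>. suminf (\<lambda>j. (T ^^ j) \<phi> \<mu> / fact j))"

definition osc_sum :: "nat \<Rightarrow> real \<Rightarrow> int set \<Rightarrow> complex \<Rightarrow> cfock \<Rightarrow> cfock" where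
  "osc_sum L x S u \<phi> =
     (\<lambda>\<mu>. - (\<Sum>\<^sub>\<infinity>n\<in>S. alpha L x n \<phi> \<mu> / of_real (qnum x (of_int n)) * zpow x u (- of_int n)))"

text \<open>
  \<open>x\<^sub>+(z)\<close> from \<open>\<F>\<^sub>l\<^sub>,\<^sub>k\<close> to the completion of \<open>\<F>\<^sub>l\<^sub>-\<^sub>2\<^sub>,\<^sub>k\<close>. On a
  polynomial the sums over \<open>n\<close> and the exponential series are, coefficient by coefficient,
  finite sums.
\<close>

definition xplus :: "nat \<Rightarrow> real \<Rightarrow> int \<Rightarrow> int \<Rightarrow> complex \<Rightarrow> fock \<Rightarrow> cfock" where
  "xplus L x l k u \<phi> =
     (\<lambda>\<mu>. op_exp (osc_sum L x {..<0} u)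
             (op_exp (osc_sum L x {0<..} u) (Poly_Mapping.lookup \<phi>)) \<mu>
           * zpow x u (sqrt (rpar L / (rpar L - 1)) * momentum L l k
                        + rpar L / (2 * (rpar L - 1))))"

text \<open>
  \<open>xplus_prod L x l k [u\<^sub>1, \<dots>, u\<^sub>n] \<phi>\<close> is \<open>x\<^sub>+(z\<^sub>1) \<cdots> x\<^sub>+(z\<^sub>n) \<phi>\<close> for \<open>\<phi>\<close> in \<open>\<F>\<^sub>l\<^sub>,\<^sub>k\<close>,
  computed by summing over a basis of intermediate states. This is meaningful only where the
  sums converge, that is, for \<open>|z\<^sub>1| \<ggreater> \<dots> \<ggreater> |z\<^sub>n|\<close>.
\<close>

fun xplus_prod :: "nat \<Rightarrow> real \<Rightarrow> int \<Rightarrow> int \<Rightarrow> complex list \<Rightarrow> fock \<Rightarrow> cfock" where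
  "xplus_prod L x l k [] \<phi> = Poly_Mapping.lookup \<phi>"
| "xplus_prod L x l k (u # us) \<phi> =
     (\<lambda>\<mu>. \<Sum>\<^sub>\<infinity>\<nu>. xplus L x (l - 2 * int (length us)) k u (Poly_Mapping.single \<nu> 1) \<mu>
              * xplus_prod L x l k us \<phi> \<nu>)"

subsection \<open>Meromorphic continuation in several variables\<close>

text \<open>
  Points of \<open>\<complex>\<^sup>n\<close> are functions \<open>nat \<Rightarrow> complex\<close> of which only the first \<open>n\<close> values matter.
\<close>

definition entire :: "nat \<Rightarrow> ((nat \<Rightarrow> complex) \<Rightarrow> complex) \<Rightarrow> bool" where
  "entire n g \<longleftrightarrow>
     (\<forall>u v. (\<forall>i<n. u i = v i) \<longrightarrow> g u = g v) \<and>
     continuous_on UNIV g \<and>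
     (\<forall>u. \<forall>i<n. (\<lambda>w. g (u(i := w))) holomorphic_on UNIV)"

definition ordered_region :: "nat \<Rightarrow> real \<Rightarrow> real \<Rightarrow> (nat \<Rightarrow> complex) set" where
  "ordered_region n x R =
     {u. \<forall>i. Suc i < n \<longrightarrow> norm (zpow x (u i) 1) > R * norm (zpow x (u (Suc i)) 1)}"

text \<open>
  The value at \<open>u\<^sub>0\<close> of the meromorphic continuation to \<open>\<complex>\<^sup>n\<close> of a function \<open>f\<close> given for
  \<open>|z\<^sub>1| \<ggreater> \<dots> \<ggreater> |z\<^sub>n|\<close>, provided that the continuation is regular at \<open>u\<^sub>0\<close>. Meromorphic
  functions on \<open>\<complex>\<^sup>n\<close> are quotients of entire functions; by the identity theorem the value
  does not depend on the quotient chosen.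
\<close>

definition mero_cont ::
  "nat \<Rightarrow> real \<Rightarrow> ((nat \<Rightarrow> complex) \<Rightarrow> complex) \<Rightarrow> (nat \<Rightarrow> complex) \<Rightarrow> complex" where
  "mero_cont n x f u0 =
     (THE c. \<exists>R>0. \<exists>g h. entire n g \<and> entire n h \<and>
        (\<forall>u\<in>ordered_region n x R. h u * f u = g u) \<and> h u0 \<noteq> 0 \<and> c = g u0 / h u0)"

subsection \<open>BRST charges\<close>

text \<open>
  \<open>(n, K)\<close> stands for the operator
  \<open>\<oint>\<cdots>\<oint> x\<^sub>+(z\<^sub>1) \<cdots> x\<^sub>+(z\<^sub>n) K(l; u\<^sub>1, \<dots>, u\<^sub>n)\<close> with all variables on the unit circle, where
  \<open>l\<close> is the value of the operator \<open>l\<close>-hat on the space on which the charge acts, and variables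
  are indexed from \<open>0\<close>.
\<close>

type_synonym charge = "nat \<times> (int \<Rightarrow> (nat \<Rightarrow> complex) \<Rightarrow> complex)"

text \<open>
  In a product the left factor acts on \<open>\<F>\<^bsub>l-2m,k\<^esub>\<close>, where \<open>m\<close> is the number of currents of the
  right factor.
\<close>

definition charge_mult :: "charge \<Rightarrow> charge \<Rightarrow> charge"  (infixr \<open>\<odot>\<close> 70) where
  "A \<odot> B =
     (fst A + fst B,
      \<lambda>l u. snd A (l - 2 * int (fst B)) u * snd B l (\<lambda>i. u (fst A + i)))"

definition charge_prod :: "charge list \<Rightarrow> charge" where
  "charge_prod As = foldr (\<odot>) As (0, \<lambda>_ _. 1)"

text \<open>
  The unit circle \<open>z = e\<^bsup>2\<pi>it\<^esup>\<close>, \<open>0 \<le> t \<le> 1\<close>, is \<open>u = \<pi>it / ln x\<close>, and \<open>dz/(2\<pi>iz) = dt\<close>.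
\<close>

definition circ :: "real \<Rightarrow> real \<Rightarrow> complex" where
  "circ x t = \<i> * of_real (pi * t / ln x)"

text \<open>
  The functions \<open>K\<close> below are meromorphic in closed form and regular on the unit torus, so only
  the product of currents has to be continued.
\<close>

definition charge_op :: "nat \<Rightarrow> real \<Rightarrow> charge \<Rightarrow> int \<Rightarrow> int \<Rightarrow> fock \<Rightarrow> cfock" where
  "charge_op L x A l k \<phi> = (\<lambda>\<mu>.
     set_lebesgue_integral (Pi\<^sub>M {..<fst A} (\<lambda>_. lborel)) (Pi\<^sub>E {..<fst A} (\<lambda>_. {0..1}))
       (\<lambda>t. mero_cont (fst A) x (\<lambda>u. xplus_prod L x l k (map u [0..<fst A]) \<phi> \<mu>)
                (\<lambda>i. circ x (t i))
            * snd A l (\<lambda>i. circ x (t i))))"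

definition Q1 :: "nat \<Rightarrow> real \<Rightarrow> charge" where
  "Q1 L x = (1, \<lambda>l u. br L x (u 0 + of_int l / 2) / br L x (u 0 + 1/2))"

definition f2 :: "nat \<Rightarrow> real \<Rightarrow> nat \<Rightarrow> complex \<Rightarrow> complex \<Rightarrow> complex" where
  "f2 L x a u1 u2 =
     br L x (2 * of_nat a + 1) * br L x (of_nat a - 1/2) * br L x (u1 - of_nat a)
       * br L x (u2 + of_nat a - 1) * br L x (u1 - u2 + of_nat a - 1/2)
     - br L x (2 * of_nat a - 1) * br L x (of_nat a + 1/2) * br L x (u1 + of_nat a)
       * br L x (u2 - of_nat a - 1) * br L x (u1 - u2 - of_nat a - 1/2)"

definition Q2 :: "nat \<Rightarrow> real \<Rightarrow> nat \<Rightarrow> charge" where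
  "Q2 L x a =
     (2, \<lambda>l u.
        1 / (br L x (u 0 + 1/2) * br L x (u 1 + 1/2))
        * (br L x (u 0 - u 1) / (br L x (u 0 - u 1 + 1) * br L x (u 0 - u 1 - 1/2)))
        * f2 L x a (u 0 + of_int l / 2) (u 1 + of_int l / 2))"

definition Q :: "nat \<Rightarrow> real \<Rightarrow> nat \<Rightarrow> charge" where
  "Q L x l =
     (let m = l div 2 in
      if odd l then charge_prod (Q1 L x # map (Q2 L x) [1..<m + 1])
      else charge_prod (map (Q2 L x) [(L + 1) div 2 - m..<(L + 1) div 2]))"

end

theory Submission
  imports Defs "HOL-Complex_Analysis.Complex_Analysis"
begin

text \<open>
  Write \<open>th\<close> for \<open>br L x\<close> and \<open>om v = th (v + 1) * th (v - 1/2)\<close>. Normal ordering gives the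
  matrix elements of \<open>x\<^sub>+(z\<^sub>1) \<cdots> x\<^sub>+(z\<^sub>n)\<close> as a symmetric function of the \<open>u\<^sub>i\<close> times the product of
  \<open>\<Gamma>(u\<^sub>i, u\<^sub>j)\<close> over \<open>i < j\<close>, and \<open>\<Gamma>(u, v) / om (u - v)\<close> is antisymmetric in \<open>u, v\<close>. All variables run over
  the same circle, so the integrand may be symmetrised. What remains is the antisymmetrisation \<open>N\<close> of an
  explicit product of theta functions, and it is to be shown that \<open>N\<close> vanishes identically.

  As a function of any subset of its variables moved simultaneously, \<open>N\<close> has theta multipliers, so it is zero
  as soon as it has one zero more than its degree. Counting zeros in this way shows first that
  the charges commute. Next, for the word \<open>Q\<^sub>1 Q\<^sub>2\<^sup>(\<^sup>1\<^sup>) \<cdots> Q\<^sub>2\<^sup>(\<^sup>m\<^sup>)\<close> in \<open>2m + 1\<close> variables, induction on \<open>m\<close> shows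
  that \<open>N\<close> vanishes when some \<open>u\<^sub>i = m\<close>. For \<open>L = 2m + 1\<close> the relation \<open>th L = 0\<close> supplies a second
  zero at \<open>u\<^sub>i = m + 1\<close>, and with both zeros available the count forces \<open>N = 0\<close>. By commutativity
  this covers \<open>Q\<^sub>l Q\<^sub>L\<^sub>-\<^sub>l\<close> for every \<open>l\<close>.
\<close>

section \<open>Theta functions with one simple zero\<close>

text \<open>The relation \<open>th L = 0\<close> expresses L = (L + 2)(r - 1): L is a lattice point,
  and the smallest positive integer that is one. This also obstructs naive counting. Zeros at
  distance L coincide modulo the lattice, and already commuting \<open>Q1\<close> with
  \<open>Q2\<close> uses zeros at distance 3, which fails for L = 3. Hence the step 1/2 in
  \<open>om\<close> is replaced by a parameter h; the zeros are distinct for generic h, and h = 1/2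
  is reached by continuity.

  A surplus of zeros is not always available. When their number equals the degree, their sum is
  prescribed modulo the lattice: a wrong sum still forces the function to vanish, while the right
  sum identifies it with a product of theta functions. In the induction on m this product is
  evaluated where three variables form a triple a, a + 1/2, a + 1; there N vanishes although the
  product does not.

  Two charges \<open>Q2\<close> are compared without counting in four variables: the symmetrised
  \<open>Q2\<close> with index b is a combination of the symmetrised words \<open>Q1 Q1\<close> and
  \<open>Q2\<close> with index a, unless the latter is identically zero.\<close>

definition exp_per :: "real \<Rightarrow> complex \<Rightarrow> complex" where
  "exp_per \<rho> u = exp (2 * of_real pi * \<i> * u / of_real \<rho>)"

lemma exp_per_add: "exp_per \<rho> (u + v) = exp_per \<rho> u * exp_per \<rho> v"
  by (simp add: exp_per_def add_divide_distrib ring_distribs exp_add)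

lemma exp_per_nz [simp]: "exp_per \<rho> u \<noteq> 0"
  by (simp add: exp_per_def)

lemma exp_per_0 [simp]: "exp_per \<rho> 0 = 1"
  by (simp add: exp_per_def)

lemma exp_per_minus: "exp_per \<rho> (- u) = inverse (exp_per \<rho> u)"
  by (simp add: exp_per_def exp_minus)

lemma exp_per_diff: "exp_per \<rho> (u - v) = exp_per \<rho> u / exp_per \<rho> v"
  by (simp add: exp_per_def diff_divide_distrib ring_distribs exp_diff)

lemma exp_per_of_nat_mult: "exp_per \<rho> (of_nat n * u) = exp_per \<rho> u ^ n"
  by (induction n) (simp_all add: ring_distribs exp_per_add)

lemma exp_per_sum: "finite A \<Longrightarrow> exp_per \<rho> (\<Sum>i\<in>A. f i) = (\<Prod>i\<in>A. exp_per \<rho> (f i))"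
  by (induction A rule: finite_induct) (simp_all add: exp_per_add)

text \<open>Entire functions have no zero divisors: f is nonzero near w, so g vanishes on a disc and
  hence everywhere. This serves to cancel theta products, which do have zeros.\<close>

lemma entire_mult_eq_0:
  assumes "f holomorphic_on UNIV" "g holomorphic_on UNIV" "\<And>z::complex. f z * g z = (0::complex)" "f w \<noteq> 0"
  shows "g z = 0"
proof -
  have "continuous (at w) f"
    using holomorphic_on_imp_continuous_on[OF assms(1)] by (simp add: continuous_on_eq_continuous_at)
  then obtain r where r: "r > 0" "\<And>z. dist z w < r \<Longrightarrow> f z \<noteq> 0"
    using continuous_at_avoid[of w f 0] assms(4) by (auto simp: dist_commute)
  show ?thesis
  proof (rule analytic_continuation_open[of "ball w r" UNIV g "\<lambda>_. 0"])
    fix z assume "z \<in> ball w r"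
    then have "f z \<noteq> 0" using r(2)[of z] by (simp add: dist_commute)
    then show "g z = 0" using assms(3)[of z] by simp
  qed (use r assms in auto)
qed

text \<open>What is used of \<open>br L x\<close>: an odd theta function of degree one for the
  rectangular lattice spanned by \<rho> and i T, with simple zeros exactly at the lattice points. T
  may be negative, as \<open>pi / ln x\<close> is, so that \<open>q\<close> may exceed 1 in
  modulus.\<close>

locale theta_function =
  fixes \<rho> T :: real and q :: complex and th :: "complex \<Rightarrow> complex"
  assumes rho_pos: "\<rho> > 0" and T_nz: "T \<noteq> 0" and q_nz: "q \<noteq> 0"
    and q_sq: "q ^ 2 = exp_per \<rho> (\<i> * of_real T)"
    and th_hol: "th holomorphic_on UNIV"
    and th_minus: "th (- u) = - th u"
    and th_rho: "th (u + of_real \<rho>) = - th u"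
    and th_tau: "th (u + \<i> * of_real T) = - q * exp_per \<rho> u * th u"
    and th_zero: "th u = 0 \<longleftrightarrow> (\<exists>m n::int. u = of_int m * of_real \<rho> + of_int n * (\<i> * of_real T))"
    and th_deriv_0: "deriv th 0 \<noteq> 0"
begin

abbreviation \<tau> :: complex where "\<tau> \<equiv> \<i> * of_real T"
abbreviation E :: "complex \<Rightarrow> complex" where "E \<equiv> exp_per \<rho>"

lemma E_tau: "E \<tau> = q ^ 2" by (simp add: q_sq)

lemma th_0 [simp]: "th 0 = 0"
  using th_zero[of 0] by (metis add.left_neutral mult_zero_left of_int_0)

lemma th_minus_rho: "th (u - of_real \<rho>) = - th u"
  using th_rho[of "u - of_real \<rho>"] by simp

lemma th_minus_tau: "th (u - \<tau>) = - q * E (- u) * th u"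
proof -
  have "th u = - q * E (u - \<tau>) * th (u - \<tau>)" using th_tau[of "u - \<tau>"] by simp
  also have "E (u - \<tau>) = E u / q^2" by (simp only: exp_per_diff E_tau)
  finally have "th u = - (E u / q) * th (u - \<tau>)" using q_nz by (simp add: power2_eq_square)
  then show ?thesis using q_nz by (simp add: exp_per_minus field_simps)
qed

lemma th_zero_add: "th a = 0 \<Longrightarrow> th b = 0 \<Longrightarrow> th (a + b) = 0"
  unfolding th_zero
proof (elim exE)
  fix m n m' n' :: int
  assume "a = of_int m * of_real \<rho> + of_int n * \<tau>" "b = of_int m' * of_real \<rho> + of_int n' * \<tau>"
  then show "\<exists>m n::int. a + b = of_int m * of_real \<rho> + of_int n * \<tau>"
    by (intro exI[of _ "m+m'"] exI[of _ "n+n'"]) (simp add: algebra_simps)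
qed

lemma th_zero_diff: "th a = 0 \<Longrightarrow> th b = 0 \<Longrightarrow> th (a - b) = 0"
  using th_zero_add[of a "- b"] by (simp add: th_minus)

text \<open>Simplicity of the zero at the origin spreads over the lattice by differentiating the two
  functional equations; at a zero of \<open>th\<close> the derivative of the multiplier drops
  out.\<close>

lemma th_deriv_nz: "th u = 0 \<Longrightarrow> deriv th u \<noteq> 0"
proof -
  have d: "(th has_field_derivative deriv th v) (at v)" for v
    using th_hol by (simp add: holomorphic_derivI)
  have 1: "deriv th (v + of_real \<rho>) = - deriv th v" for v
  proof -
    have "((\<lambda>v. th (v + of_real \<rho>)) has_field_derivative deriv th (v + of_real \<rho>)) (at v)"
      using d[of "v + of_real \<rho>"] by (simp add: DERIV_shift)
    moreover have "((\<lambda>v. th (v + of_real \<rho>)) has_field_derivative - deriv th v) (at v)"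
      unfolding th_rho by (intro derivative_intros d)
    ultimately show ?thesis by (rule DERIV_unique)
  qed
  have 2: "deriv th (v + \<tau>) = - q * E v * deriv th v" if "th v = 0" for v
  proof -
    have "((\<lambda>v. th (v + \<tau>)) has_field_derivative deriv th (v + \<tau>)) (at v)"
      using d[of "v + \<tau>"] by (simp add: DERIV_shift)
    moreover have "((\<lambda>v. th (v + \<tau>)) has_field_derivative
        (- q * E v * deriv th v + deriv (\<lambda>v. - q * E v) v * th v)) (at v)"
      unfolding th_tau
      by (rule DERIV_mult'[THEN DERIV_cong], rule DERIV_deriv_iff_field_differentiable[THEN iffD2])
         (auto simp: exp_per_def intro!: holomorphic_on_imp_differentiable_at[of _ UNIV] holomorphic_intros d)
    ultimately show ?thesis using that by (auto dest: DERIV_unique)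
  qed
  define G where "G v \<longleftrightarrow> deriv th v \<noteq> 0" for v
  have z: "th (of_int m * of_real \<rho> + of_int n * \<tau>) = 0" for m n :: int
    using th_zero by blast
  have g0: "G (of_int n * \<tau>)" for n :: int
  proof (induction n rule: int_induct[of _ 0])
    case base then show ?case using th_deriv_0 by (simp add: G_def)
  next
    case (step1 i)
    have "deriv th (of_int i * \<tau> + \<tau>) \<noteq> 0"
      using step1 z[of 0 i] q_nz by (subst 2) (auto simp: G_def)
    then show ?case by (simp add: G_def algebra_simps)
  next
    case (step2 i)
    have "deriv th (of_int (i-1) * \<tau> + \<tau>) \<noteq> 0"
      using step2 by (simp add: G_def algebra_simps)
    then show ?case using z[of 0 "i-1"] by (subst (asm) 2) (auto simp: G_def)
  qed
  have g: "G (of_int m * of_real \<rho> + of_int n * \<tau>)" for m n :: int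
  proof (induction m rule: int_induct[of _ 0])
    case base then show ?case using g0 by simp
  next
    case (step1 i)
    have "deriv th (of_int i * of_real \<rho> + of_int n * \<tau> + of_real \<rho>) \<noteq> 0"
      using step1 by (subst 1) (auto simp: G_def)
    then show ?case by (simp add: G_def algebra_simps)
  next
    case (step2 i)
    have "deriv th (of_int (i-1) * of_real \<rho> + of_int n * \<tau> + of_real \<rho>) \<noteq> 0"
      using step2 by (simp add: G_def algebra_simps)
    then show ?case by (subst (asm) 1) (auto simp: G_def)
  qed
  show "th u = 0 \<Longrightarrow> deriv th u \<noteq> 0" using g th_zero by (auto simp: G_def)
qed

lemma th_hol' [holomorphic_intros]:
  "f holomorphic_on A \<Longrightarrow> (\<lambda>z. th (f z)) holomorphic_on A"
  using holomorphic_on_compose_gen[OF _ th_hol] by (auto simp: o_def)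

lemma th_cont [continuous_intros]:
  "continuous_on A f \<Longrightarrow> continuous_on A (\<lambda>z. th (f z))"
  using continuous_on_compose2[OF holomorphic_on_imp_continuous_on[OF th_hol]] by auto

lemma th_not_all_0: obtains w where "th w \<noteq> 0"
proof -
  have "\<exists>w. th w \<noteq> 0"
  proof (rule ccontr)
    assume "\<nexists>w. th w \<noteq> 0"
    then have "th = (\<lambda>_. 0)" by auto
    then show False using th_deriv_0 by simp
  qed
  then show ?thesis using that by blast
qed

lemma th_isolated: "\<forall>\<^sub>F s in at s0. th s \<noteq> 0"
proof (cases "th s0 = 0")
  case True
  obtain w where "th w \<noteq> 0" using th_not_all_0 .
  then obtain r where "r > 0" "\<And>z. z \<in> ball s0 r - {s0} \<Longrightarrow> th z \<noteq> 0"
    using isolated_zeros[OF th_hol _ _ _ True] by auto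
  then show ?thesis unfolding eventually_at by (auto simp: dist_commute intro!: exI[of _ r])
next
  case False
  have "continuous (at s0) th"
    using holomorphic_on_imp_continuous_on[OF th_hol] by (simp add: continuous_on_eq_continuous_at)
  then have "(th \<longlongrightarrow> th s0) (at s0)" by (simp add: continuous_at)
  then show ?thesis using False by (rule tendsto_imp_eventually_ne)
qed

text \<open>Zeros are isolated, so a nonconstant line leaves them at once. This supplies the generic
  positions for all later counts.\<close>

lemma th_isolated_line:
  assumes "b \<noteq> 0" shows "\<forall>\<^sub>F s in at 0. th (a + s * b) \<noteq> 0"
proof -
  have "filterlim (\<lambda>s. a + s * b) (at a) (at 0)"
  proof (rule filterlim_atI)
    show "((\<lambda>s. a + s * b) \<longlongrightarrow> a) (at 0)" by (rule tendsto_eq_intros refl)+ simp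
    show "\<forall>\<^sub>F s in at 0. a + s * b \<noteq> a" using assms by (simp add: eventually_at_filter)
  qed
  then show ?thesis using th_isolated[of a] by (rule filterlim_iff[THEN iffD1, rule_format])
qed

text \<open>The quotient by \<open>th (u - z)\<close> has removable singularities because the zeros
  of \<open>th\<close> are simple; at such a point it is the quotient of the derivatives.\<close>

lemma th_divide:
  assumes f: "f holomorphic_on UNIV" and z: "\<And>u. th (u - z) = 0 \<Longrightarrow> f u = 0"
  obtains g where "g holomorphic_on UNIV" "\<And>u. f u = th (u - z) * g u"
proof -
  define g where "g u = (if th (u - z) = 0 then deriv f u / deriv th (u - z) else f u / th (u - z))" for u
  have eq: "f u = th (u - z) * g u" for u using z[of u] by (simp add: g_def)
  have "\<exists>r>0. g holomorphic_on ball w r" for w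
  proof -
    have "\<forall>\<^sub>F s in at 0. th ((w - z) + s * 1) \<noteq> 0" by (rule th_isolated_line) simp
    then obtain r where r: "r > 0" "\<And>s. s \<noteq> 0 \<Longrightarrow> norm s < r \<Longrightarrow> th ((w - z) + s) \<noteq> 0"
      unfolding eventually_at by (auto simp: dist_norm)
    have nz: "th (u - z) \<noteq> 0" if "u \<in> ball w r - {w}" for u
      using r(2)[of "u - w"] that by (auto simp: dist_norm norm_minus_commute algebra_simps)
    have "g holomorphic_on ball w r"
    proof (rule no_isolated_singularity'[where K="{w}"])
      have "(\<lambda>u. f u / th (u - z)) holomorphic_on ball w r - {w}"
        using nz by (intro holomorphic_intros holomorphic_on_subset[OF f]) auto
      then show "g holomorphic_on ball w r - {w}"
        by (rule holomorphic_transform) (use nz in \<open>auto simp: g_def\<close>)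
      have "(g \<longlongrightarrow> g w) (at w)"
      proof (cases "th (w - z) = 0")
        case True
        have "(f has_field_derivative deriv f w) (at w)" using f by (simp add: holomorphic_derivI)
        then have l1: "((\<lambda>u. (f u - f w) / (u - w)) \<longlongrightarrow> deriv f w) (at w)"
          by (simp add: has_field_derivative_iff)
        have "(th has_field_derivative deriv th (w - z)) (at (w - z))"
          using th_hol by (simp add: holomorphic_derivI)
        then have "((\<lambda>u. th (u + (- z))) has_field_derivative deriv th (w - z)) (at w)"
          by (subst DERIV_shift[symmetric]) simp
        then have l2: "((\<lambda>u. (th (u - z) - th (w - z)) / (u - w)) \<longlongrightarrow> deriv th (w - z)) (at w)"
          by (simp add: has_field_derivative_iff)
        have "((\<lambda>u. ((f u - f w) / (u - w)) / ((th (u - z) - th (w - z)) / (u - w))) \<longlongrightarrow> deriv f w / deriv th (w - z)) (at w)"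
          by (rule tendsto_divide[OF l1 l2]) (rule th_deriv_nz[OF True])
        moreover have "\<forall>\<^sub>F u in at w. ((f u - f w) / (u - w)) / ((th (u - z) - th (w - z)) / (u - w)) = g u"
          unfolding eventually_at using r(1) nz z[OF True] True
          by (intro exI[of _ r]) (auto simp: g_def dist_commute divide_simps)
        ultimately have "(g \<longlongrightarrow> deriv f w / deriv th (w - z)) (at w)"
          by (rule Lim_transform_eventually)
        then show ?thesis using True by (simp add: g_def)
      next
        case False
        have "((\<lambda>u. f u / th (u - z)) \<longlongrightarrow> f w / th (w - z)) (at w)"
        proof (intro tendsto_divide False)
          show "(f \<longlongrightarrow> f w) (at w)" using holomorphic_on_imp_continuous_on[OF f]
            by (auto simp: continuous_on_eq_continuous_at continuous_at)
          have "continuous_on UNIV (\<lambda>u. th (u - z))" by (intro continuous_intros)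
          then show "((\<lambda>u. th (u - z)) \<longlongrightarrow> th (w - z)) (at w)"
            by (auto simp: continuous_on_eq_continuous_at continuous_at)
        qed
        moreover have "\<forall>\<^sub>F u in at w. f u / th (u - z) = g u"
          unfolding eventually_at using r(1) nz by (intro exI[of _ r]) (auto simp: g_def dist_commute)
        ultimately have "(g \<longlongrightarrow> f w / th (w - z)) (at w)" by (rule Lim_transform_eventually)
        then show ?thesis using False by (simp add: g_def)
      qed
      then show "\<And>y. y \<in> {w} \<Longrightarrow> (g \<longlongrightarrow> g y) (at y within ball w r)"
        by (auto intro: tendsto_within_subset)
    qed auto
    then show ?thesis using r(1) by blast
  qed
  then have "g holomorphic_on UNIV"
    by (metis UNIV_I at_within_open centre_in_ball field_differentiable_at_within holomorphic_on_def
        holomorphic_on_imp_differentiable_at open_ball)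
  then show ?thesis using that eq by blast
qed

text \<open>Division by one factor preserves the other zeros only if no two of them agree modulo the
  lattice. This is why distinctness is always required in the form
  \<open>th (z i - z j) \<noteq> 0\<close>.\<close>

lemma th_divide_prod:
  assumes "finite I" "f holomorphic_on UNIV"
    and "\<And>i u. i \<in> I \<Longrightarrow> th (u - z i) = 0 \<Longrightarrow> f u = 0"
    and "\<And>i j. i \<in> I \<Longrightarrow> j \<in> I \<Longrightarrow> i \<noteq> j \<Longrightarrow> th (z i - z j) \<noteq> 0"
  obtains g where "g holomorphic_on UNIV" "\<And>u. f u = (\<Prod>i\<in>I. th (u - z i)) * g u"
proof -
  have "\<exists>g. g holomorphic_on UNIV \<and> (\<forall>u. f u = (\<Prod>i\<in>I. th (u - z i)) * g u)"
    using assms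
  proof (induction I arbitrary: f rule: finite_induct)
    case empty then show ?case by (intro exI[of _ f]) auto
  next
    case (insert i I)
    obtain g where g: "g holomorphic_on UNIV" "\<And>u. f u = th (u - z i) * g u"
      using th_divide[of f "z i"] insert.prems by auto
    have "\<exists>h. h holomorphic_on UNIV \<and> (\<forall>u. g u = (\<Prod>i\<in>I. th (u - z i)) * h u)"
    proof (rule insert.IH)
      fix j u assume j: "j \<in> I" "th (u - z j) = 0"
      then have "th (z j - z i) \<noteq> 0" using insert.prems(3)[of j i] insert.hyps by blast
      then have "th (u - z i) \<noteq> 0"
        using th_zero_diff[of "u - z i" "u - z j"] j by auto
      moreover have "f u = 0" using insert.prems j by auto
      ultimately show "g u = 0" using g by simp
    qed (use g insert.prems in auto)
    then obtain h where "h holomorphic_on UNIV" "\<And>u. g u = (\<Prod>i\<in>I. th (u - z i)) * h u" by blast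
    then show ?case using g(2) insert.hyps by (intro exI[of _ h]) (auto simp: mult_ac)
  qed
  then show ?thesis using that by blast
qed

text \<open>Liouville's theorem: all values are taken on a fundamental domain, a compact rectangle
  because one period is real and the other imaginary.\<close>

lemma doubly_periodic_const:
  assumes f: "f holomorphic_on UNIV" and p: "\<And>u. f (u + of_real \<rho>) = f u" "\<And>u. f (u + \<tau>) = f u"
  shows "f u = f v"
proof -
  have pm: "f (u + of_int m * of_real \<rho>) = f u" for u and m :: int
  proof (induction m rule: int_induct[of _ 0])
    case (step1 i) then show ?case using p(1)[of "u + of_int i * of_real \<rho>"] by (simp add: algebra_simps)
  next
    case (step2 i) then show ?case using p(1)[of "u + of_int (i-1) * of_real \<rho>"] by (simp add: algebra_simps)
  qed auto
  have pn: "f (u + of_int m * \<tau>) = f u" for u and m :: int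
  proof (induction m rule: int_induct[of _ 0])
    case (step1 i) then show ?case using p(2)[of "u + of_int i * \<tau>"] by (simp add: algebra_simps)
  next
    case (step2 i) then show ?case using p(2)[of "u + of_int (i-1) * \<tau>"] by (simp add: algebra_simps)
  qed auto
  let ?C = "(\<lambda>(a,b). Complex (a * \<rho>) (b * T)) ` ({0..1} \<times> {0..1::real})"
  have "compact ?C"
  proof (rule compact_continuous_image)
    show "continuous_on ({0..1} \<times> {0..1}) (\<lambda>(a,b). Complex (a * \<rho>) (b * T))"
      unfolding case_prod_beta Complex_eq by (intro continuous_intros)
  qed (intro compact_Times compact_Icc)
  then have b: "bounded (f ` ?C)"
    by (intro compact_imp_bounded compact_continuous_image[of ?C f]
         continuous_on_subset[OF holomorphic_on_imp_continuous_on[OF f]]) auto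
  have "range f \<subseteq> f ` ?C"
  proof
    fix y assume "y \<in> range f"
    then obtain u where y: "y = f u" by blast
    define a where "a = Re u / \<rho>" define b where "b = Im u / T"
    have u: "u = Complex (a * \<rho>) (b * T)"
      using rho_pos T_nz by (simp add: a_def b_def complex_eq_iff)
    have "Complex (frac a * \<rho>) (frac b * T) = u + of_int (- \<lfloor>a\<rfloor>) * of_real \<rho> + of_int (- \<lfloor>b\<rfloor>) * \<tau>"
      unfolding u by (simp add: complex_eq_iff frac_def algebra_simps)
    then have "y = f (Complex (frac a * \<rho>) (frac b * T))" unfolding y by (simp only: pm pn)
    moreover have "frac a \<in> {0..1}" "frac b \<in> {0..1}"
      by (auto simp: frac_ge_0 intro: less_imp_le frac_lt_1)
    ultimately show "y \<in> f ` ?C" by force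
  qed
  then have "bounded (range f)" using b bounded_subset by blast
  then show ?thesis using Liouville_theorem[OF f] by (auto simp: constant_on_def)
qed

text \<open>In f (s + u) f (v - s) the constant multiplier cancels, so this function of s is doubly
  periodic, hence constant; compare s = 0 with s = - u. Thus f is an exponential up to a constant,
  and a single zero makes it vanish.\<close>

lemma const_multiplier:
  assumes f: "f holomorphic_on UNIV" and p: "\<And>u. f (u + of_real \<rho>) = f u" "\<And>u. f (u + \<tau>) = c * f u"
    and c: "c \<noteq> 0"
  shows "f u * f v = f 0 * f (u + v)"
proof -
  have m: "f (u - of_real \<rho>) = f u" "f (u - \<tau>) = f u / c" for u
    using p(1)[of "u - of_real \<rho>"] p(2)[of "u - \<tau>"] c by auto
  define g where "g s = f (s + u) * f (v - s)" for s
  have "g 0 = g (- u)"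
  proof (rule doubly_periodic_const[of g])
    show "g holomorphic_on UNIV"
      unfolding g_def by (intro holomorphic_intros holomorphic_on_compose_gen[OF _ f, unfolded o_def]) auto
  next
    fix s
    have "f (s + of_real \<rho> + u) = f (s + u)" using p(1)[of "s + u"] by (simp add: algebra_simps)
    moreover have "f (v - (s + of_real \<rho>)) = f (v - s)" using m(1)[of "v - s"] by (simp add: algebra_simps)
    ultimately show "g (s + of_real \<rho>) = g s" by (simp add: g_def)
    have "f (s + \<tau> + u) = c * f (s + u)" using p(2)[of "s + u"] by (simp add: algebra_simps)
    moreover have "f (v - (s + \<tau>)) = f (v - s) / c" using m(2)[of "v - s"] by (simp add: algebra_simps)
    ultimately show "g (s + \<tau>) = g s" using c by (simp add: g_def)
  qed
  then show ?thesis by (simp add: g_def add.commute)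
qed

text \<open>The identity of \<open>const_multiplier\<close> gives f' = l f, so f is an exponential.
  The period \<rho> quantises l, which leaves only those c that come from lattice points.\<close>

lemma const_multiplier_exp:
  assumes f: "f holomorphic_on UNIV" and p: "\<And>u. f (u + of_real \<rho>) = f u" "\<And>u. f (u + \<tau>) = c * f u"
    and c: "c \<noteq> 0" and nz: "f w \<noteq> 0"
  obtains k :: int where "c = E (of_int k * \<tau>)"
proof -
  note m = const_multiplier[where f=f and c=c, OF f p c]
  have f0: "f 0 \<noteq> 0"
  proof
    assume "f 0 = 0"
    then have "f w * f w = 0" using m[of w w] by (simp only: mult_zero_left)
    then show False using nz by simp
  qed
  have d: "(f has_field_derivative deriv f v) (at v)" for v using f by (simp add: holomorphic_derivI)
  define l where "l = deriv f 0 / f 0"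
  have df: "deriv f v = l * f v" for v
  proof -
    have "((\<lambda>u. f 0 * f (u + v)) has_field_derivative f 0 * deriv f v) (at 0)"
      by (rule DERIV_cmult) (use d[of "0 + v"] in \<open>simp only: DERIV_shift[symmetric] add_0\<close>)
    moreover have "((\<lambda>u. f u * f v) has_field_derivative deriv f 0 * f v) (at 0)"
      by (rule DERIV_cmult_right) (rule d)
    ultimately have "f 0 * deriv f v = deriv f 0 * f v" using m by (auto dest: DERIV_unique)
    then show ?thesis using f0 by (simp add: l_def field_simps)
  qed
  have "\<exists>K. \<forall>v\<in>UNIV. f v * exp (- l * v) = K"
  proof (rule has_field_derivative_zero_constant)
    fix v
    have "((\<lambda>v. f v * exp (- l * v)) has_field_derivative
       deriv f v * exp (- l * v) + exp (- l * v) * (- l) * f v) (at v)"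
      by (rule DERIV_mult[OF d]) (auto intro!: derivative_eq_intros)
    then show "((\<lambda>v. f v * exp (- l * v)) has_field_derivative 0) (at v within UNIV)"
      by (simp add: df)
  qed simp
  then have K: "f v * exp (- l * v) = f 0" for v by (metis UNIV_I exp_zero mult.right_neutral mult_zero_right)
  have fe: "f v = f 0 * exp (l * v)" for v
  proof -
    have "f v = f v * exp (- l * v) * exp (l * v)" by (simp add: mult.assoc mult_exp_exp)
    then show ?thesis by (simp only: K)
  qed
  have "exp (l * of_real \<rho>) = 1" using p(1)[of 0] fe[of "of_real \<rho>"] f0 by simp
  then obtain k :: int where k: "l * of_real \<rho> = 2 * of_int k * of_real pi * \<i>"
    unfolding exp_eq[of _ 0, simplified] by blast
  have "c = exp (l * \<tau>)" using p(2)[of 0] fe[of \<tau>] f0 by simp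
  moreover have leq: "l = 2 * of_int k * of_real pi * \<i> / of_real \<rho>"
    using k rho_pos by (simp add: field_simps)
  then have "l * \<tau> = 2 * of_real pi * \<i> * (of_int k * \<tau>) / of_real \<rho>"
    unfolding leq by (simp only: times_divide_eq_left times_divide_eq_right mult_ac)
  ultimately show ?thesis using that[of k] by (simp add: exp_per_def)
qed

section \<open>Counting zeros of functions with theta multipliers\<close>

lemma prod_th_rho: "(\<Prod>i\<in>I. th (s + of_real \<rho> - z i)) = (-1) ^ card I * (\<Prod>i\<in>I. th (s - z i))"
proof -
  have "th (s + of_real \<rho> - z i) = (-1) * th (s - z i)" for i
    using th_rho[of "s - z i"] by (simp add: algebra_simps)
  then show ?thesis by (simp only: prod.distrib prod_constant)
qed

lemma prod_th_tau:
  assumes "finite I"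
  shows "(\<Prod>i\<in>I. th (s + \<tau> - z i)) =
    (- q) ^ card I * E (of_nat (card I) * s - (\<Sum>i\<in>I. z i)) * (\<Prod>i\<in>I. th (s - z i))"
proof -
  have "th (s + \<tau> - z i) = (- q) * E (s - z i) * th (s - z i)" for i
    using th_tau[of "s - z i"] by (simp add: algebra_simps)
  moreover have "(\<Prod>i\<in>I. E (s - z i)) = E (of_nat (card I) * s - (\<Sum>i\<in>I. z i))"
    using exp_per_sum[OF assms, of \<rho> "\<lambda>i. s - z i"] by (simp add: sum_subtractf)
  ultimately show ?thesis by (simp only: prod.distrib prod_constant)
qed

lemma prod_th_hol: "(\<lambda>s. \<Prod>i\<in>I. th (s - z i)) holomorphic_on UNIV"
  by (intro holomorphic_intros)

lemma prod_th_nz: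
  assumes "finite I"
  obtains w where "(\<Prod>i\<in>I. th (w - z i)) \<noteq> 0"
proof -
  have "\<forall>\<^sub>F s in at 0. \<forall>i\<in>I. th (- z i + s * 1) \<noteq> 0"
    using assms by (intro eventually_ball_finite ballI th_isolated_line) auto
  then obtain s where "\<forall>i\<in>I. th (- z i + s * 1) \<noteq> 0"
    using eventually_happens[of _ "at (0::complex)"] by auto
  then have "\<exists>s. \<forall>i\<in>I. th (s - z i) \<noteq> 0" by (intro exI[of _ s]) simp
  then show ?thesis using that assms by auto
qed

text \<open>The multipliers have no zeros, so the zero set is invariant under the lattice. Zeros are
  known at single points only, whereas division by \<open>th\<close> needs all their
  translates.\<close>

lemma theta_zero_lattice:
  assumes p: "\<And>s. f (s + of_real \<rho>) = a * f s" "\<And>s. f (s + \<tau>) = b s * f s"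
    and nz: "a \<noteq> 0" "\<And>s. b s \<noteq> 0" and z: "f z = 0" and u: "th (u - z) = 0"
  shows "f u = (0::complex)"
proof -
  have r: "f s = 0 \<longleftrightarrow> f (s + of_real \<rho>) = 0" "f s = 0 \<longleftrightarrow> f (s + \<tau>) = 0" for s
    using p[of s] nz(1) nz(2)[of s] by auto
  have 1: "f s = 0 \<longleftrightarrow> f (s + of_int m * of_real \<rho>) = 0" for s and m :: int
  proof (induction m rule: int_induct[of _ 0])
    case (step1 i) then show ?case using r(1)[of "s + of_int i * of_real \<rho>"] by (simp add: algebra_simps)
  next
    case (step2 i) then show ?case using r(1)[of "s + of_int (i-1) * of_real \<rho>"] by (simp add: algebra_simps)
  qed auto
  have 2: "f s = 0 \<longleftrightarrow> f (s + of_int m * \<tau>) = 0" for s and m :: int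
  proof (induction m rule: int_induct[of _ 0])
    case (step1 i) then show ?case using r(2)[of "s + of_int i * \<tau>"] by (simp add: algebra_simps)
  next
    case (step2 i) then show ?case using r(2)[of "s + of_int (i-1) * \<tau>"] by (simp add: algebra_simps)
  qed auto
  obtain m n :: int where "u - z = of_int m * of_real \<rho> + of_int n * \<tau>" using u th_zero by blast
  then have "u = z + of_int m * of_real \<rho> + of_int n * \<tau>" by (simp add: algebra_simps)
  then show ?thesis using z 1[of z m] 2[of "z + of_int m * of_real \<rho>" n] by simp
qed

text \<open>The multipliers of f are those of a product of d theta factors whose zeros have sum
  \<sigma>. After division only the constant E ((sum of the z i) - \<sigma>) is left. Both
  functional equations of the quotient are proved after multiplication by the product, which may be
  zero at the point considered.\<close>

lemma theta_factor:
  assumes f: "f holomorphic_on UNIV"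
    and p: "\<And>s. f (s + of_real \<rho>) = (-1) ^ d * f s"
      "\<And>s. f (s + \<tau>) = (- q) ^ d * E (of_nat d * s - \<sigma>) * f s"
    and I: "finite I" "card I = d"
    and z: "\<And>i. i \<in> I \<Longrightarrow> f (z i) = 0"
    and dist: "\<And>i j. i \<in> I \<Longrightarrow> j \<in> I \<Longrightarrow> i \<noteq> j \<Longrightarrow> th (z i - z j) \<noteq> 0"
  obtains g where "g holomorphic_on UNIV" "\<And>s. f s = (\<Prod>i\<in>I. th (s - z i)) * g s"
    "\<And>s. g (s + of_real \<rho>) = g s" "\<And>s. g (s + \<tau>) = E ((\<Sum>i\<in>I. z i) - \<sigma>) * g s"
proof -
  let ?P = "\<lambda>s. \<Prod>i\<in>I. th (s - z i)"
  have zz: "f u = 0" if "i \<in> I" "th (u - z i) = 0" for i u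
    by (rule theta_zero_lattice[where f=f and a="(-1) ^ d" and z="z i" and
          b="\<lambda>s. (- q) ^ d * E (of_nat d * s - \<sigma>)"])
       (use p q_nz z that in simp_all)
  obtain g where g: "g holomorphic_on UNIV" "\<And>s. f s = ?P s * g s"
    by (rule th_divide_prod[OF I(1) f, of z]) (use zz dist in blast)+
  obtain w where w: "?P w \<noteq> 0" using prod_th_nz[OF I(1)] .
  have h: "(\<lambda>s. g (s + c)) holomorphic_on UNIV" for c
    by (intro holomorphic_on_compose_gen[OF _ g(1), unfolded o_def] holomorphic_intros) auto
  have "g (s + of_real \<rho>) - g s = 0" for s
  proof (rule entire_mult_eq_0[where f="?P" and g="\<lambda>s. g (s + of_real \<rho>) - g s", OF prod_th_hol _ _ w])
    show "(\<lambda>s. g (s + of_real \<rho>) - g s) holomorphic_on UNIV" by (intro holomorphic_intros h g)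
    fix s show "?P s * (g (s + of_real \<rho>) - g s) = 0"
    proof -
      have "(-1) ^ d * ?P s * g (s + of_real \<rho>) = (-1) ^ d * (?P s * g s)"
        using p(1)[of s] by (simp only: g(2) prod_th_rho I(2))
      then show ?thesis by (simp add: mult.assoc right_diff_distrib)
    qed
  qed
  moreover have "g (s + \<tau>) - E ((\<Sum>i\<in>I. z i) - \<sigma>) * g s = 0" for s
  proof (rule entire_mult_eq_0[where f="?P" and g="\<lambda>s. g (s + \<tau>) - E ((\<Sum>i\<in>I. z i) - \<sigma>) * g s", OF prod_th_hol _ _ w])
    show "(\<lambda>s. g (s + \<tau>) - E ((\<Sum>i\<in>I. z i) - \<sigma>) * g s) holomorphic_on UNIV" by (intro holomorphic_intros h g)
    fix s
    have e: "E (of_nat d * s - \<sigma>) = E (of_nat d * s - (\<Sum>i\<in>I. z i)) * E ((\<Sum>i\<in>I. z i) - \<sigma>)"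
      by (simp flip: exp_per_add)
    show "?P s * (g (s + \<tau>) - E ((\<Sum>i\<in>I. z i) - \<sigma>) * g s) = 0"
    proof -
      let ?A = "(- q) ^ d * E (of_nat d * s - (\<Sum>i\<in>I. z i))"
      have "?A * ?P s * g (s + \<tau>) = (- q) ^ d * E (of_nat d * s - \<sigma>) * (?P s * g s)"
        using p(2)[of s] by (simp only: g(2) prod_th_tau[OF I(1)] I(2))
      also have "\<dots> = ?A * (?P s * (E ((\<Sum>i\<in>I. z i) - \<sigma>) * g s))"
        by (subst e) (simp only: mult_ac)
      finally have "?A * (?P s * (g (s + \<tau>) - E ((\<Sum>i\<in>I. z i) - \<sigma>) * g s)) = 0"
        by (simp only: mult.assoc right_diff_distrib diff_self)
      then show ?thesis using q_nz by simp
    qed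
  qed
  ultimately show ?thesis using that[OF g] by simp
qed

text \<open>A surplus zero is a zero of the quotient by d theta factors, and a quotient with
  constant multiplier has none unless it is identically zero.\<close>

lemma theta_too_many_zeros:
  assumes f: "f holomorphic_on UNIV"
    and p: "\<And>s. f (s + of_real \<rho>) = (-1) ^ d * f s"
      "\<And>s. f (s + \<tau>) = (- q) ^ d * E (of_nat d * s - \<sigma>) * f s"
    and I: "finite I" "card I > d"
    and z: "\<And>i. i \<in> I \<Longrightarrow> f (z i) = 0"
    and dist: "\<And>i j. i \<in> I \<Longrightarrow> j \<in> I \<Longrightarrow> i \<noteq> j \<Longrightarrow> th (z i - z j) \<noteq> 0"
  shows "f s = 0"
proof -
  obtain J where J: "J \<subseteq> I" "card J = d" "finite J"
    by (rule obtain_subset_with_card_n[of d I]) (use I in auto)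
  then have "J \<noteq> I" using I by auto
  then obtain k where k: "k \<in> I" "k \<notin> J" using J(1) by blast
  obtain g where g: "g holomorphic_on UNIV" "\<And>s. f s = (\<Prod>i\<in>J. th (s - z i)) * g s"
    "\<And>s. g (s + of_real \<rho>) = g s" "\<And>s. g (s + \<tau>) = E ((\<Sum>i\<in>J. z i) - \<sigma>) * g s"
    by (rule theta_factor[where f=f and z=z, OF f p J(3,2)]) (use z dist J(1) in blast)+
  have "g (z k) = 0"
  proof -
    have "(\<Prod>i\<in>J. th (z k - z i)) \<noteq> 0"
      using dist[OF k(1)] k(2) J by (auto simp: prod_zero_iff)
    then show ?thesis using z[OF k(1)] g(2)[of "z k"] by simp
  qed
  moreover have m: "g u * g v = g 0 * g (u + v)" for u v
    by (rule const_multiplier[where f=g, OF g(1,3,4)]) simp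
  ultimately have "g 0 * g s = 0" using m[of "z k" "s - z k"] by simp
  \<comment> \<open>Either g s = 0 already, or g 0 = 0 and the relation at (s, s) makes the square
    of g s vanish.\<close>
  then have "g s = 0" using m[of s s] by (metis mult_eq_0_iff)
  then show ?thesis by (simp add: g(2)[of s])
qed

text \<open>Abel's sum rule: if f is not identically zero, the quotient by the theta factors is an
  exponential whose multiplier comes from a lattice point, so the zeros have sum \<sigma> modulo the
  lattice.\<close>

lemma theta_wrong_character:
  assumes f: "f holomorphic_on UNIV"
    and p: "\<And>s. f (s + of_real \<rho>) = (-1) ^ d * f s"
      "\<And>s. f (s + \<tau>) = (- q) ^ d * E (of_nat d * s - \<sigma>) * f s"
    and I: "finite I" "card I = d"
    and z: "\<And>i. i \<in> I \<Longrightarrow> f (z i) = 0"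
    and dist: "\<And>i j. i \<in> I \<Longrightarrow> j \<in> I \<Longrightarrow> i \<noteq> j \<Longrightarrow> th (z i - z j) \<noteq> 0"
    and ch: "th ((\<Sum>i\<in>I. z i) - \<sigma>) \<noteq> 0"
  shows "f s = 0"
proof (rule ccontr)
  assume nz: "f s \<noteq> 0"
  obtain g where g: "g holomorphic_on UNIV" "\<And>s. f s = (\<Prod>i\<in>I. th (s - z i)) * g s"
    "\<And>s. g (s + of_real \<rho>) = g s" "\<And>s. g (s + \<tau>) = E ((\<Sum>i\<in>I. z i) - \<sigma>) * g s"
    by (rule theta_factor[where f=f and z=z, OF f p I]) (use z dist in blast)+
  have "g s \<noteq> 0" using nz g(2)[of s] by auto
  then obtain k :: int where k: "E ((\<Sum>i\<in>I. z i) - \<sigma>) = E (of_int k * \<tau>)"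
    using const_multiplier_exp[where f=g, OF g(1,3,4), of s] by auto
  define X where "X = (\<Sum>i\<in>I. z i) - \<sigma> - of_int k * \<tau>"
  have "E X = 1" by (simp add: X_def exp_per_diff[of _ _ "of_int k * \<tau>"] k)
  then obtain m :: int where "2 * of_real pi * \<i> * X / of_real \<rho>
      = 2 * of_int m * of_real pi * \<i>"
    unfolding exp_per_def exp_eq[of _ 0, simplified] by blast
  then have "X = of_int m * of_real \<rho>"
    using rho_pos by (simp add: field_simps)
  then have "(\<Sum>i\<in>I. z i) - \<sigma> = of_int m * of_real \<rho> + of_int k * \<tau>" by (simp add: X_def algebra_simps)
  then show False using ch th_zero by blast
qed

text \<open>When the sum of the zeros is right, the quotient is doubly periodic and hence constant.
  Cross-multiplication keeps the relation valid where the product is zero.\<close>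

lemma theta_proportional:
  assumes f: "f holomorphic_on UNIV"
    and p: "\<And>s. f (s + of_real \<rho>) = (-1) ^ d * f s"
      "\<And>s. f (s + \<tau>) = (- q) ^ d * E (of_nat d * s - (\<Sum>i\<in>I. z i)) * f s"
    and I: "finite I" "card I = d"
    and z: "\<And>i. i \<in> I \<Longrightarrow> f (z i) = 0"
    and dist: "\<And>i j. i \<in> I \<Longrightarrow> j \<in> I \<Longrightarrow> i \<noteq> j \<Longrightarrow> th (z i - z j) \<noteq> 0"
  shows "f s * (\<Prod>i\<in>I. th (t - z i)) = f t * (\<Prod>i\<in>I. th (s - z i))"
proof -
  obtain g where g: "g holomorphic_on UNIV" "\<And>s. f s = (\<Prod>i\<in>I. th (s - z i)) * g s"
    "\<And>s. g (s + of_real \<rho>) = g s" "\<And>s. g (s + \<tau>) = E ((\<Sum>i\<in>I. z i) - (\<Sum>i\<in>I. z i)) * g s"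
    by (rule theta_factor[where f=f and z=z, OF f p I]) (use z dist in blast)+
  have "g s = g t"
  proof (rule doubly_periodic_const[where f=g, OF g(1,3)])
    show "g (u + \<tau>) = g u" for u using g(4)[of u] by simp
  qed
  then show ?thesis using g(2)[of s] g(2)[of t] by simp
qed

end

section \<open>Symmetrised kernels\<close>

definition alt :: "nat \<Rightarrow> ((nat \<Rightarrow> complex) \<Rightarrow> complex) \<Rightarrow> (nat \<Rightarrow> complex) \<Rightarrow> complex" where
  "alt n f u = (\<Sum>\<sigma> | \<sigma> permutes {..<n}. of_int (sign \<sigma>) * f (u \<circ> \<sigma>))"

lemma sign_compose_permutes:
  assumes "p permutes A" "r permutes A" "finite A"
  shows "sign (p \<circ> r) = sign p * sign r"
  using assms by (intro sign_compose) (auto simp: permutation_permutes)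

lemma sign_square_complex: "complex_of_int (sign p) * complex_of_int (sign p) = 1"
  by (metis of_int_1 of_int_mult sign_idempotent)

lemma alt_permute:
  assumes "p permutes {..<n}"
  shows "alt n f (u \<circ> p) = of_int (sign p) * alt n f u"
proof -
  have "of_int (sign p) * alt n f u = (\<Sum>s | s permutes {..<n}. of_int (sign p) * (of_int (sign (p \<circ> s)) * f (u \<circ> (p \<circ> s))))"
    unfolding alt_def sum_distrib_left by (rule setum_permutations_compose_left[OF assms])
  also have "\<dots> = alt n f (u \<circ> p)"
    unfolding alt_def
    by (rule sum.cong) (auto simp: sign_compose_permutes[OF assms] o_assoc sign_square_complex
        simp flip: mult.assoc)
  finally show ?thesis by simp
qed

lemma alt_cong: "(\<And>u. f u = g u) \<Longrightarrow> alt n f u = alt n g u"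
  by (simp add: alt_def)

text \<open>A permutation p of B is absorbed into the summation variable by passing from s to s p: R
  does not see it and the signs multiply, so all p contribute equally.\<close>

lemma alt_absorb_set:
  assumes B: "B \<subseteq> {..<n}" and R: "\<And>p u. p permutes B \<Longrightarrow> R (u \<circ> p) = R u"
  shows "alt n (\<lambda>u. (\<Sum>p | p permutes B. of_int (sign p) * F (u \<circ> p)) * R u) u
    = of_nat (fact (card B)) * alt n (\<lambda>u. F u * R u) u"
proof -
  have fin: "finite B" using B finite_subset by blast
  have "alt n (\<lambda>u. (\<Sum>p | p permutes B. of_int (sign p) * F (u \<circ> p)) * R u) u =
    (\<Sum>s | s permutes {..<n}. \<Sum>p | p permutes B. of_int (sign (s \<circ> p)) * (F (u \<circ> (s \<circ> p)) * R (u \<circ> (s \<circ> p))))"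
    unfolding alt_def sum_distrib_right sum_distrib_left
  proof (intro sum.cong refl)
    fix s p assume "s \<in> {s. s permutes {..<n}}" "p \<in> {p. p permutes B}"
    then have "s permutes {..<n}" "p permutes {..<n}" "p permutes B"
      using permutes_subset[OF _ B] by auto
    then show "of_int (sign s) * (of_int (sign p) * F ((u \<circ> s) \<circ> p) * R (u \<circ> s)) =
        of_int (sign (s \<circ> p)) * (F (u \<circ> (s \<circ> p)) * R (u \<circ> (s \<circ> p)))"
      using R[of p "u \<circ> s"] by (simp add: sign_compose_permutes o_assoc)
  qed
  also have "\<dots> = (\<Sum>p | p permutes B. \<Sum>s | s permutes {..<n}. of_int (sign (s \<circ> p)) * (F (u \<circ> (s \<circ> p)) * R (u \<circ> (s \<circ> p))))"
    by (rule sum.swap)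
  also have "\<dots> = (\<Sum>p | p permutes B. alt n (\<lambda>u. F u * R u) u)"
  proof (rule sum.cong[OF refl])
    fix p assume "p \<in> {p. p permutes B}"
    then have p: "p permutes {..<n}" using permutes_subset[OF _ B] by auto
    show "(\<Sum>s | s permutes {..<n}. of_int (sign (s \<circ> p)) * (F (u \<circ> (s \<circ> p)) * R (u \<circ> (s \<circ> p)))) =
        alt n (\<lambda>u. F u * R u) u"
      unfolding alt_def
      by (rule sum_permutations_compose_right[OF p, of "\<lambda>s. of_int (sign s) * (F (u \<circ> s) * R (u \<circ> s))", symmetric])
  qed
  also have "\<dots> = of_nat (fact (card B)) * alt n (\<lambda>u. F u * R u) u"
    using card_permutations[OF refl fin] by simp
  finally show ?thesis .
qed

text \<open>Conjugation by the shift identifies permutations of the block with those of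
  \<open>{..<r}\<close>. G must ignore the arguments from r on, where the two sides read different
  variables.\<close>

lemma sum_permutes_shift:
  "(\<Sum>p | p permutes {m..<m+r}. of_int (sign p) * G (\<lambda>i. (u \<circ> p) (m + i))) = alt r G (\<lambda>i. u (m + i))"
  if G: "\<And>u v. (\<forall>i<r. u i = v i) \<Longrightarrow> G u = G v"
proof -
  let ?M = "map_permutation {..<r} ((+) m)"
  have bij: "bij_betw ((+) m) {..<r} {m..<m+r}"
    by (simp add: bij_betw_def lessThan_atLeast0 image_add_atLeastLessThan' add.commute)
  have inj: "inj_on ((+) m) {..<r}" by simp
  have ap: "?M s (m + i) = m + s i" if "i < r" for s i
    using map_permutation_apply[OF inj, of i s] that by simp
  have "bij_betw ?M {s. s permutes {..<r}} {p. p permutes {m..<m+r}}"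
    unfolding bij_betw_def
  proof
    show i: "inj_on ?M {s. s permutes {..<r}}"
    proof (rule inj_onI)
      fix s t assume st: "s \<in> {s. s permutes {..<r}}" "t \<in> {s. s permutes {..<r}}" "?M s = ?M t"
      show "s = t"
      proof
        fix i show "s i = t i"
          using ap[of i s] ap[of i t] st by (cases "i < r") (auto simp: permutes_def)
      qed
    qed
    show "?M ` {s. s permutes {..<r}} = {p. p permutes {m..<m+r}}"
    proof (rule card_subset_eq)
      show "finite {p. p permutes {m..<m+r}}" by (simp add: finite_permutations)
      show "?M ` {s. s permutes {..<r}} \<subseteq> {p. p permutes {m..<m+r}}"
        using map_permutation_permutes[OF bij] by blast
      show "card (?M ` {s. s permutes {..<r}}) = card {p. p permutes {m..<m+r}}"
        by (simp add: card_image[OF i] card_permutations[OF refl])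
    qed
  qed
  then have "(\<Sum>p | p permutes {m..<m+r}. of_int (sign p) * G (\<lambda>i. (u \<circ> p) (m + i))) =
      (\<Sum>s | s permutes {..<r}. of_int (sign (?M s)) * G (\<lambda>i. (u \<circ> ?M s) (m + i)))"
    by (rule sum.reindex_bij_betw[symmetric])
  also have "\<dots> = alt r G (\<lambda>i. u (m + i))"
    unfolding alt_def
  proof (intro sum.cong refl)
    fix s assume "s \<in> {s. s permutes {..<r}}"
    then have s: "s permutes {..<r}" by simp
    have "G (\<lambda>i. (u \<circ> ?M s) (m + i)) = G ((\<lambda>i. u (m + i)) \<circ> s)"
      by (rule G) (simp add: ap)
    then show "of_int (sign (?M s)) * G (\<lambda>i. (u \<circ> ?M s) (m + i)) = of_int (sign s) * G ((\<lambda>i. u (m + i)) \<circ> s)"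
      using sign_map_permutation[OF inj s] by simp
  qed
  finally show ?thesis .
qed

text \<open>Both inner alternations are absorbed by the outer one, each at the cost of a factorial.
  Consequently the antisymmetrised kernel of a concatenation depends on its parts only through their
  own antisymmetrisations.\<close>

lemma alt_split:
  assumes F: "\<And>u v. (\<forall>i<m. u i = v i) \<Longrightarrow> F u = F v"
    and G: "\<And>u v. (\<forall>i<r. u i = v i) \<Longrightarrow> G u = G v"
    and C1: "\<And>p u. p permutes {..<m} \<Longrightarrow> C (u \<circ> p) = C u"
    and C2: "\<And>p u. p permutes {m..<m+r} \<Longrightarrow> C (u \<circ> p) = C u"
  shows "alt (m + r) (\<lambda>u. alt m F u * alt r G (\<lambda>i. u (m + i)) * C u) u =
    of_nat (fact m * fact r) * alt (m + r) (\<lambda>u. F u * G (\<lambda>i. u (m + i)) * C u) u"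
proof -
  have "alt (m + r) (\<lambda>u. alt m F u * alt r G (\<lambda>i. u (m + i)) * C u) u
    = alt (m + r) (\<lambda>u. (\<Sum>p | p permutes {..<m}. of_int (sign p) * F (u \<circ> p)) * (alt r G (\<lambda>i. u (m + i)) * C u)) u"
    by (simp add: alt_def[of m] mult.assoc)
  also have "\<dots> = of_nat (fact (card {..<m})) * alt (m + r) (\<lambda>u. F u * (alt r G (\<lambda>i. u (m + i)) * C u)) u"
  proof (rule alt_absorb_set)
    fix p :: "nat \<Rightarrow> nat" and u :: "nat \<Rightarrow> complex" assume p: "p permutes {..<m}"
    then have "p (m + i) = m + i" for i by (simp add: permutes_def)
    then show "alt r G (\<lambda>i. (u \<circ> p) (m + i)) * C (u \<circ> p) = alt r G (\<lambda>i. u (m + i)) * C u"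
      using C1[OF p] by simp
  qed auto
  also have "alt (m + r) (\<lambda>u. F u * (alt r G (\<lambda>i. u (m + i)) * C u)) u =
    alt (m + r) (\<lambda>u. (\<Sum>p | p permutes {m..<m+r}. of_int (sign p) * G (\<lambda>i. (u \<circ> p) (m + i))) * (F u * C u)) u"
  proof (rule alt_cong)
    fix u show "F u * (alt r G (\<lambda>i. u (m + i)) * C u) =
      (\<Sum>p | p permutes {m..<m+r}. of_int (sign p) * G (\<lambda>i. (u \<circ> p) (m + i))) * (F u * C u)"
      using sum_permutes_shift[where G=G and r=r and u=u and m=m, OF G] by (simp only: mult_ac)
  qed
  also have "\<dots> = of_nat (fact (card {m..<m+r})) * alt (m + r) (\<lambda>u. G (\<lambda>i. u (m + i)) * (F u * C u)) u"
  proof (rule alt_absorb_set)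
    fix p :: "nat \<Rightarrow> nat" and u :: "nat \<Rightarrow> complex" assume p: "p permutes {m..<m+r}"
    then have "F (u \<circ> p) = F u" by (intro F) (simp add: permutes_def)
    then show "F (u \<circ> p) * C (u \<circ> p) = F u * C u" using C2[OF p] by simp
  qed auto
  finally show ?thesis by (simp add: mult_ac)
qed

text \<open>Holomorphy on every complex line suffices here, because zeros are counted, and special
  positions are left, along lines only.\<close>

definition line_entire :: "((nat \<Rightarrow> complex) \<Rightarrow> complex) \<Rightarrow> bool" where
  "line_entire f \<longleftrightarrow> (\<forall>u v. (\<lambda>s. f (\<lambda>i. u i + s * v i)) holomorphic_on UNIV)"

type_synonym block = "nat \<times> ((nat \<Rightarrow> complex) \<Rightarrow> complex)"

definition arity :: "block list \<Rightarrow> nat" where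
  "arity w = (\<Sum>b\<leftarrow>w. fst b)"

lemma arity_simps [simp]: "arity [] = 0" "arity (b # w) = fst b + arity w"
  "arity (w @ w') = arity w + arity w'"
  by (simp_all add: arity_def)

lemma prod_lessThan_add: "(\<Prod>j<m + n. f j) = (\<Prod>j<m. f j) * (\<Prod>j<n. f (m + j :: nat) :: complex)"
  by (induction n) (simp_all add: mult_ac)

lemma sum_lessThan_add: "(\<Sum>j<m + n. f j) = (\<Sum>j<m. f j) + (\<Sum>j<n. f (m + j :: nat) :: complex)"
  by (induction n) (simp_all add: add_ac)

lemma fun_upd_o_permutes:
  assumes "p permutes A" shows "(u(i := x)) \<circ> p = (u \<circ> p)(inv p i := x)"
  using permutes_inverses[OF assms] by (auto simp: fun_eq_iff)

section \<open>Words of blocks and their theta multipliers\<close>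

context theta_function
begin

text \<open>For h = 1/2 this is the denominator of \<open>Q2\<close> in terms of v = u 0 - u 1. The
  step h is kept free because commutation is continued in h.\<close>

definition om :: "complex \<Rightarrow> complex \<Rightarrow> complex" where
  "om h v = th (v + 2 * h) * th (v - h)"

lemma om_zero [simp]: "om h (- 2 * h) = 0" "om h h = 0"
  by (simp_all add: om_def)

lemma om_rho: "om h (v + of_real \<rho>) = om h v" "om h (v - of_real \<rho>) = om h v"
proof -
  have "th (v + of_real \<rho> + 2 * h) = - th (v + 2 * h)" "th (v + of_real \<rho> - h) = - th (v - h)"
    "th (v - of_real \<rho> + 2 * h) = - th (v + 2 * h)" "th (v - of_real \<rho> - h) = - th (v - h)"
    using th_rho[of "v + 2 * h"] th_rho[of "v - h"] th_minus_rho[of "v + 2 * h"] th_minus_rho[of "v - h"]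
    by (simp_all add: algebra_simps)
  then show "om h (v + of_real \<rho>) = om h v" "om h (v - of_real \<rho>) = om h v"
    by (simp_all add: om_def)
qed

lemma om_tau: "om h (v + \<tau>) = q ^ 2 * E (2 * v + h) * om h v" "om h (v - \<tau>) = q ^ 2 * E (- 2 * v - h) * om h v"
proof -
  have "th (v + \<tau> + 2 * h) = - q * E (v + 2 * h) * th (v + 2 * h)" "th (v + \<tau> - h) = - q * E (v - h) * th (v - h)"
    "th (v - \<tau> + 2 * h) = - q * E (- (v + 2 * h)) * th (v + 2 * h)" "th (v - \<tau> - h) = - q * E (- (v - h)) * th (v - h)"
    using th_tau[of "v + 2 * h"] th_tau[of "v - h"] th_minus_tau[of "v + 2 * h"] th_minus_tau[of "v - h"]
    by (simp_all add: algebra_simps)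
  moreover have "2 * v + h = (v + 2 * h) + (v - h)" "- 2 * v - h = - (v + 2 * h) + - (v - h)"
    by simp_all
  then have "E (2 * v + h) = E (v + 2 * h) * E (v - h)" "E (- 2 * v - h) = E (- (v + 2 * h)) * E (- (v - h))"
    by (simp_all only: exp_per_add)
  ultimately show "om h (v + \<tau>) = q ^ 2 * E (2 * v + h) * om h v" "om h (v - \<tau>) = q ^ 2 * E (- 2 * v - h) * om h v"
    by (simp_all add: om_def power2_eq_square)
qed

lemma om_hol [holomorphic_intros]: "f holomorphic_on A \<Longrightarrow> (\<lambda>z. om h (f z)) holomorphic_on A"
  unfolding om_def by (intro holomorphic_intros)

text \<open>
  The term \<open>(n - 1) h\<close> accounts for the shifts in the definition of \<open>kernel\<close> below.
\<close>

definition theta_like :: "complex \<Rightarrow> nat \<Rightarrow> ((nat \<Rightarrow> complex) \<Rightarrow> complex) \<Rightarrow> bool" where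
  "theta_like h n f \<longleftrightarrow> line_entire f \<and> (\<forall>u v. (\<forall>i<n. u i = v i) \<longrightarrow> f u = f v) \<and>
    (\<forall>u. \<forall>i<n. f (u(i := u i + of_real \<rho>)) = - f u) \<and>
    (\<forall>u. \<forall>i<n. f (u(i := u i + \<tau>)) =
       (- q) ^ (2 * n - 1) * E ((2 * of_nat n + 1) * u i - 2 * (\<Sum>j<n. u j) - (of_nat n - 1) * h) * f u)"

lemma theta_likeD:
  assumes "theta_like h n f"
  shows "line_entire f" "(\<And>i. i < n \<Longrightarrow> u i = v i) \<Longrightarrow> f u = f v"
    "i < n \<Longrightarrow> f (u(i := u i + of_real \<rho>)) = - f u"
    "i < n \<Longrightarrow> f (u(i := u i + \<tau>)) =
       (- q) ^ (2 * n - 1) * E ((2 * of_nat n + 1) * u i - 2 * (\<Sum>j<n. u j) - (of_nat n - 1) * h) * f u"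
  using assms unfolding theta_like_def by auto

text \<open>
  The integrand of a product of charges without the currents, multiplied by \<open>om h (u i - u j)\<close> for all \<open>i < j\<close> and freed from
  factors that are symmetric in \<open>u\<close>. For two variables of the same charge this cancels a denominator, so
  \<open>om h\<close> is left over only between different blocks. The shift by \<open>arity w\<close> is that of the operator
  \<open>l\<close>-hat.
\<close>

fun kernel :: "complex \<Rightarrow> block list \<Rightarrow> (nat \<Rightarrow> complex) \<Rightarrow> complex" where
  "kernel h [] u = 1"
| "kernel h (b # w) u = snd b (\<lambda>i. u i - 2 * h * of_nat (arity w)) * kernel h w (\<lambda>i. u (fst b + i))
     * (\<Prod>i<fst b. \<Prod>j<arity w. om h (u i - u (fst b + j)))"

definition good :: "complex \<Rightarrow> block list \<Rightarrow> bool" where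
  "good h w \<longleftrightarrow> (\<forall>b\<in>set w. fst b \<ge> 1 \<and> theta_like h (fst b) (snd b))"

lemma good_simps [simp]: "good h []" "good h (b # w) \<longleftrightarrow> fst b \<ge> 1 \<and> theta_like h (fst b) (snd b) \<and> good h w"
  "good h (w @ w') \<longleftrightarrow> good h w \<and> good h w'"
  by (auto simp: good_def)

text \<open>The multiplier must be the same for a variable of the left block and for one of the
  remaining word, otherwise antisymmetrisation would destroy it. With N variables on the right, the
  shift by 2 h N changes the exponent for the left block by - 2 h N and the factors
  \<open>om\<close> change it by + N h, together - N h. On the other side the n factors
  \<open>om\<close> give - n h, so both agree with the total (n + N - 1) h.\<close>

lemma theta_like_kernel: "good h w \<Longrightarrow> theta_like h (arity w) (kernel h w)"
proof (induction w)
  case Nil then show ?case by (simp add: theta_like_def line_entire_def)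
next
  case (Cons b w)
  obtain n f where b: "b = (n, f)" by (cases b)
  have f: "theta_like h n f" and n: "n \<ge> 1" and g: "theta_like h (arity w) (kernel h w)"
    using Cons b by auto
  define N where "N = arity w"
  define K where "K = kernel h w"
  note g = g[folded N_def K_def]
  have K: "kernel h (b # w) u = f (\<lambda>i. u i - 2 * h * of_nat N) * K (\<lambda>i. u (n + i))
     * (\<Prod>i<n. \<Prod>j<N. om h (u i - u (n + j)))" for u
    by (simp add: b N_def K_def)
  show ?case unfolding theta_like_def
  proof (intro conjI allI impI)
    show "line_entire (kernel h (b # w))" unfolding line_entire_def K
    proof (intro allI holomorphic_intros)
      fix u v :: "nat \<Rightarrow> complex"
      show "(\<lambda>s. f (\<lambda>i. u i + s * v i - 2 * h * of_nat N)) holomorphic_on UNIV"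
        using theta_likeD(1)[OF f, unfolded line_entire_def, rule_format, of "\<lambda>i. u i - 2 * h * of_nat N" v]
        by (simp add: algebra_simps)
      show "(\<lambda>s. K (\<lambda>i. u (n + i) + s * v (n + i))) holomorphic_on UNIV"
        using theta_likeD(1)[OF g, unfolded line_entire_def, rule_format, of "\<lambda>i. u (n + i)" "\<lambda>i. v (n + i)"] .
    qed
  next
    fix u v :: "nat \<Rightarrow> complex" assume uv: "\<forall>i<arity (b # w). u i = v i"
    then have uv: "u i = v i" if "i < n + N" for i using that by (simp add: b N_def)
    have "f (\<lambda>i. u i - 2 * h * of_nat N) = f (\<lambda>i. v i - 2 * h * of_nat N)"
      by (rule theta_likeD(2)[OF f]) (simp add: uv)
    moreover have "K (\<lambda>i. u (n + i)) = K (\<lambda>i. v (n + i))"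
      by (rule theta_likeD(2)[OF g]) (simp add: uv)
    ultimately show "kernel h (b # w) u = kernel h (b # w) v"
      unfolding K by (simp add: uv)
  next
    fix u :: "nat \<Rightarrow> complex" and i assume i: "i < arity (b # w)"
    let ?u = "u(i := u i + of_real \<rho>)"
    have C: "(\<Prod>i<n. \<Prod>j<N. om h (?u i - ?u (n + j))) = (\<Prod>i<n. \<Prod>j<N. om h (u i - u (n + j)))"
    proof (intro prod.cong refl)
      fix k j assume "k \<in> {..<n}" "j \<in> {..<N}"
      then have "?u k - ?u (n + j) = u k - u (n + j) \<or> ?u k - ?u (n + j) = u k - u (n + j) + of_real \<rho> \<or>
        ?u k - ?u (n + j) = u k - u (n + j) - of_real \<rho>"
        by auto
      then show "om h (?u k - ?u (n + j)) = om h (u k - u (n + j))"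
        by (auto simp only: om_rho)
    qed
    show "kernel h (b # w) ?u = - kernel h (b # w) u"
    proof (cases "i < n")
      case True
      have "(\<lambda>k. ?u k - 2 * h * of_nat N) = (\<lambda>k. u k - 2 * h * of_nat N)(i := (u i - 2 * h * of_nat N) + of_real \<rho>)"
        by (auto simp: fun_eq_iff)
      then have "f (\<lambda>k. ?u k - 2 * h * of_nat N) = - f (\<lambda>k. u k - 2 * h * of_nat N)"
        using theta_likeD(3)[OF f True, of "\<lambda>k. u k - 2 * h * of_nat N"] by simp
      moreover have "(\<lambda>k. ?u (n + k)) = (\<lambda>k. u (n + k))" using True by (auto simp: fun_eq_iff)
      ultimately show ?thesis unfolding K C by simp
    next
      case False
      then obtain k where k: "i = n + k" by (metis le_iff_add linorder_not_less)
      have "f (\<lambda>k. ?u k - 2 * h * of_nat N) = f (\<lambda>k. u k - 2 * h * of_nat N)"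
        by (rule theta_likeD(2)[OF f]) (use False in auto)
      moreover have "(\<lambda>k. ?u (n + k)) = (\<lambda>k. u (n + k))(k := u (n + k) + of_real \<rho>)" by (auto simp: fun_eq_iff k)
      then have "K (\<lambda>k. ?u (n + k)) = - K (\<lambda>k. u (n + k))"
        using theta_likeD(3)[OF g, of k "\<lambda>k. u (n + k)"] i k by (simp add: b N_def)
      ultimately show ?thesis unfolding K C by simp
    qed
  next
    fix u :: "nat \<Rightarrow> complex" and i assume i: "i < arity (b # w)"
    let ?u = "u(i := u i + \<tau>)"
    let ?C = "\<Prod>i<n. \<Prod>j<N. om h (u i - u (n + j))"
    let ?S = "\<Sum>j<n + N. u j"
    have split: "?S = (\<Sum>j<n. u j) + (\<Sum>j<N. u (n + j))" by (rule sum_lessThan_add)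
    have ar: "arity (b # w) = n + N" by (simp add: b N_def)
    show "kernel h (b # w) ?u = (- q) ^ (2 * arity (b # w) - 1) * E ((2 * of_nat (arity (b # w)) + 1) * u i
        - 2 * (\<Sum>j<arity (b # w). u j) - (of_nat (arity (b # w)) - 1) * h) * kernel h (b # w) u"
      unfolding ar
    proof (cases "i < n")
      case True
      have "(\<Prod>k<n. \<Prod>j<N. om h (?u k - ?u (n + j))) =
          (\<Prod>k<n. (if k = i then \<Prod>j<N. q ^ 2 * E (2 * (u i - u (n + j)) + h) else 1) * (\<Prod>j<N. om h (u k - u (n + j))))"
      proof (intro prod.cong refl)
        fix k assume k: "k \<in> {..<n}"
        show "(\<Prod>j<N. om h (?u k - ?u (n + j))) =
          (if k = i then \<Prod>j<N. q ^ 2 * E (2 * (u i - u (n + j)) + h) else 1) * (\<Prod>j<N. om h (u k - u (n + j)))"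
        proof (cases "k = i")
          case ki: True
          have "om h (?u k - ?u (n + j)) = q ^ 2 * E (2 * (u i - u (n + j)) + h) * om h (u k - u (n + j))" for j
            using om_tau(1)[of h "u i - u (n + j)"] True ki by (simp add: algebra_simps)
          then show ?thesis using ki by (simp add: prod.distrib)
        qed (use True in auto)
      qed
      also have "\<dots> = (\<Prod>j<N. q ^ 2 * E (2 * (u i - u (n + j)) + h)) * ?C"
        using True by (simp add: prod.distrib prod.delta')
      also have "(\<Prod>j<N. q ^ 2 * E (2 * (u i - u (n + j)) + h)) =
          (- q) ^ (2 * N) * E (\<Sum>j<N. 2 * (u i - u (n + j)) + h)"
        by (simp add: prod.distrib exp_per_sum power_mult)
      also have "(\<Sum>j<N. 2 * (u i - u (n + j)) + h) = 2 * of_nat N * u i - 2 * (\<Sum>j<N. u (n + j)) + of_nat N * h"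
        by (simp add: sum.distrib sum_subtractf algebra_simps flip: sum_distrib_left)
      finally have C: "(\<Prod>k<n. \<Prod>j<N. om h (?u k - ?u (n + j))) = (- q) ^ (2 * N) *
          E (2 * of_nat N * u i - 2 * (\<Sum>j<N. u (n + j)) + of_nat N * h) * ?C" .
      have "(\<lambda>k. ?u k - 2 * h * of_nat N) = (\<lambda>k. u k - 2 * h * of_nat N)(i := (u i - 2 * h * of_nat N) + \<tau>)"
        by (auto simp: fun_eq_iff)
      then have F: "f (\<lambda>k. ?u k - 2 * h * of_nat N) = (- q) ^ (2 * n - 1) *
          E ((2 * of_nat n + 1) * (u i - 2 * h * of_nat N) - 2 * (\<Sum>j<n. u j - 2 * h * of_nat N) - (of_nat n - 1) * h)
          * f (\<lambda>k. u k - 2 * h * of_nat N)"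
        using theta_likeD(4)[OF f True, of "\<lambda>k. u k - 2 * h * of_nat N"] by simp
      have "(\<lambda>k. ?u (n + k)) = (\<lambda>k. u (n + k))" using True by (auto simp: fun_eq_iff)
      then have G: "K (\<lambda>k. ?u (n + k)) = K (\<lambda>k. u (n + k))" by simp
      have qq: "(- q) ^ (2 * (n + N) - 1) = (- q) ^ (2 * n - 1) * (- q) ^ (2 * N)"
        using n by (simp flip: power_add)
      have ee: "E ((2 * of_nat (n + N) + 1) * u i - 2 * ?S - (of_nat (n + N) - 1) * h) =
        E ((2 * of_nat n + 1) * (u i - 2 * h * of_nat N) - 2 * (\<Sum>j<n. u j - 2 * h * of_nat N) - (of_nat n - 1) * h)
        * E (2 * of_nat N * u i - 2 * (\<Sum>j<N. u (n + j)) + of_nat N * h)"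
        unfolding split by (simp add: sum_subtractf algebra_simps flip: exp_per_add)
      show "kernel h (b # w) ?u = (- q) ^ (2 * (n + N) - 1) * E ((2 * of_nat (n + N) + 1) * u i
        - 2 * ?S - (of_nat (n + N) - 1) * h) * kernel h (b # w) u"
        unfolding K C F G qq ee by (simp only: mult_ac)
    next
      case False
      then obtain k where k: "i = n + k" by (metis le_iff_add linorder_not_less)
      have kN: "k < N" using i k ar by simp
      have "(\<Prod>i<n. \<Prod>j<N. om h (?u i - ?u (n + j))) =
          (\<Prod>i<n. (q ^ 2 * E (- 2 * (u i - u (n + k)) - h)) * (\<Prod>j<N. om h (u i - u (n + j))))"
      proof (intro prod.cong refl)
        fix m assume m: "m \<in> {..<n}"
        have "(\<Prod>j<N. om h (?u m - ?u (n + j))) =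
          (\<Prod>j<N. (if j = k then q ^ 2 * E (- 2 * (u m - u (n + k)) - h) else 1) * om h (u m - u (n + j)))"
        proof (intro prod.cong refl)
          fix j
          have "om h (u m - (u (n + k) + \<tau>)) = q ^ 2 * E (- 2 * (u m - u (n + k)) - h) * om h (u m - u (n + k))"
            using om_tau(2)[of h "u m - u (n + k)"] by (simp add: algebra_simps)
          then show "om h (?u m - ?u (n + j)) =
            (if j = k then q ^ 2 * E (- 2 * (u m - u (n + k)) - h) else 1) * om h (u m - u (n + j))"
            using m k by auto
        qed
        then show "(\<Prod>j<N. om h (?u m - ?u (n + j))) =
          (q ^ 2 * E (- 2 * (u m - u (n + k)) - h)) * (\<Prod>j<N. om h (u m - u (n + j)))"
          using kN by (simp add: prod.distrib prod.delta')
      qed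
      also have "\<dots> = (\<Prod>i<n. q ^ 2 * E (- 2 * (u i - u (n + k)) - h)) * ?C"
        by (simp only: prod.distrib)
      also have "(\<Prod>i<n. q ^ 2 * E (- 2 * (u i - u (n + k)) - h)) =
          (- q) ^ (2 * n) * E (\<Sum>i<n. - 2 * (u i - u (n + k)) - h)"
        by (simp add: prod.distrib exp_per_sum power_mult)
      also have "(\<Sum>i<n. - 2 * (u i - u (n + k)) - h) = 2 * of_nat n * u i - 2 * (\<Sum>j<n. u j) - of_nat n * h"
        by (simp add: k sum.distrib sum_subtractf algebra_simps flip: sum_distrib_left sum_distrib_right)
      finally have C: "(\<Prod>i<n. \<Prod>j<N. om h (?u i - ?u (n + j))) = (- q) ^ (2 * n) *
          E (2 * of_nat n * u i - 2 * (\<Sum>j<n. u j) - of_nat n * h) * ?C" .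
      have "(\<lambda>k. ?u (n + k)) = (\<lambda>k. u (n + k))(k := u (n + k) + \<tau>)" by (auto simp: fun_eq_iff k)
      then have G: "K (\<lambda>k. ?u (n + k)) = (- q) ^ (2 * N - 1) *
          E ((2 * of_nat N + 1) * u i - 2 * (\<Sum>j<N. u (n + j)) - (of_nat N - 1) * h) * K (\<lambda>k. u (n + k))"
        using theta_likeD(4)[OF g kN, of "\<lambda>k. u (n + k)"] k by simp
      have F: "f (\<lambda>k. ?u k - 2 * h * of_nat N) = f (\<lambda>k. u k - 2 * h * of_nat N)"
        by (rule theta_likeD(2)[OF f]) (use False in auto)
      have "2 * (n + N) - 1 = 2 * n + (2 * N - 1)" using kN by simp
      then have qq: "(- q) ^ (2 * (n + N) - 1) = (- q) ^ (2 * n) * (- q) ^ (2 * N - 1)"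
        by (simp only: power_add)
      have ee: "E ((2 * of_nat (n + N) + 1) * u i - 2 * ?S - (of_nat (n + N) - 1) * h) =
        E (2 * of_nat n * u i - 2 * (\<Sum>j<n. u j) - of_nat n * h)
        * E ((2 * of_nat N + 1) * u i - 2 * (\<Sum>j<N. u (n + j)) - (of_nat N - 1) * h)"
        unfolding split by (simp add: algebra_simps flip: exp_per_add)
      show "kernel h (b # w) ?u = (- q) ^ (2 * (n + N) - 1) * E ((2 * of_nat (n + N) + 1) * u i
        - 2 * ?S - (of_nat (n + N) - 1) * h) * kernel h (b # w) u"
        unfolding K C F G qq ee by (simp only: mult_ac)
    qed
  qed
qed

text \<open>The multiplier for u i contains the other variables only through the symmetric sum, so
  all permuted terms share it.\<close>

lemma theta_like_alt:
  assumes f: "theta_like h n f"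
  shows "theta_like h n (alt n f)"
  unfolding theta_like_def
proof (intro conjI allI impI)
  show "line_entire (alt n f)"
    unfolding line_entire_def alt_def
  proof (intro allI holomorphic_intros)
    fix u v :: "nat \<Rightarrow> complex" and p
    show "(\<lambda>s. f ((\<lambda>i. u i + s * v i) \<circ> p)) holomorphic_on UNIV"
      using theta_likeD(1)[OF f, unfolded line_entire_def, rule_format, of "u \<circ> p" "v \<circ> p"] by (simp add: o_def)
  qed
next
  fix u v :: "nat \<Rightarrow> complex" assume uv: "\<forall>i<n. u i = v i"
  show "alt n f u = alt n f v" unfolding alt_def
  proof (intro sum.cong refl arg_cong2[where f="(*)"] theta_likeD(2)[OF f])
    fix p i assume "p \<in> {p. p permutes {..<n}}" "i < n"
    then have "p i < n" using permutes_in_image[of p "{..<n}" i] by auto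
    then show "(u \<circ> p) i = (v \<circ> p) i" using uv by simp
  qed
next
  fix u :: "nat \<Rightarrow> complex" and i assume i: "i < n"
  have inv: "inv p i < n" if "p permutes {..<n}" for p
    using permutes_in_image[OF permutes_inv[OF that], of i] i by auto
  have up: "(u \<circ> p) (inv p i) = u i" if "p permutes {..<n}" for p
    using permutes_inverses[OF that] by simp
  have sm: "(\<Sum>j<n. (u \<circ> p) j) = (\<Sum>j<n. u j)" if "p permutes {..<n}" for p
    using sum.permute[OF that, of u] by simp
  have 1: "of_int (sign p) * f (u(i := u i + of_real \<rho>) \<circ> p) = - (of_int (sign p) * f (u \<circ> p))"
    if p: "p permutes {..<n}" for p
  proof -
    have "f ((u \<circ> p)(inv p i := u i + of_real \<rho>)) = - f (u \<circ> p)"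
      using theta_likeD(3)[OF f inv[OF p], of "u \<circ> p"] unfolding up[OF p] .
    then show ?thesis by (simp add: fun_upd_o_permutes[OF p])
  qed
  then show "alt n f (u(i := u i + of_real \<rho>)) = - alt n f u"
    by (simp add: alt_def flip: sum_negf)
  define M where "M = (- q) ^ (2 * n - 1) * E ((2 * of_nat n + 1) * u i - 2 * (\<Sum>j<n. u j) - (of_nat n - 1) * h)"
  have "of_int (sign p) * f (u(i := u i + \<tau>) \<circ> p) = M * (of_int (sign p) * f (u \<circ> p))"
    if p: "p permutes {..<n}" for p
  proof -
    have "f ((u \<circ> p)(inv p i := u i + \<tau>)) = M * f (u \<circ> p)"
      using theta_likeD(4)[OF f inv[OF p], of "u \<circ> p"] unfolding up[OF p] sm[OF p] M_def .
    then show ?thesis by (simp add: fun_upd_o_permutes[OF p])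
  qed
  then show "alt n f (u(i := u i + \<tau>)) = (- q) ^ (2 * n - 1) *
      E ((2 * of_nat n + 1) * u i - 2 * (\<Sum>j<n. u j) - (of_nat n - 1) * h) * alt n f u"
    unfolding M_def[symmetric] by (simp add: alt_def sum_distrib_left mult.left_commute)
qed

definition N :: "complex \<Rightarrow> block list \<Rightarrow> (nat \<Rightarrow> complex) \<Rightarrow> complex" where
  "N h w = alt (arity w) (kernel h w)"

lemma theta_like_N: "good h w \<Longrightarrow> theta_like h (arity w) (N h w)"
  unfolding N_def by (intro theta_like_alt theta_like_kernel)

lemma kernel_append:
  "kernel h (w @ w') u = kernel h w (\<lambda>i. u i - 2 * h * of_nat (arity w')) * kernel h w' (\<lambda>i. u (arity w + i))
     * (\<Prod>i<arity w. \<Prod>j<arity w'. om h (u i - u (arity w + j)))"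
proof (induction w arbitrary: u)
  case (Cons b w)
  let ?n = "fst b" and ?a = "arity w" and ?b = "arity w'"
  have 1: "(\<Prod>i<?n. \<Prod>j<?a + ?b. om h (u i - u (?n + j))) =
    (\<Prod>i<?n. \<Prod>j<?a. om h (u i - u (?n + j))) * (\<Prod>i<?n. \<Prod>j<?b. om h (u i - u (?n + ?a + j)))"
    by (simp add: prod_lessThan_add prod.distrib add.assoc)
  have 2: "(\<Prod>i<?n + ?a. \<Prod>j<?b. om h (u i - u (?n + ?a + j))) =
    (\<Prod>i<?n. \<Prod>j<?b. om h (u i - u (?n + ?a + j))) * (\<Prod>i<?a. \<Prod>j<?b. om h (u (?n + i) - u (?n + ?a + j)))"
    by (simp add: prod_lessThan_add)
  have 3: "(\<lambda>i. u i - 2 * h * of_nat (?a + ?b)) = (\<lambda>i. u i - 2 * h * of_nat ?b - 2 * h * of_nat ?a)"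
    by (simp add: algebra_simps)
  show ?case
    by (simp add: Cons 1 2 add.assoc flip: 3) (simp add: 1[unfolded add.assoc] 2[unfolded add.assoc] mult_ac)
qed simp

definition cross :: "complex \<Rightarrow> nat \<Rightarrow> nat \<Rightarrow> (nat \<Rightarrow> complex) \<Rightarrow> complex" where
  "cross h m n u = (\<Prod>i<m. \<Prod>j<n. om h (u i - u (m + j)))"

text \<open>The factor \<open>cross\<close> is invariant under permutations within either part, so
  the two alternations can be carried out separately. The result is bilinear in the symmetrised
  parts, and its vanishing can be checked term by term.\<close>

lemma N_append:
  assumes "good h w" "good h w'"
  shows "of_nat (fact (arity w) * fact (arity w')) * N h (w @ w') u =
    (\<Sum>p | p permutes {..<arity w + arity w'}. of_int (sign p) *
      (N h w (\<lambda>i. u (p i) - 2 * h * of_nat (arity w')) * N h w' (\<lambda>i. u (p (arity w + i))) *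
       cross h (arity w) (arity w') (u \<circ> p)))"
proof -
  let ?m = "arity w" and ?r = "arity w'"
  let ?F = "\<lambda>u. kernel h w (\<lambda>i. u i - 2 * h * of_nat ?r)"
  have "of_nat (fact ?m * fact ?r) * N h (w @ w') u = of_nat (fact ?m * fact ?r) *
      alt (?m + ?r) (\<lambda>u. ?F u * kernel h w' (\<lambda>i. u (?m + i)) * cross h ?m ?r u) u"
    unfolding N_def kernel_append cross_def by simp
  also have "\<dots> = alt (?m + ?r) (\<lambda>u. alt ?m ?F u * alt ?r (kernel h w') (\<lambda>i. u (?m + i)) * cross h ?m ?r u) u"
  proof (rule alt_split[symmetric])
    fix u v :: "nat \<Rightarrow> complex" assume "\<forall>i<?m. u i = v i"
    then show "?F u = ?F v" by (intro theta_likeD(2)[OF theta_like_kernel[OF assms(1)]]) auto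
  next
    fix u v :: "nat \<Rightarrow> complex" assume "\<forall>i<?r. u i = v i"
    then show "kernel h w' u = kernel h w' v" by (intro theta_likeD(2)[OF theta_like_kernel[OF assms(2)]]) auto
  next
    fix p :: "nat \<Rightarrow> nat" and u :: "nat \<Rightarrow> complex" assume p: "p permutes {..<?m}"
    then have "p (?m + j) = ?m + j" for j by (simp add: permutes_def)
    then have "cross h ?m ?r (u \<circ> p) = (\<Prod>i<?m. (\<lambda>i. \<Prod>j<?r. om h (u i - u (?m + j))) (p i))"
      by (simp add: cross_def)
    also have "\<dots> = cross h ?m ?r u" unfolding cross_def
      using prod.permute[OF p, of "\<lambda>i. \<Prod>j<?r. om h (u i - u (?m + j))"] by (simp add: o_def)
    finally show "cross h ?m ?r (u \<circ> p) = cross h ?m ?r u" .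
  next
    fix p :: "nat \<Rightarrow> nat" and u :: "nat \<Rightarrow> complex" assume p: "p permutes {?m..<?m+?r}"
    have re: "(\<Prod>j<?r. om h (a - v (?m + j))) = (\<Prod>j\<in>{?m..<?m+?r}. om h (a - v j))" for a and v :: "nat \<Rightarrow> complex"
      using prod.shift_bounds_nat_ivl[of "\<lambda>j. om h (a - v j)" 0 ?m ?r] by (simp add: lessThan_atLeast0 add.commute)
    have "p i = i" if "i < ?m" for i using p that by (simp add: permutes_def)
    then have "cross h ?m ?r (u \<circ> p) = (\<Prod>i<?m. \<Prod>j<?r. om h (u i - u (p (?m + j))))"
      by (simp add: cross_def)
    also have "\<dots> = (\<Prod>i<?m. \<Prod>j\<in>{?m..<?m+?r}. om h (u i - u (p j)))"
      using re[of _ "\<lambda>j. u (p j)"] by simp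
    also have "\<dots> = (\<Prod>i<?m. \<Prod>j\<in>{?m..<?m+?r}. om h (u i - u j))"
      using prod.permute[OF p, of "\<lambda>j. om h (u i - u j)" for i] by (simp add: o_def)
    also have "\<dots> = cross h ?m ?r u" unfolding cross_def re ..
    finally show "cross h ?m ?r (u \<circ> p) = cross h ?m ?r u" .
  qed
  also have "\<dots> = alt (?m + ?r) (\<lambda>u. N h w (\<lambda>i. u i - 2 * h * of_nat ?r) * N h w' (\<lambda>i. u (?m + i)) * cross h ?m ?r u) u"
  proof (rule alt_cong)
    fix u
    have "alt ?m ?F u = N h w (\<lambda>i. u i - 2 * h * of_nat ?r)"
      unfolding N_def alt_def by (simp add: o_def)
    then show "alt ?m ?F u * alt ?r (kernel h w') (\<lambda>i. u (?m + i)) * cross h ?m ?r u =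
      N h w (\<lambda>i. u i - 2 * h * of_nat ?r) * N h w' (\<lambda>i. u (?m + i)) * cross h ?m ?r u"
      by (simp add: N_def)
  qed
  finally show ?thesis unfolding alt_def[of "?m + ?r"] by (simp add: o_def)
qed

lemma N_append_zero:
  assumes "good h w" "good h w'"
    and "\<And>p. p permutes {..<arity w + arity w'} \<Longrightarrow>
      N h w (\<lambda>i. u (p i) - 2 * h * of_nat (arity w')) = 0 \<or> N h w' (\<lambda>i. u (p (arity w + i))) = 0 \<or>
       cross h (arity w) (arity w') (u \<circ> p) = 0"
  shows "N h (w @ w') u = 0"
proof -
  have "of_nat (fact (arity w) * fact (arity w')) * N h (w @ w') u = 0"
    unfolding N_append[OF assms(1,2)] by (intro sum.neutral ballI) (use assms(3) in auto)
  then show ?thesis by simp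
qed

text \<open>Bilinearity of concatenation lets a linear relation between symmetrised words be used
  inside a longer word. Commutation of two letters enters long words in this way.\<close>

lemma N_append_linear_right:
  assumes g: "good h w" "good h x" "good h y" "good h z" and ar: "arity y = arity x" "arity z = arity x"
    and lin: "\<And>u. N h x u = a * N h y u + b * N h z u"
  shows "N h (w @ x) u = a * N h (w @ y) u + b * N h (w @ z) u"
proof -
  let ?c = "of_nat (fact (arity w) * fact (arity x)) :: complex"
  have "?c * N h (w @ x) u = ?c * (a * N h (w @ y) u) + ?c * (b * N h (w @ z) u)"
    using N_append[OF g(1,2), of u] N_append[OF g(1,3), of u] N_append[OF g(1,4), of u]
    unfolding ar by (simp add: lin algebra_simps sum.distrib sum_distrib_left sum_distrib_right mult.left_commute[of _ a] mult.left_commute[of _ b])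
  then have "?c * N h (w @ x) u = ?c * (a * N h (w @ y) u + b * N h (w @ z) u)" by (simp only: distrib_left)
  then show ?thesis by (subst (asm) mult_cancel_left) simp
qed

lemma N_append_linear_left:
  assumes g: "good h w" "good h x" "good h y" "good h z" and ar: "arity y = arity x" "arity z = arity x"
    and lin: "\<And>u. N h x u = a * N h y u + b * N h z u"
  shows "N h (x @ w) u = a * N h (y @ w) u + b * N h (z @ w) u"
proof -
  let ?c = "of_nat (fact (arity x) * fact (arity w)) :: complex"
  have "?c * N h (x @ w) u = ?c * (a * N h (y @ w) u) + ?c * (b * N h (z @ w) u)"
    using N_append[OF g(2,1), of u] N_append[OF g(3,1), of u] N_append[OF g(4,1), of u]
    unfolding ar by (simp add: lin algebra_simps sum.distrib sum_distrib_left sum_distrib_right mult.left_commute[of _ a] mult.left_commute[of _ b])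
  then have "?c * N h (x @ w) u = ?c * (a * N h (y @ w) u + b * N h (z @ w) u)" by (simp only: distrib_left)
  then show ?thesis by (subst (asm) mult_cancel_left) simp
qed

lemma N_append_cong:
  assumes g: "good h w" "good h x" "good h y" and ar: "arity y = arity x" and eq: "\<And>u. N h x u = N h y u"
  shows "N h (w @ x) u = N h (w @ y) u" "N h (x @ w) u = N h (y @ w) u"
  using N_append_linear_right[OF g(1,2,3,3) ar ar, of 1 0] N_append_linear_left[OF g(1,2,3,3) ar ar, of 1 0] eq
  by simp_all

end

section \<open>Zeros of symmetrised kernels\<close>

definition move :: "nat set \<Rightarrow> complex \<Rightarrow> (nat \<Rightarrow> complex) \<Rightarrow> nat \<Rightarrow> complex" where
  "move S s u = (\<lambda>i. if i \<in> S then u i + s else u i)"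

lemma move_0 [simp]: "move S 0 u = u"
  by (simp add: move_def fun_eq_iff)

lemma move_add: "move S (s + t) u = move S t (move S s u)"
  by (simp add: move_def fun_eq_iff)

lemma line_entire_move: "line_entire f \<Longrightarrow> (\<lambda>s. f (move S s u)) holomorphic_on UNIV"
proof -
  assume "line_entire f"
  then have "(\<lambda>s. f (\<lambda>i. u i + s * (if i \<in> S then 1 else 0))) holomorphic_on UNIV"
    unfolding line_entire_def by (elim allE[of _ u] allE[of _ "\<lambda>i. if i \<in> S then 1 else 0"])
  moreover have "(\<lambda>i. u i + s * (if i \<in> S then 1 else 0)) = move S s u" for s
    by (auto simp: move_def fun_eq_iff)
  ultimately show ?thesis by simp
qed

definition antisym_fun :: "nat \<Rightarrow> ((nat \<Rightarrow> complex) \<Rightarrow> complex) \<Rightarrow> bool" where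
  "antisym_fun n f \<longleftrightarrow> (\<forall>p u. p permutes {..<n} \<longrightarrow> f (u \<circ> p) = of_int (sign p) * f u)"

lemma antisym_alt: "antisym_fun n (alt n f)"
  by (simp add: antisym_fun_def alt_permute)

lemma antisym_coincidence:
  assumes "antisym_fun n f" "i < n" "j < n" "i \<noteq> j" "u i = u j"
  shows "f u = 0"
proof -
  have "Transposition.transpose i j permutes {..<n}" using assms by (intro permutes_swap_id) auto
  then have "f (u \<circ> Transposition.transpose i j) = - f u"
    using assms by (simp add: sign_swap_id antisym_fun_def)
  moreover have "u \<circ> Transposition.transpose i j = u"
    using assms(5) by (auto simp: fun_eq_iff Transposition.transpose_def)
  ultimately show ?thesis by simp
qed

lemma antisym_permute_zero:
  assumes "antisym_fun n f" "p permutes {..<n}" "f (u \<circ> p) = 0"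
  shows "f u = 0"
proof -
  have "of_int (sign p) * f u = 0" using assms by (simp add: antisym_fun_def)
  then show ?thesis by simp
qed

lemma eventually_zero_imp_zero:
  assumes "continuous_on UNIV g" "\<forall>\<^sub>F s in at 0. g s = (0::complex)"
  shows "g (0::complex) = 0"
proof -
  have "(g \<longlongrightarrow> g 0) (at 0)"
    using assms(1) by (simp add: continuous_on_eq_continuous_at continuous_at)
  moreover have "(g \<longlongrightarrow> 0) (at 0)" using assms(2) by (rule tendsto_eventually)
  ultimately show ?thesis by (rule tendsto_unique[rotated]) simp
qed

lemma line_entire_extend:
  assumes "line_entire f" "\<forall>\<^sub>F s in at 0. f (\<lambda>i. u i + s * v i) = 0"
  shows "f u = 0"
proof -
  have "continuous_on UNIV (\<lambda>s. f (\<lambda>i. u i + s * v i))"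
    using assms(1) unfolding line_entire_def by (intro holomorphic_on_imp_continuous_on) blast
  from eventually_zero_imp_zero[OF this assms(2)] show ?thesis by simp
qed

section \<open>Degrees under simultaneous translation of variables\<close>

context theta_function
begin

lemma theta_like_lin:
  assumes "theta_like h n f" "theta_like h n g"
  shows "theta_like h n (\<lambda>u. a * f u + b * g u)"
  unfolding theta_like_def
proof (intro conjI allI impI)
  show "line_entire (\<lambda>u. a * f u + b * g u)"
    using theta_likeD(1)[OF assms(1)] theta_likeD(1)[OF assms(2)]
    unfolding line_entire_def by (auto intro!: holomorphic_intros)
next
  fix u v :: "nat \<Rightarrow> complex" assume "\<forall>i<n. u i = v i"
  then show "a * f u + b * g u = a * f v + b * g v"
    using theta_likeD(2)[OF assms(1), of u v] theta_likeD(2)[OF assms(2), of u v] by simp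
next
  fix u :: "nat \<Rightarrow> complex" and i assume i: "i < n"
  show "a * f (u(i := u i + of_real \<rho>)) + b * g (u(i := u i + of_real \<rho>)) = - (a * f u + b * g u)"
    by (simp add: theta_likeD(3)[OF assms(1) i] theta_likeD(3)[OF assms(2) i])
  show "a * f (u(i := u i + \<tau>)) + b * g (u(i := u i + \<tau>)) = (- q) ^ (2 * n - 1) *
     E ((2 * of_nat n + 1) * u i - 2 * (\<Sum>j<n. u j) - (of_nat n - 1) * h) * (a * f u + b * g u)"
  proof -
    define M where "M = (- q) ^ (2 * n - 1) * E ((2 * of_nat n + 1) * u i - 2 * (\<Sum>j<n. u j) - (of_nat n - 1) * h)"
    have "f (u(i := u i + \<tau>)) = M * f u" "g (u(i := u i + \<tau>)) = M * g u"
      using theta_likeD(4)[OF assms(1) i] theta_likeD(4)[OF assms(2) i] by (simp_all only: M_def)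
    then show ?thesis unfolding M_def[symmetric] by (simp add: algebra_simps)
  qed
qed

lemma antisym_lin:
  "antisym_fun n f \<Longrightarrow> antisym_fun n g \<Longrightarrow> antisym_fun n (\<lambda>u. a * f u + b * g u)"
  by (simp add: antisym_fun_def algebra_simps)

lemma antisym_N: "antisym_fun (arity w) (N h w)"
  unfolding N_def by (rule antisym_alt)

text \<open>Each translated variable contributes degree 2 n - 1, and each pair translated together
  lowers the total by 4, because the sum of all variables stands in the exponent. The degree is thus
  2 n - 1 for one variable, 3 (n - 1) for all but one, and n for all; these are the counts used
  below.\<close>

lemma theta_like_move:
  assumes f: "theta_like h n f" and S: "S \<subseteq> {..<n}"
  defines "d \<equiv> card S * (2 * n + 1 - 2 * card S)"
  shows "f (move S (of_real \<rho>) u) = (-1) ^ card S * f u"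
    and "f (move S \<tau> u) = (- q) ^ d * E ((2 * of_nat n + 1) * (\<Sum>i\<in>S. u i)
      - 2 * of_nat (card S) * (\<Sum>i<n. u i) - of_nat (card S) * (of_nat n - 1) * h) * f u"
proof -
  have fin: "finite S" using S finite_subset by blast
  have mv: "move (insert i S) s u = (move S s u)(i := move S s u i + s)" "move S s u i = u i" if "i \<notin> S" for i S s
    using that by (auto simp: move_def fun_eq_iff)
  show "f (move S (of_real \<rho>) u) = (-1) ^ card S * f u"
    using fin S
  proof (induction S rule: finite_induct)
    case empty then show ?case by (simp add: move_def)
  next
    case (insert i S)
    then have i: "i < n" "i \<notin> S" by auto
    show ?case unfolding mv(1)[OF i(2)] using theta_likeD(3)[OF f i(1), of "move S (of_real \<rho>) u"] insert
      by (simp add: fun_upd_def)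
  qed
  show "f (move S \<tau> u) = (- q) ^ d * E ((2 * of_nat n + 1) * (\<Sum>i\<in>S. u i)
      - 2 * of_nat (card S) * (\<Sum>i<n. u i) - of_nat (card S) * (of_nat n - 1) * h) * f u"
    unfolding d_def using fin S
  proof (induction S rule: finite_induct)
    case empty then show ?case by (simp add: move_def)
  next
    case (insert i S)
    have i: "i < n" "S \<subseteq> {..<n}" and iS: "i \<notin> S" using insert by auto
    have "card (insert i S) \<le> n" using insert.prems card_mono[of "{..<n}"] by fastforce
    then have k: "Suc (card S) \<le> n" using insert.hyps by simp
    define k where "k = card S"
    let ?d = "\<lambda>k. k * (2 * n + 1 - 2 * k)"
    have dd: "?d (Suc k) + 4 * k = ?d k + (2 * n - 1)"
    proof -
      obtain m where "n = Suc k + m" using k k_def le_Suc_ex by blast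
      then show ?thesis by (simp add: algebra_simps)
    qed
    have sum: "(\<Sum>j<n. move S \<tau> u j) = (\<Sum>j<n. u j) + of_nat k * \<tau>"
    proof -
      have "(\<Sum>j<n. move S \<tau> u j) = (\<Sum>j<n. u j + (if j \<in> S then \<tau> else 0))"
        by (intro sum.cong) (auto simp: move_def)
      also have "\<dots> = (\<Sum>j<n. u j) + (\<Sum>j\<in>{..<n} \<inter> S. \<tau>)"
        by (simp add: sum.distrib sum.inter_restrict[symmetric])
      also have "{..<n} \<inter> S = S" using i by auto
      finally show ?thesis by (simp add: k_def)
    qed
    let ?X = "(2 * of_nat n + 1) * u i - 2 * (\<Sum>j<n. u j) - (of_nat n - 1) * h"
    let ?Y = "(2 * of_nat n + 1) * (\<Sum>i\<in>S. u i) - 2 * of_nat k * (\<Sum>i<n. u i) - of_nat k * (of_nat n - 1) * h"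
    \<comment> \<open>The k variables moved before raise the sum in the exponent by k \<tau>, and E
      (2 k \<tau>) = q^(4 k).\<close>
    have e1: "E (?X - of_nat (2 * k) * \<tau>) = E ?X / q ^ (4 * k)"
      by (simp only: exp_per_diff exp_per_of_nat_mult E_tau power_mult[symmetric]) (simp add: mult.commute)
    have e2: "(2 * of_nat n + 1) * (\<Sum>i\<in>insert i S. u i) - 2 * of_nat (card (insert i S)) * (\<Sum>i<n. u i)
      - of_nat (card (insert i S)) * (of_nat n - 1) * h = ?X + ?Y"
      using insert.hyps by (simp add: k_def algebra_simps)
    have "f (move (insert i S) \<tau> u) = (- q) ^ (2 * n - 1) * E (?X - of_nat (2 * k) * \<tau>) * f (move S \<tau> u)"
      unfolding mv(1)[OF iS] using theta_likeD(4)[OF f i(1), of "move S \<tau> u"]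
      by (simp add: mv(2)[OF iS] sum algebra_simps)
    also have "f (move S \<tau> u) = (- q) ^ ?d k * E ?Y * f u"
      using insert.IH[OF i(2)] by (simp add: k_def)
    also have "(- q) ^ (2 * n - 1) * E (?X - of_nat (2 * k) * \<tau>) * ((- q) ^ ?d k * E ?Y * f u) =
      ((- q) ^ (?d k + (2 * n - 1)) / q ^ (4 * k)) * (E ?X * E ?Y) * f u"
      unfolding e1 power_add by simp
    also have "(- q) ^ (?d k + (2 * n - 1)) / q ^ (4 * k) = (- q) ^ ?d (Suc k)"
    proof -
      have "(- q) ^ (4 * k) = q ^ (4 * k)" by (intro power_minus_even) simp
      then show ?thesis unfolding dd[symmetric] power_add using q_nz by simp
    qed
    finally show ?case unfolding e2 exp_per_add using insert.hyps by (simp add: k_def)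
  qed
qed

text \<open>Here \<sigma> is the sum that d zeros in s must have modulo the lattice.\<close>

lemma theta_like_move_line:
  fixes u :: "nat \<Rightarrow> complex"
  assumes f: "theta_like h n f" and S: "S \<subseteq> {..<n}"
  defines "d \<equiv> card S * (2 * n + 1 - 2 * card S)"
    and "\<sigma> \<equiv> 2 * of_nat (card S) * (\<Sum>i<n. u i) + of_nat (card S) * (of_nat n - 1) * h - (2 * of_nat n + 1) * (\<Sum>i\<in>S. u i)"
  shows "(\<lambda>s. f (move S s u)) holomorphic_on UNIV"
    and "f (move S (s + of_real \<rho>) u) = (-1) ^ d * f (move S s u)"
    and "f (move S (s + \<tau>) u) = (- q) ^ d * E (of_nat d * s - \<sigma>) * f (move S s u)"
proof -
  show "(\<lambda>s. f (move S s u)) holomorphic_on UNIV"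
    by (rule line_entire_move[OF theta_likeD(1)[OF f]])
  have c: "card S \<le> n" using card_mono[OF _ S] by simp
  \<comment> \<open>The second factor of d is odd, so (-1)^d is the product of the signs of the
    moved variables.\<close>
  have "even d \<longleftrightarrow> even (card S)" unfolding d_def using c by auto
  then show "f (move S (s + of_real \<rho>) u) = (-1) ^ d * f (move S s u)"
    unfolding move_add theta_like_move(1)[OF f S] by (simp add: minus_one_power_iff)
  have s1: "(\<Sum>i\<in>S. move S s u i) = (\<Sum>i\<in>S. u i) + of_nat (card S) * s"
    by (simp add: move_def sum.distrib)
  have s2: "(\<Sum>j<n. move S s u j) = (\<Sum>j<n. u j) + of_nat (card S) * s"
  proof -
    have "(\<Sum>j<n. move S s u j) = (\<Sum>j<n. u j + (if j \<in> S then s else 0))"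
      by (intro sum.cong) (auto simp: move_def)
    also have "\<dots> = (\<Sum>j<n. u j) + (\<Sum>j\<in>{..<n} \<inter> S. s)"
      by (simp add: sum.distrib sum.inter_restrict[symmetric])
    also have "{..<n} \<inter> S = S" using S by auto
    finally show ?thesis by simp
  qed
  have d: "(of_nat d :: complex) = of_nat (card S) * (2 * of_nat n + 1 - 2 * of_nat (card S))"
    unfolding d_def using c by (simp add: of_nat_diff)
  have "(2 * of_nat n + 1) * (\<Sum>i\<in>S. move S s u i)
      - 2 * of_nat (card S) * (\<Sum>i<n. move S s u i) - of_nat (card S) * (of_nat n - 1) * h = of_nat d * s - \<sigma>"
    unfolding s1 s2 d \<sigma>_def by (simp add: algebra_simps)
  then show "f (move S (s + \<tau>) u) = (- q) ^ d * E (of_nat d * s - \<sigma>) * f (move S s u)"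
    unfolding move_add theta_like_move(2)[OF f S] d_def by simp
qed

lemma theta_like_upd_line:
  fixes u :: "nat \<Rightarrow> complex"
  assumes f: "theta_like h n f" and i: "i < n"
  defines "\<sigma> \<equiv> 2 * (\<Sum>j\<in>{..<n} - {i}. u j) + (of_nat n - 1) * h"
  shows "(\<lambda>s. f (u(i := s))) holomorphic_on UNIV"
    and "f (u(i := s + of_real \<rho>)) = (-1) ^ (2 * n - 1) * f (u(i := s))"
    and "f (u(i := s + \<tau>)) = (- q) ^ (2 * n - 1) * E (of_nat (2 * n - 1) * s - \<sigma>) * f (u(i := s))"
proof -
  define u' where "u' = u(i := 0)"
  have eq: "u(i := s) = move {i} s u'" for s by (auto simp: u'_def move_def fun_eq_iff)
  have sm: "(\<Sum>j<n. u' j) = (\<Sum>j\<in>{..<n} - {i}. u j)" "(\<Sum>j\<in>{i}. u' j) = 0"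
    unfolding u'_def using i by (auto simp: sum.remove[of _ i] intro!: sum.cong)
  have S: "{i} \<subseteq> {..<n}" using i by simp
  have d: "card {i} * (2 * n + 1 - 2 * card {i}) = 2 * n - 1" by simp
  show "(\<lambda>s. f (u(i := s))) holomorphic_on UNIV" unfolding eq
    by (rule theta_like_move_line(1)[OF f S])
  show "f (u(i := s + of_real \<rho>)) = (-1) ^ (2 * n - 1) * f (u(i := s))"
    using theta_like_move_line(2)[OF f S, of s u'] unfolding eq d .
  have "of_nat (card {i}) * x = x" for x :: complex by simp
  then show "f (u(i := s + \<tau>)) = (- q) ^ (2 * n - 1) * E (of_nat (2 * n - 1) * s - \<sigma>) * f (u(i := s))"
    using theta_like_move_line(3)[OF f S, of s u'] unfolding d eq sm \<sigma>_def by simp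
qed

lemma theta_like_upd_zero:
  assumes f: "theta_like h n f" and i: "i < n"
    and I: "finite I" "card I > 2 * n - 1"
    and z: "\<And>k. k \<in> I \<Longrightarrow> f (u(i := z k)) = 0"
    and dist: "\<And>k l. k \<in> I \<Longrightarrow> l \<in> I \<Longrightarrow> k \<noteq> l \<Longrightarrow> th (z k - z l) \<noteq> 0"
  shows "f u = 0"
  using theta_too_many_zeros[where f="\<lambda>s. f (u(i := s))" and s="u i" and z=z and I=I, OF theta_like_upd_line[OF f i] I z dist]
  by simp

lemma theta_like_upd_zero_character:
  assumes f: "theta_like h n f" and i: "i < n"
    and I: "finite I" "card I = 2 * n - 1"
    and z: "\<And>k. k \<in> I \<Longrightarrow> f (u(i := z k)) = 0"
    and dist: "\<And>k l. k \<in> I \<Longrightarrow> l \<in> I \<Longrightarrow> k \<noteq> l \<Longrightarrow> th (z k - z l) \<noteq> 0"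
    and ch: "th ((\<Sum>k\<in>I. z k) - (2 * (\<Sum>j\<in>{..<n} - {i}. u j) + (of_nat n - 1) * h)) \<noteq> 0"
  shows "f u = 0"
  using theta_wrong_character[where f="\<lambda>s. f (u(i := s))" and s="u i" and z=z and I=I, OF theta_like_upd_line[OF f i] I z dist ch]
  by simp

text \<open>Such a function is determined by its values on the strings u 0 = u 1 + 2 h. In u 0 the
  degree is 3 and there are three zeros, u 1 and u 1 \<plusminus> 2 h. Their sum 3 u 1 differs from
  the prescribed 2 u 1 + h by u 1 - h, which generically is no lattice point.\<close>

lemma two_variable_zero:
  assumes f: "theta_like h 2 f" "antisym_fun 2 f"
    and nz: "th (2 * h) \<noteq> 0" "th (4 * h) \<noteq> 0"
    and st: "\<And>u. u 0 = u 1 + 2 * h \<Longrightarrow> f u = 0"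
  shows "f u = 0"
proof -
  have st': "f u = 0" if "u 1 = u 0 + 2 * h" for u
    by (rule antisym_permute_zero[OF f(2), of "Transposition.transpose 0 1"])
       (use that in \<open>auto intro!: st permutes_swap_id\<close>)
  have gen: "f u = 0" if g: "th (u 1 - h) \<noteq> 0" for u
  proof (rule theta_like_upd_zero_character[OF f(1), of 0 "{..<3}" _ "\<lambda>k. [u 1, u 1 + 2 * h, u 1 - 2 * h] ! k"])
    fix k :: nat assume "k \<in> {..<3}"
    then consider "k = 0" | "k = 1" | "k = 2" by fastforce
    then show "f (u(0 := [u 1, u 1 + 2 * h, u 1 - 2 * h] ! k)) = 0"
    proof cases
      case 1 then show ?thesis by (intro antisym_coincidence[OF f(2), of 0 1]) auto
    next
      case 2 then show ?thesis by (intro st) auto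
    next
      case 3 then show ?thesis by (intro st') auto
    qed
  next
    fix k l :: nat assume "k \<in> {..<3}" "l \<in> {..<3}" "k \<noteq> l"
    then consider "k = 0" "l = 1" | "k = 0" "l = 2" | "k = 1" "l = 0" | "k = 1" "l = 2" | "k = 2" "l = 0" | "k = 2" "l = 1"
      by fastforce
    then show "th ([u 1, u 1 + 2 * h, u 1 - 2 * h] ! k - [u 1, u 1 + 2 * h, u 1 - 2 * h] ! l) \<noteq> 0"
      by cases (use nz in \<open>auto simp: th_minus\<close>)
  next
    have "{..<2::nat} - {0} = {1}" by auto
    then show "th ((\<Sum>k<3. [u 1, u 1 + 2 * h, u 1 - 2 * h] ! k) - (2 * (\<Sum>j\<in>{..<2} - {0}. u j) + (of_nat 2 - 1) * h)) \<noteq> 0"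
      using g by (simp add: numeral_3_eq_3 algebra_simps)
  qed auto
  show ?thesis
  proof (rule line_entire_extend[OF theta_likeD(1)[OF f(1)], of _ "\<lambda>_. 1"])
    have "\<forall>\<^sub>F s in at 0. th ((u 1 - h) + s * 1) \<noteq> 0" by (rule th_isolated_line) simp
    then show "\<forall>\<^sub>F s in at 0. f (\<lambda>i. u i + s * 1) = 0"
      by eventually_elim (rule gen, simp add: algebra_simps)
  qed
qed

text \<open>
  A factor \<open>om h\<close> vanishes as soon as three arguments form a triple \<open>a, a + h, a + 2 h\<close> that is
  not contained in one block.
\<close>

lemma kernel_wheel:
  assumes "\<And>b. b \<in> set w \<Longrightarrow> fst b \<le> 2"
    and "i < arity w" "j < arity w" "k < arity w" "u j = u i + h" "u k = u i + 2 * h" "i \<noteq> j" "i \<noteq> k" "j \<noteq> k"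
  shows "kernel h w u = 0"
  using assms
proof (induction w arbitrary: i j k u)
  case (Cons b w)
  let ?n = "fst b"
  have zero: "kernel h (b # w) u = 0" if "a < ?n" "?n \<le> c" "c < arity (b # w)" "om h (u a - u c) = 0" for a c
  proof -
    have "om h (u a - u (?n + (c - ?n))) = 0" "c - ?n < arity w" using that by auto
    then have "(\<Prod>i<?n. \<Prod>j<arity w. om h (u i - u (?n + j))) = 0"
      using that(1) by (intro prod_zero) auto
    then show ?thesis by simp
  qed
  \<comment> \<open>The factor \<open>om\<close> vanishes for the ordered pairs (i, k), (k, j), (j,
    i). They form a cycle, so for any distribution over several blocks one of them runs from an
    earlier block to a later one.\<close>
  have z: "om h (u i - u k) = 0" "om h (u j - u i) = 0" "om h (u k - u j) = 0"
    using Cons.prems(5,6) om_zero(1)[of h] om_zero(2)[of h] by (simp_all add: algebra_simps)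
  show ?case
  proof (cases "i < ?n")
    case True
    have "\<not> (j < ?n \<and> k < ?n)"
    proof
      assume "j < ?n \<and> k < ?n"
      then have "card {i, j, k} \<le> card {..<?n}" using True by (intro card_mono) auto
      then show False using Cons.prems(1)[of b] Cons.prems(7-9) by simp
    qed
    then consider "?n \<le> k" | "k < ?n" "?n \<le> j" by linarith
    then show ?thesis
    proof cases
      case 1 then show ?thesis using zero[OF True, of k] z Cons.prems by simp
    next
      case 2 then show ?thesis using zero[of k j] z Cons.prems by simp
    qed
  next
    case False
    consider "j < ?n" | "k < ?n" "?n \<le> j" | "?n \<le> j" "?n \<le> k" by linarith
    then show ?thesis
    proof cases
      case 1 then show ?thesis using zero[of j i] z Cons.prems False by simp
    next
      case 2 then show ?thesis using zero[of k j] z Cons.prems by simp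
    next
      case 3
      have "kernel h w (\<lambda>m. u (?n + m)) = 0"
      proof (rule Cons.IH)
        show "i - ?n < arity w" "j - ?n < arity w" "k - ?n < arity w" using False 3 Cons.prems by auto
        show "u (?n + (j - ?n)) = u (?n + (i - ?n)) + h" "u (?n + (k - ?n)) = u (?n + (i - ?n)) + 2 * h"
          using False 3 Cons.prems by auto
        show "i - ?n \<noteq> j - ?n" "i - ?n \<noteq> k - ?n" "j - ?n \<noteq> k - ?n" using False 3 Cons.prems by auto
        show "fst b \<le> 2" if "b \<in> set w" for b using Cons.prems that by auto
      qed
      then show ?thesis by simp
    qed
  qed
qed simp

lemma inv_permutes_less: "p permutes {..<n} \<Longrightarrow> i < n \<Longrightarrow> inv p i < (n::nat) \<and> p (inv p i) = i"
  using permutes_in_image[OF permutes_inv, of p "{..<n}" i] permutes_inverses(1)[of p "{..<n}" i] by auto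

lemma inv_permutes_neq: "p permutes A \<Longrightarrow> i \<noteq> j \<Longrightarrow> inv p i \<noteq> inv p j"
  by (metis permutes_inverses(1))

lemma N_wheel:
  assumes "\<And>b. b \<in> set w \<Longrightarrow> fst b \<le> 2"
    and ijk: "i < arity w" "j < arity w" "k < arity w" "u j = u i + h" "u k = u i + 2 * h" "i \<noteq> j" "i \<noteq> k" "j \<noteq> k"
  shows "N h w u = 0"
  unfolding N_def alt_def
proof (intro sum.neutral ballI)
  fix p assume "p \<in> {p. p permutes {..<arity w}}"
  then have p: "p permutes {..<arity w}" by simp
  have "kernel h w (u \<circ> p) = 0"
    by (rule kernel_wheel[OF assms(1), where i="inv p i" and j="inv p j" and k="inv p k"])
       (use inv_permutes_less[OF p] inv_permutes_neq[OF p] ijk in auto)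
  then show "of_int (sign p) * kernel h w (u \<circ> p) = 0" by simp
qed

lemma cross_zero:
  assumes "i < m" "m \<le> j" "j < m + n" "om h (u i - u j) = 0"
  shows "cross h m n u = 0"
proof -
  have "om h (u i - u (m + (j - m))) = 0" "j - m < n" using assms by auto
  then show ?thesis unfolding cross_def using assms(1) by (intro prod_zero) auto
qed

section \<open>Blocks of the elementary charges\<close>

definition b1 :: block where
  "b1 = (1, \<lambda>u. th (u 0))"

text \<open>At h = 1/2 this is th (u 0 - u 1) times \<open>f2\<close>, where a is the superscript of
  the charge. The constants 1/2 and 1 are replaced by h and 2 h so that h can vary.\<close>

definition b2 :: "complex \<Rightarrow> complex \<Rightarrow> block" where
  "b2 h a = (2, \<lambda>u. th (u 0 - u 1) *
     (th (2 * a + 2 * h) * th (a - h) * th (u 0 - a) * th (u 1 + a - 2 * h) * th (u 0 - u 1 + a - h)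
      - th (2 * a - 2 * h) * th (a + h) * th (u 0 + a) * th (u 1 - a - 2 * h) * th (u 0 - u 1 - a - h)))"

lemma fst_b [simp]: "fst b1 = 1" "fst (b2 h a) = 2"
  by (simp_all add: b1_def b2_def)

lemma theta_like_b1: "theta_like h 1 (snd b1)"
proof -
  have "(\<lambda>s. th (u 0 + s * v 0)) holomorphic_on UNIV" for u v :: "nat \<Rightarrow> complex"
    by (intro holomorphic_intros)
  then show ?thesis unfolding theta_like_def line_entire_def b1_def
    by (auto simp: th_rho th_tau)
qed

text \<open>In each of the two terms the contributions of a to the multiplier cancel, so that the
  terms, in which a has opposite signs, share a multiplier.\<close>

lemma theta_like_b2: "theta_like h 2 (snd (b2 h a))"
  unfolding theta_like_def
proof (intro conjI allI impI)
  show "line_entire (snd (b2 h a))" unfolding line_entire_def b2_def snd_conv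
    by (intro allI holomorphic_intros)
next
  fix u v :: "nat \<Rightarrow> complex" assume "\<forall>i<2. u i = v i"
  then have "u 0 = v 0" "u 1 = v 1" by auto
  then show "snd (b2 h a) u = snd (b2 h a) v" by (simp add: b2_def)
next
  fix u :: "nat \<Rightarrow> complex" and i :: nat assume "i < 2"
  then consider "i = 0" | "i = 1" by linarith
  note c = this
  have s: "(\<Sum>j<2. u j) = u 0 + u 1" by (simp add: numeral_2_eq_2)
  have r: "th (x + of_real \<rho> - y) = - th (x - y)" "th (x - (y + of_real \<rho>)) = - th (x - y)"
    "th (x + of_real \<rho> + y) = - th (x + y)" for x y
    using th_rho[of "x - y"] th_minus_rho[of "x - y"] th_rho[of "x + y"] by (simp_all add: algebra_simps)
  have r': "th (x - (y + of_real \<rho>) + z - w) = - th (x - y + z - w)" "th (x - (y + of_real \<rho>) - z - w) = - th (x - y - z - w)"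
    "th (x + of_real \<rho> - y + z - w) = - th (x - y + z - w)" "th (x + of_real \<rho> - y - z - w) = - th (x - y - z - w)"
    "th (x + of_real \<rho> + z - w) = - th (x + z - w)" for x y z w
    using th_rho[of "x - y + z - w"] th_minus_rho[of "x - y + z - w"]
      th_rho[of "x - y - z - w"] th_minus_rho[of "x - y - z - w"] th_rho[of "x + z - w"] by (simp_all add: algebra_simps)
  show "snd (b2 h a) (u(i := u i + of_real \<rho>)) = - snd (b2 h a) u"
    using c
  proof cases
    case 1 then show ?thesis by (simp add: b2_def r r', (simp add: algebra_simps)?)
  next
    case 2
    have "th (u 1 + of_real \<rho> - a - 2 * h) = - th (u 1 - a - 2 * h)" using r'(4)[of "u 1" 0 a "2*h"] by simp
    then show ?thesis using 2 by (simp add: b2_def r r', (simp add: algebra_simps)?)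
  qed
  have t: "th (x + \<tau> - y) = - q * E (x - y) * th (x - y)" "th (x - (y + \<tau>)) = - q * E (y - x) * th (x - y)"
    "th (x + \<tau> + y) = - q * E (x + y) * th (x + y)" for x y
    using th_tau[of "x - y"] th_minus_tau[of "x - y"] th_tau[of "x + y"] by (simp_all add: algebra_simps)
  have t': "th (x - (y + \<tau>) + z - w) = - q * E (y - x - z + w) * th (x - y + z - w)"
    "th (x - (y + \<tau>) - z - w) = - q * E (y - x + z + w) * th (x - y - z - w)"
    "th (x + \<tau> - y + z - w) = - q * E (x - y + z - w) * th (x - y + z - w)"
    "th (x + \<tau> - y - z - w) = - q * E (x - y - z - w) * th (x - y - z - w)"
    "th (x + \<tau> + z - w) = - q * E (x + z - w) * th (x + z - w)"
    "th (x + \<tau> - z - w) = - q * E (x - z - w) * th (x - z - w)" for x y z w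
    using th_tau[of "x - y + z - w"] th_minus_tau[of "x - y + z - w"] th_tau[of "x - z - w"]
      th_tau[of "x - y - z - w"] th_minus_tau[of "x - y - z - w"] th_tau[of "x + z - w"] by (simp_all add: algebra_simps)
  have q3: "(- q) ^ (2 * 2 - 1) = - q * - q * - q" by (simp add: numeral_3_eq_3)
  show "snd (b2 h a) (u(i := u i + \<tau>)) = (- q) ^ (2 * 2 - 1) *
     E ((2 * of_nat 2 + 1) * u i - 2 * (\<Sum>j<2. u j) - (of_nat 2 - 1) * h) * snd (b2 h a) u"
    using c
  proof cases
    case 1
    let ?e = "E ((2 * of_nat 2 + 1) * u i - 2 * (\<Sum>j<2. u j) - (of_nat 2 - 1) * h)"
    have e1: "E (u 0 - u 1) * E (u 0 - a) * E (u 0 - u 1 + a - h) = ?e"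
      unfolding s 1 exp_per_add[symmetric] by (simp add: algebra_simps)
    have e2: "E (u 0 - u 1) * E (u 0 + a) * E (u 0 - u 1 - a - h) = ?e"
      unfolding s 1 exp_per_add[symmetric] by (simp add: algebra_simps)
    have "snd (b2 h a) (u(i := u i + \<tau>)) = - q * - q * - q * th (u 0 - u 1) *
     (th (2 * a + 2 * h) * th (a - h) * th (u 0 - a) * th (u 1 + a - 2 * h) * th (u 0 - u 1 + a - h)
        * (E (u 0 - u 1) * E (u 0 - a) * E (u 0 - u 1 + a - h))
      - th (2 * a - 2 * h) * th (a + h) * th (u 0 + a) * th (u 1 - a - 2 * h) * th (u 0 - u 1 - a - h)
        * (E (u 0 - u 1) * E (u 0 + a) * E (u 0 - u 1 - a - h)))"
      unfolding 1 b2_def by (simp add: t t', (simp add: ring_distribs mult_ac)?)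
    then show ?thesis unfolding e1 e2 q3 b2_def by (simp add: algebra_simps)
  next
    case 2
    let ?e = "E ((2 * of_nat 2 + 1) * u i - 2 * (\<Sum>j<2. u j) - (of_nat 2 - 1) * h)"
    have e1: "E (u 1 - u 0) * E (u 1 + a - 2 * h) * E (u 1 - u 0 - a + h) = ?e"
      unfolding s 2 exp_per_add[symmetric] by (simp add: algebra_simps)
    have e2: "E (u 1 - u 0) * E (u 1 - a - 2 * h) * E (u 1 - u 0 + a + h) = ?e"
      unfolding s 2 exp_per_add[symmetric] by (simp add: algebra_simps)
    have "snd (b2 h a) (u(i := u i + \<tau>)) = - q * - q * - q * th (u 0 - u 1) *
     (th (2 * a + 2 * h) * th (a - h) * th (u 0 - a) * th (u 1 + a - 2 * h) * th (u 0 - u 1 + a - h)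
        * (E (u 1 - u 0) * E (u 1 + a - 2 * h) * E (u 1 - u 0 - a + h))
      - th (2 * a - 2 * h) * th (a + h) * th (u 0 + a) * th (u 1 - a - 2 * h) * th (u 0 - u 1 - a - h)
        * (E (u 1 - u 0) * E (u 1 - a - 2 * h) * E (u 1 - u 0 + a + h)))"
      unfolding 2 b2_def by (simp add: t t', (simp add: ring_distribs mult_ac)?)
    then show ?thesis unfolding e1 e2 q3 b2_def by (simp add: algebra_simps)
  qed
qed

lemma good_b2 [simp]: "good h [b2 h a]"
  using theta_like_b1 theta_like_b2 by simp_all

section \<open>Commutation of elementary blocks\<close>

lemma N_b1: "N h [b1] u = th (u 0)"
proof -
  have "{p. p permutes {..<1::nat}} = {id}" by (auto simp: lessThan_Suc)
  then show ?thesis by (simp add: N_def alt_def b1_def)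
qed

lemma permutes_two: "{p. p permutes {..<2::nat}} = {id, Transposition.transpose 0 1}"
proof -
  have "{..<2::nat} = {0, 1}" by auto
  then show ?thesis by (auto simp: permutes_doubleton_iff)
qed

lemma alt_two: "alt 2 f u = f u - f (u \<circ> Transposition.transpose 0 1)"
proof -
  have "id \<noteq> Transposition.transpose (0::nat) 1" by (metis id_apply transpose_apply_first zero_neq_one)
  then show ?thesis by (simp add: alt_def permutes_two sign_swap_id)
qed

lemma N_b2:
  "N h [b2 h a] u = snd (b2 h a) u - snd (b2 h a) (u \<circ> Transposition.transpose 0 1)"
proof -
  have "arity [b2 h a] = 2" "kernel h [b2 h a] = snd (b2 h a)" by (simp_all add: fun_eq_iff)
  then show ?thesis unfolding N_def by (simp only: alt_two)
qed

lemma N_b2_swap: "N h [b2 h a] (u \<circ> Transposition.transpose 0 1) = - N h [b2 h a] u"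
proof -
  have "Transposition.transpose 0 1 permutes {..<2::nat}" by (intro permutes_swap_id) auto
  then show ?thesis using antisym_N[of "[b2 h a]" h]
    unfolding antisym_fun_def by (simp add: sign_swap_id)
qed

text \<open>In one order of the variables each term of \<open>b2\<close> vanishes by itself. In the
  other order the two terms cancel, and the coefficients
  \<open>th (2 * a + 2 * h) * th (a - h)\<close> and \<open>th (2 * a - 2 * h) * th (a + h)\<close>
  are what makes them do so.\<close>

lemma N_b2_center:
  assumes "u 0 = a + 2 * h \<and> u 1 = a \<or> u 0 = a \<and> u 1 = a + 2 * h \<or>
    u 0 = 2 * h - a \<and> u 1 = - a \<or> u 0 = - a \<and> u 1 = 2 * h - a"
  shows "N h [b2 h a] u = 0"
proof -
  have e: "th (- a - a) = - th (2 * a)" "th (- (2 * a) - 2 * h) = - th (2 * a + 2 * h)"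
    "th (2 * h - 2 * a) = - th (2 * a - 2 * h)" "th (- (2 * h)) = - th (2 * h)" "th (h - a) = - th (a - h)"
    using th_minus[of "2 * a"] th_minus[of "2 * a + 2 * h"] th_minus[of "2 * a - 2 * h"] th_minus[of "2 * h"] th_minus[of "a - h"]
    by (simp_all add: algebra_simps)
  have f: "2 * h - a - a = 2 * h - 2 * a" "a + (a - 2 * h) = 2 * a - 2 * h" "a + a = 2 * a" "- a - a - 2 * h = - (2 * a) - 2 * h"
    "a + 2 * h + a = 2 * a + 2 * h" "a + a - 2 * h = 2 * a - 2 * h" "2 * h + a - h = h + a" by simp_all
  have n1: "N h [b2 h a] u = 0" if "u 0 = a + 2 * h" "u 1 = a" for u
    unfolding N_b2 unfolding b2_def snd_conv using that by (simp add: e f) (simp add: e algebra_simps)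
  have n2: "N h [b2 h a] u = 0" if "u 0 = 2 * h - a" "u 1 = - a" for u
    unfolding N_b2 unfolding b2_def snd_conv using that by (simp add: e f) (simp add: e algebra_simps)
  define v where "v = u \<circ> Transposition.transpose 0 1"
  have v: "v 0 = u 1" "v 1 = u 0" by (simp_all add: v_def)
  have sw: "N h [b2 h a] u = - N h [b2 h a] v" unfolding v_def N_b2_swap by simp
  consider "u 0 = a + 2 * h" "u 1 = a" | "v 0 = a + 2 * h" "v 1 = a"
    | "u 0 = 2 * h - a" "u 1 = - a" | "v 0 = 2 * h - a" "v 1 = - a"
    using assms unfolding v by blast
  then show ?thesis
  proof cases
    case 1 then show ?thesis by (rule n1)
  next
    case 2 then show ?thesis using n1[of v] sw by simp
  next
    case 3 then show ?thesis by (rule n2)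
  next
    case 4 then show ?thesis using n2[of v] sw by simp
  qed
qed

text \<open>The first term of \<open>b2\<close> has lost its coefficient. In the second,
  \<open>th (u 0 + a)\<close> and \<open>th (u 1 - a - 2 * h)\<close> both vanish at a + 2 h. At h =
  1/2 and a = (L - 1) / 2 the hypothesis reads th L = 0.\<close>

lemma N_b2_degenerate:
  assumes "th (2 * a + 2 * h) = 0" "u 0 = a + 2 * h \<or> u 1 = a + 2 * h"
  shows "N h [b2 h a] u = 0"
proof -
  have "th (a + 2 * h + a) = 0" using assms(1) by (simp add: algebra_simps)
  then show ?thesis unfolding N_b2 unfolding b2_def snd_conv using assms by auto
qed

lemma permutes_three_fix:
  assumes "p permutes {..<3::nat}" "p i = i" "i < 3" "{..<3} - {i} = {j, k}"
  shows "p = id \<or> p = Transposition.transpose j k"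
proof -
  have "p permutes {j, k}" by (rule permutes_superset[OF assms(1)]) (use assms in auto)
  then show ?thesis by (simp add: permutes_doubleton_iff)
qed

text \<open>For three variables on a string the factors \<open>om\<close> leave only the
  permutations that fix the place of the one-variable block, and two terms remain.\<close>

lemma alt_three_fix:
  assumes i: "i < 3" "{..<3} - {i} = {j, k}" "j \<noteq> k"
    and z: "\<And>p. p permutes {..<3} \<Longrightarrow> p i \<noteq> i \<Longrightarrow> f (u \<circ> p) = 0"
  shows "alt 3 f u = f u - f (u \<circ> Transposition.transpose j k)"
proof -
  have "j < 3" "k < 3" "i \<noteq> j" "i \<noteq> k" using i by blast+
  then have t: "Transposition.transpose j k permutes {..<3}" by (intro permutes_swap_id) auto
  have ne: "id \<noteq> Transposition.transpose j k" using i(3) by (metis id_apply transpose_apply_first)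
  have "alt 3 f u = (\<Sum>p\<in>{id, Transposition.transpose j k}. of_int (sign p) * f (u \<circ> p))"
    unfolding alt_def
  proof (rule sum.mono_neutral_right)
    show "\<forall>p\<in>{p. p permutes {..<3}} - {id, Transposition.transpose j k}. of_int (sign p) * f (u \<circ> p) = 0"
      using z permutes_three_fix[OF _ _ i(1,2)] by auto
  qed (use t in \<open>auto simp: finite_permutations permutes_id\<close>)
  then show ?thesis using ne i(3) by (simp add: sign_swap_id)
qed

text \<open>On the string, \<open>om h (- 2 * h) = 0\<close> forces the one-variable block to take u
  0 when it stands on the left and u 2 when it stands on the right. The shifts then bring both words
  to the same arguments: u 0 - 4 h = u 2, and the pair u 0 - 2 h, u 1 - 2 h is u 1, u 2.\<close>

lemma string_commute:
  assumes u: "u 0 = u 1 + 2 * h" "u 1 = u 2 + 2 * h"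
  shows "N h [b1, b2 h a] u = N h [b2 h a, b1] u"
proof -
  let ?t = "\<lambda>i j::nat. u \<circ> Transposition.transpose i j"
  have t: "(\<Prod>i<2. g i) = g 0 * g 1" for g :: "nat \<Rightarrow> complex" by (simp add: numeral_2_eq_2)
  have less3: "x = 0 \<or> x = 1 \<or> x = 2" if "x < (3::nat)" for x using that by auto
  have pl: "p x < 3" if "p permutes {..<3}" "x < 3" for p and x :: nat
    using permutes_in_image[OF that(1), of x] that(2) by simp
  have o: "om h (u 1 - u 0) = 0" "om h (u 2 - u 1) = 0"
    using om_zero(1)[of h] u by (simp_all add: algebra_simps)
  have A: "kernel h [b1, b2 h a] v = th (v 0 - 4 * h) * snd (b2 h a) (\<lambda>i. v (Suc i)) * (om h (v 0 - v 1) * om h (v 0 - v 2))" for v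
    by (simp add: b1_def t numeral_2_eq_2)
  have B: "kernel h [b2 h a, b1] v = snd (b2 h a) (\<lambda>i. v i - 2 * h) * th (v 2) * (om h (v 0 - v 2) * om h (v 1 - v 2))" for v
    by (simp add: b1_def t) (simp add: numeral_2_eq_2)
  have b2c: "snd (b2 h a) v = snd (b2 h a) w" if "v 0 = w 0" "v 1 = w 1" for v w
    using that by (simp add: b2_def)
  have "N h [b1, b2 h a] u = alt 3 (kernel h [b1, b2 h a]) u" by (simp add: N_def numeral_3_eq_3)
  also have "\<dots> = kernel h [b1, b2 h a] u - kernel h [b1, b2 h a] (?t 1 2)"
  proof (rule alt_three_fix[of 0])
    fix p :: "nat \<Rightarrow> nat" assume p: "p permutes {..<3}" "p 0 \<noteq> 0"
    \<comment> \<open>The place x carries the variable that is larger by 2 h than the one in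
      \<open>b1\<close>. It belongs to \<open>b2\<close>, so the corresponding factor
      \<open>om\<close> is zero.\<close>
    define x where "x = inv p (p 0 - 1)"
    have "p 0 < 3" using pl[OF p(1)] by simp
    then have x: "x < 3" "p x = p 0 - 1" using inv_permutes_less[OF p(1), of "p 0 - 1"] by (simp_all add: x_def)
    have "x \<noteq> 0"
    proof
      assume "x = 0"
      then have "p 0 = p 0 - 1" using x(2) by simp
      then show False using p(2) by simp
    qed
    then have "x = 1 \<or> x = 2" using less3[OF x(1)] by blast
    moreover have "p 0 = 1 \<or> p 0 = 2" using less3[OF \<open>p 0 < 3\<close>] p(2) by blast
    then have "om h (u (p 0) - u (p x)) = 0" unfolding x(2) using o by (elim disjE) simp_all
    ultimately have "om h (u (p 0) - u (p 1)) = 0 \<or> om h (u (p 0) - u (p 2)) = 0" by blast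
    then show "kernel h [b1, b2 h a] (u \<circ> p) = 0" unfolding A by (elim disjE) simp_all
  qed auto
  also have "kernel h [b1, b2 h a] u = th (u 0 - 4 * h) * snd (b2 h a) (\<lambda>i. u (Suc i)) * (om h (u 0 - u 1) * om h (u 0 - u 2))"
    by (rule A)
  also have "kernel h [b1, b2 h a] (?t 1 2) = th (u 0 - 4 * h) * snd (b2 h a) (\<lambda>i. ?t 1 2 (Suc i)) * (om h (u 0 - u 1) * om h (u 0 - u 2))"
    unfolding A by (simp add: mult.commute[of "om h (u 0 - u 2)"])
  finally have L: "N h [b1, b2 h a] u = th (u 0 - 4 * h) * (snd (b2 h a) (\<lambda>i. u (Suc i)) - snd (b2 h a) (\<lambda>i. ?t 1 2 (Suc i))) * (om h (u 0 - u 1) * om h (u 0 - u 2))"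
    by (simp add: left_diff_distrib right_diff_distrib)
  have "N h [b2 h a, b1] u = alt 3 (kernel h [b2 h a, b1]) u" by (simp add: N_def numeral_3_eq_3)
  also have "\<dots> = kernel h [b2 h a, b1] u - kernel h [b2 h a, b1] (?t 0 1)"
  proof (rule alt_three_fix[of 2])
    fix p :: "nat \<Rightarrow> nat" assume p: "p permutes {..<3}" "p 2 \<noteq> 2"
    define x where "x = inv p (p 2 + 1)"
    have "p 2 < 3" using pl[OF p(1)] by simp
    then have "p 2 = 0 \<or> p 2 = 1" using less3[of "p 2"] p(2) by blast
    then have x: "x < 3" "p x = p 2 + 1" using inv_permutes_less[OF p(1), of "p 2 + 1"] by (auto simp: x_def)
    have "x \<noteq> 2"
    proof
      assume "x = 2"
      then have "p 2 = p 2 + 1" using x(2) by simp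
      then show False by simp
    qed
    then have "x = 0 \<or> x = 1" using less3[OF x(1)] by blast
    moreover have "om h (u (p x) - u (p 2)) = 0"
      unfolding x(2) using o \<open>p 2 = 0 \<or> p 2 = 1\<close> by (elim disjE) (simp_all add: numeral_2_eq_2)
    ultimately have "om h (u (p 0) - u (p 2)) = 0 \<or> om h (u (p 1) - u (p 2)) = 0" by blast
    then show "kernel h [b2 h a, b1] (u \<circ> p) = 0" unfolding B by (elim disjE) simp_all
  qed auto
  also have "kernel h [b2 h a, b1] u = snd (b2 h a) (\<lambda>i. u i - 2 * h) * th (u 2) * (om h (u 0 - u 2) * om h (u 1 - u 2))"
    by (rule B)
  also have "kernel h [b2 h a, b1] (?t 0 1) = snd (b2 h a) (\<lambda>i. ?t 0 1 i - 2 * h) * th (u 2) * (om h (u 0 - u 2) * om h (u 1 - u 2))"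
    unfolding B by (simp add: mult.commute[of "om h (u 0 - u 2)"])
  finally have R: "N h [b2 h a, b1] u = (snd (b2 h a) (\<lambda>i. u i - 2 * h) - snd (b2 h a) (\<lambda>i. ?t 0 1 i - 2 * h)) * th (u 2) * (om h (u 0 - u 2) * om h (u 1 - u 2))"
    by (simp add: left_diff_distrib right_diff_distrib)
  have "snd (b2 h a) (\<lambda>i. u (Suc i)) = snd (b2 h a) (\<lambda>i. u i - 2 * h)"
    by (rule b2c) (use u in \<open>auto simp: numeral_2_eq_2\<close>)
  moreover have "snd (b2 h a) (\<lambda>i. ?t 1 2 (Suc i)) = snd (b2 h a) (\<lambda>i. ?t 0 1 i - 2 * h)"
    by (rule b2c) (use u in \<open>auto simp: numeral_2_eq_2\<close>)
  moreover have "u 0 - 4 * h = u 2" "u 0 - u 1 = u 1 - u 2" using u by simp_all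
  ultimately show ?thesis unfolding L R by (simp only: mult_ac)
qed

lemma three_perm:
  assumes "{i, j, k} = {0, 1, 2::nat}"
  obtains p where "p permutes {..<3}" "p 0 = i" "p 1 = j" "p 2 = k"
proof -
  define p where "p x = (if x = 0 then i else if x = 1 then j else if x = 2 then k else x)" for x :: nat
  have s: "{..<3} = {0, 1, 2::nat}" by auto
  have pv: "p 0 = i" "p 1 = j" "p 2 = k" by (simp_all add: p_def)
  have "p ` {..<3} = {p 0, p 1, p 2}" unfolding s by simp
  then have img: "p ` {..<3} = {..<3}" unfolding pv assms s .
  have "p permutes {..<3}"
  proof (rule bij_imp_permutes)
    show "bij_betw p {..<3} {..<3}"
      unfolding bij_betw_def using img by (simp add: eq_card_imp_inj_on)
  qed (auto simp: p_def)
  then show ?thesis using that[of p] by (simp add: p_def)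
qed

lemma three_distinct:
  assumes "{i, j, k} = {0, 1, 2::nat}"
  shows "i < 3" "j < 3" "k < 3" "i \<noteq> j" "i \<noteq> k" "j \<noteq> k" "{..<3} - {k} = {i, j}"
proof -
  have s: "{..<3} = {0, 1, 2::nat}" by auto
  have "{i, j, k} \<subseteq> {..<3}" unfolding assms s ..
  then show "i < 3" "j < 3" "k < 3" by auto
  have "card {i, j, k} = 3" unfolding assms by simp
  then show d: "i \<noteq> j" "i \<noteq> k" "j \<noteq> k" by (auto simp: card_insert_if split: if_splits)
  have "{..<3} - {k} = {i, j, k} - {k}" unfolding assms s ..
  then show "{..<3} - {k} = {i, j}" using d by auto
qed

lemma three_swap: "{i, j, k} = A \<Longrightarrow> {i, k, j} = A" "{i, j, k} = A \<Longrightarrow> {j, i, k} = A" "{i, j, k} = A \<Longrightarrow> {k, j, i} = A"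
  by auto

definition commutator :: "complex \<Rightarrow> complex \<Rightarrow> (nat \<Rightarrow> complex) \<Rightarrow> complex" where
  "commutator h a u = 1 * N h [b1, b2 h a] u + (-1) * N h [b2 h a, b1] u"

lemma theta_like_commutator: "theta_like h 3 (commutator h a)"
proof -
  have "theta_like h 3 (N h [b1, b2 h a])" "theta_like h 3 (N h [b2 h a, b1])"
    using theta_like_N[of h "[b1, b2 h a]"] theta_like_N[of h "[b2 h a, b1]"] theta_like_b1 theta_like_b2
    by (simp_all add: numeral_3_eq_3)
  from theta_like_lin[OF this, of 1 "-1"] show ?thesis unfolding commutator_def .
qed

lemma antisym_commutator: "antisym_fun 3 (commutator h a)"
proof -
  have "antisym_fun 3 (N h [b1, b2 h a])" "antisym_fun 3 (N h [b2 h a, b1])"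
    using antisym_N[of "[b1, b2 h a]" h] antisym_N[of "[b2 h a, b1]" h]
    by (simp_all add: numeral_3_eq_3)
  from antisym_lin[OF this, of 1 "-1"] show ?thesis unfolding commutator_def .
qed

text \<open>Vanishing spreads from strings of three variables to strings of two and from these to
  all points, each time by counting zeros in one variable, of degree 5. The multiples of h excluded
  by the hypotheses are differences of these zeros, up to sign.\<close>

lemma commutator_generic:
  assumes nz: "th h \<noteq> 0" "th (2 * h) \<noteq> 0" "th (3 * h) \<noteq> 0" "th (4 * h) \<noteq> 0" "th (6 * h) \<noteq> 0"
  shows "commutator h a u = 0"
proof -
  let ?D = "commutator h a"
  note D = theta_like_commutator[of h a] and A = antisym_commutator[of h a]
  have s3: "?D u = 0" if ijk: "{i, j, k} = {0, 1, 2}" and u: "u i = u j + 2 * h" "u j = u k + 2 * h" for u i j k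
  proof -
    obtain p where p: "p permutes {..<3}" "p 0 = i" "p 1 = j" "p 2 = k" using three_perm[OF ijk] .
    show ?thesis
    proof (rule antisym_permute_zero[OF A p(1)])
      show "?D (u \<circ> p) = 0"
        using string_commute[of "u \<circ> p" h a] u p by (simp add: commutator_def)
    qed
  qed
  have wh: "?D u = 0" if "{i, j, k} = {0, 1, 2}" "u j = u i + h" "u k = u i + 2 * h" for u i j k
  proof -
    note l = three_distinct(1-3)[OF that(1)] and d = three_distinct(4-6)[OF that(1)]
    have "N h [b1, b2 h a] u = 0" "N h [b2 h a, b1] u = 0"
      by (rule N_wheel[where i=i and j=j and k=k]; use l d that(2,3) in auto)+
    then show ?thesis by (simp add: commutator_def)
  qed
  \<comment> \<open>With the string u i, u i + 2 h fixed, the third variable has five zeros: two by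
    antisymmetry, one by the triple u i, u i + h, u i + 2 h, and two by prolonging the string at
    either end. Their number equals the degree, but their sum is off by u i - h.\<close>
  have s2g: "?D u = 0" if ijk: "{i, j, k} = {0, 1, 2}" and u: "u j = u i + 2 * h" and g: "th (u i - h) \<noteq> 0" for u i j k
  proof -
    note l = three_distinct(1-3)[OF ijk] and d = three_distinct(4-6)[OF ijk]
    let ?z = "\<lambda>m. u i + [0, 2, 1, - 2, 4] ! m * h"
    show ?thesis
    proof (rule theta_like_upd_zero_character[OF D l(3), of "{..<5}" _ ?z])
      fix m :: nat assume "m \<in> {..<5}"
      then consider "m = 0" | "m = 1" | "m = 2" | "m = 3" | "m = 4" by fastforce
      then show "?D (u(k := ?z m)) = 0"
      proof cases
        case 1 then show ?thesis using d l by (intro antisym_coincidence[OF A, of i k]) auto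
      next
        case 2 then show ?thesis using d l u by (intro antisym_coincidence[OF A, of j k]) auto
      next
        case 3 then show ?thesis using d u by (intro wh[OF three_swap(1)[OF ijk]]) auto
      next
        case 4 then show ?thesis using d u by (intro s3[OF three_swap(2)[OF ijk]]) auto
      next
        case 5 then show ?thesis using d u by (intro s3[OF three_swap(3)[OF ijk]]) auto
      qed
    next
      fix m n :: nat assume mn: "m \<in> {..<5}" "n \<in> {..<5}" "m \<noteq> n"
      have "th (c * h) \<noteq> 0" if "c \<in> {1, 2, 3, 4, 6, -1, -2, -3, -4, -6}" for c
        using that nz by (auto simp: th_minus)
      moreover have "[0, 2, 1, - 2, 4] ! m - [0, 2, 1, - 2, 4] ! n \<in> {1, 2, 3, 4, 6, -1, -2, -3, -4, - 6 :: complex}"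
      proof -
        have "m \<in> {0, 1, 2, 3, 4}" "n \<in> {0, 1, 2, 3, 4}" using mn by auto
        then show ?thesis using mn(3) by auto
      qed
      ultimately have "th (([0, 2, 1, - 2, 4] ! m - [0, 2, 1, - 2, 4] ! n) * h) \<noteq> 0" by blast
      then show "th (?z m - ?z n) \<noteq> 0" by (simp add: algebra_simps)
    next
      have s: "(\<Sum>j\<in>{..<3} - {k}. u j) = 2 * u i + 2 * h" unfolding three_distinct(7)[OF ijk] using d u by simp
      have "(\<Sum>m<5. ?z m) = 5 * u i + 5 * h" by (simp add: eval_nat_numeral algebra_simps)
      then have e: "(\<Sum>m<5. ?z m) - (2 * (\<Sum>j\<in>{..<3} - {k}. u j) + (of_nat 3 - 1) * h) = u i - h"
        unfolding s by simp
      show "th ((\<Sum>m<5. ?z m) - (2 * (\<Sum>j\<in>{..<3} - {k}. u j) + (of_nat 3 - 1) * h)) \<noteq> 0"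
        unfolding e by (rule g)
    qed auto
  qed
  have s2: "?D u = 0" if ijk: "{i, j, k} = {0, 1, 2}" and u: "u j = u i + 2 * h" for u i j k
  proof (rule line_entire_extend[OF theta_likeD(1)[OF D], of _ "\<lambda>_. 1"])
    have "\<forall>\<^sub>F s in at 0. th ((u i - h) + s * 1) \<noteq> 0" by (rule th_isolated_line) simp
    then show "\<forall>\<^sub>F s in at 0. ?D (\<lambda>i. u i + s * 1) = 0"
      by eventually_elim (rule s2g[OF ijk], use u in \<open>auto simp: algebra_simps\<close>)
  qed
  let ?e = "\<lambda>m. [0, 2, - 2] ! m :: complex"
  \<comment> \<open>In u 0 there are now six zeros, u j and u j \<plusminus> 2 h for j = 1, 2, one
    more than the degree.\<close>
  have gen: "?D u = 0" if g: "\<forall>c\<in>{0, 2, -2, 4, -4}. th (u 1 - u 2 + c * h) \<noteq> 0" for u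
  proof (rule theta_like_upd_zero[OF D, of 0 "{1, 2} \<times> {..<3}" _ "\<lambda>(j, m). u j + ?e m * h"])
    fix x :: "nat \<times> nat" assume "x \<in> {1, 2} \<times> {..<3}"
    then obtain j m where x: "x = (j, m)" "j \<in> {1, 2}" "m < 3" by fastforce
    have k: "{0, j, 3 - j} = {0, 1, 2}" using x(2) by auto
    have "m = 0 \<or> m = 1 \<or> m = 2" using x(3) by auto
    then consider "m = 0" | "m = 1" | "m = 2" by blast
    then have "?D (u(0 := u j + ?e m * h)) = 0"
    proof cases
      case 1 then show ?thesis using x by (intro antisym_coincidence[OF A, of 0 j]) auto
    next
      case 2 then show ?thesis using x by (intro s2[OF three_swap(2)[OF k]]) auto
    next
      case 3 then show ?thesis using x by (intro s2[OF k]) auto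
    qed
    then show "?D (u(0 := case x of (j, m) \<Rightarrow> u j + ?e m * h)) = 0" using x by simp
  next
    fix x y :: "nat \<times> nat" assume xy: "x \<in> {1, 2} \<times> {..<3}" "y \<in> {1, 2} \<times> {..<3}" "x \<noteq> y"
    obtain j m j' m' where x: "x = (j, m)" "y = (j', m')" by (cases x, cases y)
    have m: "m \<in> {0, 1, 2}" "m' \<in> {0, 1, 2}" using xy x by auto
    show "th ((case x of (j, m) \<Rightarrow> u j + ?e m * h) - (case y of (j, m) \<Rightarrow> u j + ?e m * h)) \<noteq> 0"
    proof (cases "j = j'")
      case True
      then have "m \<noteq> m'" using xy x by auto
      then have "?e m - ?e m' \<in> {2, 4, -2, -4}" using m by auto
      moreover have "\<forall>c\<in>{2, 4, -2, -4}. th (c * h) \<noteq> 0" using nz by (auto simp: th_minus)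
      ultimately have "th ((?e m - ?e m') * h) \<noteq> 0" by blast
      then show ?thesis using x True by (simp add: algebra_simps)
    next
      case False
      have c: "?e m - ?e m' \<in> {0, 2, -2, 4, -4}" "?e m' - ?e m \<in> {0, 2, -2, 4, -4}" using m by auto
      consider "j = 1" "j' = 2" | "j = 2" "j' = 1" using False xy x by auto
      then show ?thesis
      proof cases
        case 1
        then have "th (u 1 - u 2 + (?e m - ?e m') * h) \<noteq> 0" using g c by blast
        then show ?thesis using x 1 by (simp add: algebra_simps)
      next
        case 2
        then have "th (u 1 - u 2 + (?e m' - ?e m) * h) \<noteq> 0" using g c by blast
        then have "th (- (u 1 - u 2 + (?e m' - ?e m) * h)) \<noteq> 0" by (simp only: th_minus neg_equal_0_iff_equal not_False_eq_True)
        then show ?thesis using x 2 by (simp add: algebra_simps)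
      qed
    qed
  qed auto
  show ?thesis
  proof (rule line_entire_extend[OF theta_likeD(1)[OF D], of _ "\<lambda>i. if i = 1 then 1 else 0"])
    have "\<forall>\<^sub>F s in at 0. \<forall>c\<in>{0, 2, -2, 4, -4}. th ((u 1 - u 2 + c * h) + s * 1) \<noteq> 0"
      by (intro eventually_ball_finite ballI th_isolated_line) auto
    then show "\<forall>\<^sub>F s in at 0. ?D (\<lambda>i. u i + s * (if i = 1 then 1 else 0)) = 0"
      by eventually_elim (rule gen, simp add: algebra_simps)
  qed
qed

text \<open>The commutator is continuous in h, and for small s \<noteq> 0 the step h + s is generic.
  This covers in particular h = 1/2 for L = 3, where th (6 h) = 0.\<close>

lemma b1_b2_commute: "N h [b1, b2 h a] u = N h [b2 h a, b1] u"
proof -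
  have c: "continuous_on UNIV (\<lambda>s. commutator (h + s) a u)"
    unfolding commutator_def N_def alt_def kernel.simps b1_def b2_def om_def snd_conv fst_conv arity_simps
    by (intro continuous_intros)
  have "\<forall>\<^sub>F s in at 0. \<forall>c\<in>{1, 2, 3, 4, 6}. th (c * h + s * c) \<noteq> 0"
    by (intro eventually_ball_finite ballI th_isolated_line) auto
  then have "\<forall>\<^sub>F s in at 0. commutator (h + s) a u = 0"
    by eventually_elim (rule commutator_generic, simp_all add: algebra_simps)
  from eventually_zero_imp_zero[OF c this] show ?thesis by (simp add: commutator_def)
qed

section \<open>Vanishing of the full kernel\<close>

text \<open>Only the identity permutation survives on the string, the transposition meeting
  \<open>om h (- 2 * h) = 0\<close>. What matters for \<open>b2_b2_commute\<close> is that the value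
  is zero at y = 0 and nonzero at y = a.\<close>

lemma N_b1_b1_string: "N h [b1, b1] (\<lambda>i. if i = 0 then y + 2 * h else y) = th y ^ 2 * om h (2 * h)"
proof -
  let ?u = "\<lambda>i::nat. if i = 0 then y + 2 * h else y"
  have K: "kernel h [b1, b1] v = th (v 0 - 2 * h) * th (v 1) * om h (v 0 - v 1)" for v
    by (simp add: b1_def)
  have "N h [b1, b1] ?u = kernel h [b1, b1] ?u - kernel h [b1, b1] (?u \<circ> Transposition.transpose 0 1)"
    using alt_two[of "kernel h [b1, b1]" ?u] by (simp add: N_def numeral_2_eq_2)
  also have "\<dots> = th y ^ 2 * om h (2 * h)"
    using om_zero(1)[of h] unfolding K by (simp add: power2_eq_square)
  finally show ?thesis .
qed

text \<open>On the string y + 2 h, y the functions concerned have degree 2 in y and zeros of sum 0,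
  so zeros at both y = 0 and y = a make them vanish, as th a \<noteq> 0. Hence their values at these
  two points determine them. Since the symmetrised \<open>b2 h a\<close> vanishes at y = a and the
  word of two letters \<open>b1\<close> at y = 0, the symmetrised \<open>b2 h b\<close> is a
  combination of the two, and \<open>b2 h a\<close> commutes with each of them.\<close>

lemma b2_b2_commute:
  assumes a: "th a \<noteq> 0" and nz: "th h \<noteq> 0" "th (2 * h) \<noteq> 0" "th (4 * h) \<noteq> 0"
  shows "N h [b2 h a, b2 h b] u = N h [b2 h b, b2 h a] u"
proof -
  let ?s = "\<lambda>y i::nat. if i = 0 then y + 2 * h else y"
  have line: "f (?s y) = 0"
    if f: "theta_like h 2 f" and z: "f (?s 0) = 0" "f (?s a) = 0" for f y
  proof -
    let ?g = "\<lambda>s. f (move {..<2} s (?s 0))"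
    have eq: "?g s = f (?s s)" for s
      by (rule theta_likeD(2)[OF f]) (auto simp: move_def)
    have s: "{..<2::nat} = {0, 1}" by auto
    note m = theta_like_move_line[OF f order.refl, where u="?s 0"]
    have "?g y = 0"
    proof (rule theta_wrong_character[where f="?g" and z="\<lambda>k. if k = 0 then 0 else a" and I="{0, 1::nat}" and d=2])
      show "?g holomorphic_on UNIV" by (rule m(1))
      show "?g (s + of_real \<rho>) = (- 1) ^ 2 * ?g s" for s using m(2)[of s] by simp
      show "?g (s + \<tau>) = (- q) ^ 2 * E (of_nat 2 * s - 0) * ?g s" for s using m(3)[of s] by (simp add: s power2_eq_square)
      show "?g (if i = 0 then 0 else a) = 0" if "i \<in> {0, 1}" for i :: nat unfolding eq using z that by auto
      show "th ((if i = 0 then 0 else a) - (if j = 0 then 0 else a)) \<noteq> 0"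
        if "i \<in> {0, 1}" "j \<in> {0, 1}" "i \<noteq> j" for i j :: nat using that a by (auto simp: th_minus)
      show "th ((\<Sum>k\<in>{0, 1::nat}. if k = 0 then 0 else a) - 0) \<noteq> 0" using a by simp
    qed auto
    then show ?thesis unfolding eq .
  qed
  have zero: "f u = 0"
    if f: "theta_like h 2 f" "antisym_fun 2 f" and z: "f (?s 0) = 0" "f (?s a) = 0" for f u
  proof (rule two_variable_zero[OF f nz(2,3)])
    fix u :: "nat \<Rightarrow> complex" assume u: "u 0 = u 1 + 2 * h"
    have "f u = f (?s (u 1))" by (rule theta_likeD(2)[OF f(1)]) (use u in \<open>auto simp: less_2_cases_iff\<close>)
    then show "f u = 0" using line[OF f(1) z] by simp
  qed
  have A: "theta_like h 2 (N h [b2 h c])" "antisym_fun 2 (N h [b2 h c])" for c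
    using theta_like_N[of h "[b2 h c]"] antisym_N[of "[b2 h c]" h] theta_like_b2 by simp_all
  have B: "theta_like h 2 (N h [b1, b1])" "antisym_fun 2 (N h [b1, b1])"
    using theta_like_N[of h "[b1, b1]"] antisym_N[of "[b1, b1]" h] theta_like_b1 by (simp_all add: numeral_2_eq_2)
  have Aa: "N h [b2 h c] (?s c) = 0" for c by (rule N_b2_center) simp
  have g: "good h [b2 h c]" "good h [b1, b1]" for c using theta_like_b1 theta_like_b2 by simp_all
  have ar: "arity [b1, b1] = arity [b2 h c]" "arity [b2 h d] = arity [b2 h c]" for c d by simp_all
  show ?thesis
  proof (cases "N h [b2 h a] (?s 0) = 0")
    \<comment> \<open>Here the symmetrised \<open>b2 h a\<close> vanishes at both points, hence
      identically, and so do both products.\<close>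
    case True
    have z: "N h [b2 h a] v = 0" for v by (rule zero[OF A]) (use True Aa[of a] in simp_all)
    have "N h ([b2 h a] @ [b2 h b]) u = 0" by (rule N_append_zero[OF g(1) g(1)]) (simp add: z)
    moreover have "N h ([b2 h b] @ [b2 h a]) u = 0" by (rule N_append_zero[OF g(1) g(1)]) (simp add: z)
    ultimately show ?thesis by simp
  next
    case False
    \<comment> \<open>The coefficients match the values of \<open>b2 h b\<close> at y = 0 and y = a,
      at each of which one of the two other functions is zero.\<close>
    define \<beta> where "\<beta> = N h [b2 h b] (?s 0) / N h [b2 h a] (?s 0)"
    define \<alpha> where "\<alpha> = N h [b2 h b] (?s a) / N h [b1, b1] (?s a)"
    have "om h (2 * h) \<noteq> 0" using nz by (simp add: om_def)
    then have n11: "N h [b1, b1] (?s a) \<noteq> 0" "N h [b1, b1] (?s 0) = 0"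
      using a unfolding N_b1_b1_string by simp_all
    let ?f = "\<lambda>u. 1 * N h [b2 h b] u + (-1) * (\<alpha> * N h [b1, b1] u + \<beta> * N h [b2 h a] u)"
    have lin: "N h [b2 h b] v = \<alpha> * N h [b1, b1] v + \<beta> * N h [b2 h a] v" for v
    proof -
      have t: "theta_like h 2 ?f" "antisym_fun 2 ?f"
        by (rule theta_like_lin[OF A(1) theta_like_lin[OF B(1) A(1)]]
              antisym_lin[OF A(2) antisym_lin[OF B(2) A(2)]])+
      have z1: "?f (?s 0) = 0"
        using n11(2) False unfolding \<beta>_def by simp
      have z2: "?f (?s a) = 0"
        using n11(1) Aa[of a] unfolding \<alpha>_def by simp
      have "?f v = 0" by (rule zero[OF t z1 z2])
      moreover have "?f v = N h [b2 h b] v - (\<alpha> * N h [b1, b1] v + \<beta> * N h [b2 h a] v)" by simp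
      ultimately show ?thesis by (simp only: right_minus_eq)
    qed
    have c1: "N h ([b2 h a] @ [b1, b1]) u = N h ([b1, b1] @ [b2 h a]) u" for u
    proof -
      have "N h ([b2 h a, b1] @ [b1]) u = N h ([b1, b2 h a] @ [b1]) u"
        by (rule N_append_cong(2)) (use theta_like_b1 theta_like_b2 b1_b2_commute in auto)
      moreover have "N h ([b1] @ [b2 h a, b1]) u = N h ([b1] @ [b1, b2 h a]) u"
        by (rule N_append_cong(1)) (use theta_like_b1 theta_like_b2 b1_b2_commute in auto)
      ultimately show ?thesis by simp
    qed
    have "N h ([b2 h a] @ [b2 h b]) u = \<alpha> * N h ([b2 h a] @ [b1, b1]) u + \<beta> * N h ([b2 h a] @ [b2 h a]) u"
      by (rule N_append_linear_right[OF g(1) g(1) g(2) g(1) ar lin])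
    also have "\<dots> = \<alpha> * N h ([b1, b1] @ [b2 h a]) u + \<beta> * N h ([b2 h a] @ [b2 h a]) u"
      by (simp only: c1)
    also have "\<dots> = N h ([b2 h b] @ [b2 h a]) u"
      by (rule N_append_linear_left[OF g(1) g(1) g(2) g(1) ar lin, symmetric])
    finally show ?thesis by simp
  qed
qed

section \<open>Reordering the letters of a word\<close>

lemma N_swap:
  assumes good: "good h (ps @ [x, y] @ qs)" and eq: "\<And>u. N h [x, y] u = N h [y, x] u"
  shows "N h (ps @ x # y # qs) u = N h (ps @ y # x # qs) u"
proof -
  have 1: "N h ([x, y] @ qs) v = N h ([y, x] @ qs) v" for v
    by (rule N_append_cong(2)) (use good eq in auto)
  have "N h (ps @ ([x, y] @ qs)) u = N h (ps @ ([y, x] @ qs)) u"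
    by (rule N_append_cong(1)) (use good 1 in auto)
  then show ?thesis by simp
qed

lemma N_commute:
  assumes "good h (xs @ ys)" and "\<And>x y u. x \<in> set xs \<Longrightarrow> y \<in> set ys \<Longrightarrow> N h [x, y] u = N h [y, x] u"
  shows "N h (xs @ ys) u = N h (ys @ xs) u"
proof -
  have move: "N h (ps @ x # ys @ qs) u = N h (ps @ ys @ x # qs) u"
    if "good h (ps @ x # ys @ qs)" "\<And>y u. y \<in> set ys \<Longrightarrow> N h [x, y] u = N h [y, x] u" for ps x ys qs u
    using that
  proof (induction ys arbitrary: ps)
    case (Cons y ys)
    have "N h (ps @ x # y # (ys @ qs)) u = N h (ps @ y # x # (ys @ qs)) u"
      by (rule N_swap) (use Cons.prems in auto)
    also have "\<dots> = N h ((ps @ [y]) @ ys @ x # qs) u"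
      using Cons.IH[of "ps @ [y]"] Cons.prems by simp
    finally show ?case by simp
  qed simp
  have "N h (ps @ xs @ ys) u = N h (ps @ ys @ xs) u" if "good h (ps @ xs @ ys)" for ps
    using that assms(2)
  proof (induction xs arbitrary: ps)
    case (Cons x xs)
    have "N h ((ps @ [x]) @ xs @ ys) u = N h ((ps @ [x]) @ ys @ xs) u"
      by (rule Cons.IH, use Cons.prems(1) in simp, rule Cons.prems(2)) simp_all
    also have "\<dots> = N h (ps @ ys @ x # xs) u"
      using move[of ps x ys xs u] Cons.prems by auto
    finally show ?case by simp
  qed simp
  from this[of "[]"] assms(1) show ?thesis by simp
qed

definition full_word :: "nat \<Rightarrow> block list" where
  "full_word m = b1 # map (\<lambda>k. b2 (1/2) (of_nat k)) [1..<m + 1]"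

lemma full_word_Suc: "full_word (Suc m) = full_word m @ [b2 (1/2) (of_nat (Suc m))]"
  by (simp add: full_word_def)

lemma arity_full_word [simp]: "arity (full_word m) = 2 * m + 1"
  by (induction m) (simp_all add: full_word_Suc, simp add: full_word_def)

lemma good_full_word [simp]: "good (1/2) (full_word m)"
  using theta_like_b1 theta_like_b2 by (auto simp: full_word_def good_def)

lemma full_word_arity_le: "b \<in> set (full_word m) \<Longrightarrow> fst b \<le> 2"
  by (auto simp: full_word_def)

end

section \<open>Vanishing for the word in 2 M + 1 variables, where L = 2 M + 1\<close>

locale vanishing = theta_function +
  fixes M :: nat
  assumes M_pos: "M \<ge> 1"
    and nonzero: "\<And>k. 1 \<le> k \<Longrightarrow> k \<le> 2 * M \<Longrightarrow> th (of_nat k) \<noteq> 0"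
    and half: "th (1/2) \<noteq> 0" "th (3/2) \<noteq> 0"
    and period: "th (of_nat (2 * M + 1)) = 0"
begin

lemma th_small_nz: "th 1 \<noteq> 0" "th 2 \<noteq> 0"
  using nonzero[of 1] nonzero[of 2] M_pos by simp_all

lemma th_small_nz': "c \<in> {1, 2, -1, -2} \<Longrightarrow> th c \<noteq> 0"
  using th_small_nz by (auto simp: th_minus)

lemma letters_commute:
  assumes "x \<in> insert b1 ((\<lambda>k. b2 (1/2) (of_nat k)) ` {1..M})" "y \<in> insert b1 ((\<lambda>k. b2 (1/2) (of_nat k)) ` {1..M})"
  shows "N (1/2) [x, y] u = N (1/2) [y, x] u"
proof -
  have "N (1/2) [b2 (1/2) (of_nat k), b2 (1/2) (of_nat l)] u = N (1/2) [b2 (1/2) (of_nat l), b2 (1/2) (of_nat k)] u"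
    if "k \<in> {1..M}" for k l :: nat
    by (rule b2_b2_commute) (use nonzero[of k] that half th_small_nz in auto)
  then show ?thesis using assms by (auto simp: b1_b2_commute)
qed

text \<open>The offsets -1, 0, 1 are indexed by 0, 1, 2, so that families of three zeros per
  variable can be indexed by products with \<open>{..<3}\<close>.\<close>

definition gap :: "nat \<Rightarrow> complex" where
  "gap e = of_nat e - 1"

lemma gap_simps [simp]: "gap 0 = -1" "gap 1 = 0" "gap (Suc 0) = 0" "gap 2 = 1"
  by (simp_all add: gap_def)

lemma gap_diff: "e < 3 \<Longrightarrow> e' < 3 \<Longrightarrow> gap e - gap e' \<in> {0, 1, 2, -1, -2}"
proof -
  assume "e < 3" "e' < 3"
  then have "e \<in> {0, 1, 2}" "e' \<in> {0, 1, 2}" by auto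
  then show ?thesis by auto
qed

lemma gap_diff_nz: "e < 3 \<Longrightarrow> e' < 3 \<Longrightarrow> e \<noteq> e' \<Longrightarrow> th (gap e - gap e') \<noteq> 0"
proof -
  assume *: "e < 3" "e' < 3" "e \<noteq> e'"
  then have "e \<in> {0, 1, 2}" "e' \<in> {0, 1, 2}" by auto
  then have "gap e - gap e' \<in> {1, 2, -1, -2}" using *(3) by auto
  then show ?thesis by (rule th_small_nz')
qed

text \<open>
  For generic positions the zeros found below are distinct modulo the period lattice. The general case
  follows by continuity along a line.
\<close>

definition generic :: "nat \<Rightarrow> (nat \<Rightarrow> complex) \<Rightarrow> bool" where
  "generic n u \<longleftrightarrow> (\<forall>i\<in>{..<n}. \<forall>j\<in>{..<n}. i \<noteq> j \<longrightarrow> (\<forall>c\<in>{0, 1, 2, -1, -2}. th (u i - u j + c) \<noteq> 0))"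

lemma genericD: "generic n u \<Longrightarrow> i < n \<Longrightarrow> j < n \<Longrightarrow> i \<noteq> j \<Longrightarrow> c \<in> {0, 1, 2, -1, -2} \<Longrightarrow> th (u i - u j + c) \<noteq> 0"
  by (auto simp: generic_def)

lemma eventually_generic:
  assumes v: "inj_on v {..<n}"
  shows "\<forall>\<^sub>F s in at 0. generic n (\<lambda>i. u i + s * v i)"
proof -
  have "\<forall>\<^sub>F s in at 0. i \<noteq> j \<longrightarrow> (\<forall>c\<in>{0, 1, 2, -1, -2}. th ((u i - u j + c) + s * (v i - v j)) \<noteq> 0)"
    if "i \<in> {..<n}" "j \<in> {..<n}" for i j
  proof (cases "i = j")
    case False
    then have "v i - v j \<noteq> 0" using v that by (auto dest: inj_onD)
    then have "\<forall>\<^sub>F s in at 0. \<forall>c\<in>{0, 1, 2, -1, -2}. th ((u i - u j + c) + s * (v i - v j)) \<noteq> 0"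
      by (intro eventually_ball_finite ballI th_isolated_line) auto
    then show ?thesis by eventually_elim simp
  qed simp
  then have "\<forall>\<^sub>F s in at 0. \<forall>i\<in>{..<n}. \<forall>j\<in>{..<n}. i \<noteq> j \<longrightarrow>
      (\<forall>c\<in>{0, 1, 2, -1, -2}. th ((u i - u j + c) + s * (v i - v j)) \<noteq> 0)"
    by (intro eventually_ball_finite ballI) auto
  then show ?thesis unfolding generic_def by eventually_elim (simp add: algebra_simps)
qed

text \<open>A direction that keeps the prescribed variable u i0 fixed and moves the others at
  distinct nonzero speeds. An index i0 outside the range lets all variables move.\<close>

definition dir :: "nat \<Rightarrow> nat \<Rightarrow> complex" where
  "dir i0 i = (if i = i0 then 0 else of_nat (Suc i))"

lemma inj_dir: "inj_on (dir i0) A"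
  by (auto simp: inj_on_def dir_def of_nat_eq_iff simp del: of_nat_Suc)

text \<open>There are three ways to distribute u i = m + 1 and u j = m + 2. If u j falls to the
  shorter word, the shift by 2 takes it to m and the induction hypothesis applies. If only u i does,
  \<open>om\<close> vanishes at the difference - 1. If both are in the last letter, they are its
  zero pair a, a + 1 with a = m + 1.\<close>

lemma next_zero_up:
  assumes IH: "\<And>u i. i < 2 * m + 1 \<Longrightarrow> u i = of_nat m \<Longrightarrow> N (1/2) (full_word m) u = 0"
    and ij: "i < 2 * m + 3" "j < 2 * m + 3" and u: "u i = of_nat m + 1" "u j = of_nat m + 2"
  shows "N (1/2) (full_word (Suc m)) u = 0"
  unfolding full_word_Suc
proof (rule N_append_zero)
  fix p assume "p permutes {..<arity (full_word m) + arity [b2 (1/2) (of_nat (Suc m))]}"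
  then have p: "p permutes {..<2 * m + 3}" by (simp add: eval_nat_numeral)
  let ?i = "inv p i" and ?j = "inv p j" and ?n = "2 * m + 1"
  note l = inv_permutes_less[OF p ij(1)] inv_permutes_less[OF p ij(2)]
  have "i \<noteq> j"
  proof
    assume "i = j" then show False using u by simp
  qed
  then have ne: "?i \<noteq> ?j" using inv_permutes_neq[OF p, of i j] by simp
  consider "?j < ?n" | "?n \<le> ?j" "?i < ?n" | "?n \<le> ?j" "?n \<le> ?i" by linarith
  then show "N (1/2) (full_word m) (\<lambda>i. u (p i) - 2 * (1/2) * of_nat (arity [b2 (1/2) (of_nat (Suc m))])) = 0 \<or>
    N (1/2) [b2 (1/2) (of_nat (Suc m))] (\<lambda>i. u (p (arity (full_word m) + i))) = 0 \<or>
    cross (1/2) (arity (full_word m)) (arity [b2 (1/2) (of_nat (Suc m))]) (u \<circ> p) = 0"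
  proof cases
    case 1
    then have "N (1/2) (full_word m) (\<lambda>i. u (p i) - 2 * (1/2) * of_nat (arity [b2 (1/2) (of_nat (Suc m))])) = 0"
      by (rule IH) (use l u in simp)
    then show ?thesis by blast
  next
    case 2
    have "om (1/2) ((u \<circ> p) ?i - (u \<circ> p) ?j) = 0" using om_zero(1)[of "1/2"] l u by simp
    then have "cross (1/2) ?n 2 (u \<circ> p) = 0" using 2 l by (intro cross_zero[of ?i _ ?j]) auto
    then show ?thesis by simp
  next
    case 3
    have "?i = ?n \<and> ?j = Suc ?n \<or> ?j = ?n \<and> ?i = Suc ?n" using 3 l ne by linarith
    then have "N (1/2) [b2 (1/2) (of_nat (Suc m))] (\<lambda>i. u (p (?n + i))) = 0"
      by (intro N_b2_center) (use l u in \<open>auto simp: add_ac\<close>)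
    then show ?thesis by simp
  qed
qed (use theta_like_b2 in simp_all)

text \<open>Here the last letter is commuted to the front, where its shift is 2 m + 1. If u j = m
  falls to the shorter word, the induction hypothesis applies. If only u j is in the letter,
  \<open>om\<close> vanishes at - 1. If both are, they are shifted to 1 - a and - a with a = m + 1,
  again a zero pair.\<close>

lemma next_zero_down:
  assumes IH: "\<And>u i. i < 2 * m + 1 \<Longrightarrow> u i = of_nat m \<Longrightarrow> N (1/2) (full_word m) u = 0" and m: "Suc m \<le> M"
    and ij: "i < 2 * m + 3" "j < 2 * m + 3" and u: "u i = of_nat m + 1" "u j = of_nat m"
  shows "N (1/2) (full_word (Suc m)) u = 0"
proof -
  let ?b = "b2 (1/2) (of_nat (Suc m))"
  have "N (1/2) (full_word m @ [?b]) u = N (1/2) ([?b] @ full_word m) u"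
  proof (rule N_commute)
    show "good (1/2) (full_word m @ [?b])" using theta_like_b2 by simp
    fix x y u assume "x \<in> set (full_word m)" "y \<in> set [?b]"
    then show "N (1/2) [x, y] u = N (1/2) [y, x] u"
      by (intro letters_commute) (use m in \<open>auto simp: full_word_def simp del: of_nat_Suc\<close>)
  qed
  also have "\<dots> = 0"
  proof (rule N_append_zero)
    fix p assume "p permutes {..<arity [?b] + arity (full_word m)}"
    then have p: "p permutes {..<2 * m + 3}" by (simp add: eval_nat_numeral)
    let ?i = "inv p i" and ?j = "inv p j" and ?n = "2 * m + 1"
    note l = inv_permutes_less[OF p ij(1)] inv_permutes_less[OF p ij(2)]
    have "i \<noteq> j"
    proof
      assume "i = j" then show False using u by simp
    qed
    then have ne: "?i \<noteq> ?j" using inv_permutes_neq[OF p, of i j] by simp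
    consider "?j \<ge> 2" | "?j < 2" "?i \<ge> 2" | "?j < 2" "?i < 2" by linarith
    then show "N (1/2) [?b] (\<lambda>i. u (p i) - 2 * (1/2) * of_nat (arity (full_word m))) = 0 \<or>
      N (1/2) (full_word m) (\<lambda>i. u (p (arity [?b] + i))) = 0 \<or>
      cross (1/2) (arity [?b]) (arity (full_word m)) (u \<circ> p) = 0"
    proof cases
      case 1
      then obtain k where k: "?j = 2 + k" using le_Suc_ex by blast
      have "N (1/2) (full_word m) (\<lambda>i. u (p (arity [?b] + i))) = 0"
      proof (rule IH[of k])
        show "k < 2 * m + 1" using k l by simp
        have "u (p (2 + k)) = of_nat m" unfolding k[symmetric] using l u by simp
        then show "u (p (arity [?b] + k)) = of_nat m" by simp
      qed
      then show ?thesis by blast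
    next
      case 2
      have "om (1/2) ((u \<circ> p) ?j - (u \<circ> p) ?i) = 0" using om_zero(1)[of "1/2"] l u by simp
      then have "cross (1/2) 2 ?n (u \<circ> p) = 0" using 2 l by (intro cross_zero[of ?j _ ?i]) auto
      then show ?thesis by simp
    next
      case 3
      have "?i = 0 \<and> ?j = 1 \<or> ?j = 0 \<and> ?i = 1" using 3 ne by linarith
      then have "N (1/2) [?b] (\<lambda>i. u (p i) - 2 * (1/2) * of_nat (2 * m + 1)) = 0"
        by (intro N_b2_center) (use l u in \<open>auto simp: algebra_simps\<close>)
      then show ?thesis by simp
    qed
  qed (use theta_like_b2 in simp_all)
  finally show ?thesis by (simp add: full_word_Suc)
qed

text \<open>With u i0 = c = m + 1 fixed, translating all other variables by s has degree 3 (n - 1),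
  and each of them supplies three zeros, when it reaches c - 1, c or c + 1. The number is exact and
  the sum right, so the dependence on s is a known product. A triple c - 1/2, c, c + 1/2 gives one
  zero more, which shows that the function vanishes whenever two of the other variables differ by 1.
  As a function of a single variable it then has 3 (n - 1) zeros, more than its degree 2 n -
  1.\<close>

lemma next_zero:
  assumes IH: "\<And>u i. i < 2 * m + 1 \<Longrightarrow> u i = of_nat m \<Longrightarrow> N (1/2) (full_word m) u = 0" and m: "Suc m \<le> M"
    and i0: "i0 < 2 * m + 3" and u0: "u i0 = of_nat m + 1"
  shows "N (1/2) (full_word (Suc m)) u = 0"
proof -
  let ?n = "2 * m + 3" and ?f = "N (1/2) (full_word (Suc m))" and ?c = "of_nat m + 1 :: complex"
  let ?J = "{..<?n} - {i0}"
  have ar: "arity (full_word (Suc m)) = ?n" by simp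
  have f: "theta_like (1/2) ?n ?f" "antisym_fun ?n ?f"
    using theta_like_N[OF good_full_word] antisym_N ar by metis+
  have sub: "?J \<subseteq> {..<?n}" by blast
  have cJ: "card ?J = 2 * m + 2" using i0 by simp
  have up: "?f u = 0" if "u i0 = ?c" "j < ?n" "u j = ?c + 1" for u j
    by (rule next_zero_up[OF IH i0 that(2)]) (use that in simp_all)
  have down: "?f u = 0" if "u i0 = ?c" "j < ?n" "u j = ?c - 1" for u j
    by (rule next_zero_down[OF IH m i0 that(2)]) (use that in simp_all)
  have wheel: "?f u = 0" if "u i0 = ?c" "j \<in> ?J" "k \<in> ?J" "j \<noteq> k" "u j = ?c + 1/2" "u k = ?c - 1/2" for u j k
    by (rule N_wheel[OF full_word_arity_le, where i=k and j=i0 and k=j]) (use that i0 ar in auto)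
  \<comment> \<open>The factor for (j, e) vanishes when u j + s = c + \<open>gap e\<close>.\<close>
  define P where "P u s = (\<Prod>(j, e)\<in>?J \<times> {..<3}. th (s - (?c + gap e - u j)))" for u s
  have prop_generic: "?f (move ?J s u) * P u t = ?f (move ?J t u) * P u s" if u: "u i0 = ?c" and g: "generic ?n u" for u s t
  proof -
    let ?g = "\<lambda>s. ?f (move ?J s u)" and ?z = "\<lambda>(j, e). ?c + gap e - u j"
    let ?d = "card ?J * (2 * ?n + 1 - 2 * card ?J)"
    note ml = theta_like_move_line[OF f(1) sub, where u=u]
    have d: "card (?J \<times> {..<3::nat}) = ?d" by (simp add: cJ card_cartesian_product)
    have gaps: "(\<Sum>e<3. gap e) = 0" by (simp add: eval_nat_numeral gap_def)
    have "(\<Sum>x\<in>?J \<times> {..<3}. ?z x) = (\<Sum>j\<in>?J. \<Sum>e<3. ?c + gap e - u j)"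
      by (simp add: sum.cartesian_product)
    also have "\<dots> = (\<Sum>j\<in>?J. 3 * ?c - 3 * u j)"
      by (intro sum.cong refl) (simp add: sum.distrib sum_subtractf gaps)
    also have "\<dots> = of_nat (2 * m + 2) * (3 * ?c) - 3 * (\<Sum>j\<in>?J. u j)"
      by (simp only: sum_subtractf sum_constant cJ sum_distrib_left[symmetric])
    finally have sz: "(\<Sum>x\<in>?J \<times> {..<3}. ?z x) = of_nat (2 * m + 2) * (3 * ?c) - 3 * (\<Sum>j\<in>?J. u j)" .
    have su: "(\<Sum>i<?n. u i) = ?c + (\<Sum>j\<in>?J. u j)" using i0 u by (subst sum.remove[of _ i0]) auto
    \<comment> \<open>The sum of zeros prescribed by the multiplier agrees with the sum of the zeros
      found, so the proportionality applies instead of vanishing.\<close>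
    have sig: "2 * of_nat (card ?J) * (\<Sum>i<?n. u i) + of_nat (card ?J) * (of_nat ?n - 1) * (1/2)
        - (2 * of_nat ?n + 1) * (\<Sum>i\<in>?J. u i) = (\<Sum>x\<in>?J \<times> {..<3}. ?z x)"
      unfolding sz su cJ by (simp add: algebra_simps)
    have "?g s * (\<Prod>x\<in>?J \<times> {..<3}. th (t - ?z x)) = ?g t * (\<Prod>x\<in>?J \<times> {..<3}. th (s - ?z x))"
    proof (rule theta_proportional[where f="?g" and z="?z" and I="?J \<times> {..<3}" and d="?d"])
      show "?g holomorphic_on UNIV" by (rule ml(1))
      show "?g (s + of_real \<rho>) = (- 1) ^ ?d * ?g s" for s by (rule ml(2))
      show "?g (s + \<tau>) = (- q) ^ ?d * E (of_nat ?d * s - (\<Sum>x\<in>?J \<times> {..<3}. ?z x)) * ?g s" for s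
        unfolding sig[symmetric] by (rule ml(3))
      show "finite (?J \<times> {..<3::nat})" by simp
      show "card (?J \<times> {..<3::nat}) = ?d" by (rule d)
    next
      fix x assume "x \<in> ?J \<times> {..<3::nat}"
      then obtain j e where x: "x = (j, e)" "j \<in> ?J" "e < 3" by blast
      let ?w = "move ?J (?c + gap e - u j) u"
      have w: "?w i0 = ?c" "?w j = ?c + gap e" using x u by (simp_all add: move_def)
      have "e = 0 \<or> e = 1 \<or> e = 2" using x(3) by auto
      then consider "e = 0" | "e = 1" | "e = 2" by blast
      then have "?f ?w = 0"
      proof cases
        case 1 then show ?thesis using w x by (intro down[of _ j]) auto
      next
        case 2 then show ?thesis using w x i0 by (intro antisym_coincidence[OF f(2), of i0 j]) auto
      next
        case 3 then show ?thesis using w x by (intro up[of _ j]) auto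
      qed
      then show "?g (?z x) = 0" using x by simp
    next
      fix x y assume xy: "x \<in> ?J \<times> {..<3::nat}" "y \<in> ?J \<times> {..<3::nat}" "x \<noteq> y"
      obtain j e k e' where x: "x = (j, e)" "y = (k, e')" by (cases x, cases y)
      show "th (?z x - ?z y) \<noteq> 0"
      proof (cases "j = k")
        case True
        then have "th (gap e - gap e') \<noteq> 0" using xy x by (intro gap_diff_nz) auto
        then show ?thesis using x True by simp
      next
        case False
        have "th (u k - u j + (gap e - gap e')) \<noteq> 0"
          using False xy x by (intro genericD[OF g] gap_diff) auto
        moreover have "?z x - ?z y = u k - u j + (gap e - gap e')" using x by simp
        ultimately show ?thesis by simp
      qed
    qed
    then show ?thesis unfolding P_def by (simp add: case_prod_beta)
  qed
  have move_dir: "move ?J s (\<lambda>i. u i + r * v i) = (\<lambda>i. move ?J s u i + r * v i)" for s u r v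
    by (auto simp: move_def fun_eq_iff)
  \<comment> \<open>Both sides are continuous along \<open>dir i0\<close>, which respects u i0 = c,
    so the relation extends beyond generic positions.\<close>
  have proportional: "?f (move ?J s u) * P u t = ?f (move ?J t u) * P u s" if u: "u i0 = ?c" for u s t
  proof -
    let ?h = "\<lambda>r. ?f (move ?J s (\<lambda>i. u i + r * dir i0 i)) * P (\<lambda>i. u i + r * dir i0 i) t -
      ?f (move ?J t (\<lambda>i. u i + r * dir i0 i)) * P (\<lambda>i. u i + r * dir i0 i) s"
    have "continuous_on UNIV (\<lambda>r. ?f (move ?J s (\<lambda>i. u i + r * dir i0 i)))" for s
      unfolding move_dir using theta_likeD(1)[OF f(1)] unfolding line_entire_def
      by (intro holomorphic_on_imp_continuous_on) blast
    then have c: "continuous_on UNIV ?h"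
      unfolding P_def case_prod_beta by (intro continuous_intros)
    have "\<forall>\<^sub>F r in at 0. ?h r = 0"
      using eventually_generic[OF inj_dir[of i0 "{..<?n}"], of u]
      by eventually_elim (use prop_generic u in \<open>simp add: dir_def\<close>)
    from eventually_zero_imp_zero[OF c this] show ?thesis by simp
  qed
  have pair: "?f u = 0" if u: "u i0 = ?c" and jk: "j \<in> ?J" "k \<in> ?J" "u j = u k + 1" for u j k
  proof -
    have jk': "j \<noteq> k" using jk(3) by auto
    have gen: "?f u = 0" if u: "u i0 = ?c" "u j = u k + 1"
      and g: "\<forall>l\<in>?J - {j, k}. \<forall>e<3. th (1/2 - gap e - u j + u l) \<noteq> 0" for u
    proof -
      \<comment> \<open>This translation brings u j and u k to c + 1/2 and c - 1/2, on either side
        of u i0 = c.\<close>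
      define s where "s = ?c + 1/2 - u j"
      have "?f (move ?J s u) = 0"
        by (rule wheel[OF _ jk(1,2) jk']) (use u jk in \<open>auto simp: move_def s_def\<close>)
      then have 0: "?f u * P u s = 0" using proportional[of u 0 s, OF u(1)] by simp
      \<comment> \<open>At this s the factors of the product for l = j and l = k are values of
        \<open>th\<close> at \<plusminus>1/2 and \<plusminus>3/2, which are nonzero.\<close>
      have hz: "th (1/2 - gap e) \<noteq> 0" "th (- (1/2) - gap e) \<noteq> 0" if "e < 3" for e
      proof -
        have "e = 0 \<or> e = 1 \<or> e = 2" using that by auto
        moreover have "th (- (1/2)) \<noteq> 0" "th (- (3/2)) \<noteq> 0" using half by (simp_all only: th_minus neg_equal_0_iff_equal not_False_eq_True)
        ultimately show "th (1/2 - gap e) \<noteq> 0" "th (- (1/2) - gap e) \<noteq> 0" using half by auto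
      qed
      have "th (s - (?c + gap e - u l)) \<noteq> 0" if l: "l \<in> ?J" "e < 3" for l e
      proof -
        have e: "s - (?c + gap e - u l) = 1/2 - gap e - u j + u l" by (simp add: s_def)
        consider "l = j" | "l = k" | "l \<in> ?J - {j, k}" using l by blast
        then show ?thesis
        proof cases
          case 1 then show ?thesis unfolding e using hz(1)[OF l(2)] by simp
        next
          case 2
          then have e2: "1/2 - gap e - u j + u l = - (1/2) - gap e" using u(2) by simp
          show ?thesis unfolding e e2 by (rule hz(2)[OF l(2)])
        next
          case 3 then show ?thesis unfolding e using g l by blast
        qed
      qed
      then have "P u s \<noteq> 0" unfolding P_def by (auto simp: prod_zero_iff)
      then show ?thesis using 0 by simp
    qed
    show ?thesis
    \<comment> \<open>Fixing u i0, u j and u k preserves both constraints, while all other variables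
      move away from the zeros of the product.\<close>
    proof (rule line_entire_extend[OF theta_likeD(1)[OF f(1)], of _ "\<lambda>l. if l \<in> {i0, j, k} then 0 else 1"])
      have "\<forall>\<^sub>F s in at 0. \<forall>l\<in>?J - {j, k}. \<forall>e\<in>{..<3}. th ((1/2 - gap e - u j + u l) + s * 1) \<noteq> 0"
        by (intro eventually_ball_finite ballI th_isolated_line) auto
      then show "\<forall>\<^sub>F s in at 0. ?f (\<lambda>l. u l + s * (if l \<in> {i0, j, k} then 0 else 1)) = 0"
        by eventually_elim (rule gen, use u jk in \<open>auto simp: add_ac\<close>)
    qed
  qed
  obtain j where j: "j < ?n" "j \<noteq> i0"
    using i0 by (metis One_nat_def add_less_cancel_left less_add_same_cancel2 linorder_neqE_nat not_less_eq numeral_3_eq_3 zero_less_Suc)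
  have gen: "?f u = 0" if u: "u i0 = ?c" and g: "generic ?n u" for u
  proof (rule theta_like_upd_zero[OF f(1) j(1), of "({..<?n} - {j}) \<times> {..<3}" _ "\<lambda>(i, e). u i + gap e"])
    show "finite (({..<?n} - {j}) \<times> {..<3::nat})" by simp
    show "2 * ?n - 1 < card (({..<?n} - {j}) \<times> {..<3::nat})"
      using j by (simp add: card_cartesian_product)
  next
    fix x assume "x \<in> ({..<?n} - {j}) \<times> {..<3::nat}"
    then obtain i e where x: "x = (i, e)" "i < ?n" "i \<noteq> j" "e < 3" by blast
    let ?w = "u(j := u i + gap e)"
    have "e = 0 \<or> e = 1 \<or> e = 2" using x by auto
    then consider "e = 1" | "e = 0" "i = i0" | "e = 2" "i = i0" | "e = 0" "i \<noteq> i0" | "e = 2" "i \<noteq> i0" by blast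
    then have "?f ?w = 0"
    proof cases
      case 1 then show ?thesis using x j by (intro antisym_coincidence[OF f(2), of i j]) auto
    next
      case 2 then show ?thesis using x j u by (intro down[of _ j]) auto
    next
      case 3 then show ?thesis using x j u by (intro up[of _ j]) auto
    next
      case 4 then show ?thesis using x j u by (intro pair[of _ i j]) auto
    next
      case 5 then show ?thesis using x j u by (intro pair[of _ j i]) auto
    qed
    then show "?f (u(j := case x of (i, e) \<Rightarrow> u i + gap e)) = 0" using x by simp
  next
    fix x y assume xy: "x \<in> ({..<?n} - {j}) \<times> {..<3::nat}" "y \<in> ({..<?n} - {j}) \<times> {..<3::nat}" "x \<noteq> y"
    obtain i e k e' where x: "x = (i, e)" "y = (k, e')" by (cases x, cases y)
    show "th ((case x of (i, e) \<Rightarrow> u i + gap e) - (case y of (i, e) \<Rightarrow> u i + gap e)) \<noteq> 0"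
    proof (cases "i = k")
      case True
      then have "th (gap e - gap e') \<noteq> 0" using xy x by (intro gap_diff_nz) auto
      then show ?thesis using x True by simp
    next
      case False
      have e2: "u i + gap e - (u k + gap e') = u i - u k + (gap e - gap e')" by simp
      have "th (u i + gap e - (u k + gap e')) \<noteq> 0" unfolding e2
        using False xy x by (intro genericD[OF g] gap_diff) auto
      then show ?thesis using x by simp
    qed
  qed
  show ?thesis
  proof (rule line_entire_extend[OF theta_likeD(1)[OF f(1)], of _ "dir i0"])
    show "\<forall>\<^sub>F s in at 0. ?f (\<lambda>i. u i + s * dir i0 i) = 0"
      using eventually_generic[OF inj_dir[of i0 "{..<?n}"], of u]
      by eventually_elim (rule gen, use u0 in \<open>simp add: dir_def\<close>)
  qed
qed

lemma full_word_zero: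
  assumes "m \<le> M" "i < 2 * m + 1" "u i = of_nat m"
  shows "N (1/2) (full_word m) u = 0"
  using assms
proof (induction m arbitrary: u i)
  case 0 then show ?case by (simp add: full_word_def N_b1)
next
  case (Suc m)
  show ?case by (rule next_zero[where ?i0.0=i]) (use Suc in \<open>auto simp: add_ac\<close>)
qed

text \<open>Translating all n = 2 M + 1 variables together has only degree n. The n zeros at u i + s
  = M and one more at u 0 + s = M + 1 exceed it.\<close>

theorem full_word_vanishes: "N (1/2) (full_word M) u = 0"
proof -
  let ?n = "2 * M + 1" and ?f = "N (1/2) (full_word M)"
  have f: "theta_like (1/2) ?n ?f" "antisym_fun ?n ?f"
    using theta_like_N[OF good_full_word] antisym_N arity_full_word by metis+
  obtain m where m: "M = Suc m" using M_pos by (cases M) auto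
  \<comment> \<open>If u i falls to the shorter word, the shift by 2 takes it to M - 1, a zero of
    that word. In the last letter, a = M is the degenerate case th (2 a + 1) = 0.\<close>
  have second: "?f u = 0" if i: "i < ?n" "u i = of_nat M + 1" for u i
    unfolding m full_word_Suc
  proof (rule N_append_zero)
    fix p assume "p permutes {..<arity (full_word m) + arity [b2 (1/2) (of_nat (Suc m))]}"
    then have p: "p permutes {..<?n}" by (simp add: m)
    let ?i = "inv p i" and ?k = "2 * m + 1"
    note l = inv_permutes_less[OF p i(1)]
    show "N (1/2) (full_word m) (\<lambda>i. u (p i) - 2 * (1/2) * of_nat (arity [b2 (1/2) (of_nat (Suc m))])) = 0 \<or>
      N (1/2) [b2 (1/2) (of_nat (Suc m))] (\<lambda>i. u (p (arity (full_word m) + i))) = 0 \<or>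
      cross (1/2) (arity (full_word m)) (arity [b2 (1/2) (of_nat (Suc m))]) (u \<circ> p) = 0"
    proof (cases "?i < ?k")
      case True
      then have "N (1/2) (full_word m) (\<lambda>i. u (p i) - 2 * (1/2) * of_nat (arity [b2 (1/2) (of_nat (Suc m))])) = 0"
        by (intro full_word_zero[of m ?i]) (use l i m in auto)
      then show ?thesis by blast
    next
      case False
      then have "?i = ?k \<or> ?i = Suc ?k" using l by (simp add: m) linarith
      moreover have "th (2 * of_nat (Suc m) + 2 * (1/2)) = 0" using period by (simp add: m)
      ultimately have "N (1/2) [b2 (1/2) (of_nat (Suc m))] (\<lambda>i. u (p (?k + i))) = 0"
        by (intro N_b2_degenerate) (use l i m in auto)
      then show ?thesis by simp
    qed
  qed (use theta_like_b2 in simp_all)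
  have gen: "?f u = 0" if g: "generic ?n u" for u
  proof -
    let ?g = "\<lambda>s. ?f (move {..<?n} s u)"
    \<comment> \<open>The index n carries the additional zero, obtained from u 0.\<close>
    let ?z = "\<lambda>i. if i < ?n then of_nat M - u i else of_nat M + 1 - u 0"
    note ml = theta_like_move_line[OF f(1) order.refl, where u=u]
    let ?d = "card {..<?n} * (2 * ?n + 1 - 2 * card {..<?n})"
    let ?\<sigma> = "2 * of_nat (card {..<?n}) * (\<Sum>i<?n. u i) + of_nat (card {..<?n}) * (of_nat ?n - 1) * (1/2)
        - (2 * of_nat ?n + 1) * (\<Sum>i\<in>{..<?n}. u i)"
    have "?g 0 = 0"
    proof (rule theta_too_many_zeros[where f="?g" and z="?z" and I="{..?n}" and d="?d" and \<sigma>="?\<sigma>"])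
      show "?g holomorphic_on UNIV" by (rule ml(1))
      show "?g (s + of_real \<rho>) = (- 1) ^ ?d * ?g s" for s by (rule ml(2))
      show "?g (s + \<tau>) = (- q) ^ ?d * E (of_nat ?d * s - ?\<sigma>) * ?g s" for s by (rule ml(3))
      show "finite {..?n}" "?d < card {..?n}" by simp_all
    next
      fix i assume "i \<in> {..?n}"
      show "?g (?z i) = 0"
      proof (cases "i < ?n")
        case True
        then show ?thesis by (intro full_word_zero[of M i]) (auto simp: move_def)
      next
        case False
        then show ?thesis by (intro second[of 0]) (auto simp: move_def)
      qed
    next
      fix i j assume ij: "i \<in> {..?n}" "j \<in> {..?n}" "i \<noteq> j"
      have 1: "th (u 0 - u k - 1) \<noteq> 0 \<and> th (u k - u 0 + 1) \<noteq> 0" if "k < ?n" for k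
      proof (cases "k = 0")
        case True then show ?thesis using th_small_nz' by simp
      next
        case False
        then show ?thesis using genericD[OF g, of 0 k "-1"] genericD[OF g, of k 0 1] that by simp
      qed
      consider "i < ?n" "j < ?n" | "i < ?n" "j = ?n" | "i = ?n" "j < ?n" using ij by fastforce
      then show "th (?z i - ?z j) \<noteq> 0"
      proof cases
        case 1 then show ?thesis using genericD[OF g, of j i 0] ij by simp
      next
        case 2 then show ?thesis using 1[of i] by (simp add: algebra_simps)
      next
        case 3 then show ?thesis using 1[of j] by (simp add: algebra_simps)
      qed
    qed
    then show ?thesis by simp
  qed
  show ?thesis
  proof (rule line_entire_extend[OF theta_likeD(1)[OF f(1)], of _ "dir ?n"])
    show "\<forall>\<^sub>F s in at 0. ?f (\<lambda>i. u i + s * dir ?n i) = 0"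
      using eventually_generic[OF inj_dir[of ?n "{..<?n}"], of u]
      by eventually_elim (rule gen)
  qed
qed

text \<open>Needed for even l, where the letter \<open>Q1\<close> belongs to the right factor and
  the word of the product is a rotation of \<open>full_word M\<close>.\<close>

corollary split_word_vanishes:
  assumes w: "full_word M = w1 @ w2"
  shows "N (1/2) (w2 @ w1) u = 0"
proof -
  have s: "set (full_word M) \<subseteq> insert b1 ((\<lambda>k. b2 (1/2) (of_nat k)) ` {1..M})"
    by (auto simp: full_word_def)
  have "N (1/2) (w1 @ w2) u = N (1/2) (w2 @ w1) u"
  proof (rule N_commute)
    show "good (1/2) (w1 @ w2)" using good_full_word[of M] w by simp
    show "N (1/2) [x, y] u = N (1/2) [y, x] u" if "x \<in> set w1" "y \<in> set w2" for x y u
      by (rule letters_commute) (use that s w in auto)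
  qed
  then show ?thesis using full_word_vanishes[of u] w by simp
qed

end

section \<open>Sums over a basis of Fock space\<close>

text \<open>
  The coefficient of \<open>a ^ k\<close> in \<open>exp (S a) (a + t) ^ p\<close>.
\<close>

primrec mode_coeff :: "complex \<Rightarrow> complex \<Rightarrow> nat \<Rightarrow> nat \<Rightarrow> complex" where
  "mode_coeff S t 0 k = S ^ k / fact k"
| "mode_coeff S t (Suc p) k = (if k = 0 then 0 else mode_coeff S t p (k - 1)) + t * mode_coeff S t p k"

text \<open>This is Pascal's rule. The closed form exhibits a polynomial in S and t, from which
  holomorphy in the variables is read off later.\<close>

lemma mode_coeff_closed:
  "mode_coeff S t p k = (\<Sum>c\<le>k. of_nat (p choose c) * t ^ (p - c) * (S ^ (k - c) / fact (k - c)))"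
proof (induction p arbitrary: k)
  case 0
  have "(\<Sum>c\<le>k. of_nat (0 choose c) * t ^ (0 - c) * (S ^ (k - c) / fact (k - c))) =
    (\<Sum>c\<in>{0}. of_nat (0 choose c) * t ^ (0 - c) * (S ^ (k - c) / fact (k - c)))"
    by (rule sum.mono_neutral_right) auto
  then show ?case by simp
next
  case (Suc p)
  let ?f = "\<lambda>p k c. of_nat (p choose c) * t ^ (p - c) * (S ^ (k - c) / fact (k - c))"
  have tt: "t * (of_nat (p choose c) * t ^ (p - c) * z) = of_nat (p choose c) * t ^ (Suc p - c) * z" for c z
    by (cases "c \<le> p") (simp_all add: Suc_diff_le)
  show ?case
  proof (cases k)
    case 0
    then show ?thesis by (simp add: Suc)
  next
    case (Suc k')
    have "(\<Sum>c\<le>k. ?f (Suc p) k c) = ?f (Suc p) k 0 + (\<Sum>c\<le>k'. ?f (Suc p) k (Suc c))"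
      unfolding Suc by (rule sum.atMost_Suc_shift)
    also have "(\<Sum>c\<le>k'. ?f (Suc p) k (Suc c)) = (\<Sum>c\<le>k'. ?f p k' c) +
        (\<Sum>c\<le>k'. of_nat (p choose Suc c) * t ^ (Suc p - Suc c) * (S ^ (k - Suc c) / fact (k - Suc c)))"
      by (simp add: Suc sum.distrib ring_distribs add_divide_distrib)
    also have "?f (Suc p) k 0 + ((\<Sum>c\<le>k'. ?f p k' c) +
        (\<Sum>c\<le>k'. of_nat (p choose Suc c) * t ^ (Suc p - Suc c) * (S ^ (k - Suc c) / fact (k - Suc c)))) =
      (\<Sum>c\<le>k'. ?f p k' c) + (\<Sum>c\<le>k. of_nat (p choose c) * t ^ (Suc p - c) * (S ^ (k - c) / fact (k - c)))"
      using sum.atMost_Suc_shift[of "\<lambda>c. of_nat (p choose c) * t ^ (Suc p - c) * (S ^ (k - c) / fact (k - c))" k']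
      by (simp add: Suc)
    also have "(\<Sum>c\<le>k. of_nat (p choose c) * t ^ (Suc p - c) * (S ^ (k - c) / fact (k - c))) = t * mode_coeff S t p k"
      unfolding Suc.IH sum_distrib_left tt ..
    finally show ?thesis by (simp add: Suc Suc.IH)
  qed
qed

lemma mode_coeff_0_right: "mode_coeff S t p 0 = t ^ p"
  by (induction p) auto

lemma mode_coeff_S0: "mode_coeff 0 t p k = of_nat (p choose k) * t ^ (p - k)"
proof -
  have "(\<Sum>c\<le>k. of_nat (p choose c) * t ^ (p - c) * (0 ^ (k - c) / fact (k - c))) =
    (\<Sum>c\<in>{k}. of_nat (p choose c) * t ^ (p - c) * (0 ^ (k - c) / fact (k - c)))"
    by (rule sum.mono_neutral_right) auto
  then show ?thesis unfolding mode_coeff_closed by simp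
qed

lemma mode_coeff_t0: "mode_coeff S 0 p k = (if p \<le> k then S ^ (k - p) / fact (k - p) else 0)"
  by (induction p arbitrary: k) (auto simp: Suc_diff_le Suc_le_eq)

text \<open>Neighbouring coefficients of (a + t)^p are related through the operator t d/da, which
  lowers the occupation number by one.\<close>

lemma mode_coeff_annihilate:
  "t * of_nat (Suc k) * mode_coeff 0 t p (Suc k) = of_nat (p - k) * mode_coeff 0 t p k"
proof (cases "k < p")
  case True
  have "Suc k * (p choose Suc k) = (p - k) * (p choose k)"
    using binomial_absorb_comp[of p k] times_binomial_minus1_eq[of "Suc k" p] binomial_absorption[of k "p - 1"] True
    by simp
  then have "of_nat (Suc k) * of_nat (p choose Suc k) = of_nat (p - k) * (of_nat (p choose k) :: complex)"
    by (simp only: of_nat_mult[symmetric])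
  moreover have "t ^ (p - k) = t * t ^ (p - Suc k)" using True by (simp add: Suc_diff_Suc flip: power_Suc)
  ultimately show ?thesis unfolding mode_coeff_S0 by (simp add: mult_ac)
qed (simp add: mode_coeff_S0)

text \<open>The counterpart for multiplication by s a, read off from the coefficients of exp (s a)
  a^p.\<close>

lemma mode_coeff_create:
  "k > 0 \<Longrightarrow> s * mode_coeff s 0 p (k - 1) = of_nat (k - p) * mode_coeff s 0 p k"
proof (cases "p < k")
  case True
  then obtain d where "k = Suc (p + d)" using less_iff_Suc_add by blast
  then have k: "k - p = Suc d" "k - 1 - p = d" "p \<le> k" "p \<le> k - 1" by simp_all
  have "s * (s ^ d / fact d) = s ^ Suc d * (of_nat (Suc d) / fact (Suc d))"
    by (simp add: fact_Suc del: of_nat_Suc)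
  then show ?thesis unfolding mode_coeff_t0 k using k by (simp only: if_True mult_ac times_divide_eq_left times_divide_eq_right)
next
  case False
  assume "k > 0"
  then show ?thesis using False by (auto simp: mode_coeff_t0)
qed

lemma exp_has_sum: "((\<lambda>n. z ^ n / fact n) has_sum exp z) (UNIV :: nat set)" for z :: complex
proof (rule norm_summable_imp_has_sum)
  show "summable (\<lambda>n. norm (z ^ n / fact n))"
    using summable_norm_exp[of z] by (simp add: divide_inverse scaleR_conv_of_real mult.commute norm_mult norm_inverse)
  show "(\<lambda>n. z ^ n / fact n) sums exp z"
    using exp_converges[of z] by (simp add: divide_inverse scaleR_conv_of_real mult.commute)
qed

lemma has_sum_shift_nat:
  fixes f :: "nat \<Rightarrow> complex"
  assumes "((\<lambda>k. f (k + c)) has_sum a) UNIV" "\<And>k. k < c \<Longrightarrow> f k = 0"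
  shows "(f has_sum a) UNIV"
proof -
  have "(f has_sum a) (range (\<lambda>k. k + c))"
    using assms(1) by (subst has_sum_reindex) (auto simp: o_def)
  moreover have "(f has_sum a) (range (\<lambda>k. k + c)) \<longleftrightarrow> (f has_sum a) UNIV"
  proof (rule has_sum_cong_neutral)
    fix k assume "k \<in> UNIV - range (\<lambda>k. k + c)"
    then have "k < c" by (metis DiffE le_add_diff_inverse2 not_less rangeI)
    then show "f k = 0" by (rule assms(2))
  qed auto
  ultimately show ?thesis by blast
qed

lemma has_sum_finite_sum:
  fixes f :: "'c \<Rightarrow> 'a \<Rightarrow> complex"
  assumes "finite A" "\<And>c. c \<in> A \<Longrightarrow> (f c has_sum a c) B"
  shows "((\<lambda>k. \<Sum>c\<in>A. f c k) has_sum (\<Sum>c\<in>A. a c)) B"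
  using assms by (induction A rule: finite_induct) (auto intro: has_sum_add)

text \<open>Normal ordering in a single mode. The operator with matrix
  \<open>mode_coeff s t'\<close> substitutes a + t' for a and multiplies by exp (s a). Applied to
  exp (S a) (a + t)^p it gives exp (S t') exp ((S + s) a) (a + t + t')^p; the factor exp (S t') is
  the contraction.\<close>

lemma mode_sum:
  "((\<lambda>k. mode_coeff s t' k \<kappa> * mode_coeff S t p k) has_sum (exp (S * t') * mode_coeff (S + s) (t + t') p \<kappa>)) UNIV"
proof (induction p arbitrary: \<kappa>)
  case 0
  have 1: "((\<lambda>k. of_nat (k choose c) * t' ^ (k - c) * (S ^ k / fact k)) has_sum (S ^ c / fact c * exp (t' * S))) UNIV" for c
  proof (rule has_sum_shift_nat)
    have "of_nat ((k + c) choose c) * t' ^ (k + c - c) * (S ^ (k + c) / fact (k + c)) = S ^ c / fact c * ((t' * S) ^ k / fact k)" for k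
    proof -
      have "of_nat ((k + c) choose c) = (fact (k + c) / (fact c * fact k) :: complex)"
        by (subst binomial_fact) auto
      then show ?thesis by (simp add: power_add power_mult_distrib field_simps)
    qed
    then show "((\<lambda>k. of_nat ((k + c) choose c) * t' ^ (k + c - c) * (S ^ (k + c) / fact (k + c))) has_sum (S ^ c / fact c * exp (t' * S))) UNIV"
      by (simp only:) (intro has_sum_cmult_right exp_has_sum)
  qed simp
  have "((\<lambda>k. \<Sum>c\<le>\<kappa>. (s ^ (\<kappa> - c) / fact (\<kappa> - c)) * (of_nat (k choose c) * t' ^ (k - c) * (S ^ k / fact k)))
      has_sum (\<Sum>c\<le>\<kappa>. (s ^ (\<kappa> - c) / fact (\<kappa> - c)) * (S ^ c / fact c * exp (t' * S)))) UNIV"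
    by (intro has_sum_finite_sum has_sum_cmult_right 1) auto
  moreover have "(\<Sum>c\<le>\<kappa>. (s ^ (\<kappa> - c) / fact (\<kappa> - c)) * (of_nat (k choose c) * t' ^ (k - c) * (S ^ k / fact k)))
      = mode_coeff s t' k \<kappa> * mode_coeff S t 0 k" for k
    by (simp add: mode_coeff_closed[of s] sum_distrib_right sum_distrib_left mult_ac sum_divide_distrib)
  moreover have "(\<Sum>c\<le>\<kappa>. (s ^ (\<kappa> - c) / fact (\<kappa> - c)) * (S ^ c / fact c * exp (t' * S))) =
      exp (S * t') * mode_coeff (S + s) (t + t') 0 \<kappa>"
  proof -
    have "(S + s) ^ \<kappa> / fact \<kappa> = (\<Sum>c\<le>\<kappa>. (of_nat (\<kappa> choose c) * S ^ c * s ^ (\<kappa> - c)) / fact \<kappa>)"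
      by (simp add: binomial_ring sum_divide_distrib)
    also have "\<dots> = (\<Sum>c\<le>\<kappa>. (s ^ (\<kappa> - c) / fact (\<kappa> - c)) * (S ^ c / fact c))"
      by (intro sum.cong refl) (simp add: binomial_fact mult_ac)
    finally show ?thesis by (simp add: sum_distrib_left mult_ac)
  qed
  ultimately show ?case by simp
next
  case (Suc p)
  let ?m = "\<lambda>k \<kappa>. mode_coeff s t' k \<kappa>" and ?M = "mode_coeff S t"
  let ?X = "\<lambda>p \<kappa>. exp (S * t') * mode_coeff (S + s) (t + t') p \<kappa>"
  have a: "((\<lambda>k. ?m (Suc k) \<kappa> * ?M p k) has_sum ((if \<kappa> = 0 then 0 else ?X p (\<kappa> - 1)) + t' * ?X p \<kappa>)) UNIV"
  proof -
    have "((\<lambda>k. (if \<kappa> = 0 then 0 else ?m k (\<kappa> - 1) * ?M p k) + t' * (?m k \<kappa> * ?M p k))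
       has_sum ((if \<kappa> = 0 then 0 else ?X p (\<kappa> - 1)) + t' * ?X p \<kappa>)) UNIV"
      by (intro has_sum_add has_sum_cmult_right Suc.IH) (cases "\<kappa> = 0"; simp add: Suc.IH)
    moreover have "(if \<kappa> = 0 then 0 else ?m k (\<kappa> - 1) * ?M p k) + t' * (?m k \<kappa> * ?M p k) = ?m (Suc k) \<kappa> * ?M p k" for k
      by (simp add: algebra_simps)
    ultimately show ?thesis by simp
  qed
  have b: "((\<lambda>k. ?m k \<kappa> * (if k = 0 then 0 else ?M p (k - 1))) has_sum ((if \<kappa> = 0 then 0 else ?X p (\<kappa> - 1)) + t' * ?X p \<kappa>)) UNIV"
    by (rule has_sum_shift_nat[where c=1]) (use a in simp_all)
  have "((\<lambda>k. ?m k \<kappa> * (if k = 0 then 0 else ?M p (k - 1)) + t * (?m k \<kappa> * ?M p k))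
      has_sum (((if \<kappa> = 0 then 0 else ?X p (\<kappa> - 1)) + t' * ?X p \<kappa>) + t * ?X p \<kappa>)) UNIV"
    by (intro has_sum_add has_sum_cmult_right Suc.IH b)
  moreover have "?m k \<kappa> * (if k = 0 then 0 else ?M p (k - 1)) + t * (?m k \<kappa> * ?M p k) = ?m k \<kappa> * ?M (Suc p) k" for k
    by (simp add: algebra_simps)
  moreover have "((if \<kappa> = 0 then 0 else ?X p (\<kappa> - 1)) + t' * ?X p \<kappa>) + t * ?X p \<kappa> = ?X (Suc p) \<kappa>"
    by (simp add: algebra_simps)
  ultimately show ?case by (simp only:)
qed

lemma infsum_increasing_limit:
  fixes g :: "'a \<Rightarrow> complex"
  assumes g: "g summable_on UNIV" and B: "\<And>F. finite F \<Longrightarrow> \<forall>\<^sub>F N in sequentially. F \<subseteq> B N"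
  shows "(\<lambda>N. infsum g (B N)) \<longlonglongrightarrow> infsum g UNIV"
proof (rule metric_LIMSEQ_I)
  fix e :: real assume e: "e > 0"
  have "(sum g \<longlongrightarrow> infsum g UNIV) (finite_subsets_at_top UNIV)"
    using has_sum_infsum[OF g] by (simp add: has_sum_def)
  then have "\<forall>\<^sub>F F in finite_subsets_at_top UNIV. dist (sum g F) (infsum g UNIV) < e / 2"
    using e by (intro tendstoD) auto
  then obtain F0 where F0: "finite F0" "\<And>F. finite F \<Longrightarrow> F0 \<subseteq> F \<Longrightarrow> dist (sum g F) (infsum g UNIV) < e / 2"
    unfolding eventually_finite_subsets_at_top by auto
  obtain N0 where N0: "\<And>N. N \<ge> N0 \<Longrightarrow> F0 \<subseteq> B N"
    using B[OF F0(1)] by (auto simp: eventually_sequentially)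
  show "\<exists>N0. \<forall>N\<ge>N0. dist (infsum g (B N)) (infsum g UNIV) < e"
  proof (intro exI allI impI)
    fix N assume N: "N \<ge> N0"
    have s: "g summable_on B N" by (rule summable_on_subset_banach[OF g]) auto
    have l: "((\<lambda>F. dist (sum g F) (infsum g UNIV)) \<longlongrightarrow> dist (infsum g (B N)) (infsum g UNIV)) (finite_subsets_at_top (B N))"
      using has_sum_infsum[OF s] by (intro tendsto_intros) (simp add: has_sum_def)
    have "dist (infsum g (B N)) (infsum g UNIV) \<le> e / 2"
    proof (rule tendsto_upperbound[OF l])
      show "\<forall>\<^sub>F F in finite_subsets_at_top (B N). dist (sum g F) (infsum g UNIV) \<le> e / 2"
        unfolding eventually_finite_subsets_at_top
        by (intro exI[of _ F0]) (use F0 N0[OF N] in \<open>auto intro: less_imp_le\<close>)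
    qed simp
    then show "dist (infsum g (B N)) (infsum g UNIV) < e" using e by simp
  qed
qed

text \<open>A sum over monomials factorises over the modes. Monomials in the first N modes
  correspond to functions on \<open>{..<N}\<close>, for which this is a product of N series; the
  uniform bound C gives absolute summability and lets N tend to infinity.\<close>

lemma has_sum_poly_mapping_prod:
  fixes f :: "nat \<Rightarrow> nat \<Rightarrow> complex"
  assumes A: "finite A" "\<And>i. i \<notin> A \<Longrightarrow> f i 0 = 1"
    and s: "\<And>i. (f i has_sum a i) UNIV"
    and bd: "\<And>N. (\<Prod>i<N. \<Sum>\<^sub>\<infinity>k. norm (f i k)) \<le> C"
    and lim: "(\<lambda>N. \<Prod>i<N. a i) \<longlonglongrightarrow> P"
  shows "((\<lambda>\<nu>. \<Prod>i\<in>A \<union> Poly_Mapping.keys \<nu>. f i (Poly_Mapping.lookup \<nu> i)) has_sum P) UNIV"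
proof -
  define g where "g \<nu> = (\<Prod>i\<in>A \<union> Poly_Mapping.keys \<nu>. f i (Poly_Mapping.lookup \<nu> i))" for \<nu> :: "nat \<Rightarrow>\<^sub>0 nat"
  define B where "B N = {\<nu> :: nat \<Rightarrow>\<^sub>0 nat. Poly_Mapping.keys \<nu> \<subseteq> {..<N}}" for N
  have abs: "(\<lambda>k. norm (f i k)) summable_on UNIV" for i
    using s[of i] summable_on_iff_abs_summable_on_complex has_sum_imp_summable by blast
  obtain N0 where N0: "A \<subseteq> {..<N0}"
    using finite_nat_iff_bounded[THEN iffD1, OF A(1)] by auto
  have gB: "g \<nu> = (\<Prod>i<N. f i (Poly_Mapping.lookup \<nu> i))" if "\<nu> \<in> B N" "N \<ge> N0" for \<nu> N
    unfolding g_def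
  proof (rule prod.mono_neutral_left)
    show "A \<union> Poly_Mapping.keys \<nu> \<subseteq> {..<N}" using that N0 by (auto simp: B_def)
    show "\<forall>i\<in>{..<N} - (A \<union> Poly_Mapping.keys \<nu>). f i (Poly_Mapping.lookup \<nu> i) = 1"
      using A(2) by (auto simp: in_keys_iff)
  qed simp
  have bij: "bij_betw (\<lambda>\<nu>. restrict (Poly_Mapping.lookup \<nu>) {..<N}) (B N) (PiE {..<N} (\<lambda>_. UNIV))" for N
  proof -
    define Q where "Q h = Abs_poly_mapping (\<lambda>i. if i < N then h i else (0::nat))" for h
    have lk: "Poly_Mapping.lookup (Q h) i = (if i < N then h i else 0)" for h i
    proof -
      have "finite {i. (if i < N then h i else 0) \<noteq> (0::nat)}"
        by (rule finite_subset[of _ "{..<N}"]) auto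
      then show ?thesis unfolding Q_def by (subst Abs_poly_mapping_inverse) (simp_all only: mem_Collect_eq)
    qed
    have Q: "Q h \<in> B N" for h
    proof -
      have "i < N" if "i \<in> Poly_Mapping.keys (Q h)" for i
      proof (rule ccontr)
        assume "\<not> i < N"
        then have "Poly_Mapping.lookup (Q h) i = 0" unfolding lk by simp
        then show False using that by (simp add: in_keys_iff)
      qed
      then show ?thesis unfolding B_def by blast
    qed
    show ?thesis
    proof (rule bij_betwI[where g = Q])
      show "Q (restrict (Poly_Mapping.lookup \<nu>) {..<N}) = \<nu>" if "\<nu> \<in> B N" for \<nu>
      proof (rule poly_mapping_eqI)
        fix i
        have "i \<notin> Poly_Mapping.keys \<nu>" if "\<not> i < N" using \<open>\<nu> \<in> B N\<close> that unfolding B_def by blast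
        then show "Poly_Mapping.lookup (Q (restrict (Poly_Mapping.lookup \<nu>) {..<N})) i = Poly_Mapping.lookup \<nu> i"
          unfolding lk by (simp add: in_keys_iff)
      qed
      show "restrict (Poly_Mapping.lookup (Q h)) {..<N} = h" if "h \<in> PiE {..<N} (\<lambda>_. UNIV)" for h
      proof
        fix i show "restrict (Poly_Mapping.lookup (Q h)) {..<N} i = h i"
          using PiE_arb[OF that, of i] by (simp add: lk)
      qed
      show "(\<lambda>\<nu>. restrict (Poly_Mapping.lookup \<nu>) {..<N}) \<in> B N \<rightarrow> PiE {..<N} (\<lambda>_. UNIV)" by simp
      show "Q \<in> PiE {..<N} (\<lambda>_. UNIV) \<rightarrow> B N" using Q by blast
    qed
  qed
  have BI: "\<forall>\<^sub>F N in sequentially. F \<subseteq> B N \<and> N \<ge> N0" if "finite F" for F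
  proof -
    have "finite (\<Union>\<nu>\<in>F. Poly_Mapping.keys \<nu>)" using that by simp
    then obtain n where "(\<Union>\<nu>\<in>F. Poly_Mapping.keys \<nu>) \<subseteq> {..<n}" using finite_nat_iff_bounded by blast
    then have "F \<subseteq> B N \<and> N \<ge> N0" if "N \<ge> max n N0" for N
      using that by (fastforce simp: B_def)
    then show ?thesis unfolding eventually_sequentially by blast
  qed
  have "(\<lambda>\<nu>. norm (g \<nu>)) summable_on UNIV"
    unfolding abs_summable_iff_bdd_above
  proof (rule bdd_aboveI2)
    fix F :: "(nat \<Rightarrow>\<^sub>0 nat) set" assume "F \<in> {F. F \<subseteq> UNIV \<and> finite F}"
    then have F: "finite F" by simp
    obtain N where N: "F \<subseteq> B N" "N \<ge> N0" using BI[OF F] by (auto simp: eventually_sequentially)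
    let ?R = "\<lambda>\<nu>. restrict (Poly_Mapping.lookup \<nu>) {..<N}"
    obtain K where K: "(\<Union>\<nu>\<in>F. Poly_Mapping.lookup \<nu> ` {..<N}) \<subseteq> {..<K}"
      using finite_nat_iff_bounded[THEN iffD1, of "\<Union>\<nu>\<in>F. Poly_Mapping.lookup \<nu> ` {..<N}"] F by auto
    have inj: "inj_on ?R F" using bij[of N] N(1) inj_on_subset by (auto simp: bij_betw_def)
    have "(\<Sum>\<nu>\<in>F. norm (g \<nu>)) = (\<Sum>\<nu>\<in>F. \<Prod>i<N. norm (f i (?R \<nu> i)))"
    proof (intro sum.cong refl)
      fix \<nu> assume "\<nu> \<in> F"
      then show "norm (g \<nu>) = (\<Prod>i<N. norm (f i (?R \<nu> i)))" using gB[of \<nu> N] N by (auto simp: prod_norm)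
    qed
    also have "\<dots> = (\<Sum>h\<in>?R ` F. \<Prod>i<N. norm (f i (h i)))"
      by (simp add: sum.reindex[OF inj] o_def)
    also have "\<dots> \<le> (\<Sum>h\<in>PiE {..<N} (\<lambda>_. {..<K}). \<Prod>i<N. norm (f i (h i)))"
    proof (rule sum_mono2)
      show "finite (PiE {..<N} (\<lambda>_. {..<K}))" by (intro finite_PiE) auto
      show "?R ` F \<subseteq> PiE {..<N} (\<lambda>_. {..<K})" using K by (fastforce simp: PiE_def)
    qed (auto intro: prod_nonneg)
    also have "\<dots> = (\<Prod>i<N. \<Sum>k<K. norm (f i k))"
      by (simp add: prod_sum_PiE)
    also have "\<dots> \<le> (\<Prod>i<N. \<Sum>\<^sub>\<infinity>k. norm (f i k))"
      by (intro prod_mono conjI sum_nonneg finite_sum_le_infsum abs) auto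
    also have "\<dots> \<le> C" by (rule bd)
    finally show "(\<Sum>\<nu>\<in>F. norm (g \<nu>)) \<le> C" .
  qed
  then have gs: "g summable_on UNIV" by (rule abs_summable_summable)
  have "(\<lambda>N. infsum g (B N)) \<longlonglongrightarrow> infsum g UNIV"
  proof (rule infsum_increasing_limit[OF gs])
    fix F :: "(nat \<Rightarrow>\<^sub>0 nat) set" assume "finite F"
    then show "\<forall>\<^sub>F N in sequentially. F \<subseteq> B N"
      by (rule eventually_mono[OF BI]) simp
  qed
  moreover have "infsum g (B N) = (\<Prod>i<N. a i)" if "N \<ge> N0" for N
  proof -
    have "infsum g (B N) = infsum (\<lambda>\<nu>. \<Prod>i<N. f i (restrict (Poly_Mapping.lookup \<nu>) {..<N} i)) (B N)"
      by (intro infsum_cong) (use gB that in auto)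
    also have "\<dots> = infsum (\<lambda>h. \<Prod>i<N. f i (h i)) (PiE {..<N} (\<lambda>_. UNIV))"
      by (rule infsum_reindex_bij_betw[OF bij])
    also have "\<dots> = (\<Prod>i<N. infsum (f i) UNIV)"
      by (rule infsum_prod_PiE_abs) (use abs in auto)
    also have "\<dots> = (\<Prod>i<N. a i)" by (intro prod.cong refl infsumI s)
    finally show ?thesis .
  qed
  then have "\<forall>\<^sub>F N in sequentially. (\<Prod>i<N. a i) = infsum g (B N)"
    unfolding eventually_sequentially by (intro exI[of _ N0]) simp
  then have "(\<lambda>N. infsum g (B N)) \<longlonglongrightarrow> P"
    by (rule Lim_transform_eventually[OF lim])
  ultimately have "infsum g UNIV = P" by (rule LIMSEQ_unique)
  then have "(g has_sum P) UNIV" using has_sum_infsum[OF gs] by simp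
  then show ?thesis unfolding g_def[abs_def] .
qed

text \<open>
  The coefficient of the monomial \<open>\<mu>\<close> in \<open>exp (\<Sum>i. S i a\<^sub>i) (\<Prod>i. (a\<^sub>i + t i) ^ \<pi> i)\<close>.
\<close>

definition mono_coeff :: "(nat \<Rightarrow> complex) \<Rightarrow> (nat \<Rightarrow> complex) \<Rightarrow> mono \<Rightarrow> mono \<Rightarrow> complex" where
  "mono_coeff S t \<pi> \<mu> = (\<Prod>i\<in>Poly_Mapping.keys \<pi> \<union> Poly_Mapping.keys \<mu>.
     mode_coeff (S i) (t i) (Poly_Mapping.lookup \<pi> i) (Poly_Mapping.lookup \<mu> i))"

lemma mono_coeff_superset:
  assumes "finite A" "Poly_Mapping.keys \<pi> \<union> Poly_Mapping.keys \<mu> \<subseteq> A"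
  shows "mono_coeff S t \<pi> \<mu> = (\<Prod>i\<in>A. mode_coeff (S i) (t i) (Poly_Mapping.lookup \<pi> i) (Poly_Mapping.lookup \<mu> i))"
  unfolding mono_coeff_def
  by (rule prod.mono_neutral_left) (use assms in \<open>auto simp: in_keys_iff\<close>)

text \<open>Normal ordering for all modes at once. Outside the finite set of modes occupied in \<pi>
  or \<mu> a mode contributes only its exponential series, so summability of the S i t' i controls
  the infinite product.\<close>

lemma mono_coeff_sum:
  assumes w: "summable (\<lambda>i. norm (S i * t' i))"
  shows "((\<lambda>\<nu>. mono_coeff s t' \<nu> \<mu> * mono_coeff S t \<pi> \<nu>) has_sum
    (exp (suminf (\<lambda>i. S i * t' i)) * mono_coeff (\<lambda>i. S i + s i) (\<lambda>i. t i + t' i) \<pi> \<mu>)) UNIV"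
proof -
  let ?l = Poly_Mapping.lookup
  define A where "A = Poly_Mapping.keys \<mu> \<union> Poly_Mapping.keys \<pi>"
  have A: "finite A" by (simp add: A_def)
  define f where "f i k = mode_coeff (s i) (t' i) k (?l \<mu> i) * mode_coeff (S i) (t i) (?l \<pi> i) k" for i k
  define m where "m i = mode_coeff (S i + s i) (t i + t' i) (?l \<pi> i) (?l \<mu> i)" for i
  have fA: "f i k = (S i * t' i) ^ k / fact k" if "i \<notin> A" for i k
    using that by (simp add: f_def A_def in_keys_iff mode_coeff_0_right power_mult_distrib mult.commute)
  have eq: "mono_coeff s t' \<nu> \<mu> * mono_coeff S t \<pi> \<nu> = (\<Prod>i\<in>A \<union> Poly_Mapping.keys \<nu>. f i (?l \<nu> i))" for \<nu>
    unfolding f_def prod.distrib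
    by (subst (1 2) mono_coeff_superset[where A="A \<union> Poly_Mapping.keys \<nu>"]) (auto simp: A_def)
  obtain N0 where N0: "A \<subseteq> {..<N0}" using finite_nat_iff_bounded[THEN iffD1, OF A] by auto
  have mprod: "(\<Prod>i<N. m i) = mono_coeff (\<lambda>i. S i + s i) (\<lambda>i. t i + t' i) \<pi> \<mu>" if "N \<ge> N0" for N
    unfolding m_def by (rule mono_coeff_superset[symmetric]) (use that N0 in \<open>auto simp: A_def\<close>)
  have hs: "(f i has_sum exp (S i * t' i) * m i) UNIV" for i
    unfolding f_def m_def by (rule mode_sum)
  define nb where "nb i = (\<Sum>\<^sub>\<infinity>k. norm (f i k))" for i
  have nbA: "nb i = exp (norm (S i * t' i))" if "i \<notin> A" for i
  proof -
    have "((\<lambda>k. of_real (norm (f i k)) :: complex) has_sum exp (of_real (norm (S i * t' i)))) UNIV"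
      using exp_has_sum[of "of_real (norm (S i * t' i))"] by (simp add: fA[OF that] norm_divide norm_power norm_mult)
    then have "((\<lambda>k. of_real (norm (f i k)) :: complex) has_sum of_real (exp (norm (S i * t' i)))) UNIV"
      by (simp only: exp_of_real)
    then have "((\<lambda>k. norm (f i k)) has_sum exp (norm (S i * t' i))) UNIV"
      by (simp only: has_sum_of_real_iff)
    then show ?thesis by (simp add: nb_def infsumI)
  qed
  have nb0: "nb i \<ge> 0" for i unfolding nb_def by (intro infsum_nonneg) auto
  \<comment> \<open>The finitely many modes in A are bounded separately; outside A the norms of the
    series add up to exp (norm (S i t' i)).\<close>
  define C where "C = (\<Prod>i\<in>A. max 1 (nb i)) * exp (suminf (\<lambda>i. norm (S i * t' i)))"
  have bd: "(\<Prod>i<N. nb i) \<le> C" for N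
  proof -
    have "(\<Prod>i<N. nb i) \<le> (\<Prod>i<N. (if i \<in> A then max 1 (nb i) else 1) * exp (norm (S i * t' i)))"
    proof (intro prod_mono conjI nb0)
      fix i
      have "max 1 (nb i) * 1 \<le> max 1 (nb i) * exp (norm (S i * t' i))"
        by (intro mult_left_mono) auto
      then show "nb i \<le> (if i \<in> A then max 1 (nb i) else 1) * exp (norm (S i * t' i))"
        by (auto simp: nbA)
    qed
    also have "\<dots> = (\<Prod>i<N. if i \<in> A then max 1 (nb i) else 1) * exp (\<Sum>i<N. norm (S i * t' i))"
      by (simp add: prod.distrib exp_sum)
    also have "(\<Prod>i<N. if i \<in> A then max 1 (nb i) else 1) = (\<Prod>i\<in>{..<N} \<inter> A. max 1 (nb i))"
      by (simp add: prod.inter_restrict)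
    also have "\<dots> * exp (\<Sum>i<N. norm (S i * t' i)) \<le> C"
      unfolding C_def
    proof (intro mult_mono)
      show "(\<Prod>i\<in>{..<N} \<inter> A. max 1 (nb i)) \<le> (\<Prod>i\<in>A. max 1 (nb i))"
        by (rule prod_mono2) (use A in auto)
      show "exp (\<Sum>i<N. norm (S i * t' i)) \<le> exp (suminf (\<lambda>i. norm (S i * t' i)))"
        using w by (simp add: sum_le_suminf)
    qed (auto intro!: prod_nonneg)
    finally show ?thesis .
  qed
  have "(\<lambda>N. exp (\<Sum>i<N. S i * t' i)) \<longlonglongrightarrow> exp (suminf (\<lambda>i. S i * t' i))"
    by (rule tendsto_exp[OF summable_LIMSEQ[OF summable_norm_cancel[OF w]]])
  then have "(\<lambda>N. exp (\<Sum>i<N. S i * t' i) * mono_coeff (\<lambda>i. S i + s i) (\<lambda>i. t i + t' i) \<pi> \<mu>) \<longlonglongrightarrow>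
     exp (suminf (\<lambda>i. S i * t' i)) * mono_coeff (\<lambda>i. S i + s i) (\<lambda>i. t i + t' i) \<pi> \<mu>"
    by (rule tendsto_mult_right)
  moreover have "\<forall>\<^sub>F N in sequentially. exp (\<Sum>i<N. S i * t' i) * mono_coeff (\<lambda>i. S i + s i) (\<lambda>i. t i + t' i) \<pi> \<mu>
      = (\<Prod>i<N. exp (S i * t' i) * m i)"
    unfolding eventually_sequentially
    by (intro exI[of _ N0] allI impI) (simp add: prod.distrib exp_sum mprod)
  ultimately have lim: "(\<lambda>N. \<Prod>i<N. exp (S i * t' i) * m i) \<longlonglongrightarrow>
     exp (suminf (\<lambda>i. S i * t' i)) * mono_coeff (\<lambda>i. S i + s i) (\<lambda>i. t i + t' i) \<pi> \<mu>"
    by (rule Lim_transform_eventually)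
  show ?thesis unfolding eq
    by (rule has_sum_poly_mapping_prod[OF A _ hs _ lim, of C])
       (use bd fA in \<open>auto simp: nb_def\<close>)
qed

section \<open>Matrix elements of the current\<close>

text \<open>The number of oscillators, not weighted by their mode. A creation or annihilation sum
  changes it by exactly one, so a given matrix element receives only one power from the exponential
  series.\<close>

definition mono_deg :: "mono \<Rightarrow> nat" where
  "mono_deg \<mu> = (\<Sum>i\<in>Poly_Mapping.keys \<mu>. Poly_Mapping.lookup \<mu> i)"

lemma mono_deg_superset:
  assumes "finite A" "Poly_Mapping.keys \<mu> \<subseteq> A"
  shows "mono_deg \<mu> = (\<Sum>i\<in>A. Poly_Mapping.lookup \<mu> i)"
  unfolding mono_deg_def by (rule sum.mono_neutral_left) (use assms in \<open>auto simp: in_keys_iff\<close>)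

lemma mono_deg_add_single: "mono_deg (\<mu> + Poly_Mapping.single i 1) = Suc (mono_deg \<mu>)"
proof -
  let ?A = "insert i (Poly_Mapping.keys \<mu>)"
  have k: "Poly_Mapping.keys (\<mu> + Poly_Mapping.single i 1) \<subseteq> ?A"
    using Poly_Mapping.keys_add[of \<mu> "Poly_Mapping.single i 1"] by (auto split: if_splits)
  have "mono_deg (\<mu> + Poly_Mapping.single i 1) = (\<Sum>j\<in>?A. Poly_Mapping.lookup \<mu> j + (if j = i then 1 else 0))"
    by (subst mono_deg_superset[OF _ k]) (auto simp: lookup_add lookup_single when_def intro!: sum.cong)
  also have "\<dots> = mono_deg \<mu> + 1"
    unfolding sum.distrib by (subst mono_deg_superset[of ?A]) auto
  finally show ?thesis by simp
qed

lemma minus_single_add: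
  assumes "Poly_Mapping.lookup \<mu> i > 0"
  shows "(\<mu> - Poly_Mapping.single i 1) + Poly_Mapping.single i 1 = (\<mu> :: mono)"
  by (rule poly_mapping_eqI) (use assms in \<open>auto simp: lookup_add lookup_minus lookup_single when_def\<close>)

lemma mono_deg_minus_single:
  "Poly_Mapping.lookup \<mu> i > 0 \<Longrightarrow> Suc (mono_deg (\<mu> - Poly_Mapping.single i 1)) = mono_deg \<mu>"
  using mono_deg_add_single[of "\<mu> - Poly_Mapping.single i 1" i] minus_single_add[of \<mu> i] by simp

definition mono_le :: "mono \<Rightarrow> mono \<Rightarrow> bool" where
  "mono_le \<kappa> \<mu> \<longleftrightarrow> (\<forall>i. Poly_Mapping.lookup \<kappa> i \<le> Poly_Mapping.lookup \<mu> i)"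

lemma mono_le_keys: "mono_le \<kappa> \<mu> \<Longrightarrow> Poly_Mapping.keys \<kappa> \<subseteq> Poly_Mapping.keys \<mu>"
proof
  fix i assume "mono_le \<kappa> \<mu>" "i \<in> Poly_Mapping.keys \<kappa>"
  then have "Poly_Mapping.lookup \<kappa> i \<noteq> 0" "Poly_Mapping.lookup \<kappa> i \<le> Poly_Mapping.lookup \<mu> i"
    by (simp_all add: in_keys_iff mono_le_def)
  then show "i \<in> Poly_Mapping.keys \<mu>" by (simp add: in_keys_iff)
qed

lemma mono_deg_diff:
  assumes "mono_le \<kappa> \<mu>"
  shows "mono_deg \<mu> - mono_deg \<kappa> = (\<Sum>i\<in>Poly_Mapping.keys \<mu>. Poly_Mapping.lookup \<mu> i - Poly_Mapping.lookup \<kappa> i)"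
    and "mono_deg \<kappa> \<le> mono_deg \<mu>"
proof -
  have e: "mono_deg \<kappa> = (\<Sum>i\<in>Poly_Mapping.keys \<mu>. Poly_Mapping.lookup \<kappa> i)"
    by (rule mono_deg_superset) (use mono_le_keys[OF assms] in auto)
  show "mono_deg \<mu> - mono_deg \<kappa> = (\<Sum>i\<in>Poly_Mapping.keys \<mu>. Poly_Mapping.lookup \<mu> i - Poly_Mapping.lookup \<kappa> i)"
    unfolding e mono_deg_def[of \<mu>] using assms by (subst sum_subtractf_nat) (auto simp: mono_le_def)
  show "mono_deg \<kappa> \<le> mono_deg \<mu>"
    unfolding e mono_deg_def[of \<mu>] using assms by (intro sum_mono) (auto simp: mono_le_def)
qed

lemma mono_le_deg_eq:
  assumes "mono_le \<kappa> \<mu>" "mono_deg \<kappa> = mono_deg \<mu>"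
  shows "\<kappa> = \<mu>"
proof (rule poly_mapping_eqI)
  fix i
  have "(\<Sum>i\<in>Poly_Mapping.keys \<mu>. Poly_Mapping.lookup \<mu> i - Poly_Mapping.lookup \<kappa> i) = 0"
    using mono_deg_diff(1)[OF assms(1)] assms(2) by simp
  then have *: "\<forall>i\<in>Poly_Mapping.keys \<mu>. Poly_Mapping.lookup \<mu> i \<le> Poly_Mapping.lookup \<kappa> i" by simp
  show "Poly_Mapping.lookup \<kappa> i = Poly_Mapping.lookup \<mu> i"
  proof (cases "i \<in> Poly_Mapping.keys \<mu>")
    case True then show ?thesis using * assms(1) by (simp add: mono_le_def le_antisym)
  next
    case False
    then have "Poly_Mapping.lookup \<mu> i = 0" by (simp add: in_keys_iff)
    then show ?thesis using assms(1) unfolding mono_le_def by (metis le_zero_eq)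
  qed
qed

lemma finite_mono_le: "finite {\<kappa>. mono_le \<kappa> \<mu>}"
proof (rule inj_on_finite)
  let ?R = "\<lambda>\<kappa>. restrict (Poly_Mapping.lookup \<kappa>) (Poly_Mapping.keys \<mu>)"
  show "inj_on ?R {\<kappa>. mono_le \<kappa> \<mu>}"
  proof (rule inj_onI)
    fix \<kappa> \<nu> assume kn: "\<kappa> \<in> {\<kappa>. mono_le \<kappa> \<mu>}" "\<nu> \<in> {\<kappa>. mono_le \<kappa> \<mu>}" "?R \<kappa> = ?R \<nu>"
    show "\<kappa> = \<nu>"
    proof (rule poly_mapping_eqI)
      fix i
      show "Poly_Mapping.lookup \<kappa> i = Poly_Mapping.lookup \<nu> i"
      proof (cases "i \<in> Poly_Mapping.keys \<mu>")
        case True then show ?thesis using fun_cong[OF kn(3), of i] by simp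
      next
        case False
        then have "i \<notin> Poly_Mapping.keys \<kappa>" "i \<notin> Poly_Mapping.keys \<nu>" using kn mono_le_keys by blast+
        then show ?thesis by (simp add: in_keys_iff)
      qed
    qed
  qed
  show "?R ` {\<kappa>. mono_le \<kappa> \<mu>} \<subseteq> PiE (Poly_Mapping.keys \<mu>) (\<lambda>i. {..Poly_Mapping.lookup \<mu> i})"
    by (auto simp: mono_le_def)
  show "finite (PiE (Poly_Mapping.keys \<mu>) (\<lambda>i. {..Poly_Mapping.lookup \<mu> i}))"
    by (intro finite_PiE) auto
qed

lemma mono_coeff_S0_eq_0: "\<not> mono_le \<kappa> \<nu> \<Longrightarrow> mono_coeff (\<lambda>_. 0) t \<nu> \<kappa> = 0"
proof -
  assume "\<not> mono_le \<kappa> \<nu>"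
  then obtain i where i: "Poly_Mapping.lookup \<nu> i < Poly_Mapping.lookup \<kappa> i" by (auto simp: mono_le_def not_le)
  then have "i \<in> Poly_Mapping.keys \<nu> \<union> Poly_Mapping.keys \<kappa>" by (auto simp: in_keys_iff)
  moreover have "mode_coeff 0 (t i) (Poly_Mapping.lookup \<nu> i) (Poly_Mapping.lookup \<kappa> i) = 0"
    using i by (simp add: mode_coeff_S0)
  ultimately show ?thesis unfolding mono_coeff_def by (intro prod_zero) auto
qed

lemma mono_coeff_t0_eq_0: "\<not> mono_le \<kappa> \<mu> \<Longrightarrow> mono_coeff s (\<lambda>_. 0) \<kappa> \<mu> = 0"
proof -
  assume "\<not> mono_le \<kappa> \<mu>"
  then obtain i where i: "Poly_Mapping.lookup \<mu> i < Poly_Mapping.lookup \<kappa> i" by (auto simp: mono_le_def not_le)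
  then have "i \<in> Poly_Mapping.keys \<kappa> \<union> Poly_Mapping.keys \<mu>" by (auto simp: in_keys_iff)
  moreover have "mode_coeff (s i) 0 (Poly_Mapping.lookup \<kappa> i) (Poly_Mapping.lookup \<mu> i) = 0"
    using i by (simp add: mode_coeff_t0)
  ultimately show ?thesis unfolding mono_coeff_def by (intro prod_zero) auto
qed

lemma mono_coeff_annihilate:
  "t i * of_nat (Poly_Mapping.lookup \<kappa> i + 1) * mono_coeff (\<lambda>_. 0) t \<nu> (\<kappa> + Poly_Mapping.single i 1) =
   of_nat (Poly_Mapping.lookup \<nu> i - Poly_Mapping.lookup \<kappa> i) * mono_coeff (\<lambda>_. 0) t \<nu> \<kappa>"
proof -
  let ?l = Poly_Mapping.lookup
  let ?A = "insert i (Poly_Mapping.keys \<nu> \<union> Poly_Mapping.keys \<kappa>)"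
  have k: "Poly_Mapping.keys \<nu> \<union> Poly_Mapping.keys (\<kappa> + Poly_Mapping.single i 1) \<subseteq> ?A"
    using Poly_Mapping.keys_add[of \<kappa> "Poly_Mapping.single i 1"] by (auto split: if_splits)
  let ?r = "\<Prod>j\<in>?A - {i}. mode_coeff 0 (t j) (?l \<nu> j) (?l \<kappa> j)"
  have 1: "mono_coeff (\<lambda>_. 0) t \<nu> (\<kappa> + Poly_Mapping.single i 1) = mode_coeff 0 (t i) (?l \<nu> i) (Suc (?l \<kappa> i)) * ?r"
    by (subst mono_coeff_superset[OF _ k], simp, subst prod.remove[of _ i])
       (auto simp: lookup_add lookup_single when_def intro!: prod.cong)
  have 2: "mono_coeff (\<lambda>_. 0) t \<nu> \<kappa> = mode_coeff 0 (t i) (?l \<nu> i) (?l \<kappa> i) * ?r"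
    by (subst mono_coeff_superset[of ?A], simp, blast, subst prod.remove[of _ i]) auto
  show ?thesis
    unfolding 1 2 using mode_coeff_annihilate[of "t i" "?l \<kappa> i" "?l \<nu> i"]
    by (simp only: mult.assoc[symmetric]) simp
qed

lemma mono_coeff_create:
  assumes "Poly_Mapping.lookup \<mu> i > 0"
  shows "s i * mono_coeff s (\<lambda>_. 0) \<kappa> (\<mu> - Poly_Mapping.single i 1) =
   of_nat (Poly_Mapping.lookup \<mu> i - Poly_Mapping.lookup \<kappa> i) * mono_coeff s (\<lambda>_. 0) \<kappa> \<mu>"
proof -
  let ?l = Poly_Mapping.lookup
  let ?A = "insert i (Poly_Mapping.keys \<kappa> \<union> Poly_Mapping.keys \<mu>)"
  have k: "Poly_Mapping.keys \<kappa> \<union> Poly_Mapping.keys (\<mu> - Poly_Mapping.single i 1) \<subseteq> ?A"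
    by (auto simp: in_keys_iff lookup_minus)
  let ?r = "\<Prod>j\<in>?A - {i}. mode_coeff (s j) 0 (?l \<kappa> j) (?l \<mu> j)"
  have 1: "mono_coeff s (\<lambda>_. 0) \<kappa> (\<mu> - Poly_Mapping.single i 1) = mode_coeff (s i) 0 (?l \<kappa> i) (?l \<mu> i - 1) * ?r"
    by (subst mono_coeff_superset[OF _ k], simp, subst prod.remove[of _ i])
       (auto simp: lookup_minus lookup_single when_def intro!: prod.cong)
  have 2: "mono_coeff s (\<lambda>_. 0) \<kappa> \<mu> = mode_coeff (s i) 0 (?l \<kappa> i) (?l \<mu> i) * ?r"
    by (subst mono_coeff_superset[of ?A], simp, blast, subst prod.remove[of _ i]) auto
  show ?thesis
    unfolding 1 2 mult.assoc[symmetric] mode_coeff_create[OF assms] ..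
qed

lemma mono_coeff_00: "mono_coeff (\<lambda>_. 0) (\<lambda>_. 0) \<pi> \<mu> = (if \<mu> = \<pi> then 1 else 0)"
proof (cases "\<mu> = \<pi>")
  case True
  then show ?thesis by (simp add: mono_coeff_def mode_coeff_t0)
next
  case False
  then have "mono_coeff (\<lambda>_. 0) (\<lambda>_. 0) \<pi> \<mu> = 0"
    using mono_coeff_S0_eq_0[of \<mu> \<pi> "\<lambda>_. 0"] mono_coeff_t0_eq_0[of \<pi> \<mu> "\<lambda>_. 0"]
    unfolding mono_le_def by (metis le_antisym poly_mapping_eqI)
  then show ?thesis using False by simp
qed

text \<open>In the exponent of \<open>xplus\<close> the mode n = - (i + 1) has the coefficient - 1 /
  [n] = 1 / [i + 1]: the minus sign is absorbed by the oddness of \<open>qnum\<close>.\<close>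

definition creation_coeff :: "real \<Rightarrow> complex \<Rightarrow> nat \<Rightarrow> complex" where
  "creation_coeff x u i = zpow x u (of_nat (Suc i)) / of_real (qnum x (of_nat (Suc i)))"

text \<open>For n = i + 1 the operator \<open>alpha\<close> is a multiple of a derivative, so its
  exponential translates the variable of mode i. This is the amount of the translation, which
  therefore contains \<open>osc_coeff\<close>.\<close>

definition annihilation_coeff :: "nat \<Rightarrow> real \<Rightarrow> complex \<Rightarrow> nat \<Rightarrow> complex" where
  "annihilation_coeff L x u i =
     - (of_real (osc_coeff L x (int (Suc i))) / of_real (qnum x (of_nat (Suc i))) * zpow x u (- of_nat (Suc i)))"

lemma qnum_minus: "qnum x (- a) = - qnum x a"
  by (simp add: qnum_def minus_divide_left)

lemma osc_sum_negative:
  "osc_sum L x {..<0} u \<phi> \<mu> = (\<Sum>i\<in>Poly_Mapping.keys \<mu>. creation_coeff x u i * \<phi> (\<mu> - Poly_Mapping.single i 1))"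
proof -
  let ?g = "\<lambda>n. alpha L x n \<phi> \<mu> / of_real (qnum x (of_int n)) * zpow x u (- of_int n)"
  let ?j = "\<lambda>i. - int (Suc i)"
  have inj: "inj_on ?j (Poly_Mapping.keys \<mu>)" by (auto simp: inj_on_def)
  have "infsum ?g {..<0} = infsum ?g (?j ` Poly_Mapping.keys \<mu>)"
  proof (rule infsum_cong_neutral)
    fix n assume n: "n \<in> {..<0} - ?j ` Poly_Mapping.keys \<mu>"
    have "nat (- n) - 1 \<notin> Poly_Mapping.keys \<mu>"
    proof
      assume a: "nat (- n) - 1 \<in> Poly_Mapping.keys \<mu>"
      have "n = ?j (nat (- n) - 1)" using n by simp
      then show False using a n by blast
    qed
    then show "?g n = 0" using n by (simp add: alpha_def Let_def in_keys_iff)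
  qed auto
  also have "\<dots> = (\<Sum>i\<in>Poly_Mapping.keys \<mu>. ?g (?j i))"
    unfolding infsum_finite[OF finite_imageI[OF finite_keys]] by (rule sum.reindex[OF inj, unfolded o_def])
  also have "\<dots> = - (\<Sum>i\<in>Poly_Mapping.keys \<mu>. creation_coeff x u i * \<phi> (\<mu> - Poly_Mapping.single i 1))"
    unfolding sum_negf[symmetric]
  proof (intro sum.cong refl)
    fix i assume "i \<in> Poly_Mapping.keys \<mu>"
    then have k: "Poly_Mapping.lookup \<mu> i \<noteq> 0" by (simp add: in_keys_iff)
    have n: "nat (- ?j i) - 1 = i" by simp
    have a: "alpha L x (?j i) \<phi> \<mu> = \<phi> (\<mu> - Poly_Mapping.single i 1)"
      unfolding alpha_def Let_def n using k by simp
    have r: "real_of_int (?j i) = - of_nat (Suc i)" by simp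
    show "?g (?j i) = - (creation_coeff x u i * \<phi> (\<mu> - Poly_Mapping.single i 1))"
      unfolding a creation_coeff_def r qnum_minus by (simp add: add.commute)
  qed
  finally show ?thesis by (simp add: osc_sum_def)
qed

lemma osc_sum_positive:
  assumes A: "finite A" "\<And>i. i \<notin> A \<Longrightarrow> \<phi> (\<mu> + Poly_Mapping.single i 1) = 0"
  shows "osc_sum L x {0<..} u \<phi> \<mu> = (\<Sum>i\<in>A. annihilation_coeff L x u i *
    of_nat (Poly_Mapping.lookup \<mu> i + 1) * \<phi> (\<mu> + Poly_Mapping.single i 1))"
proof -
  let ?g = "\<lambda>n. alpha L x n \<phi> \<mu> / of_real (qnum x (of_int n)) * zpow x u (- of_int n)"
  let ?j = "\<lambda>i. int (Suc i)"
  have inj: "inj_on ?j A" by (auto simp: inj_on_def)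
  have "infsum ?g {0<..} = infsum ?g (?j ` A)"
  proof (rule infsum_cong_neutral)
    fix n assume n: "n \<in> {0<..} - ?j ` A"
    have "nat n - 1 \<notin> A"
    proof
      assume a: "nat n - 1 \<in> A"
      have "n = ?j (nat n - 1)" using n by simp
      then show False using a n by blast
    qed
    then have "\<phi> (\<mu> + Poly_Mapping.single (nat n - 1) 1) = 0" by (rule A(2))
    then show "?g n = 0" using n by (simp add: alpha_def Let_def)
  qed auto
  also have "\<dots> = (\<Sum>i\<in>A. ?g (?j i))"
    unfolding infsum_finite[OF finite_imageI[OF A(1)]] by (rule sum.reindex[OF inj, unfolded o_def])
  also have "\<dots> = - (\<Sum>i\<in>A. annihilation_coeff L x u i *
    of_nat (Poly_Mapping.lookup \<mu> i + 1) * \<phi> (\<mu> + Poly_Mapping.single i 1))"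
    unfolding sum_negf[symmetric]
  proof (intro sum.cong refl)
    fix i assume "i \<in> A"
    have n: "nat (?j i) - 1 = i" by simp
    have a: "alpha L x (?j i) \<phi> \<mu> = of_real (osc_coeff L x (?j i)) * of_nat (Poly_Mapping.lookup \<mu> i + 1) * \<phi> (\<mu> + Poly_Mapping.single i 1)"
      unfolding alpha_def Let_def n by simp
    have r: "real_of_int (?j i) = of_nat (Suc i)" by simp
    show "?g (?j i) = - (annihilation_coeff L x u i * of_nat (Poly_Mapping.lookup \<mu> i + 1) * \<phi> (\<mu> + Poly_Mapping.single i 1))"
      unfolding a annihilation_coeff_def r by (simp add: mult_ac)
  qed
  finally show ?thesis by (simp add: osc_sum_def)
qed

text \<open>The exponential of a derivation is a translation, and its part of order j consists of
  the matrix elements that remove j oscillators. In the induction the differences of occupation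
  numbers sum to j + 1, which turns j! into (j + 1)!.\<close>

lemma osc_power_positive:
  "(osc_sum L x {0<..} u ^^ j) (Poly_Mapping.lookup (Poly_Mapping.single \<nu> 1)) \<kappa> =
     (if mono_deg \<kappa> + j = mono_deg \<nu> then fact j * mono_coeff (\<lambda>_. 0) (annihilation_coeff L x u) \<nu> \<kappa> else 0)"
proof (induction j arbitrary: \<kappa>)
  case 0
  show ?case
  proof (cases "\<kappa> = \<nu>")
    case True
    then show ?thesis by (simp add: mono_coeff_def mode_coeff_S0)
  next
    case False
    have "mono_coeff (\<lambda>_. 0) (annihilation_coeff L x u) \<nu> \<kappa> = 0" if "mono_deg \<kappa> = mono_deg \<nu>"
      using mono_coeff_S0_eq_0[of \<kappa> \<nu>] mono_le_deg_eq[of \<kappa> \<nu>] that False by blast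
    then show ?thesis using False by (simp add: lookup_single when_def)
  qed
next
  case (Suc j)
  let ?t = "annihilation_coeff L x u" and ?l = Poly_Mapping.lookup
  let ?\<phi> = "(osc_sum L x {0<..} u ^^ j) (Poly_Mapping.lookup (Poly_Mapping.single \<nu> 1))"
  have out: "?\<phi> (\<kappa> + Poly_Mapping.single i 1) = 0" if "i \<notin> Poly_Mapping.keys \<nu>" for i
  proof -
    have "\<not> mono_le (\<kappa> + Poly_Mapping.single i 1) \<nu>"
    proof
      assume "mono_le (\<kappa> + Poly_Mapping.single i 1) \<nu>"
      then have "?l (\<kappa> + Poly_Mapping.single i 1) i \<le> ?l \<nu> i" unfolding mono_le_def by blast
      then show False using that by (simp add: lookup_add in_keys_iff)
    qed
    then show ?thesis unfolding Suc.IH by (simp add: mono_coeff_S0_eq_0)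
  qed
  have "(osc_sum L x {0<..} u ^^ Suc j) (?l (Poly_Mapping.single \<nu> 1)) \<kappa> = osc_sum L x {0<..} u ?\<phi> \<kappa>"
    by simp
  also have "\<dots> = (\<Sum>i\<in>Poly_Mapping.keys \<nu>. ?t i * of_nat (?l \<kappa> i + 1) * ?\<phi> (\<kappa> + Poly_Mapping.single i 1))"
    by (rule osc_sum_positive[where \<phi>="?\<phi>" and \<mu>=\<kappa>]) (use out in auto)
  also have "\<dots> = (\<Sum>i\<in>Poly_Mapping.keys \<nu>. (if mono_deg \<kappa> + Suc j = mono_deg \<nu> then fact j else 0) *
      (of_nat (?l \<nu> i - ?l \<kappa> i) * mono_coeff (\<lambda>_. 0) ?t \<nu> \<kappa>))"
    unfolding Suc.IH mono_deg_add_single mono_coeff_annihilate[symmetric]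
    by (intro sum.cong refl) (simp add: mult_ac)
  also have "\<dots> = (if mono_deg \<kappa> + Suc j = mono_deg \<nu> then fact j else 0) *
      (of_nat (\<Sum>i\<in>Poly_Mapping.keys \<nu>. ?l \<nu> i - ?l \<kappa> i) * mono_coeff (\<lambda>_. 0) ?t \<nu> \<kappa>)"
    by (simp add: sum_distrib_left sum_distrib_right)
  also have "\<dots> = (if mono_deg \<kappa> + Suc j = mono_deg \<nu> then fact (Suc j) * mono_coeff (\<lambda>_. 0) ?t \<nu> \<kappa> else 0)"
  proof (cases "mono_le \<kappa> \<nu> \<and> mono_deg \<kappa> + Suc j = mono_deg \<nu>")
    case True
    then have "mono_deg \<nu> - mono_deg \<kappa> = Suc j" by linarith
    then have "(\<Sum>i\<in>Poly_Mapping.keys \<nu>. ?l \<nu> i - ?l \<kappa> i) = Suc j"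
      using mono_deg_diff(1)[of \<kappa> \<nu>] True by simp
    then show ?thesis using True by (simp only: if_True fact_Suc of_nat_mult mult_ac simp_thms)
  next
    case False
    then show ?thesis using mono_coeff_S0_eq_0[of \<kappa> \<nu> ?t] by auto
  qed
  finally show ?case .
qed

lemma suminf_single_nz:
  fixes f :: "nat \<Rightarrow> complex"
  assumes "\<And>j. j \<noteq> d \<Longrightarrow> f j = 0"
  shows "suminf f = f d"
  using suminf_finite[of "{d}" f] assms by auto

lemma op_exp_positive:
  "op_exp (osc_sum L x {0<..} u) (Poly_Mapping.lookup (Poly_Mapping.single \<nu> 1)) =
     mono_coeff (\<lambda>_. 0) (annihilation_coeff L x u) \<nu>"
proof
  fix \<kappa>
  let ?c = "mono_coeff (\<lambda>_. 0) (annihilation_coeff L x u) \<nu> \<kappa>"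
  have "op_exp (osc_sum L x {0<..} u) (Poly_Mapping.lookup (Poly_Mapping.single \<nu> 1)) \<kappa> =
      suminf (\<lambda>j. if mono_deg \<kappa> + j = mono_deg \<nu> then ?c else 0)"
    unfolding op_exp_def osc_power_positive by (intro arg_cong[where f=suminf]) auto
  also have "\<dots> = ?c"
  proof (cases "mono_le \<kappa> \<nu>")
    case True
    then have "mono_deg \<kappa> \<le> mono_deg \<nu>" by (rule mono_deg_diff)
    then show ?thesis by (subst suminf_single_nz[of "mono_deg \<nu> - mono_deg \<kappa>"]) auto
  next
    case False
    then have "?c = 0" by (rule mono_coeff_S0_eq_0)
    then show ?thesis by (simp cong: if_cong)
  qed
  finally show "op_exp (osc_sum L x {0<..} u) (Poly_Mapping.lookup (Poly_Mapping.single \<nu> 1)) \<kappa> = ?c" .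
qed

text \<open>Creation operators reach \<mu> only from the monomials below it. These are finitely
  many, so \<phi> may be an arbitrary family of coefficients.\<close>

lemma osc_power_negative:
  "(osc_sum L x {..<0} u ^^ j) \<phi> \<mu> =
     (\<Sum>\<kappa> | mono_le \<kappa> \<mu>. (if mono_deg \<kappa> + j = mono_deg \<mu> then fact j else 0) *
        mono_coeff (creation_coeff x u) (\<lambda>_. 0) \<kappa> \<mu> * \<phi> \<kappa>)"
proof (induction j arbitrary: \<mu>)
  case 0
  have "(\<Sum>\<kappa> | mono_le \<kappa> \<mu>. (if mono_deg \<kappa> + 0 = mono_deg \<mu> then fact 0 else 0) *
        mono_coeff (creation_coeff x u) (\<lambda>_. 0) \<kappa> \<mu> * \<phi> \<kappa>) =
     (\<Sum>\<kappa>\<in>{\<mu>}. (if mono_deg \<kappa> + 0 = mono_deg \<mu> then fact 0 else 0) *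
        mono_coeff (creation_coeff x u) (\<lambda>_. 0) \<kappa> \<mu> * \<phi> \<kappa>)"
    by (rule sum.mono_neutral_right) (use mono_le_deg_eq in \<open>auto simp: finite_mono_le mono_le_def[of \<mu> \<mu>]\<close>)
  then show ?case by (simp add: mono_coeff_def mode_coeff_t0)
next
  case (Suc j)
  let ?s = "creation_coeff x u" and ?l = Poly_Mapping.lookup
  let ?\<phi> = "(osc_sum L x {..<0} u ^^ j) \<phi>"
  have step: "?s i * ?\<phi> (\<mu> - Poly_Mapping.single i 1) =
      (\<Sum>\<kappa> | mono_le \<kappa> \<mu>. (if mono_deg \<kappa> + Suc j = mono_deg \<mu> then fact j else 0) *
        (of_nat (?l \<mu> i - ?l \<kappa> i) * mono_coeff ?s (\<lambda>_. 0) \<kappa> \<mu>) * \<phi> \<kappa>)"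
    if "i \<in> Poly_Mapping.keys \<mu>" for i
  proof -
    have pos: "?l \<mu> i > 0" using that by (simp add: in_keys_iff)
    let ?\<mu> = "\<mu> - Poly_Mapping.single i 1"
    have le: "mono_le \<kappa> \<mu>" if "mono_le \<kappa> ?\<mu>" for \<kappa>
      unfolding mono_le_def
    proof
      fix k show "?l \<kappa> k \<le> ?l \<mu> k"
        using that[unfolded mono_le_def, rule_format, of k] by (simp add: lookup_minus)
    qed
    have "?s i * ?\<phi> ?\<mu> = (\<Sum>\<kappa> | mono_le \<kappa> ?\<mu>. (if mono_deg \<kappa> + j = mono_deg ?\<mu> then fact j else 0) *
        (?s i * mono_coeff ?s (\<lambda>_. 0) \<kappa> ?\<mu>) * \<phi> \<kappa>)"
      unfolding Suc.IH sum_distrib_left by (intro sum.cong refl) (simp add: mult_ac)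
    also have "\<dots> = (\<Sum>\<kappa> | mono_le \<kappa> \<mu>. (if mono_deg \<kappa> + j = mono_deg ?\<mu> then fact j else 0) *
        (?s i * mono_coeff ?s (\<lambda>_. 0) \<kappa> ?\<mu>) * \<phi> \<kappa>)"
      by (rule sum.mono_neutral_left) (use le mono_coeff_t0_eq_0 in \<open>auto simp: finite_mono_le\<close>)
    also have "\<dots> = (\<Sum>\<kappa> | mono_le \<kappa> \<mu>. (if mono_deg \<kappa> + Suc j = mono_deg \<mu> then fact j else 0) *
        (of_nat (?l \<mu> i - ?l \<kappa> i) * mono_coeff ?s (\<lambda>_. 0) \<kappa> \<mu>) * \<phi> \<kappa>)"
      unfolding mono_coeff_create[OF pos] using mono_deg_minus_single[OF pos] by (intro sum.cong refl) auto
    finally show ?thesis .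
  qed
  have "(osc_sum L x {..<0} u ^^ Suc j) \<phi> \<mu> = (\<Sum>i\<in>Poly_Mapping.keys \<mu>. ?s i * ?\<phi> (\<mu> - Poly_Mapping.single i 1))"
    by (simp add: osc_sum_negative)
  also have "\<dots> = (\<Sum>\<kappa> | mono_le \<kappa> \<mu>. \<Sum>i\<in>Poly_Mapping.keys \<mu>. (if mono_deg \<kappa> + Suc j = mono_deg \<mu> then fact j else 0) *
        (of_nat (?l \<mu> i - ?l \<kappa> i) * mono_coeff ?s (\<lambda>_. 0) \<kappa> \<mu>) * \<phi> \<kappa>)"
    by (subst sum.swap) (rule sum.cong[OF refl step])
  also have "\<dots> = (\<Sum>\<kappa> | mono_le \<kappa> \<mu>. (if mono_deg \<kappa> + Suc j = mono_deg \<mu> then fact (Suc j) else 0) *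
        mono_coeff ?s (\<lambda>_. 0) \<kappa> \<mu> * \<phi> \<kappa>)"
  proof (intro sum.cong refl)
    fix \<kappa> assume "\<kappa> \<in> {\<kappa>. mono_le \<kappa> \<mu>}"
    then have le: "mono_le \<kappa> \<mu>" by simp
    show "(\<Sum>i\<in>Poly_Mapping.keys \<mu>. (if mono_deg \<kappa> + Suc j = mono_deg \<mu> then fact j else 0) *
        (of_nat (?l \<mu> i - ?l \<kappa> i) * mono_coeff ?s (\<lambda>_. 0) \<kappa> \<mu>) * \<phi> \<kappa>) =
      (if mono_deg \<kappa> + Suc j = mono_deg \<mu> then fact (Suc j) else 0) * mono_coeff ?s (\<lambda>_. 0) \<kappa> \<mu> * \<phi> \<kappa>"
    proof (cases "mono_deg \<kappa> + Suc j = mono_deg \<mu>")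
      case True
      then have "mono_deg \<mu> - mono_deg \<kappa> = Suc j" by linarith
      then have "(\<Sum>i\<in>Poly_Mapping.keys \<mu>. ?l \<mu> i - ?l \<kappa> i) = Suc j"
        using mono_deg_diff(1)[OF le] by simp
      moreover have "(\<Sum>i\<in>Poly_Mapping.keys \<mu>. fact j *
          (of_nat (?l \<mu> i - ?l \<kappa> i) * mono_coeff ?s (\<lambda>_. 0) \<kappa> \<mu>) * \<phi> \<kappa>) =
        fact j * of_nat (\<Sum>i\<in>Poly_Mapping.keys \<mu>. ?l \<mu> i - ?l \<kappa> i) * mono_coeff ?s (\<lambda>_. 0) \<kappa> \<mu> * \<phi> \<kappa>"
        by (simp add: sum_distrib_left sum_distrib_right mult_ac)
      ultimately show ?thesis using True by (simp only: if_True fact_Suc of_nat_mult mult_ac simp_thms)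
    qed simp
  qed
  finally show ?case .
qed

lemma op_exp_negative:
  "op_exp (osc_sum L x {..<0} u) \<phi> \<mu> = (\<Sum>\<kappa> | mono_le \<kappa> \<mu>. mono_coeff (creation_coeff x u) (\<lambda>_. 0) \<kappa> \<mu> * \<phi> \<kappa>)"
proof -
  let ?m = "\<lambda>\<kappa>. mono_coeff (creation_coeff x u) (\<lambda>_. 0) \<kappa> \<mu> * \<phi> \<kappa>"
  have "op_exp (osc_sum L x {..<0} u) \<phi> \<mu> =
    suminf (\<lambda>j. \<Sum>\<kappa> | mono_le \<kappa> \<mu>. if mono_deg \<kappa> + j = mono_deg \<mu> then ?m \<kappa> else 0)"
    unfolding op_exp_def osc_power_negative sum_divide_distrib
    by (intro arg_cong[where f=suminf] ext sum.cong refl) auto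
  also have "\<dots> = (\<Sum>\<kappa> | mono_le \<kappa> \<mu>. suminf (\<lambda>j. if mono_deg \<kappa> + j = mono_deg \<mu> then ?m \<kappa> else 0))"
  proof (rule suminf_sum)
    fix \<kappa>
    have "finite {j. mono_deg \<kappa> + j = mono_deg \<mu>}" by (rule finite_subset[of _ "{mono_deg \<mu> - mono_deg \<kappa>}"]) auto
    then show "summable (\<lambda>j. if mono_deg \<kappa> + j = mono_deg \<mu> then ?m \<kappa> else 0)"
      by (rule summable_finite) auto
  qed
  also have "\<dots> = (\<Sum>\<kappa> | mono_le \<kappa> \<mu>. ?m \<kappa>)"
  proof (intro sum.cong refl)
    fix \<kappa> assume "\<kappa> \<in> {\<kappa>. mono_le \<kappa> \<mu>}"
    then have "mono_deg \<kappa> \<le> mono_deg \<mu>" using mono_deg_diff(2) by simp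
    then show "suminf (\<lambda>j. if mono_deg \<kappa> + j = mono_deg \<mu> then ?m \<kappa> else 0) = ?m \<kappa>"
      by (subst suminf_single_nz[of "mono_deg \<mu> - mono_deg \<kappa>"]) auto
  qed
  finally show ?thesis .
qed

text \<open>Within one current the annihilation part stands on the right, so composing the two
  exponentials is the case S = 0, t' = 0 of \<open>mono_coeff_sum\<close> and produces no
  contraction.\<close>

lemma xplus_single:
  "xplus L x l k u (Poly_Mapping.single \<nu> 1) \<mu> =
     mono_coeff (creation_coeff x u) (annihilation_coeff L x u) \<nu> \<mu> *
     zpow x u (sqrt (rpar L / (rpar L - 1)) * momentum L l k + rpar L / (2 * (rpar L - 1)))"
proof -
  let ?s = "creation_coeff x u" and ?t = "annihilation_coeff L x u"
  have "((\<lambda>\<kappa>. mono_coeff ?s (\<lambda>_. 0) \<kappa> \<mu> * mono_coeff (\<lambda>_. 0) ?t \<nu> \<kappa>) has_sum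
      (exp (suminf (\<lambda>i. 0 * 0)) * mono_coeff (\<lambda>i. 0 + ?s i) (\<lambda>i. ?t i + 0) \<nu> \<mu>)) UNIV"
    by (rule mono_coeff_sum[where S="\<lambda>_. 0" and t'="\<lambda>_. 0"]) simp
  then have 1: "((\<lambda>\<kappa>. mono_coeff ?s (\<lambda>_. 0) \<kappa> \<mu> * mono_coeff (\<lambda>_. 0) ?t \<nu> \<kappa>) has_sum mono_coeff ?s ?t \<nu> \<mu>) UNIV"
    by simp
  have "((\<lambda>\<kappa>. mono_coeff ?s (\<lambda>_. 0) \<kappa> \<mu> * mono_coeff (\<lambda>_. 0) ?t \<nu> \<kappa>) has_sum mono_coeff ?s ?t \<nu> \<mu>) {\<kappa>. mono_le \<kappa> \<mu>}"
    by (rule has_sum_cong_neutral[THEN iffD1, OF _ _ _ 1]) (auto simp: mono_coeff_t0_eq_0)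
  then have "(\<Sum>\<kappa> | mono_le \<kappa> \<mu>. mono_coeff ?s (\<lambda>_. 0) \<kappa> \<mu> * mono_coeff (\<lambda>_. 0) ?t \<nu> \<kappa>) = mono_coeff ?s ?t \<nu> \<mu>"
    using infsumI infsum_finite[OF finite_mono_le] by metis
  then show ?thesis unfolding xplus_def op_exp_positive op_exp_negative by simp
qed

section \<open>Infinite products\<close>

locale nome =
  fixes p :: real
  assumes p: "0 < p" "p < 1"
begin

abbreviation (input) P :: complex where "P \<equiv> of_real p"

lemma norm_P_power: "norm (P ^ n * z) = p ^ n * norm z"
  using p by (simp add: norm_mult norm_power)

lemma qpoch_convergent: "convergent_prod (\<lambda>n. 1 - P ^ n * z)"
proof (rule abs_convergent_prod_imp_convergent_prod, rule summable_imp_abs_convergent_prod)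
  have "summable (\<lambda>n. p ^ n * norm z)" using p by (intro summable_mult2 summable_geometric) simp
  then show "summable (\<lambda>n. norm (1 - P ^ n * z - 1))"
    by (simp add: norm_P_power[symmetric])
qed

lemma qpoch_LIMSEQ: "(\<lambda>n. \<Prod>i<n. 1 - P ^ i * z) \<longlonglongrightarrow> qpoch P z"
  using convergent_prod_LIMSEQ[OF qpoch_convergent[of z]] unfolding qpoch_def
  by (simp add: LIMSEQ_lessThan_iff_atMost)

lemma qpoch_rec: "qpoch P z = (1 - z) * qpoch P (P * z)"
proof (rule LIMSEQ_unique)
  show "(\<lambda>n. \<Prod>i<Suc n. 1 - P ^ i * z) \<longlonglongrightarrow> qpoch P z"
    by (rule LIMSEQ_Suc[OF qpoch_LIMSEQ])
  have "(\<lambda>n. (1 - z) * (\<Prod>i<n. 1 - P ^ i * (P * z))) \<longlonglongrightarrow> (1 - z) * qpoch P (P * z)"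
    by (intro tendsto_mult_left qpoch_LIMSEQ)
  moreover have "(\<Prod>i<Suc n. 1 - P ^ i * z) = (1 - z) * (\<Prod>i<n. 1 - P ^ i * (P * z))" for n
    unfolding prod.lessThan_Suc_shift by (simp add: mult_ac)
  ultimately show "(\<lambda>n. \<Prod>i<Suc n. 1 - P ^ i * z) \<longlonglongrightarrow> (1 - z) * qpoch P (P * z)" by simp
qed

lemma qpoch_eq_0_iff: "qpoch P z = 0 \<longleftrightarrow> (\<exists>n. P ^ n * z = 1)"
proof
  assume "qpoch P z = 0"
  then show "\<exists>n. P ^ n * z = 1"
    using prodinf_nonzero[OF qpoch_convergent[of z]] by (auto simp: qpoch_def)
next
  assume "\<exists>n. P ^ n * z = 1"
  then obtain n where n: "1 - P ^ n * z = 0" by auto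
  show "qpoch P z = 0" unfolding qpoch_def
    by (rule has_prod_zeroI[OF convergent_prod_has_prod[OF qpoch_convergent] n])
qed

lemma qpoch_nonzero: "norm z < 1 \<Longrightarrow> qpoch P z \<noteq> 0"
proof
  assume z: "norm z < 1" and "qpoch P z = 0"
  then obtain n where "P ^ n * z = 1" by (auto simp: qpoch_eq_0_iff)
  then have "p ^ n * norm z = 1" by (metis norm_P_power norm_one)
  moreover have "p ^ n * norm z \<le> 1 * norm z" using p by (intro mult_right_mono power_le_one) auto
  ultimately show False using z by simp
qed

text \<open>The partial products converge uniformly on discs of radius 1, by comparison with a
  geometric series.\<close>

lemma qpoch_hol: "qpoch P holomorphic_on UNIV"
proof (rule holomorphic_uniform_sequence[where f="\<lambda>n z. \<Prod>i<n. 1 - P ^ i * z"])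
  show "(\<lambda>z. \<Prod>i<n. 1 - P ^ i * z) holomorphic_on UNIV" for n by (intro holomorphic_intros)
  fix w :: complex
  have "uniformly_convergent_on (cball w 1) (\<lambda>N z. \<Prod>i<N. 1 - P ^ i * z)"
  proof (rule uniformly_convergent_on_prod')
    show "uniformly_convergent_on (cball w 1) (\<lambda>N z. \<Sum>n<N. norm (1 - P ^ n * z - 1))"
    proof (rule Weierstrass_m_test')
      show "summable (\<lambda>n. p ^ n * (norm w + 1))" using p by (intro summable_mult2 summable_geometric) simp
      fix n z assume "z \<in> cball w 1"
      then have "norm z \<le> norm w + 1" using norm_triangle_sub[of z w] by (simp add: dist_norm norm_minus_commute)
      then have "p ^ n * norm z \<le> p ^ n * (norm w + 1)" using p by (intro mult_left_mono) auto
      then show "norm (norm (1 - P ^ n * z - 1)) \<le> p ^ n * (norm w + 1)"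
        by (simp add: norm_P_power[symmetric])
    qed
  qed (auto intro!: continuous_intros)
  then obtain l where l: "uniform_limit (cball w 1) (\<lambda>N z. \<Prod>i<N. 1 - P ^ i * z) l sequentially"
    by (auto simp: uniformly_convergent_on_def)
  have "l z = qpoch P z" if "z \<in> cball w 1" for z
    by (rule LIMSEQ_unique[OF tendsto_uniform_limitI[OF l that] qpoch_LIMSEQ])
  then have "uniform_limit (cball w 1) (\<lambda>N z. \<Prod>i<N. 1 - P ^ i * z) (qpoch P) sequentially"
    by (intro uniform_limit_cong'[THEN iffD1, OF _ _ l]) auto
  then show "\<exists>d>0. cball w d \<subseteq> UNIV \<and> uniform_limit (cball w d) (\<lambda>N z. \<Prod>i<N. 1 - P ^ i * z) (qpoch P) sequentially"
    by (intro exI[of _ 1]) simp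
qed simp

lemma qpoch_hol' [holomorphic_intros]: "f holomorphic_on A \<Longrightarrow> (\<lambda>z. qpoch P (f z)) holomorphic_on A"
  using holomorphic_on_compose_gen[OF _ qpoch_hol] by (auto simp: o_def)

text \<open>The series with these terms is minus the logarithm of the infinite product, obtained by
  expanding the logarithm of each factor and summing over the factors.\<close>

definition qlog_term :: "complex \<Rightarrow> nat \<Rightarrow> complex" where
  "qlog_term w n = w ^ Suc n / (of_nat (Suc n) * (1 - P ^ Suc n))"

lemma qlog_summable:
  assumes w: "norm w < 1"
  shows "summable (\<lambda>n. norm (qlog_term w n))"
proof (rule summable_comparison_test'[where N=0])
  show "summable (\<lambda>n. norm w ^ n * (1 / (1 - p)))" using w by (intro summable_mult2 summable_geometric) simp
  fix n
  have "1 - p \<le> norm (1 - P ^ Suc n)"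
  proof -
    have "p ^ Suc n \<le> p ^ 1" using p by (intro power_decreasing) auto
    then have "1 - p \<le> 1 - p ^ Suc n" by simp
    also have "\<dots> \<le> norm (1 - P ^ Suc n)"
      by (metis abs_ge_self norm_of_real of_real_1 of_real_diff of_real_power)
    finally show ?thesis .
  qed
  moreover have "1 \<le> real (Suc n)" by simp
  ultimately have "1 * (1 - p) \<le> real (Suc n) * norm (1 - P ^ Suc n)" using p by (intro mult_mono) auto
  then have d: "1 - p \<le> norm (of_nat (Suc n) * (1 - P ^ Suc n))" unfolding norm_mult norm_of_nat by simp
  have "norm (qlog_term w n) = norm w ^ Suc n / norm (of_nat (Suc n) * (1 - P ^ Suc n))"
    by (simp only: qlog_term_def norm_divide norm_power)
  also have "\<dots> \<le> norm w ^ n / (1 - p)"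
    using w d p by (intro frac_le) (auto intro!: power_decreasing mult_left_le_one_le)
  finally show "norm (norm (qlog_term w n)) \<le> norm w ^ n * (1 / (1 - p))" by simp
qed

text \<open>Both sides satisfy F(w) = (1 - w) F(p w) and tend to 1 at the origin, so iteration
  identifies them.\<close>

lemma qpoch_exp:
  assumes w: "norm w < 1"
  shows "qpoch P w = exp (- suminf (qlog_term w))"
proof -
  define Lq where "Lq w = suminf (qlog_term w)" for w
  have wP: "norm (P ^ N * w) < 1" for N
  proof -
    have "p ^ N * norm w \<le> 1 * norm w" using p by (intro mult_right_mono power_le_one) auto
    then show ?thesis unfolding norm_P_power using w by simp
  qed
  have step: "exp (- Lq v) = (1 - v) * exp (- Lq (P * v))" if v: "norm v < 1" for v
  proof -
    have Pv: "norm (P * v) < 1"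
    proof -
      have "p * norm v \<le> 1 * norm v" using p by (intro mult_right_mono) auto
      then show ?thesis using v p by (simp add: norm_mult)
    qed
    have t: "qlog_term v n - qlog_term (P * v) n = v ^ Suc n / of_nat (Suc n)" for n
    proof -
      have "P ^ Suc n \<noteq> 1"
      proof
        assume "P ^ Suc n = 1"
        then have "p ^ Suc n = 1" by (metis of_real_eq_1_iff of_real_power)
        moreover have "p ^ Suc n < 1" using p by (intro power_Suc_less_one) auto
        ultimately show False by simp
      qed
      then have nz: "1 - P ^ Suc n \<noteq> 0" by simp
      have "qlog_term v n - qlog_term (P * v) n = (v ^ Suc n * (1 - P ^ Suc n)) / (of_nat (Suc n) * (1 - P ^ Suc n))"
        unfolding qlog_term_def power_mult_distrib by (simp only: diff_divide_distrib[symmetric]) (simp add: algebra_simps)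
      then show ?thesis by (simp only: nonzero_mult_divide_mult_cancel_right[OF nz])
    qed
    have s: "(\<lambda>n. qlog_term v n - qlog_term (P * v) n) sums (Lq v - Lq (P * v))"
      unfolding Lq_def by (intro sums_diff summable_sums summable_norm_cancel[OF qlog_summable] v Pv)
    have "(\<lambda>n. - ((- (- v)) ^ n) / of_nat n) sums ln (1 + - v)"
      by (rule Ln_series') (use v in simp)
    then have "(\<lambda>n. - (v ^ Suc n) / of_nat (Suc n)) sums ln (1 - v)"
      by (subst sums_Suc_iff) simp
    then have "(\<lambda>n. - (- (v ^ Suc n) / of_nat (Suc n))) sums - ln (1 - v)" by (rule sums_minus)
    then have "(\<lambda>n. v ^ Suc n / of_nat (Suc n)) sums - ln (1 - v)" by simp
    then have "Lq v - Lq (P * v) = - ln (1 - v)" using s unfolding t by (rule sums_unique2[rotated])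
    then have "- Lq v = ln (1 - v) + - Lq (P * v)" by (simp add: algebra_simps)
    moreover have "1 - v \<noteq> 0" using v by auto
    ultimately show ?thesis using exp_add exp_Ln by metis
  qed
  have iter: "exp (- Lq w) = (\<Prod>i<N. 1 - P ^ i * w) * exp (- Lq (P ^ N * w))" for N
  proof (induction N)
    case (Suc N)
    then show ?case using step[OF wP[of N]] by (simp add: mult_ac)
  qed simp
  have "(\<lambda>N. Lq (P ^ N * w)) \<longlonglongrightarrow> 0"
  proof (rule Lim_null_comparison)
    show "(\<lambda>N. p ^ N * suminf (\<lambda>n. norm (qlog_term w n))) \<longlonglongrightarrow> 0"
      using p by (intro tendsto_mult_left_zero LIMSEQ_power_zero) simp
    have "norm (Lq (P ^ N * w)) \<le> p ^ N * suminf (\<lambda>n. norm (qlog_term w n))" for N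
    proof -
      have "norm (Lq (P ^ N * w)) \<le> suminf (\<lambda>n. norm (qlog_term (P ^ N * w) n))"
        unfolding Lq_def by (rule summable_norm[OF qlog_summable[OF wP]])
      also have "\<dots> \<le> suminf (\<lambda>n. p ^ N * norm (qlog_term w n))"
      proof (rule suminf_le)
        fix n
        have "norm (qlog_term (P ^ N * w) n) = (p ^ N) ^ Suc n * norm (qlog_term w n)"
          using p by (simp add: qlog_term_def power_mult_distrib norm_mult norm_divide norm_power)
        also have "\<dots> \<le> p ^ N * norm (qlog_term w n)"
        proof (rule mult_right_mono)
          have "(p ^ N) ^ Suc n \<le> (p ^ N) ^ 1" using p by (intro power_decreasing) (auto simp: power_le_one)
          then show "(p ^ N) ^ Suc n \<le> p ^ N" by simp
        qed simp
        finally show "norm (qlog_term (P ^ N * w) n) \<le> p ^ N * norm (qlog_term w n)" .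
      qed (intro qlog_summable wP summable_mult qlog_summable[OF w])+
      also have "\<dots> = p ^ N * suminf (\<lambda>n. norm (qlog_term w n))"
        by (rule suminf_mult[OF qlog_summable[OF w]])
      finally show ?thesis .
    qed
    then show "\<forall>\<^sub>F N in sequentially. norm (Lq (P ^ N * w)) \<le> p ^ N * suminf (\<lambda>n. norm (qlog_term w n))" by simp
  qed
  then have "(\<lambda>N. exp (- Lq (P ^ N * w))) \<longlonglongrightarrow> exp (- 0)" by (intro tendsto_exp tendsto_minus)
  then have "(\<lambda>N. (\<Prod>i<N. 1 - P ^ i * w) * exp (- Lq (P ^ N * w))) \<longlonglongrightarrow> qpoch P w * exp (- 0)"
    by (intro tendsto_mult qpoch_LIMSEQ)
  then have "(\<lambda>N::nat. exp (- Lq w)) \<longlonglongrightarrow> qpoch P w" unfolding iter[symmetric] by simp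
  then show ?thesis unfolding Lq_def using LIMSEQ_unique[OF _ tendsto_const] by metis
qed

end

section \<open>The bracket as a theta function\<close>

locale brst_parameters =
  fixes L :: nat and x :: real
  assumes L: "odd L" "L \<ge> 3" and x: "0 < x" "x < 1"
begin

abbreviation (input) \<rho> :: real where "\<rho> \<equiv> rpar L - 1"
abbreviation (input) T :: real where "T \<equiv> pi / ln x"
abbreviation (input) P' :: real where "P' \<equiv> x powr (2 * rpar L - 2)"
abbreviation (input) Pc :: complex where "Pc \<equiv> complex_of_real P'"
abbreviation (input) xc :: complex where "xc \<equiv> complex_of_real x"

lemma rho_eq: "\<rho> = real L / (real L + 2)"
  by (simp add: rpar_def field_simps)

lemma rho_bounds: "\<rho> > 0" "\<rho> < 1"
  using L by (simp_all add: rho_eq)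

lemma ln_x: "ln x < 0" "ln x \<noteq> 0"
  using x by (simp_all add: ln_less_zero)

lemma nome_bounds: "0 < P'" "P' < 1"
proof -
  show "0 < P'" using x by simp
  have "x powr (2 * rpar L - 2) < x powr 0" using x rho_bounds by (intro powr_less_mono') auto
  then show "P' < 1" using x by simp
qed

sublocale nome P'
  by unfold_locales (rule nome_bounds)+

lemma xpow_exp: "xpow x u = exp (of_real (ln x) * u)"
  using x by (simp add: xpow_def powr_def Ln_of_real mult.commute)

lemma zpow_exp: "zpow x u s = exp (2 * of_real (ln x) * u * of_real s)"
  by (simp add: zpow_def xpow_exp mult_ac)

lemma nome_exp: "complex_of_real P' = exp (2 * of_real (ln x) * of_real \<rho>)"
proof -
  have "P' = exp (2 * ln x * \<rho>)" using x by (simp add: powr_def algebra_simps)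
  then show ?thesis by (simp flip: exp_of_real)
qed

text \<open>The factor 1 - z, which carries the zero at the origin, is split off from the theta
  product.\<close>

lemma br_eq: "br L x u = exp (of_real (ln x) * (u\<^sup>2 / of_real \<rho> - u)) *
    ((1 - zpow x u 1) * qpoch (of_real P') (of_real P' * zpow x u 1)) * qpoch (of_real P') (of_real P' / zpow x u 1)
    * qpoch (of_real P') (of_real P')"
  unfolding br_def Theta_def xpow_exp qpoch_rec[of "zpow x u 1", symmetric] by (simp add: mult_ac)

lemma zpow_add: "zpow x (u + v) s = zpow x u s * zpow x v s"
  by (simp add: zpow_exp ring_distribs exp_add)

lemma zpow_minus: "zpow x (- u) s = 1 / zpow x u s"
  by (simp add: zpow_exp exp_minus field_simps)

lemma zpow_nz: "zpow x u s \<noteq> 0" by (simp add: zpow_exp)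

lemma zpow_hol: "f holomorphic_on A \<Longrightarrow> (\<lambda>u. zpow x (f u) s) holomorphic_on A"
  unfolding zpow_exp by (intro holomorphic_intros)

lemma br_hol: "br L x holomorphic_on UNIV"
proof -
  have "(\<lambda>u. exp (of_real (ln x) * (u\<^sup>2 / of_real \<rho> - u)) *
    ((1 - zpow x u 1) * qpoch (of_real P') (of_real P' * zpow x u 1)) * qpoch (of_real P') (of_real P' / zpow x u 1)
    * qpoch (of_real P') (of_real P')) holomorphic_on UNIV"
    by (intro holomorphic_intros zpow_hol qpoch_hol') (use rho_bounds zpow_nz in auto)
  then show ?thesis by (simp only: br_eq[abs_def])
qed

lemma br_minus: "br L x (- u) = - br L x u"
proof -
  let ?z = "zpow x u 1" and ?Q = "qpoch (of_real P')" and ?P = "complex_of_real P'"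
  let ?e = "exp (of_real (ln x) * (u\<^sup>2 / of_real \<rho> - u))"
  have e: "exp (of_real (ln x) * ((- u)\<^sup>2 / of_real \<rho> - (- u))) = ?e * ?z"
    by (simp add: zpow_exp exp_add[symmetric] algebra_simps)
  have "br L x (- u) = (?e * ?z) * ((1 - 1 / ?z) * ?Q (?P / ?z)) * ?Q (?P * ?z) * ?Q ?P"
    unfolding br_eq[of "- u"] e zpow_minus by simp
  also have "?z * (1 - 1 / ?z) = - (1 - ?z)" using zpow_nz[of u 1] by (simp add: field_simps)
  then have "(?e * ?z) * ((1 - 1 / ?z) * ?Q (?P / ?z)) * ?Q (?P * ?z) * ?Q ?P =
      ?e * (- (1 - ?z) * ?Q (?P / ?z)) * ?Q (?P * ?z) * ?Q ?P" by (simp only: mult.assoc[symmetric]) (simp add: mult.assoc)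
  finally show ?thesis unfolding br_eq[of u] by (simp only: mult_ac mult_minus_left mult_minus_right)
qed

text \<open>A shift of u by \<rho> multiplies z by the nome. The power of z produced by the theta
  product is compensated by the Gaussian prefactor, and only a sign remains.\<close>

lemma br_rho: "br L x (u + of_real \<rho>) = - br L x u"
proof -
  let ?z = "zpow x u 1" and ?Q = "qpoch (of_real P')" and ?P = "complex_of_real P'"
  let ?e = "exp (of_real (ln x) * (u\<^sup>2 / of_real \<rho> - u))"
  have \<rho>0: "complex_of_real \<rho> \<noteq> 0" using rho_bounds by (simp add: of_real_eq_0_iff del: of_real_diff)
  have "(u + of_real \<rho>)\<^sup>2 / of_real \<rho> - (u + of_real \<rho>) = (u\<^sup>2 / of_real \<rho> - u) + 2 * u"
    using \<rho>0 by (simp add: power2_eq_square field_simps del: of_real_diff)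
  then have e: "exp (of_real (ln x) * ((u + of_real \<rho>)\<^sup>2 / of_real \<rho> - (u + of_real \<rho>))) = ?e * ?z"
    by (simp add: zpow_exp exp_add[symmetric] algebra_simps)
  have z: "zpow x (u + of_real \<rho>) 1 = ?P * ?z"
    unfolding zpow_add by (simp add: zpow_exp nome_exp)
  have P0: "?P \<noteq> 0" using nome_bounds by simp
  have "br L x (u + of_real \<rho>) = (?e * ?z) * ?Q (?P * ?z) * ?Q (?P / (?P * ?z)) * ?Q ?P"
    unfolding br_def Theta_def xpow_exp e z by simp
  also have "?P / (?P * ?z) = 1 / ?z" using P0 by simp
  also have "?Q (1 / ?z) = (1 - 1 / ?z) * ?Q (?P / ?z)" using qpoch_rec[of "1 / ?z"] by simp
  also have "(?e * ?z) * ?Q (?P * ?z) * ((1 - 1 / ?z) * ?Q (?P / ?z)) * ?Q ?P =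
      ?e * (?z * (1 - 1 / ?z)) * ?Q (?P * ?z) * ?Q (?P / ?z) * ?Q ?P" by (simp only: mult_ac)
  also have "?z * (1 - 1 / ?z) = - (1 - ?z)" using zpow_nz[of u 1] by (simp add: field_simps)
  finally show ?thesis unfolding br_eq[of u] by (simp only: mult_ac mult_minus_left mult_minus_right)
qed

lemma zpow_tau: "zpow x (\<i> * of_real T) 1 = 1"
proof -
  have "2 * of_real (ln x) * (\<i> * of_real T) * of_real 1 = 2 * of_real pi * \<i>"
    using ln_x by simp
  then show ?thesis by (simp only: zpow_exp) (simp add: exp_eq_1)
qed

text \<open>A shift of u by i T leaves z unchanged, so the multiplier comes from the Gaussian
  prefactor alone.\<close>

lemma br_tau: "br L x (u + \<i> * of_real T) = - of_real (exp (- (pi\<^sup>2 / (\<rho> * ln x)))) * exp_per \<rho> u * br L x u"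
proof -
  let ?t = "\<i> * complex_of_real T"
  have z: "zpow x (u + ?t) 1 = zpow x u 1" unfolding zpow_add zpow_tau by simp
  have \<rho>0: "complex_of_real \<rho> \<noteq> 0" using rho_bounds by (simp add: of_real_eq_0_iff del: of_real_diff)
  have l0: "complex_of_real (ln x) \<noteq> 0" using ln_x by simp
  define R l where "R = complex_of_real \<rho>" and "l = complex_of_real (ln x)"
  have nz: "R \<noteq> 0" "l \<noteq> 0" using \<rho>0 l0 by (simp_all only: R_def l_def not_False_eq_True)
  have c: "complex_of_real (- (pi\<^sup>2 / (\<rho> * ln x))) = - (of_real pi ^ 2 / (R * l))"
    by (simp only: R_def l_def of_real_minus of_real_divide of_real_mult of_real_power)
  have t: "?t = \<i> * of_real pi / l" by (simp only: l_def of_real_divide times_divide_eq_right)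
  have "of_real (ln x) * ((u + ?t)\<^sup>2 / of_real \<rho> - (u + ?t)) = of_real (ln x) * (u\<^sup>2 / of_real \<rho> - u) + 2 * of_real pi * \<i> * u / of_real \<rho>
      + of_real (- (pi\<^sup>2 / (\<rho> * ln x))) - \<i> * of_real pi"
    unfolding c t R_def[symmetric] l_def[symmetric] using nz by (simp add: power2_eq_square field_simps)
  then have e: "exp (of_real (ln x) * ((u + ?t)\<^sup>2 / of_real \<rho> - (u + ?t))) =
     - (exp (of_real (ln x) * (u\<^sup>2 / of_real \<rho> - u)) * exp_per \<rho> u * of_real (exp (- (pi\<^sup>2 / (\<rho> * ln x)))))"
    by (simp add: exp_add exp_diff exp_per_def exp_of_real[symmetric] mult.commute[of \<i>] del: of_real_diff of_real_minus)
  show ?thesis unfolding br_def xpow_exp e z by (simp only: mult_ac mult_minus_left mult_minus_right)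
qed

text \<open>Zeros occur where z is an integral power of the nome; passing from z to u adds the
  multiples of i T.\<close>

lemma br_zero_iff:
  "br L x u = 0 \<longleftrightarrow> (\<exists>m n::int. u = of_int m * of_real \<rho> + of_int n * (\<i> * of_real T))"
proof -
  let ?z = "zpow x u 1" and ?P = "complex_of_real P'"
  have P0: "?P \<noteq> 0" using nome_bounds by simp
  have pw: "?P powi k = exp (of_int k * (2 * of_real (ln x) * of_real \<rho>))" for k :: int
    unfolding nome_exp by (simp add: exp_power_int)
  have "br L x u = 0 \<longleftrightarrow> qpoch ?P ?z = 0 \<or> qpoch ?P (?P / ?z) = 0"
    unfolding br_def Theta_def xpow_exp using qpoch_nonzero[of ?P] nome_bounds by auto
  also have "\<dots> \<longleftrightarrow> (\<exists>n. ?P ^ n * ?z = 1) \<or> (\<exists>n. ?P ^ n * (?P / ?z) = 1)"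
    unfolding qpoch_eq_0_iff ..
  also have "\<dots> \<longleftrightarrow> (\<exists>k::int. ?z = ?P powi k)"
  proof safe
    fix n assume "?P ^ n * ?z = 1"
    then have "?z = ?P powi (- int n)" using P0 by (simp add: power_int_minus field_simps)
    then show "\<exists>k. ?z = ?P powi k" ..
  next
    fix n assume "?P ^ n * (?P / ?z) = 1"
    then have "?z = ?P ^ Suc n" using zpow_nz[of u 1] by (simp add: field_simps)
    then have "?z = ?P powi (int (Suc n))" by (simp only: power_int_of_nat)
    then show "\<exists>k. ?z = ?P powi k" ..
  next
    fix k assume k: "?z = ?P powi k" and "\<nexists>n. ?P ^ n * (?P / ?z) = 1"
    show "\<exists>n. ?P ^ n * ?z = 1"
    proof (cases "k \<le> 0")
      case True
      then have "?P ^ nat (- k) * ?z = 1" unfolding k using P0 by (simp add: power_int_def power_inverse)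
      then show ?thesis ..
    next
      case False
      then have "?P ^ nat (k - 1) * (?P / ?z) = 1" unfolding k using P0
        by (simp add: power_int_def power_Suc2[symmetric] Suc_nat_eq_nat_zadd1 del: power_Suc2)
      then show ?thesis using \<open>\<nexists>n. ?P ^ n * (?P / ?z) = 1\<close> by blast
    qed
  qed
  also have "\<dots> \<longleftrightarrow> (\<exists>m n::int. u = of_int m * of_real \<rho> + of_int n * (\<i> * of_real T))"
  proof -
    have "?z = ?P powi k \<longleftrightarrow> (\<exists>n::int. u = of_int k * of_real \<rho> + of_int n * (\<i> * of_real T))" for k :: int
    proof -
      have l0: "complex_of_real (ln x) \<noteq> 0" using ln_x by simp
      have "?z = ?P powi k \<longleftrightarrow> (\<exists>n::int. 2 * of_real (ln x) * u = of_int k * (2 * of_real (ln x) * of_real \<rho>) + of_int (2 * n) * of_real pi * \<i>)"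
        unfolding pw zpow_exp exp_eq by simp
      also have "\<dots> \<longleftrightarrow> (\<exists>n::int. u = of_int k * of_real \<rho> + of_int n * (\<i> * of_real T))"
      proof (intro ex_cong1)
        fix n :: int
        define R l where "R = complex_of_real \<rho>" and "l = complex_of_real (ln x)"
        have "2 * l * u = of_int k * (2 * l * R) + of_int (2 * n) * of_real pi * \<i> \<longleftrightarrow>
            (2 * l) * u = (2 * l) * (of_int k * R + of_int n * (\<i> * (of_real pi / l)))"
          using l0 by (simp add: l_def[symmetric] ring_distribs mult_ac)
        also have "\<dots> \<longleftrightarrow> u = of_int k * R + of_int n * (\<i> * (of_real pi / l))"
          using l0 by (simp only: mult_cancel_left) (simp add: l_def)
        finally show "2 * of_real (ln x) * u = of_int k * (2 * of_real (ln x) * of_real \<rho>) + of_int (2 * n) * of_real pi * \<i> \<longleftrightarrow>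
            u = of_int k * of_real \<rho> + of_int n * (\<i> * of_real T)"
          by (simp only: R_def l_def of_real_divide)
      qed
      finally show ?thesis .
    qed
    then show ?thesis by blast
  qed
  finally show ?thesis .
qed

lemma br_deriv_0: "deriv (br L x) 0 \<noteq> 0"
proof -
  let ?k = "\<lambda>u. exp (of_real (ln x) * (u\<^sup>2 / of_real \<rho> - u)) * qpoch (of_real P') (of_real P' * zpow x u 1) *
     qpoch (of_real P') (of_real P' / zpow x u 1) * qpoch (of_real P') (of_real P')"
  have h: "?k holomorphic_on UNIV"
    by (intro holomorphic_intros zpow_hol qpoch_hol') (use rho_bounds zpow_nz in auto)
  have eq: "br L x = (\<lambda>u. (1 - exp (2 * of_real (ln x) * u)) * ?k u)"
    unfolding br_eq[abs_def] by (simp add: zpow_exp mult_ac)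
  have "((\<lambda>u. (1 - exp (2 * of_real (ln x) * u)) * ?k u) has_field_derivative
     ((1 - exp (2 * of_real (ln x) * 0)) * deriv ?k 0 + (- (2 * of_real (ln x))) * ?k 0)) (at 0)"
    by (rule DERIV_mult') (use h in \<open>auto intro!: derivative_eq_intros holomorphic_derivI\<close>)
  then have "deriv (br L x) 0 = - (2 * of_real (ln x)) * ?k 0"
    unfolding eq by (simp add: DERIV_imp_deriv)
  moreover have "?k 0 \<noteq> 0"
    using qpoch_nonzero[of "of_real P'"] nome_bounds by (simp add: zpow_exp)
  ultimately show ?thesis using ln_x by simp
qed

lemma br_theta_function: "theta_function \<rho> T (of_real (exp (- (pi\<^sup>2 / (\<rho> * ln x))))) (br L x)"
proof
  show "\<rho> > 0" "T \<noteq> 0" using rho_bounds ln_x by simp_all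
  show "complex_of_real (exp (- (pi\<^sup>2 / (\<rho> * ln x)))) \<noteq> 0" by simp
  show "complex_of_real (exp (- (pi\<^sup>2 / (\<rho> * ln x)))) ^ 2 = exp_per \<rho> (\<i> * of_real T)"
  proof -
    have \<rho>0: "complex_of_real \<rho> \<noteq> 0" using rho_bounds by (simp add: of_real_eq_0_iff del: of_real_diff)
    have l0: "complex_of_real (ln x) \<noteq> 0" using ln_x by simp
    define R l where "R = complex_of_real \<rho>" and "l = complex_of_real (ln x)"
    have nz: "R \<noteq> 0" "l \<noteq> 0" using \<rho>0 l0 by (simp_all only: R_def l_def not_False_eq_True)
    have c: "complex_of_real (- (pi\<^sup>2 / (\<rho> * ln x))) = - (of_real pi ^ 2 / (R * l))"
      by (simp only: R_def l_def of_real_minus of_real_divide of_real_mult of_real_power)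
    have t: "complex_of_real T = of_real pi / l" by (simp only: l_def of_real_divide)
    have "2 * of_real (- (pi\<^sup>2 / (\<rho> * ln x))) = 2 * of_real pi * \<i> * (\<i> * of_real T) / of_real \<rho>"
      unfolding c t R_def[symmetric] using nz by (simp add: field_simps power2_eq_square)
    then show ?thesis unfolding exp_per_def exp_of_real[symmetric] exp_double[symmetric] by simp
  qed
qed (rule br_hol br_minus br_rho br_tau br_zero_iff br_deriv_0)+

end

section \<open>Products of currents\<close>

context brst_parameters
begin

lemmas nome = nome_bounds

text \<open>With X = x^n and Y = x^((r - 1) n) the quotient is rational in X and Y^2 = P'^n. Each of
  its six terms is a power a^n over n (1 - P'^n), so each series sums to the logarithm of an
  infinite product.\<close>

lemma qnum_ratio:
  assumes "n > 0"
  shows "osc_coeff L x (int n) / (qnum x (real n))\<^sup>2 =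
    (1 + (1 / x\<^sup>2) ^ n - (1 / x) ^ n - (P' * x\<^sup>2) ^ n - P' ^ n + (P' * x) ^ n) / (real n * (1 - P' ^ n))"
proof -
  define X where "X = x ^ n"
  define Y where "Y = x powr ((rpar L - 1) * real n)"
  have X: "0 < X" "X < 1" using x assms by (simp_all add: X_def power_Suc_less_one power_less_one_iff)
  have Y: "0 < Y" using x by (simp add: Y_def)
  have YP: "P' ^ n = Y\<^sup>2"
    using x by (simp add: Y_def powr_power algebra_simps)
  have Y1: "Y\<^sup>2 < 1"
    unfolding YP[symmetric] using nome assms by (simp add: power_less_one_iff)
  have "x\<^sup>2 < 1" using x by (simp add: power_less_one_iff)
  then have d: "x - inverse x \<noteq> 0" using x by (simp add: field_simps power2_eq_square)
  have pn: "x powr (real n) = X" "x powr (- real n) = 1 / X"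
    using x by (simp_all add: X_def powr_realpow powr_minus_divide)
  have "x powr (2 * real n) = X\<^sup>2"
    using powr_add[of x "real n" "real n"] by (simp only: pn mult_2 power2_eq_square)
  then have p2: "x powr (2 * real n) = X\<^sup>2" "x powr (- (2 * real n)) = 1 / X\<^sup>2"
    by (simp_all only: powr_minus_divide)
  have py: "x powr ((rpar L - 1) * real n) = Y" "x powr (- ((rpar L - 1) * real n)) = 1 / Y"
    by (simp_all only: Y_def powr_minus_divide)
  have r: "rpar L * real n = (rpar L - 1) * real n + real n" by (simp add: algebra_simps)
  have pr: "x powr (rpar L * real n) = Y * X" "x powr (- (rpar L * real n)) = 1 / (Y * X)"
    unfolding powr_minus_divide r powr_add py(1) pn by simp_all
  have q: "qnum x (real n) = (X - 1 / X) / (x - inverse x)"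
    "qnum x (2 * real n) = (X\<^sup>2 - 1 / X\<^sup>2) / (x - inverse x)"
    "qnum x (rpar L * real n) = (Y * X - 1 / (Y * X)) / (x - inverse x)"
    "qnum x ((rpar L - 1) * real n) = (Y - 1 / Y) / (x - inverse x)"
    unfolding qnum_def pn p2 pr py by simp_all
  define D where "D = x - inverse x"
  have X1: "X\<^sup>2 - 1 \<noteq> 0" using X by (simp add: power_less_one_iff less_imp_neq abs_square_less_1[THEN iffD2])
  have XX: "X - 1 / X = (X\<^sup>2 - 1) / X" using X by (simp add: field_simps power2_eq_square)
  have X2: "X\<^sup>2 - 1 / X\<^sup>2 = (X\<^sup>2 - 1) / X * (X + 1 / X)" using X by (simp add: field_simps power2_eq_square)
  have Yy: "Y - 1 / Y = (Y\<^sup>2 - 1) / Y" "Y * X - 1 / (Y * X) = (Y\<^sup>2 * X\<^sup>2 - 1) / (Y * X)"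
    using X Y by (simp_all add: field_simps power2_eq_square)
  have a: "a * D' * (a * D' * b - a * D') / c * (e / f) / (a * D')\<^sup>2 = (b - 1) / c * (e / f)"
    if "a * D' \<noteq> 0" for a b c e f D' :: real
  proof -
    have "a * D' * (a * D' * b - a * D') = (a * D')\<^sup>2 * (b - 1)" by (simp add: power2_eq_square algebra_simps)
    then show ?thesis using that by simp
  qed
  have "osc_coeff L x (int n) / (qnum x (real n))\<^sup>2 =
     (X + 1 / X - 1) / real n * (((Y\<^sup>2 * X\<^sup>2 - 1) / (Y * X) / D) / ((Y\<^sup>2 - 1) / Y / D))"
  proof -
    have "osc_coeff L x (int n) / (qnum x (real n))\<^sup>2 = ((X\<^sup>2 - 1) / X) * (1/D) * (((X\<^sup>2 - 1) / X) * (1/D) * (X + 1 / X) - ((X\<^sup>2 - 1) / X) * (1/D)) / real n *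
      (((Y\<^sup>2 * X\<^sup>2 - 1) / (Y * X) / D) / ((Y\<^sup>2 - 1) / Y / D)) / (((X\<^sup>2 - 1) / X) * (1/D))\<^sup>2"
      unfolding osc_coeff_def of_int_of_nat_eq q XX X2 Yy D_def[symmetric] by simp
    also have "\<dots> = (X + 1 / X - 1) / real n * (((Y\<^sup>2 * X\<^sup>2 - 1) / (Y * X) / D) / ((Y\<^sup>2 - 1) / Y / D))"
      by (rule a) (use X X1 d D_def in auto)
    finally show ?thesis .
  qed
  also have "((Y\<^sup>2 * X\<^sup>2 - 1) / (Y * X) / D) / ((Y\<^sup>2 - 1) / Y / D) = (1 - Y\<^sup>2 * X\<^sup>2) / (X * (1 - Y\<^sup>2))"
    using d X Y Y1 unfolding D_def[symmetric] by (simp add: divide_simps) (simp add: algebra_simps)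
  also have "(X + 1 / X - 1) / real n * ((1 - Y\<^sup>2 * X\<^sup>2) / (X * (1 - Y\<^sup>2))) =
     (1 + 1 / X\<^sup>2 - 1 / X - Y\<^sup>2 * X\<^sup>2 - Y\<^sup>2 + Y\<^sup>2 * X) / (real n * (1 - Y\<^sup>2))"
    using X Y1 assms by (simp add: divide_simps power2_eq_square) (simp add: algebra_simps)
  also have "1 / X\<^sup>2 = (1 / x\<^sup>2) ^ n" by (simp add: X_def power_divide power_mult[symmetric] mult.commute)
  also have "1 / X = (1 / x) ^ n" by (simp add: X_def power_divide)
  also have "Y\<^sup>2 * X\<^sup>2 = (P' * x\<^sup>2) ^ n" by (simp add: YP[symmetric] X_def power_mult_distrib power_mult[symmetric] mult.commute)
  also have "Y\<^sup>2 * X = (P' * x) ^ n" by (simp add: YP[symmetric] X_def power_mult_distrib)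
  finally show ?thesis unfolding YP .
qed

text \<open>The contraction of two currents as a function of the ratio w of the right variable to
  the left one. The infinite products at w and P' w, both among the six terms, cancel up to 1 -
  w.\<close>

definition contr :: "complex \<Rightarrow> complex" where
  "contr w = (1 - w) * qpoch Pc (w / xc\<^sup>2) * qpoch Pc (Pc * xc * w) / (qpoch Pc (w / xc) * qpoch Pc (Pc * xc\<^sup>2 * w))"

lemma creation_annihilation:
  "creation_coeff x v i * annihilation_coeff L x u i =
     - (qlog_term (zpow x (v - u) 1) i + qlog_term (zpow x (v - u) 1 / xc\<^sup>2) i
        - qlog_term (zpow x (v - u) 1 / xc) i - qlog_term (Pc * xc\<^sup>2 * zpow x (v - u) 1) i
        - qlog_term (Pc * zpow x (v - u) 1) i + qlog_term (Pc * xc * zpow x (v - u) 1) i)"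
proof -
  let ?w = "zpow x (v - u) 1" and ?n = "Suc i"
  have z: "zpow x v (of_nat ?n) * zpow x u (- of_nat ?n) = ?w ^ ?n"
    unfolding zpow_exp exp_add[symmetric] exp_of_nat_mult[symmetric]
    by (rule arg_cong[where f=exp]) (simp add: algebra_simps)
  have "creation_coeff x v i * annihilation_coeff L x u i =
     - (of_real (osc_coeff L x (int ?n) / (qnum x (real ?n))\<^sup>2) * (zpow x v (of_nat ?n) * zpow x u (- of_nat ?n)))"
    by (simp only: creation_coeff_def annihilation_coeff_def power2_eq_square of_real_divide of_real_mult) simp
  also have "\<dots> = - ((1 + (1 / xc\<^sup>2) ^ ?n - (1 / xc) ^ ?n - (Pc * xc\<^sup>2) ^ ?n - Pc ^ ?n + (Pc * xc) ^ ?n) * ?w ^ ?n / (of_nat ?n * (1 - Pc ^ ?n)))"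
    unfolding z qnum_ratio[OF zero_less_Suc] by simp
  also have "\<dots> = - (?w ^ ?n / (of_nat ?n * (1 - Pc ^ ?n)) + (?w / xc\<^sup>2) ^ ?n / (of_nat ?n * (1 - Pc ^ ?n)) -
     (?w / xc) ^ ?n / (of_nat ?n * (1 - Pc ^ ?n)) - (Pc * xc\<^sup>2 * ?w) ^ ?n / (of_nat ?n * (1 - Pc ^ ?n)) -
      (Pc * ?w) ^ ?n / (of_nat ?n * (1 - Pc ^ ?n)) + (Pc * xc * ?w) ^ ?n / (of_nat ?n * (1 - Pc ^ ?n)))"
    unfolding power_mult_distrib power_divide by (simp only: add_divide_distrib[symmetric] diff_divide_distrib[symmetric]) (simp add: algebra_simps del: power_Suc of_nat_Suc)
  finally show ?thesis unfolding qlog_term_def .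
qed

text \<open>The bound x^2 is the radius within which all six logarithmic series converge; the
  critical argument is w / x^2.\<close>

lemma contraction:
  fixes u v :: complex
  defines "w \<equiv> zpow x (v - u) 1"
  assumes w: "norm w < x\<^sup>2"
  shows "summable (\<lambda>i. norm (creation_coeff x v i * annihilation_coeff L x u i))"
    and "exp (suminf (\<lambda>i. creation_coeff x v i * annihilation_coeff L x u i)) = contr w"
proof -
  note P = nome
  have xx: "x\<^sup>2 < x" using x by (simp add: power2_eq_square)
  have n1: "norm w < 1" using w xx x by linarith
  have n2: "norm (w / xc\<^sup>2) < 1" "norm (w / xc) < 1"
    using w xx x by (simp_all add: norm_divide norm_power divide_less_eq)
  have le: "a * norm w < 1" if "0 \<le> a" "a \<le> 1" for a :: real
    using mult_right_mono[of a 1 "norm w"] that n1 by simp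
  have n3: "norm (Pc * w) < 1"
    using P x by (simp add: norm_mult) (intro le, auto)
  have n4: "norm (Pc * xc * w) < 1"
    using P x by (simp add: norm_mult) (intro le, auto intro: mult_le_one)
  have n5: "norm (Pc * xc\<^sup>2 * w) < 1"
    using P x by (simp add: norm_mult norm_power) (intro le, auto intro!: mult_le_one power_le_one)
  note ns = n1 n2 n3 n4 n5
  note qs = qlog_summable[OF ns(1)] qlog_summable[OF ns(2)] qlog_summable[OF ns(3)] qlog_summable[OF ns(4)]
     qlog_summable[OF ns(5)] qlog_summable[OF ns(6)]
  note qc = qs[THEN summable_norm_cancel]
  have eq: "(\<lambda>i. creation_coeff x v i * annihilation_coeff L x u i) = (\<lambda>i. - (qlog_term w i + qlog_term (w / xc\<^sup>2) i
        - qlog_term (w / xc) i - qlog_term (Pc * xc\<^sup>2 * w) i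
        - qlog_term (Pc * w) i + qlog_term (Pc * xc * w) i))"
    unfolding creation_annihilation w_def ..
  have S: "summable (\<lambda>i. norm (qlog_term w i) + norm (qlog_term (w / xc\<^sup>2) i)
        + norm (qlog_term (w / xc) i) + norm (qlog_term (Pc * xc\<^sup>2 * w) i)
        + norm (qlog_term (Pc * w) i) + norm (qlog_term (Pc * xc * w) i))"
    by (intro summable_add qs)
  have tri: "norm (- (a + b - c - d - e + f)) \<le> norm a + norm b + norm c + norm d + norm e + norm f" for a b c d e f :: complex
    by norm
  show "summable (\<lambda>i. norm (creation_coeff x v i * annihilation_coeff L x u i))"
    unfolding fun_cong[OF eq]
    by (rule summable_comparison_test[OF _ S]) (use tri in auto)
  define q where "q y = suminf (qlog_term y)" for y
  have "(\<lambda>i. creation_coeff x v i * annihilation_coeff L x u i) sums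
     - (q w + q (w / xc\<^sup>2) - q (w / xc) - q (Pc * xc\<^sup>2 * w) - q (Pc * w) + q (Pc * xc * w))"
    unfolding eq q_def by (intro sums_minus sums_add sums_diff summable_sums qc)
  from sums_unique[OF this, symmetric]
  have "exp (suminf (\<lambda>i. creation_coeff x v i * annihilation_coeff L x u i)) =
     exp ((- q w) + (- q (w / xc\<^sup>2)) - (- q (w / xc)) - (- q (Pc * xc\<^sup>2 * w)) - (- q (Pc * w)) + (- q (Pc * xc * w)))"
    by (simp only:) (rule arg_cong[where f=exp], simp)
  also have "\<dots> = qpoch Pc w * qpoch Pc (w / xc\<^sup>2) / qpoch Pc (w / xc) / qpoch Pc (Pc * xc\<^sup>2 * w) / qpoch Pc (Pc * w) * qpoch Pc (Pc * xc * w)"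
    unfolding exp_add exp_diff q_def ns[THEN qpoch_exp, symmetric] ..
  also have "qpoch Pc w = (1 - w) * qpoch Pc (Pc * w)" by (rule qpoch_rec)
  also have "(1 - w) * qpoch Pc (Pc * w) * qpoch Pc (w / xc\<^sup>2) / qpoch Pc (w / xc) / qpoch Pc (Pc * xc\<^sup>2 * w) / qpoch Pc (Pc * w) * qpoch Pc (Pc * xc * w) = contr w"
    using qpoch_nonzero[OF n3] by (simp add: contr_def)
  finally show "exp (suminf (\<lambda>i. creation_coeff x v i * annihilation_coeff L x u i)) = contr w" .
qed

lemma contraction_list:
  assumes "\<And>v. v \<in> set vs \<Longrightarrow> norm (zpow x (v - u) 1) < x\<^sup>2"
  shows "summable (\<lambda>i. norm ((\<Sum>v\<leftarrow>vs. creation_coeff x v i) * annihilation_coeff L x u i)) \<and>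
     exp (suminf (\<lambda>i. (\<Sum>v\<leftarrow>vs. creation_coeff x v i) * annihilation_coeff L x u i)) = (\<Prod>v\<leftarrow>vs. contr (zpow x (v - u) 1))"
  using assms
proof (induction vs)
  case (Cons v vs)
  let ?a = "\<lambda>i. creation_coeff x v i * annihilation_coeff L x u i"
  let ?b = "\<lambda>i. (\<Sum>v\<leftarrow>vs. creation_coeff x v i) * annihilation_coeff L x u i"
  have IH: "summable (\<lambda>i. norm (?b i))" "exp (suminf ?b) = (\<Prod>v\<leftarrow>vs. contr (zpow x (v - u) 1))"
    using Cons by auto
  have v: "norm (zpow x (v - u) 1) < x\<^sup>2" using Cons.prems by simp
  note c = contraction[OF v]
  have "summable (\<lambda>i. norm (?a i + ?b i))"
    by (rule summable_comparison_test[OF _ summable_add[OF c(1) IH(1)]]) (auto intro: norm_triangle_ineq)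
  moreover have "suminf (\<lambda>i. ?a i + ?b i) = suminf ?a + suminf ?b"
    by (rule suminf_add[symmetric]) (rule summable_norm_cancel, rule c IH)+
  ultimately show ?case by (simp add: distrib_right exp_add c IH)
qed simp

text \<open>The power of z is the zero-mode part: the current to the right has raised the momentum
  on which the current at u acts.\<close>

definition pair_factor :: "complex \<Rightarrow> complex \<Rightarrow> complex" where
  "pair_factor u v = zpow x u (rpar L / (rpar L - 1)) * contr (zpow x (v - u) 1)"

definition current_exponent :: "int \<Rightarrow> int \<Rightarrow> real" where
  "current_exponent l k = sqrt (rpar L / (rpar L - 1)) * momentum L l k + rpar L / (2 * (rpar L - 1))"

definition matrix_coeff :: "complex list \<Rightarrow> fock \<Rightarrow> mono \<Rightarrow> complex" where
  "matrix_coeff us \<phi> \<mu> = (\<Sum>\<pi>\<in>Poly_Mapping.keys \<phi>. Poly_Mapping.lookup \<phi> \<pi> *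
     mono_coeff (\<lambda>i. \<Sum>v\<leftarrow>us. creation_coeff x v i) (\<lambda>i. \<Sum>v\<leftarrow>us. annihilation_coeff L x v i) \<pi> \<mu>)"

fun vacuum_factor :: "int \<Rightarrow> int \<Rightarrow> complex list \<Rightarrow> complex" where
  "vacuum_factor l k [] = 1"
| "vacuum_factor l k (u # us) = zpow x u (current_exponent l k) * (\<Prod>v\<leftarrow>us. pair_factor u v) * vacuum_factor l k us"

lemma current_exponent_shift:
  "current_exponent (l - 2 * int n) k = current_exponent l k + real n * (rpar L / (rpar L - 1))"
proof -
  have "rpar L / (rpar L - 1) \<ge> 0" using rho_bounds by simp
  then have s: "sqrt (rpar L / (rpar L - 1)) * sqrt (rpar L / (rpar L - 1)) = rpar L / (rpar L - 1)" using real_sqrt_pow2 by (simp only: power2_eq_square)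
  have m: "momentum L (l - 2 * int n) k = momentum L l k + real n * sqrt (rpar L / (rpar L - 1))"
    by (simp add: momentum_def algebra_simps diff_divide_distrib)
  show ?thesis unfolding current_exponent_def m distrib_left using s by (simp add: mult_ac)
qed

lemma zpow_exponent_shift:
  "zpow x u (current_exponent (l - 2 * int n) k) = zpow x u (current_exponent l k) * zpow x u (rpar L / (rpar L - 1)) ^ n"
  unfolding current_exponent_shift zpow_exp exp_of_nat_mult[symmetric] exp_add[symmetric]
  by (rule arg_cong[where f=exp]) (simp add: algebra_simps)

text \<open>The sum over intermediate monomials is an instance of \<open>mono_coeff_sum\<close>. The
  coefficients of the currents add up, and the exponential becomes the product of the contractions
  of the new leftmost current with all others.\<close>

theorem xplus_prod_eq:
  assumes "sorted_wrt (\<lambda>u v. norm (zpow x (v - u) 1) < x\<^sup>2) us"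
  shows "xplus_prod L x l k us \<phi> \<mu> = vacuum_factor l k us * matrix_coeff us \<phi> \<mu>"
  using assms
proof (induction us arbitrary: \<mu>)
  case Nil
  have "matrix_coeff [] \<phi> \<mu> = (\<Sum>\<pi>\<in>Poly_Mapping.keys \<phi>. if \<mu> = \<pi> then Poly_Mapping.lookup \<phi> \<pi> else 0)"
    unfolding matrix_coeff_def by (intro sum.cong) (auto simp: mono_coeff_00)
  also have "\<dots> = Poly_Mapping.lookup \<phi> \<mu>" by (auto simp: sum.delta in_keys_iff)
  finally show ?case by simp
next
  case (Cons u us)
  let ?S = "\<lambda>i. \<Sum>v\<leftarrow>us. creation_coeff x v i" and ?t = "\<lambda>i. \<Sum>v\<leftarrow>us. annihilation_coeff L x v i"
  let ?s = "creation_coeff x u" and ?t' = "annihilation_coeff L x u"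
  let ?e = "zpow x u (current_exponent l k) * zpow x u (rpar L / (rpar L - 1)) ^ length us"
  let ?V = "vacuum_factor l k us" and ?lk = "Poly_Mapping.lookup \<phi>"
  have o: "\<And>v. v \<in> set us \<Longrightarrow> norm (zpow x (v - u) 1) < x\<^sup>2" using Cons.prems by simp
  note c = contraction_list[of us u, OF o]
  have IH: "xplus_prod L x l k us \<phi> \<nu> = ?V * matrix_coeff us \<phi> \<nu>" for \<nu>
    using Cons by simp
  have one: "((\<lambda>\<nu>. mono_coeff ?s ?t' \<nu> \<mu> * mono_coeff ?S ?t \<pi> \<nu>) has_sum
    ((\<Prod>v\<leftarrow>us. contr (zpow x (v - u) 1)) * mono_coeff (\<lambda>i. ?S i + ?s i) (\<lambda>i. ?t i + ?t' i) \<pi> \<mu>)) UNIV" for \<pi>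
    using mono_coeff_sum[of ?S ?t' ?s \<mu> ?t \<pi>] c by simp
  have "((\<lambda>\<nu>. \<Sum>\<pi>\<in>Poly_Mapping.keys \<phi>. ?e * ?V * ?lk \<pi> * (mono_coeff ?s ?t' \<nu> \<mu> * mono_coeff ?S ?t \<pi> \<nu>)) has_sum
     (\<Sum>\<pi>\<in>Poly_Mapping.keys \<phi>. ?e * ?V * ?lk \<pi> * ((\<Prod>v\<leftarrow>us. contr (zpow x (v - u) 1)) * mono_coeff (\<lambda>i. ?S i + ?s i) (\<lambda>i. ?t i + ?t' i) \<pi> \<mu>))) UNIV"
    by (intro has_sum_finite_sum has_sum_cmult_right one) simp
  moreover have "(\<Sum>\<pi>\<in>Poly_Mapping.keys \<phi>. ?e * ?V * ?lk \<pi> * (mono_coeff ?s ?t' \<nu> \<mu> * mono_coeff ?S ?t \<pi> \<nu>)) =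
     xplus L x (l - 2 * int (length us)) k u (Poly_Mapping.single \<nu> 1) \<mu> * xplus_prod L x l k us \<phi> \<nu>" for \<nu>
    unfolding xplus_single IH matrix_coeff_def current_exponent_def[symmetric] zpow_exponent_shift sum_distrib_left
    by (intro sum.cong) (simp_all add: mult_ac)
  ultimately have "xplus_prod L x l k (u # us) \<phi> \<mu> = (\<Sum>\<pi>\<in>Poly_Mapping.keys \<phi>. ?e * ?V * ?lk \<pi> *
     ((\<Prod>v\<leftarrow>us. contr (zpow x (v - u) 1)) * mono_coeff (\<lambda>i. ?S i + ?s i) (\<lambda>i. ?t i + ?t' i) \<pi> \<mu>))"
    by (simp add: infsumI)
  also have "\<dots> = ?e * ?V * (\<Prod>v\<leftarrow>us. contr (zpow x (v - u) 1)) * matrix_coeff (u # us) \<phi> \<mu>"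
    unfolding matrix_coeff_def sum_distrib_left by (intro sum.cong) (simp_all add: mult_ac add.commute)
  also have "(\<Prod>v\<leftarrow>us. pair_factor u v) = zpow x u (rpar L / (rpar L - 1)) ^ length us * (\<Prod>v\<leftarrow>us. contr (zpow x (v - u) 1))" for us
    by (induction us) (simp_all add: pair_factor_def mult_ac)
  then have "?e * ?V * (\<Prod>v\<leftarrow>us. contr (zpow x (v - u) 1)) = vacuum_factor l k (u # us)"
    by (simp add: mult_ac)
  finally show ?case .
qed

lemma vacuum_factor_upt:
  "vacuum_factor l k (map u [a..<b]) = (\<Prod>i\<in>{a..<b}. zpow x (u i) (current_exponent l k)) *
     (\<Prod>i\<in>{a..<b}. \<Prod>j\<in>{i<..<b}. pair_factor (u i) (u j))"
proof (induction "b - a" arbitrary: a)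
  case (Suc d)
  then have ab: "a < b" "d = b - Suc a" by simp_all
  have s: "{a..<b} = insert a {Suc a..<b}" using ab by auto
  have p: "(\<Prod>v\<leftarrow>map u [Suc a..<b]. pair_factor (u a) v) = (\<Prod>j\<in>{a<..<b}. pair_factor (u a) (u j))"
    by (simp add: o_def prod.distinct_set_conv_list[symmetric] atLeastSucLessThan_greaterThanLessThan)
  show ?case unfolding upt_conv_Cons[OF ab(1)] list.map vacuum_factor.simps p Suc(1)[OF ab(2)] s
    by (simp add: mult_ac)
qed simp

text \<open>The normally ordered part. It depends on the variables only through sums over all
  currents and is therefore symmetric.\<close>

definition matrix_fn :: "nat \<Rightarrow> fock \<Rightarrow> mono \<Rightarrow> (nat \<Rightarrow> complex) \<Rightarrow> complex" where
  "matrix_fn n \<phi> \<mu> u = (\<Sum>\<pi>\<in>Poly_Mapping.keys \<phi>. Poly_Mapping.lookup \<phi> \<pi> *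
     mono_coeff (\<lambda>i. \<Sum>j<n. creation_coeff x (u j) i) (\<lambda>i. \<Sum>j<n. annihilation_coeff L x (u j) i) \<pi> \<mu>)"

lemma matrix_coeff_map: "matrix_coeff (map u [0..<n]) \<phi> \<mu> = matrix_fn n \<phi> \<mu> u"
  by (simp add: matrix_coeff_def matrix_fn_def o_def interv_sum_list_conv_sum_set_nat atLeast0LessThan)

corollary xplus_prod_map:
  assumes "\<And>i j. i < j \<Longrightarrow> j < n \<Longrightarrow> norm (zpow x (u j - u i) 1) < x\<^sup>2"
  shows "xplus_prod L x l k (map u [0..<n]) \<phi> \<mu> = (\<Prod>i<n. zpow x (u i) (current_exponent l k)) *
     (\<Prod>i<n. \<Prod>j\<in>{i<..<n}. pair_factor (u i) (u j)) * matrix_fn n \<phi> \<mu> u"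
proof -
  have "sorted_wrt (\<lambda>u v. norm (zpow x (v - u) 1) < x\<^sup>2) (map u [0..<n])"
    using assms by (simp add: sorted_wrt_iff_nth_less)
  from xplus_prod_eq[OF this, of l k \<phi> \<mu>] show ?thesis
    by (simp add: vacuum_factor_upt matrix_coeff_map atLeast0LessThan)
qed

end

section \<open>Meromorphic continuation\<close>

lemma entire_const [intro]: "entire n (\<lambda>_. c)"
  by (auto simp: entire_def)

lemma entire_coord [intro]: "i < n \<Longrightarrow> entire n (\<lambda>u. u i)"
proof -
  have "(\<lambda>w. (u(j := w)) i) holomorphic_on UNIV" for u :: "nat \<Rightarrow> complex" and j
    by (cases "i = j") (auto intro!: holomorphic_intros)
  then show "i < n \<Longrightarrow> entire n (\<lambda>u. u i)" by (auto simp: entire_def)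
qed

lemma entire_add [intro]: "entire n f \<Longrightarrow> entire n g \<Longrightarrow> entire n (\<lambda>u. f u + g u)"
  unfolding entire_def by (intro conjI allI impI continuous_intros holomorphic_intros) metis+

lemma entire_mult [intro]: "entire n f \<Longrightarrow> entire n g \<Longrightarrow> entire n (\<lambda>u. f u * g u)"
  unfolding entire_def by (intro conjI allI impI continuous_intros holomorphic_intros) metis+

lemma entire_diff [intro]: "entire n f \<Longrightarrow> entire n g \<Longrightarrow> entire n (\<lambda>u. f u - g u)"
  using entire_add[of n f "\<lambda>u. - 1 * g u"] entire_mult[OF entire_const, of n g "- 1"] by simp

lemma entire_sum [intro]: "(\<And>i. i \<in> A \<Longrightarrow> entire n (f i)) \<Longrightarrow> entire n (\<lambda>u. \<Sum>i\<in>A. f i u)"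
  by (induction A rule: infinite_finite_induct) auto

lemma entire_prod [intro]: "(\<And>i. i \<in> A \<Longrightarrow> entire n (f i)) \<Longrightarrow> entire n (\<lambda>u. \<Prod>i\<in>A. f i u)"
  by (induction A rule: infinite_finite_induct) auto

lemma entire_power [intro]: "entire n f \<Longrightarrow> entire n (\<lambda>u. f u ^ k)"
  by (induction k) auto

lemma entire_compose:
  assumes F: "F holomorphic_on UNIV" and f: "entire n f"
  shows "entire n (\<lambda>u. F (f u))"
  unfolding entire_def
proof (intro conjI allI impI)
  show "F (f u) = F (f v)" if "\<forall>i<n. u i = v i" for u v
    using f that unfolding entire_def by metis
  show "continuous_on UNIV (\<lambda>u. F (f u))"
    using continuous_on_compose2[OF holomorphic_on_imp_continuous_on[OF F]] f unfolding entire_def by blast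
  show "(\<lambda>w. F (f (u(i := w)))) holomorphic_on UNIV" if "i < n" for u i
    using holomorphic_on_compose[of "\<lambda>w. f (u(i := w))" UNIV F] f that holomorphic_on_subset[OF F]
    unfolding entire_def o_def by blast
qed

lemma entire_mode_coeff:
  assumes "entire n S" "entire n t"
  shows "entire n (\<lambda>u. mode_coeff (S u) (t u) p k)"
  unfolding mode_coeff_closed divide_inverse
  by (intro entire_sum entire_mult entire_power entire_const assms)

lemma entire_mono_coeff:
  assumes "\<And>i. entire n (\<lambda>u. S u i)" "\<And>i. entire n (\<lambda>u. t u i)"
  shows "entire n (\<lambda>u. mono_coeff (S u) (t u) \<pi> \<mu>)"
  unfolding mono_coeff_def using assms by (intro entire_prod entire_mode_coeff)

context brst_parameters
begin

lemma norm_zpow_pos: "norm (zpow x u s) > 0"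
  using zpow_nz by simp

text \<open>The ordering constraints are removed one variable at a time, from the last one: that
  variable ranges over the nonempty open set of sufficiently small z, and the identity theorem in it
  alone removes its constraint.\<close>

lemma entire_zero:
  assumes D: "entire n D" and R: "R > 0" and zero: "\<And>u. u \<in> ordered_region n x R \<Longrightarrow> D u = 0"
  shows "D u = 0"
proof -
  have "\<forall>u. (\<forall>i. Suc i < n - d \<longrightarrow> norm (zpow x (u i) 1) > R * norm (zpow x (u (Suc i)) 1)) \<longrightarrow> D u = 0" if "d \<le> n" for d
    using that
  proof (induction d)
    case 0
    then show ?case using zero by (simp add: ordered_region_def)
  next
    case (Suc d)
    define m where "m = n - Suc d"
    have m: "n - d = Suc m" "m < n" using Suc.prems by (simp_all add: m_def)
    have IH: "D u = 0" if "\<And>i. Suc i < Suc m \<Longrightarrow> norm (zpow x (u i) 1) > R * norm (zpow x (u (Suc i)) 1)" for u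
      using Suc that by (simp add: m)
    show ?case unfolding m_def[symmetric]
    proof (intro allI impI)
      fix u assume u: "\<forall>i. Suc i < m \<longrightarrow> norm (zpow x (u i) 1) > R * norm (zpow x (u (Suc i)) 1)"
      \<comment> \<open>For m = 0 no constraint is left, and any positive bound serves.\<close>
      define a where "a = (if m = 0 then 1 else norm (zpow x (u (m - 1)) 1))"
      have a: "a > 0" using norm_zpow_pos by (simp add: a_def)
      define U where "U = {w. R * norm (zpow x w 1) < a}"
      have "continuous_on UNIV (\<lambda>w. zpow x w 1)"
        by (intro holomorphic_on_imp_continuous_on zpow_hol holomorphic_intros)
      then have "open U" unfolding U_def by (intro open_Collect_less continuous_intros)
      have "zpow x (of_real (ln (a / (2 * R)) / (2 * ln x))) 1 = of_real (a / (2 * R))"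
      proof -
        have "2 * of_real (ln x) * of_real (ln (a / (2 * R)) / (2 * ln x)) * of_real 1 = complex_of_real (ln (a / (2 * R)))"
          using ln_x by simp
        then show ?thesis unfolding zpow_exp using a R by (simp only: exp_of_real) simp
      qed
      then have "of_real (ln (a / (2 * R)) / (2 * ln x)) \<in> U"
        unfolding U_def using a R by (simp add: norm_mult norm_divide)
      then have ne: "U \<noteq> {}" by blast
      have U0: "D (u(m := w)) = 0" if w: "w \<in> U" for w
      proof (rule IH)
        fix i assume i: "Suc i < Suc m"
        show "norm (zpow x ((u(m := w)) i) 1) > R * norm (zpow x ((u(m := w)) (Suc i)) 1)"
        proof (cases "Suc i = m")
          case True
          then show ?thesis using w by (auto simp: U_def a_def)
        next
          case False
          then show ?thesis using u i by simp
        qed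
      qed
      have "D (u(m := u m)) = 0"
      proof (rule analytic_continuation_open[of U UNIV "\<lambda>w. D (u(m := w))" "\<lambda>_. 0"])
        show "(\<lambda>w. D (u(m := w))) holomorphic_on UNIV" using D m by (simp add: entire_def)
      qed (use \<open>open U\<close> ne U0 in auto)
      then show "D u = 0" by simp
    qed
  qed
  from this[of n] show ?thesis by simp
qed

lemma ordered_region_mono: "R \<le> R' \<Longrightarrow> ordered_region n x R' \<subseteq> ordered_region n x R"
  unfolding ordered_region_def by (auto intro: le_less_trans[OF mult_right_mono])

text \<open>Two representations g / h and g' / h' agree on a common ordered region, so the entire
  function g' h - g h' vanishes there and hence everywhere. This makes the described value
  unique.\<close>

lemma mero_cont_eq:
  assumes R: "R > 0" and g: "entire n g" and h: "entire n h"
    and eq: "\<And>u. u \<in> ordered_region n x R \<Longrightarrow> h u * f u = g u" and h0: "h u0 \<noteq> 0"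
  shows "mero_cont n x f u0 = g u0 / h u0"
  unfolding mero_cont_def
proof (rule the_equality)
  show "\<exists>R>0. \<exists>g' h'. entire n g' \<and> entire n h' \<and> (\<forall>u\<in>ordered_region n x R. h' u * f u = g' u) \<and> h' u0 \<noteq> 0 \<and> g u0 / h u0 = g' u0 / h' u0"
    using assms by blast
next
  fix c assume "\<exists>R>0. \<exists>g h. entire n g \<and> entire n h \<and> (\<forall>u\<in>ordered_region n x R. h u * f u = g u) \<and> h u0 \<noteq> 0 \<and> c = g u0 / h u0"
  then obtain R' g' h' where *: "R' > 0" "entire n g'" "entire n h'"
    "\<And>u. u \<in> ordered_region n x R' \<Longrightarrow> h' u * f u = g' u" "h' u0 \<noteq> 0" "c = g' u0 / h' u0" by blast
  have "g' u0 * h u0 - g u0 * h' u0 = 0"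
  proof (rule entire_zero[of n "\<lambda>u. g' u * h u - g u * h' u" "max R R'"])
    fix u assume u: "u \<in> ordered_region n x (max R R')"
    then have "u \<in> ordered_region n x R" "u \<in> ordered_region n x R'"
      using ordered_region_mono[of R "max R R'"] ordered_region_mono[of R' "max R R'"] by auto
    then have "h u * f u = g u" "h' u * f u = g' u" using eq *(4) by auto
    then show "g' u * h u - g u * h' u = 0" by (metis mult.assoc mult.commute right_minus_eq)
  qed (use R * g h in auto)
  then show "c = g u0 / h u0" using h0 *(5) unfolding *(6) by (simp add: frac_eq_eq mult.commute)
qed

lemma zpow_entire: "entire n f \<Longrightarrow> entire n (\<lambda>u. zpow x (f u) s)"
  by (rule entire_compose[of "\<lambda>v. zpow x v s"]) (intro zpow_hol holomorphic_intros)

lemma qpoch_entire: "entire n f \<Longrightarrow> entire n (\<lambda>u. qpoch Pc (f u))"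
  by (rule entire_compose[OF qpoch_hol])

lemma matrix_fn_entire: "entire n (matrix_fn n \<phi> \<mu>)"
  unfolding matrix_fn_def[abs_def] creation_coeff_def annihilation_coeff_def divide_inverse minus_mult_left
  by (intro entire_sum entire_mult entire_const entire_mono_coeff zpow_entire entire_coord) auto

lemma zpow_diff_norm: "norm (zpow x (v - u) 1) = norm (zpow x v 1) / norm (zpow x u 1)"
  using zpow_add[of v "- u" 1] by (simp add: zpow_minus norm_divide)

lemma ordered_region_lt:
  assumes u: "u \<in> ordered_region n x (1 / x\<^sup>2)" and "i < j" "j < n"
  shows "norm (zpow x (u j - u i) 1) < x\<^sup>2"
proof -
  have "norm (zpow x (u j) 1) < x\<^sup>2 * norm (zpow x (u i) 1)"
    using assms(2,3)
  proof (induction j)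
    case (Suc j)
    have 1: "norm (zpow x (u (Suc j)) 1) < x\<^sup>2 * norm (zpow x (u j) 1)"
      using u Suc.prems x by (simp add: ordered_region_def field_simps)
    show ?case
    proof (cases "i = j")
      case False
      then have "norm (zpow x (u j) 1) < x\<^sup>2 * norm (zpow x (u i) 1)" using Suc by simp
      moreover have "x\<^sup>2 * norm (zpow x (u i) 1) \<le> 1 * norm (zpow x (u i) 1)"
        using x by (intro mult_right_mono) (simp_all add: power_le_one)
      ultimately have "norm (zpow x (u j) 1) \<le> norm (zpow x (u i) 1)" by simp
      then have "x\<^sup>2 * norm (zpow x (u j) 1) \<le> x\<^sup>2 * norm (zpow x (u i) 1)" by (intro mult_left_mono) auto
      then show ?thesis using 1 by simp
    qed (use 1 in simp)
  qed simp
  then show ?thesis using norm_zpow_pos[of "u i" 1] by (simp add: zpow_diff_norm divide_less_eq)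
qed

definition contr_denom :: "complex \<Rightarrow> complex" where
  "contr_denom w = qpoch Pc (w / xc) * qpoch Pc (Pc * xc\<^sup>2 * w)"

text \<open>On the unit circle a zero of the first product would need P'^n = x, that is 2 n L = L +
  2, which is impossible for odd L. The argument of the second product lies inside the unit
  disc.\<close>

lemma contr_denom_nz:
  assumes "norm w < x \<or> norm w = 1"
  shows "qpoch Pc (w / xc) \<noteq> 0" "qpoch Pc (Pc * xc\<^sup>2 * w) \<noteq> 0"
proof -
  note P = nome_bounds
  have w: "norm w \<le> 1" using assms x by auto
  have "x powr (2 * rpar L - 2) * x\<^sup>2 < 1 * 1"
    using P x by (intro mult_strict_mono) (auto simp: power_less_one_iff)
  moreover have "x powr (2 * rpar L - 2) * x\<^sup>2 * norm w \<le> x powr (2 * rpar L - 2) * x\<^sup>2 * 1"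
    using w by (intro mult_left_mono) auto
  ultimately have "x powr (2 * rpar L - 2) * x\<^sup>2 * norm w < 1" by linarith
  then have "norm (Pc * xc\<^sup>2 * w) < 1"
    using x by (simp add: norm_mult norm_power)
  then show "qpoch Pc (Pc * xc\<^sup>2 * w) \<noteq> 0" by (rule qpoch_nonzero)
  show "qpoch Pc (w / xc) \<noteq> 0"
    using assms
  proof
    assume "norm w < x"
    then show ?thesis using x by (intro qpoch_nonzero) (simp add: norm_divide)
  next
    assume w1: "norm w = 1"
    show ?thesis
    proof
      assume "qpoch Pc (w / xc) = 0"
      then obtain n where "Pc ^ n * (w / xc) = 1" using qpoch_eq_0_iff by blast
      then have "norm (Pc ^ n * (w / xc)) = 1" by simp
      then have "(x powr (2 * rpar L - 2)) ^ n = x" using x w1 by (simp add: norm_mult norm_power norm_divide)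
      then have "x powr (real n * (2 * rpar L - 2)) = x powr 1" using x by (simp add: powr_power)
      then have "real n * (2 * rpar L - 2) = 1" by (subst (asm) powr_inj) (use x in auto)
      then have "2 * real n * (rpar L - 1) = 1" by (simp add: algebra_simps)
      then have "2 * real n * real L = real L + 2" unfolding rho_eq by (simp add: field_simps)
      then have "real (2 * n * L) = real (L + 2)" by simp
      then have "2 * n * L = L + 2" by (simp only: of_nat_eq_iff)
      then have "even (L + 2)" by (metis dvd_triv_left mult.assoc)
      then show False using L by simp
    qed
  qed
qed

text \<open>One quotient of entire functions serves in both places: it equals the product of
  currents in the ordered region, and its denominator has no zero on the unit torus, where it is
  evaluated.\<close>

theorem mero_cont_currents:
  assumes u0: "\<And>i. i < n \<Longrightarrow> norm (zpow x (u0 i) 1) = 1"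
  shows "mero_cont n x (\<lambda>u. xplus_prod L x l k (map u [0..<n]) \<phi> \<mu>) u0 =
    (\<Prod>i<n. zpow x (u0 i) (current_exponent l k)) *
     (\<Prod>i<n. \<Prod>j\<in>{i<..<n}. pair_factor (u0 i) (u0 j)) * matrix_fn n \<phi> \<mu> u0"
proof -
  let ?w = "\<lambda>u i j. zpow x (u j - u i) 1"
  define num where "num a w = zpow x a (rpar L / (rpar L - 1)) * ((1 - w) * qpoch Pc (w / xc\<^sup>2) * qpoch Pc (Pc * xc * w))" for a w
  define h where "h u = (\<Prod>i<n. \<Prod>j\<in>{i<..<n}. contr_denom (?w u i j))" for u
  define g where "g u = (\<Prod>i<n. zpow x (u i) (current_exponent l k)) *
     (\<Prod>i<n. \<Prod>j\<in>{i<..<n}. num (u i) (?w u i j)) * matrix_fn n \<phi> \<mu> u" for u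
  have cd: "contr_denom w \<noteq> 0" if "norm w < x \<or> norm w = 1" for w
    using contr_denom_nz[OF that] by (simp add: contr_denom_def)
  have pf: "num (u i) (?w u i j) = contr_denom (?w u i j) * pair_factor (u i) (u j)"
    if "norm (?w u i j) < x \<or> norm (?w u i j) = 1" for u i j
    using contr_denom_nz[OF that] by (simp add: num_def pair_factor_def contr_def contr_denom_def)
  have gh: "g u = h u * ((\<Prod>i<n. zpow x (u i) (current_exponent l k)) *
     (\<Prod>i<n. \<Prod>j\<in>{i<..<n}. pair_factor (u i) (u j)) * matrix_fn n \<phi> \<mu> u)" "h u \<noteq> 0"
    if *: "\<And>i j. i < j \<Longrightarrow> j < n \<Longrightarrow> norm (?w u i j) < x \<or> norm (?w u i j) = 1" for u
  proof -
    have "(\<Prod>i<n. \<Prod>j\<in>{i<..<n}. num (u i) (?w u i j)) = (\<Prod>i<n. \<Prod>j\<in>{i<..<n}. contr_denom (?w u i j) * pair_factor (u i) (u j))"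
      by (intro prod.cong refl pf *) auto
    then show "g u = h u * ((\<Prod>i<n. zpow x (u i) (current_exponent l k)) *
     (\<Prod>i<n. \<Prod>j\<in>{i<..<n}. pair_factor (u i) (u j)) * matrix_fn n \<phi> \<mu> u)"
      unfolding g_def h_def by (simp add: prod.distrib mult_ac)
    show "h u \<noteq> 0" unfolding h_def using * cd by auto
  qed
  have "mero_cont n x (\<lambda>u. xplus_prod L x l k (map u [0..<n]) \<phi> \<mu>) u0 = g u0 / h u0"
  proof (rule mero_cont_eq[of "1 / x\<^sup>2"])
    show "entire n g" unfolding g_def num_def
      by (intro entire_mult entire_prod entire_const entire_diff zpow_entire qpoch_entire entire_coord matrix_fn_entire)
         (auto simp: divide_inverse intro!: entire_mult entire_diff zpow_entire)
    show "entire n h" unfolding h_def contr_denom_def divide_inverse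
      by (intro entire_mult entire_prod entire_const entire_diff zpow_entire qpoch_entire entire_coord) auto
    show "h u * xplus_prod L x l k (map u [0..<n]) \<phi> \<mu> = g u" if u: "u \<in> ordered_region n x (1 / x\<^sup>2)" for u
    proof -
      note lt = ordered_region_lt[OF u]
      have "norm (?w u i j) < x" if "i < j" "j < n" for i j
        using lt[OF that] x power2_eq_square[of x] by (smt (verit) mult_left_le_one_le)
      then have "g u = h u * ((\<Prod>i<n. zpow x (u i) (current_exponent l k)) *
         (\<Prod>i<n. \<Prod>j\<in>{i<..<n}. pair_factor (u i) (u j)) * matrix_fn n \<phi> \<mu> u)"
        by (intro gh) auto
      also have "(\<Prod>i<n. zpow x (u i) (current_exponent l k)) *
         (\<Prod>i<n. \<Prod>j\<in>{i<..<n}. pair_factor (u i) (u j)) * matrix_fn n \<phi> \<mu> u = xplus_prod L x l k (map u [0..<n]) \<phi> \<mu>"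
        using xplus_prod_map[OF lt] by simp
      finally show ?thesis by simp
    qed
    show "h u0 \<noteq> 0" using u0 by (intro gh) (auto simp: zpow_diff_norm)
  qed (use x in auto)
  also have "g u0 = h u0 * ((\<Prod>i<n. zpow x (u0 i) (current_exponent l k)) *
     (\<Prod>i<n. \<Prod>j\<in>{i<..<n}. pair_factor (u0 i) (u0 j)) * matrix_fn n \<phi> \<mu> u0)"
    using u0 by (intro gh) (auto simp: zpow_diff_norm)
  finally show ?thesis using gh(2)[of u0] u0 by (auto simp: zpow_diff_norm)
qed

end

section \<open>Symmetrisation of the integral\<close>

text \<open>Sorting the images of the pairs i < j costs a sign for each inversion. The transposition
  of a < b inverts the pairs (a, j) with a < j \<le> b and (i, b) with a < i < b, an odd
  number.\<close>

lemma prod_pairs_transpose: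
  fixes G :: "nat \<Rightarrow> nat \<Rightarrow> complex"
  assumes G: "\<And>i j. i < n \<Longrightarrow> j < n \<Longrightarrow> i \<noteq> j \<Longrightarrow> G j i = - G i j" and ab: "a < b" "b < n"
  defines "\<tau> \<equiv> Transposition.transpose a b"
  shows "(\<Prod>i<n. \<Prod>j\<in>{i<..<n}. G (\<tau> i) (\<tau> j)) = - (\<Prod>i<n. \<Prod>j\<in>{i<..<n}. G i j)"
proof -
  define T where "T = Sigma {..<n} (\<lambda>i. {i<..<n})"
  have fin: "finite T" by (simp add: T_def)
  have \<tau>_lt: "\<tau> i < n" if "i < n" for i using ab that by (auto simp: \<tau>_def Transposition.transpose_def)
  have \<tau>\<tau>: "\<tau> (\<tau> i) = i" for i by (simp add: \<tau>_def)
  have \<tau>_inj: "\<tau> i = \<tau> j \<longleftrightarrow> i = j" for i j using \<tau>\<tau> by metis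
  define m where "m = (\<lambda>(i,j). (min (\<tau> i) (\<tau> j), max (\<tau> i) (\<tau> j)))"
  have mT: "m p \<in> T" if p: "p \<in> T" for p
  proof -
    obtain i j where ij: "p = (i, j)" "i < j" "j < n" using p by (auto simp: T_def)
    then have "\<tau> i \<noteq> \<tau> j" "\<tau> i < n" "\<tau> j < n" using \<tau>_lt \<tau>_inj by auto
    then show ?thesis using ij by (auto simp: m_def T_def)
  qed
  have mm: "m (m p) = p" if "p \<in> T" for p
    using that by (auto simp: m_def T_def min_def max_def \<tau>\<tau>)
  have bij: "bij_betw m T T"
    by (rule bij_betw_byWitness[of T m m]) (use mT mm in auto)
  have "(\<Prod>i<n. \<Prod>j\<in>{i<..<n}. G (\<tau> i) (\<tau> j)) = (\<Prod>p\<in>T. G (\<tau> (fst p)) (\<tau> (snd p)))"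
    unfolding T_def by (subst prod.Sigma) (auto simp: case_prod_unfold)
  also have "\<dots> = (\<Prod>p\<in>T. (if \<tau> (snd p) < \<tau> (fst p) then - 1 else 1) * (case m p of (i, j) \<Rightarrow> G i j))"
  proof (rule prod.cong[OF refl])
    fix p assume p: "p \<in> T"
    then have "\<tau> (fst p) < n" "\<tau> (snd p) < n" "\<tau> (fst p) \<noteq> \<tau> (snd p)" using \<tau>_lt \<tau>_inj by (auto simp: T_def)
    then show "G (\<tau> (fst p)) (\<tau> (snd p)) = (if \<tau> (snd p) < \<tau> (fst p) then - 1 else 1) * (case m p of (i, j) \<Rightarrow> G i j)"
      using G[of "\<tau> (snd p)" "\<tau> (fst p)"] by (auto simp: m_def case_prod_unfold min_def max_def)
  qed
  also have "\<dots> = (\<Prod>p\<in>T. if \<tau> (snd p) < \<tau> (fst p) then - 1 else 1) * (\<Prod>p\<in>T. case m p of (i, j) \<Rightarrow> G i j)"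
    by (rule prod.distrib)
  also have "(\<Prod>p\<in>T. case m p of (i, j) \<Rightarrow> G i j) = (\<Prod>p\<in>T. case p of (i, j) \<Rightarrow> G i j)"
    by (rule prod.reindex_bij_betw[OF bij])
  also have "\<dots> = (\<Prod>i<n. \<Prod>j\<in>{i<..<n}. G i j)"
    unfolding T_def by (subst prod.Sigma) auto
  also have "(\<Prod>p\<in>T. if \<tau> (snd p) < \<tau> (fst p) then - 1 else 1 :: complex) = (- 1) ^ card {p\<in>T. \<tau> (snd p) < \<tau> (fst p)}"
    using fin by (subst prod.If_cases) (auto simp: Int_def)
  also have "{p\<in>T. \<tau> (snd p) < \<tau> (fst p)} = Pair a ` {a<..b} \<union> (\<lambda>i. (i, b)) ` {a<..<b}"
    using ab by (auto simp: T_def \<tau>_def Transposition.transpose_def split: if_splits)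
  also have "card \<dots> = card (Pair a ` {a<..b}) + card ((\<lambda>i. (i, b)) ` {a<..<b})"
    by (rule card_Un_disjoint) auto
  also have "\<dots> = Suc (2 * (b - Suc a))"
    using ab by (subst (1 2) card_image) (auto simp: inj_on_def)
  finally show ?thesis by simp
qed

lemma prod_pairs_permute:
  fixes G :: "nat \<Rightarrow> nat \<Rightarrow> complex"
  assumes G: "\<And>i j. i < n \<Longrightarrow> j < n \<Longrightarrow> i \<noteq> j \<Longrightarrow> G j i = - G i j" and p: "p permutes {..<n}"
  shows "(\<Prod>i<n. \<Prod>j\<in>{i<..<n}. G (p i) (p j)) = of_int (sign p) * (\<Prod>i<n. \<Prod>j\<in>{i<..<n}. G i j)"
  using finite_lessThan p
proof (induction p rule: permutes_rev_induct)
  case id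
  then show ?case by simp
next
  case (swap a b p)
  have main: "(\<Prod>i<n. \<Prod>j\<in>{i<..<n}. G ((p \<circ> Transposition.transpose a b) i) ((p \<circ> Transposition.transpose a b) j)) =
     - (\<Prod>i<n. \<Prod>j\<in>{i<..<n}. G (p i) (p j))" if "a < b" "b < n" for a b
    unfolding o_def
  proof (rule prod_pairs_transpose[where G = "\<lambda>i j. G (p i) (p j)"])
    fix i j assume "i < n" "j < n" "i \<noteq> j"
    then show "G (p j) (p i) = - G (p i) (p j)"
      using G[of "p i" "p j"] permutes_in_image[OF swap(4)] permutes_inj[OF swap(4)] by (auto dest: injD)
  qed (use that in auto)
  have "(\<Prod>i<n. \<Prod>j\<in>{i<..<n}. G ((p \<circ> Transposition.transpose a b) i) ((p \<circ> Transposition.transpose a b) j)) =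
     - (\<Prod>i<n. \<Prod>j\<in>{i<..<n}. G (p i) (p j))"
    using main[of a b] main[of b a] swap(1,2,3) by (cases "a < b") (auto simp: transpose_commute[of a b])
  moreover have "sign (p \<circ> Transposition.transpose a b) = - sign p"
    using swap(3) permutation_permutes[THEN iffD2, OF exI, of "{..<n}" p] swap(4)
    by (subst sign_compose) (auto simp: sign_swap_id permutation_swap_id)
  ultimately show ?case by (simp only: swap(5)) simp
qed

lemma prod_pairs_add:
  fixes F :: "nat \<Rightarrow> nat \<Rightarrow> complex"
  shows "(\<Prod>i<k + m. \<Prod>j\<in>{i<..<k + m}. F i j) = (\<Prod>i<k. \<Prod>j\<in>{i<..<k}. F i j) * (\<Prod>i<k. \<Prod>j<m. F i (k + j)) *
     (\<Prod>i<m. \<Prod>j\<in>{i<..<m}. F (k + i) (k + j))"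
proof -
  have shift: "(\<Prod>j\<in>{k + i..<k + m}. g j) = (\<Prod>j\<in>{i..<m}. g (k + j))" for g :: "nat \<Rightarrow> complex" and i
    using prod.shift_bounds_nat_ivl[of g i k m] by (simp add: add.commute)
  have "(\<Prod>i<k + m. \<Prod>j\<in>{i<..<k + m}. F i j) = (\<Prod>i<k. \<Prod>j\<in>{i<..<k + m}. F i j) * (\<Prod>i<m. \<Prod>j\<in>{k + i<..<k + m}. F (k + i) j)"
    using prod.atLeastLessThan_concat[of 0 k "k + m" "\<lambda>i. \<Prod>j\<in>{i<..<k + m}. F i j", symmetric] shift[of _ 0]
    by (simp add: atLeast0LessThan)
  also have "(\<Prod>i<m. \<Prod>j\<in>{k + i<..<k + m}. F (k + i) j) = (\<Prod>i<m. \<Prod>j\<in>{i<..<m}. F (k + i) (k + j))"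
    using shift[of _ "Suc _"] by (simp add: atLeastSucLessThan_greaterThanLessThan[symmetric])
  also have "(\<Prod>i<k. \<Prod>j\<in>{i<..<k + m}. F i j) = (\<Prod>i<k. (\<Prod>j\<in>{i<..<k}. F i j) * (\<Prod>j<m. F i (k + j)))"
  proof (rule prod.cong[OF refl])
    fix i assume "i \<in> {..<k}"
    then show "(\<Prod>j\<in>{i<..<k + m}. F i j) = (\<Prod>j\<in>{i<..<k}. F i j) * (\<Prod>j<m. F i (k + j))"
      using prod.atLeastLessThan_concat[of "Suc i" k "k + m" "F i", symmetric] shift[of "F i" 0]
      by (simp add: atLeast0LessThan atLeastSucLessThan_greaterThanLessThan)
  qed
  finally show ?thesis by (simp add: prod.distrib)
qed

text \<open>The product measure is determined by its values on boxes, and permuting the sides of a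
  box does not change them.\<close>

lemma distr_PiM_permute:
  fixes n :: nat
  assumes s: "\<sigma> permutes {..<n}"
  defines "M \<equiv> Pi\<^sub>M {..<n} (\<lambda>_. lborel :: real measure)"
  shows "(\<lambda>t. t \<circ> \<sigma>) \<in> measurable M M" "distr M M (\<lambda>t. t \<circ> \<sigma>) = M"
proof -
  interpret P: product_sigma_finite "\<lambda>_::nat. lborel :: real measure" ..
  have \<sigma>i: "\<sigma> i < n \<longleftrightarrow> i < n" for i using permutes_in_image[OF s] by simp
  have \<sigma>o: "\<not> i < n \<Longrightarrow> \<sigma> i = i" for i using s by (simp add: permutes_not_in)
  have "(\<lambda>t i. t (\<sigma> i)) \<in> measurable M M" unfolding M_def
    by (rule measurable_PiM_single')
       (auto simp: space_PiM PiE_def extensional_def \<sigma>o intro!: measurable_component_singleton simp: \<sigma>i)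
  then show meas: "(\<lambda>t. t \<circ> \<sigma>) \<in> measurable M M" by (simp add: o_def[abs_def])
  have boxes: "emeasure (distr M M (\<lambda>t. t \<circ> \<sigma>)) (Pi\<^sub>E {..<n} A) = (\<Prod>i<n. emeasure lborel (A i))"
    if A: "\<And>i. i \<in> {..<n} \<Longrightarrow> A i \<in> sets lborel" for A :: "nat \<Rightarrow> real set"
  proof -
    have inv: "inv \<sigma> permutes {..<n}" by (rule permutes_inv[OF s])
    have "(\<lambda>t. t \<circ> \<sigma>) -` Pi\<^sub>E {..<n} A \<inter> space M = Pi\<^sub>E {..<n} (\<lambda>i. A (inv \<sigma> i))"
    proof (intro equalityI subsetI)
      fix t assume "t \<in> (\<lambda>t. t \<circ> \<sigma>) -` Pi\<^sub>E {..<n} A \<inter> space M"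
      then have t: "t \<circ> \<sigma> \<in> Pi\<^sub>E {..<n} A" "t \<in> space M" by auto
      show "t \<in> Pi\<^sub>E {..<n} (\<lambda>i. A (inv \<sigma> i))"
      proof (rule PiE_I)
        fix i assume "i \<in> {..<n}"
        then have "inv \<sigma> i \<in> {..<n}" using permutes_in_image[OF inv] by simp
        then have "(t \<circ> \<sigma>) (inv \<sigma> i) \<in> A (inv \<sigma> i)" using t(1) by blast
        then show "t i \<in> A (inv \<sigma> i)" by (simp add: permutes_inverses(1)[OF s])
      qed (use t(2) in \<open>auto simp: M_def space_PiM PiE_def extensional_def\<close>)
    next
      fix t assume t: "t \<in> Pi\<^sub>E {..<n} (\<lambda>i. A (inv \<sigma> i))"
      have "t \<circ> \<sigma> \<in> Pi\<^sub>E {..<n} A"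
      proof (rule PiE_I)
        fix i assume "i \<in> {..<n}"
        then have "t (\<sigma> i) \<in> A (inv \<sigma> (\<sigma> i))" using t \<sigma>i by blast
        then show "(t \<circ> \<sigma>) i \<in> A i" by (simp add: permutes_inverses(2)[OF s])
      qed (use t \<sigma>o in \<open>auto simp: PiE_def extensional_def\<close>)
      moreover have "t \<in> space M" using t by (auto simp: M_def space_PiM PiE_def)
      ultimately show "t \<in> (\<lambda>t. t \<circ> \<sigma>) -` Pi\<^sub>E {..<n} A \<inter> space M" by simp
    qed
    moreover have "Pi\<^sub>E {..<n} A \<in> sets M" unfolding M_def using A by (intro sets_PiM_I_finite) auto
    ultimately have "emeasure (distr M M (\<lambda>t. t \<circ> \<sigma>)) (Pi\<^sub>E {..<n} A) = emeasure M (Pi\<^sub>E {..<n} (\<lambda>i. A (inv \<sigma> i)))"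
      using meas by (simp add: emeasure_distr)
    also have "\<dots> = (\<Prod>i<n. emeasure lborel (A (inv \<sigma> i)))"
      unfolding M_def using A permutes_in_image[OF inv] by (intro P.emeasure_PiM) auto
    also have "\<dots> = (\<Prod>i<n. emeasure lborel (A i))"
      using prod.permute[OF inv, of "\<lambda>i. emeasure lborel (A i)"] by (simp add: o_def)
    finally show ?thesis .
  qed
  show "distr M M (\<lambda>t. t \<circ> \<sigma>) = M"
    using P.PiM_eqI[of "{..<n}" "distr M M (\<lambda>t. t \<circ> \<sigma>)"] boxes by (simp add: M_def)
qed

text \<open>All permutations of the variables give the same integral over the cube, so n! times the
  integral is that of the symmetrised integrand.\<close>

lemma cube_integral_zero:
  fixes F :: "(nat \<Rightarrow> real) \<Rightarrow> complex"
  assumes F: "\<And>t. t \<in> Pi\<^sub>E {..<n} (\<lambda>_. {0..1}) \<Longrightarrow> (\<Sum>\<sigma> | \<sigma> permutes {..<n}. F (t \<circ> \<sigma>)) = 0"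
  shows "set_lebesgue_integral (Pi\<^sub>M {..<n} (\<lambda>_. lborel)) (Pi\<^sub>E {..<n} (\<lambda>_. {0..1})) F = 0"
proof -
  define M where "M = Pi\<^sub>M {..<n} (\<lambda>_. lborel :: real measure)"
  define C where "C = Pi\<^sub>E {..<n} (\<lambda>_. {0..1::real})"
  define g where "g t = indicator C t *\<^sub>R F t" for t
  define S where "S = {\<sigma>. \<sigma> permutes {..<n}}"
  have S: "finite S" "id \<in> S" using finite_permutations[of "{..<n}"] permutes_id by (auto simp: S_def)
  have inC: "t \<circ> \<sigma> \<in> C" if "t \<in> C" "\<sigma> \<in> S" for t \<sigma>
    using that permutes_in_image[of \<sigma> "{..<n}"] permutes_not_in[of \<sigma> "{..<n}"]
    by (fastforce simp: C_def S_def PiE_def extensional_def Pi_def)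
  have iff: "t \<circ> \<sigma> \<in> C \<longleftrightarrow> t \<in> C" if "\<sigma> \<in> S" for t \<sigma>
  proof
    assume "t \<circ> \<sigma> \<in> C"
    then have "(t \<circ> \<sigma>) \<circ> inv \<sigma> \<in> C" using that by (rule_tac inC) (auto simp: S_def permutes_inv)
    moreover have "(t \<circ> \<sigma>) \<circ> inv \<sigma> = t"
      using that permutes_inv_o(1)[of \<sigma> "{..<n}"] by (simp only: S_def mem_Collect_eq comp_assoc) simp
    ultimately show "t \<in> C" by (simp only:)
  qed (use inC that in auto)
  have sum0: "(\<Sum>\<sigma>\<in>S. g (t \<circ> \<sigma>)) = 0" for t
  proof (cases "t \<in> C")
    case True
    then show ?thesis using F[of t] by (simp add: g_def iff S_def C_def cong: sum.cong) (simp add: S_def[symmetric] C_def[symmetric] inC)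
  next
    case False
    then show ?thesis by (simp add: g_def iff)
  qed
  have "integral\<^sup>L M g = 0"
  proof (cases "integrable M g")
    case True
    have *: "integrable M (\<lambda>t. g (t \<circ> \<sigma>))" "integral\<^sup>L M (\<lambda>t. g (t \<circ> \<sigma>)) = integral\<^sup>L M g" if "\<sigma> \<in> S" for \<sigma>
    proof -
      have \<sigma>: "\<sigma> permutes {..<n}" using that by (simp add: S_def)
      note d = distr_PiM_permute[OF \<sigma>, folded M_def]
      show "integrable M (\<lambda>t. g (t \<circ> \<sigma>))"
        using integrable_distr[OF d(1), of g] d(2) True by simp
      show "integral\<^sup>L M (\<lambda>t. g (t \<circ> \<sigma>)) = integral\<^sup>L M g"
        using integral_distr[OF d(1), of g] d(2) True by simp
    qed
    have "of_nat (card S) * integral\<^sup>L M g = (\<Sum>\<sigma>\<in>S. integral\<^sup>L M (\<lambda>t. g (t \<circ> \<sigma>)))"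
      using * by simp
    also have "\<dots> = integral\<^sup>L M (\<lambda>t. \<Sum>\<sigma>\<in>S. g (t \<circ> \<sigma>))"
      using * by (intro Bochner_Integration.integral_sum[symmetric])
    also have "\<dots> = 0" unfolding sum0 by simp
    finally show ?thesis using S by auto
  \<comment> \<open>Without integrability the Bochner integral is 0 by definition.\<close>
  qed (rule not_integrable_integral_eq)
  then show ?thesis unfolding set_lebesgue_integral_def g_def M_def C_def .
qed

lemma charge_mult_assoc: "(A \<odot> B) \<odot> C = A \<odot> (B \<odot> C)"
  by (simp add: charge_mult_def add.assoc mult.assoc diff_diff_add algebra_simps)

lemma charge_prod_simps: "charge_prod [] = (0, \<lambda>_ _. 1)" "charge_prod (A # As) = A \<odot> charge_prod As"
  by (simp_all add: charge_prod_def)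

lemma charge_prod_append: "charge_prod (As @ Bs) = charge_prod As \<odot> charge_prod Bs"
  by (induction As) (simp_all add: charge_prod_simps charge_mult_assoc, simp add: charge_mult_def)

section \<open>Products of BRST charges\<close>

context brst_parameters
begin

interpretation th: theta_function "rpar L - 1" "pi / ln x" "of_real (exp (- (pi\<^sup>2 / ((rpar L - 1) * ln x))))" "br L x"
  by (rule br_theta_function)

abbreviation (input) om12 :: "complex \<Rightarrow> complex" where "om12 \<equiv> th.om (1/2)"

lemma br_zero_Re:
  assumes "br L x u = 0"
  shows "\<exists>m::int. Re u * real (L + 2) = real_of_int (m * int L)"
proof -
  obtain m n :: int where "u = of_int m * of_real (rpar L - 1) + of_int n * (\<i> * of_real (pi / ln x))"
    using assms br_zero_iff by blast
  then have "Re u = of_int m * (rpar L - 1)" by simp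
  then show ?thesis unfolding rho_eq by (intro exI[of _ m]) (simp add: field_simps)
qed

text \<open>A zero would give k (L + 2) = 2 m L, whose two sides differ in parity.\<close>

lemma br_half_odd_nz:
  assumes "Re u = real_of_int k / 2" "odd k"
  shows "br L x u \<noteq> 0"
proof
  assume "br L x u = 0"
  then obtain m :: int where "Re u * real (L + 2) = real_of_int (m * int L)" using br_zero_Re by blast
  then have "real_of_int (k * (int L + 2)) = real_of_int (2 * (m * int L))" unfolding assms(1) by (simp add: algebra_simps)
  then have "k * (int L + 2) = 2 * (m * int L)" by (simp only: of_int_eq_iff)
  then have "even (k * (int L + 2))" by simp
  then show False using assms(2) L by simp
qed

text \<open>A zero would give k (L + 2) = m L, so L divides 2 k and, being odd, divides k.\<close>

lemma br_int_nz:
  assumes "Re u = real k" "1 \<le> k" "k < L"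
  shows "br L x u \<noteq> 0"
proof
  assume "br L x u = 0"
  then obtain m :: int where "Re u * real (L + 2) = real_of_int (m * int L)" using br_zero_Re by blast
  then have "real_of_int (int k * (int L + 2)) = real_of_int (m * int L)" unfolding assms(1) by (simp add: algebra_simps)
  then have "int k * (int L + 2) = m * int L" by (simp only: of_int_eq_iff)
  then have "int k * 2 = int L * (m - int k)" by (simp add: algebra_simps)
  then have "int L dvd int k * 2" by simp
  moreover have "coprime (int L) 2" using L by simp
  ultimately have "int L dvd int k" by (simp add: coprime_dvd_mult_left_iff)
  then show False using assms zdvd_imp_le[of "int L" "int k"] by simp
qed

lemma norm_zpow_1: "norm (zpow x u 1) = exp (2 * ln x * Re u)"
  by (simp add: zpow_exp)

lemma norm_zpow_1_iff: "norm (zpow x u 1) = 1 \<longleftrightarrow> Re u = 0"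
  using ln_x by (simp add: norm_zpow_1)

lemma om_nz: "Re v = 0 \<Longrightarrow> om12 v \<noteq> 0"
  unfolding th.om_def using br_int_nz[of "v + 1" 1] br_half_odd_nz[of "v - 1/2" "- 1"] L by simp

text \<open>Once the factors with denominators are cancelled, both sides contain the same infinite
  products, collected in B. What remains are rational factors in ratio - w^3 and exponentials whose
  quadratic exponents compensate w^3. The hypotheses put w on the unit circle, where the
  denominators are nonzero.\<close>

lemma pair_factor_exchange:
  assumes u: "Re u = 0" "Re v = 0"
  shows "pair_factor u v * om12 (v - u) = - (pair_factor v u * om12 (u - v))"
proof -
  let ?q = "qpoch Pc" and ?\<rho> = "complex_of_real (rpar L - 1)"
  define s where "s = v - u"
  define w where "w = zpow x s 1"
  have w0: "w \<noteq> 0" using zpow_nz by (simp add: w_def)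
  have wn: "norm w = 1" using u by (simp add: w_def s_def norm_zpow_1_iff)
  have x0: "xc \<noteq> 0" using x by simp
  note nz = contr_denom_nz[of w] contr_denom_nz[of "1 / w"]
  have nz: "?q (w / xc) \<noteq> 0" "?q (Pc * xc\<^sup>2 * w) \<noteq> 0" "?q (1 / (xc * w)) \<noteq> 0" "?q (Pc * xc\<^sup>2 / w) \<noteq> 0"
    using nz wn by (simp_all add: norm_divide mult.commute)
  define X where "X a = exp (of_real (ln x) * (a\<^sup>2 / ?\<rho> - a))" for a
  have brX: "br L x a = X a * (?q (zpow x a 1) * ?q (Pc / zpow x a 1) * ?q Pc)" for a
    by (simp add: br_def Theta_def xpow_exp X_def)
  have xz: "zpow x 1 1 = xc\<^sup>2" "zpow x (- 1 / 2) 1 = 1 / xc" "zpow x (- s) 1 = 1 / w"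
  proof -
    show "zpow x 1 1 = xc\<^sup>2" using x by (simp add: zpow_exp exp_double exp_of_real)
    show "zpow x (- 1 / 2) 1 = 1 / xc" using x by (simp add: zpow_exp exp_minus exp_of_real field_simps)
    show "zpow x (- s) 1 = 1 / w" by (simp add: zpow_minus w_def)
  qed
  have z: "zpow x (s + 1) 1 = xc\<^sup>2 * w" "zpow x (s + - 1 / 2) 1 = w / xc"
    "zpow x (- s + 1) 1 = xc\<^sup>2 / w" "zpow x (- s + - 1 / 2) 1 = 1 / (xc * w)"
    unfolding zpow_add xz w_def[symmetric] by simp_all
  have om1: "om12 s = X (s + 1) * (?q (xc\<^sup>2 * w) * ?q (Pc / (xc\<^sup>2 * w)) * ?q Pc) *
     (X (s + - 1 / 2) * (?q (w / xc) * ?q (Pc / (w / xc)) * ?q Pc))"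
    unfolding th.om_def z[symmetric] brX[symmetric] by simp
  have om2: "om12 (- s) = X (- s + 1) * (?q (xc\<^sup>2 / w) * ?q (Pc / (xc\<^sup>2 / w)) * ?q Pc) *
     (X (- s + - 1 / 2) * (?q (1 / (xc * w)) * ?q (Pc / (1 / (xc * w))) * ?q Pc))"
    unfolding th.om_def z[symmetric] brX[symmetric] by simp
  have rec: "?q a = (1 - a) * ?q (Pc * a)" for a by (rule qpoch_rec)
  define c where "c = rpar L / (rpar L - 1)"
  define B where "B = ?q (Pc * (w / xc\<^sup>2)) * ?q (Pc * xc * w) * ?q (Pc / (xc\<^sup>2 * w)) * ?q (Pc * xc / w) * (?q Pc * ?q Pc)"
  have comb: "y = - y'" if "y = E1 * F1 * B'" "y' = E2 * F2 * B'" "F1 = - W * F2" "E1 * W = E2" for y y' E1 E2 F1 F2 B' W :: complex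
    using that by (simp add: mult_ac)
  have "pair_factor u v * om12 s = zpow x u c * (X (s + 1) * X (s + - 1 / 2)) * ((1 - w) * (1 - xc\<^sup>2 * w) * (1 - w / xc\<^sup>2)) * B"
  proof -
    have "pair_factor u v * om12 s = zpow x u c * ((1 - w) * ((1 - w / xc\<^sup>2) * ?q (Pc * (w / xc\<^sup>2))) * ?q (Pc * xc * w) / (?q (w / xc) * ?q (Pc * xc\<^sup>2 * w))) *
      (X (s + 1) * ((1 - xc\<^sup>2 * w) * ?q (Pc * xc\<^sup>2 * w) * ?q (Pc / (xc\<^sup>2 * w)) * ?q Pc) *
      (X (s + - 1 / 2) * (?q (w / xc) * ?q (Pc * xc / w) * ?q Pc)))"
      unfolding om1 pair_factor_def contr_def c_def[symmetric] s_def[symmetric] w_def[symmetric]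
        rec[of "w / xc\<^sup>2"] rec[of "xc\<^sup>2 * w"] by (simp add: mult.assoc)
    also have "\<dots> = zpow x u c * (X (s + 1) * X (s + - 1 / 2)) * ((1 - w) * (1 - xc\<^sup>2 * w) * (1 - w / xc\<^sup>2)) * B *
       (?q (w / xc) / ?q (w / xc)) * (?q (Pc * xc\<^sup>2 * w) / ?q (Pc * xc\<^sup>2 * w))"
      unfolding B_def by (simp only: divide_inverse inverse_mult_distrib mult_ac)
    finally show ?thesis by (simp only: divide_self[OF nz(1)] divide_self[OF nz(2)] mult_1_right)
  qed
  moreover have "pair_factor v u * om12 (- s) = zpow x v c * (X (- s + 1) * X (- s + - 1 / 2)) * ((1 - 1 / w) * (1 - 1 / (xc\<^sup>2 * w)) * (1 - xc\<^sup>2 / w)) * B"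
  proof -
    have sw: "zpow x (u - v) 1 = 1 / w" using xz(3) by (simp add: s_def)
    have "pair_factor v u * om12 (- s) = zpow x v c * ((1 - 1 / w) * ((1 - 1 / (xc\<^sup>2 * w)) * ?q (Pc / (xc\<^sup>2 * w))) * ?q (Pc * xc / w) / (?q (1 / (xc * w)) * ?q (Pc * xc\<^sup>2 / w))) *
      (X (- s + 1) * ((1 - xc\<^sup>2 / w) * ?q (Pc * xc\<^sup>2 / w) * ?q (Pc * (w / xc\<^sup>2)) * ?q Pc) *
      (X (- s + - 1 / 2) * (?q (1 / (xc * w)) * ?q (Pc * xc * w) * ?q Pc)))"
      unfolding om2 pair_factor_def contr_def c_def[symmetric] sw
        rec[of "xc\<^sup>2 / w"] using rec[of "1 / (xc\<^sup>2 * w)"] by (simp add: mult.assoc mult.commute[of w])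
    also have "\<dots> = zpow x v c * (X (- s + 1) * X (- s + - 1 / 2)) * ((1 - 1 / w) * (1 - 1 / (xc\<^sup>2 * w)) * (1 - xc\<^sup>2 / w)) * B *
       (?q (1 / (xc * w)) / ?q (1 / (xc * w))) * (?q (Pc * xc\<^sup>2 / w) / ?q (Pc * xc\<^sup>2 / w))"
      unfolding B_def by (simp only: divide_inverse inverse_mult_distrib mult_ac)
    finally show ?thesis by (simp only: divide_self[OF nz(3)] divide_self[OF nz(4)] mult_1_right)
  qed
  moreover have "(1 - w) * (1 - xc\<^sup>2 * w) * (1 - w / xc\<^sup>2) = - (w ^ 3) * ((1 - 1 / w) * (1 - 1 / (xc\<^sup>2 * w)) * (1 - xc\<^sup>2 / w))"
    using w0 x0 by (simp add: divide_simps) (simp add: algebra_simps power2_eq_square power3_eq_cube)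
  moreover have "zpow x u c * (X (s + 1) * X (s + - 1 / 2)) * w ^ 3 = zpow x v c * (X (- s + 1) * X (- s + - 1 / 2))"
  proof -
    define R where "R = ?\<rho>"
    have R0: "R \<noteq> 0" using rho_bounds by (simp add: R_def of_real_eq_0_iff del: of_real_diff)
    have "rpar L = (rpar L - 1) + 1" by simp
    then have "c = ((rpar L - 1) + 1) / (rpar L - 1)" unfolding c_def by metis
    then have cR: "of_real c = (R + 1) / R" by (simp only: R_def of_real_divide of_real_add of_real_1)
    have w3: "w ^ 3 = exp (of_nat 3 * (2 * of_real (ln x) * s * of_real 1))"
      unfolding w_def zpow_exp exp_of_nat_mult ..
    show ?thesis
      unfolding w3 X_def zpow_exp exp_add[symmetric] cR R_def[symmetric]
      by (rule arg_cong[where f=exp]) (use R0 in \<open>simp add: s_def field_simps power2_eq_square\<close>)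
  qed
  ultimately have "pair_factor u v * om12 s = - (pair_factor v u * om12 (- s))"
    by (rule comb)
  then show ?thesis by (simp add: s_def)
qed

lemma pair_ratio_antisym:
  assumes "Re u = 0" "Re v = 0"
  shows "pair_factor v u / om12 (v - u) = - (pair_factor u v / om12 (u - v))"
  using pair_factor_exchange[OF assms] om_nz[of "u - v"] om_nz[of "v - u"] assms
  by (simp add: divide_simps)

text \<open>\<open>None\<close> stands for \<open>Q1\<close> and \<open>Some a\<close> for
  \<open>Q2\<close> with index a, so that a product of charges and its word of blocks are read off
  from the same list.\<close>

abbreviation letter_charge :: "nat option \<Rightarrow> charge" where
  "letter_charge \<equiv> case_option (Q1 L x) (Q2 L x)"

abbreviation letter_block :: "nat option \<Rightarrow> block" where
  "letter_block \<equiv> case_option th.b1 (\<lambda>a. th.b2 (1/2) (of_nat a))"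

lemma fst_letter: "fst (letter_charge c) = fst (letter_block c)"
  by (cases c) (simp_all add: Q1_def Q2_def)

lemma snd_letter:
  assumes "\<And>i j. i < j \<Longrightarrow> j < fst (letter_block c) \<Longrightarrow> om12 (u i - u j) \<noteq> 0"
  shows "snd (letter_charge c) l u * (\<Prod>i<fst (letter_block c). \<Prod>j\<in>{i<..<fst (letter_block c)}. om12 (u i - u j)) =
     (\<Prod>i<fst (letter_block c). 1 / br L x (u i + 1/2)) * snd (letter_block c) (\<lambda>i. u i + of_int l / 2)"
proof (cases c)
  case None
  have "{0<..<1::nat} = {}" by auto
  then show ?thesis using None by (simp add: Q1_def th.b1_def)
next
  case (Some a)
  have om: "om12 (u 0 - u 1) \<noteq> 0" using assms[of 0 1] Some by simp
  have e: "{..<2::nat} = {0, 1}" "{0<..<2::nat} = {1}" "{1<..<2::nat} = {}" "{Suc 0<..<2} = {}" by auto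
  have s: "snd (letter_block c) (\<lambda>i. u i + of_int l / 2) = br L x (u 0 - u 1) * f2 L x a (u 0 + of_int l / 2) (u 1 + of_int l / 2)"
    using Some by (simp add: th.b2_def f2_def)
  have o: "br L x (u 0 - u 1 + 1) * br L x (u 0 - u 1 - 1/2) = om12 (u 0 - u 1)" by (simp add: th.om_def)
  have q: "snd (letter_charge c) l u = 1 / (br L x (u 0 + 1/2) * br L x (u 1 + 1/2))
        * (br L x (u 0 - u 1) / om12 (u 0 - u 1)) * f2 L x a (u 0 + of_int l / 2) (u 1 + of_int l / 2)"
    unfolding o[symmetric] using Some by (simp add: Q2_def)
  have n2: "fst (letter_block c) = 2" using Some by simp
  show ?thesis unfolding n2 q s using om by (simp add: e)
qed

lemma fst_charge_word: "fst (charge_prod (map letter_charge ls)) = arity (map letter_block ls)"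
  by (induction ls) (simp_all add: charge_prod_simps charge_mult_def fst_letter)

text \<open>With m currents on the right the operator l-hat takes the value l - 2 m, which lowers u
  + l / 2 by m; this is the shift 2 h m of \<open>kernel\<close> at h = 1/2. Factors
  \<open>om\<close> within a letter cancel its denominator, those between letters remain.\<close>

lemma snd_charge_word:
  assumes "\<And>i j. i < j \<Longrightarrow> j < arity (map letter_block ls) \<Longrightarrow> om12 (u i - u j) \<noteq> 0"
  shows "snd (charge_prod (map letter_charge ls)) l u * (\<Prod>i<arity (map letter_block ls). \<Prod>j\<in>{i<..<arity (map letter_block ls)}. om12 (u i - u j)) =
     (\<Prod>i<arity (map letter_block ls). 1 / br L x (u i + 1/2)) * th.kernel (1/2) (map letter_block ls) (\<lambda>i. u i + of_int l / 2)"
  using assms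
proof (induction ls arbitrary: u)
  case Nil
  then show ?case by (simp add: charge_prod_simps)
next
  case (Cons c ls)
  define k m where "k = fst (letter_block c)" and "m = arity (map letter_block ls)"
  have n: "arity (map letter_block (c # ls)) = k + m" by (simp add: k_def m_def)
  have om: "om12 (u i - u j) \<noteq> 0" if "i < j" "j < k + m" for i j using Cons.prems that unfolding n by blast
  have 1: "snd (letter_charge c) (l - 2 * int m) u * (\<Prod>i<k. \<Prod>j\<in>{i<..<k}. om12 (u i - u j)) =
     (\<Prod>i<k. 1 / br L x (u i + 1/2)) * snd (letter_block c) (\<lambda>i. u i + of_int (l - 2 * int m) / 2)"
    unfolding k_def by (rule snd_letter) (use om k_def in auto)
  have 2: "snd (charge_prod (map letter_charge ls)) l (\<lambda>i. u (k + i)) * (\<Prod>i<m. \<Prod>j\<in>{i<..<m}. om12 (u (k + i) - u (k + j))) =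
     (\<Prod>i<m. 1 / br L x (u (k + i) + 1/2)) * th.kernel (1/2) (map letter_block ls) (\<lambda>i. u (k + i) + of_int l / 2)"
    unfolding m_def by (rule Cons.IH) (use om m_def in auto)
  have s: "snd (charge_prod (map letter_charge (c # ls))) l u = snd (letter_charge c) (l - 2 * int m) u * snd (charge_prod (map letter_charge ls)) l (\<lambda>i. u (k + i))"
    by (simp add: charge_prod_simps charge_mult_def fst_charge_word fst_letter k_def m_def)
  have b: "(\<Prod>i<k + m. 1 / br L x (u i + 1/2)) = (\<Prod>i<k. 1 / br L x (u i + 1/2)) * (\<Prod>i<m. 1 / br L x (u (k + i) + 1/2))"
    using prod_lessThan_add[of "\<lambda>i. 1 / br L x (u i + 1/2)" k m] by simp
  have shift: "(\<lambda>i. u i + of_int l / 2 - 2 * (1/2) * of_nat m) = (\<lambda>i. u i + of_int (l - 2 * int m) / 2)"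
    by (simp add: diff_divide_distrib add_diff_eq)
  have K: "th.kernel (1/2) (map letter_block (c # ls)) (\<lambda>i. u i + of_int l / 2) =
     snd (letter_block c) (\<lambda>i. u i + of_int (l - 2 * int m) / 2) * th.kernel (1/2) (map letter_block ls) (\<lambda>i. u (k + i) + of_int l / 2) *
       (\<Prod>i<k. \<Prod>j<m. om12 (u i - u (k + j)))"
    unfolding list.map th.kernel.simps m_def[symmetric] k_def[symmetric] shift by simp
  have arr: "(a * b) * (c * d * e) = (a * c) * (b * e) * d" for a b c d e :: complex by simp
  show ?case unfolding n s prod_pairs_add arr 1 2 b K by (simp only: mult_ac)
qed

lemma matrix_fn_permute:
  assumes "\<sigma> permutes {..<n}"
  shows "matrix_fn n \<phi> \<mu> (u \<circ> \<sigma>) = matrix_fn n \<phi> \<mu> u"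
proof -
  have "(\<Sum>j<n. f (u (\<sigma> j))) = (\<Sum>j<n. f (u j))" for f :: "complex \<Rightarrow> complex"
    using sum.permute[OF assms, of "\<lambda>j. f (u j)"] by (simp add: o_def)
  from this[of "\<lambda>v. creation_coeff x v i" for i] this[of "\<lambda>v. annihilation_coeff L x v i" for i]
  show ?thesis by (simp add: matrix_fn_def)
qed

lemma zpow_circ: "norm (zpow x (circ x t) 1) = 1"
  unfolding norm_zpow_1_iff by (simp add: circ_def)

text \<open>Summed over all permutations the integrand is C A N, with C symmetric and A
  antisymmetric in the variables. The shift by l / 2 is common to all variables and so commutes with
  permutations.\<close>

theorem charge_word_zero:
  assumes N: "\<And>v. th.N (1/2) (map letter_block ls) v = 0"
  shows "charge_op L x (charge_prod (map letter_charge ls)) l k \<phi> = (\<lambda>_. 0)"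
proof
  fix \<mu>
  define n where "n = arity (map letter_block ls)"
  define F where "F t = mero_cont n x (\<lambda>u. xplus_prod L x l k (map u [0..<n]) \<phi> \<mu>) (\<lambda>i. circ x (t i))
            * snd (charge_prod (map letter_charge ls)) l (\<lambda>i. circ x (t i))" for t :: "nat \<Rightarrow> real"
  have "(\<Sum>\<sigma> | \<sigma> permutes {..<n}. F (t \<circ> \<sigma>)) = 0" for t
  proof -
    define u where "u i = circ x (t i)" for i
    define C where "C u = (\<Prod>i<n. zpow x (u i) (current_exponent l k)) * matrix_fn n \<phi> \<mu> u * (\<Prod>i<n. 1 / br L x (u i + 1/2))" for u
    define G where "G u i j = pair_factor (u i) (u j) / om12 (u i - u j)" for u :: "nat \<Rightarrow> complex" and i j
    define A where "A u = (\<Prod>i<n. \<Prod>j\<in>{i<..<n}. G u i j)" for u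
    have Fu: "F s = C v * A v * th.kernel (1/2) (map letter_block ls) (\<lambda>i. v i + of_int l / 2)"
      if v: "v = (\<lambda>i. circ x (s i))" for s v
    proof -
      have Re: "Re (v i) = 0" for i by (simp add: v circ_def)
      have om: "om12 (v i - v j) \<noteq> 0" for i j by (rule om_nz) (simp add: Re)
      have "(\<Prod>i<n. \<Prod>j\<in>{i<..<n}. pair_factor (v i) (v j)) = (\<Prod>i<n. \<Prod>j\<in>{i<..<n}. G v i j * om12 (v i - v j))"
        using om by (simp add: G_def)
      also have "\<dots> = A v * (\<Prod>i<n. \<Prod>j\<in>{i<..<n}. om12 (v i - v j))" by (simp add: A_def prod.distrib)
      finally have pf: "(\<Prod>i<n. \<Prod>j\<in>{i<..<n}. pair_factor (v i) (v j)) = A v * (\<Prod>i<n. \<Prod>j\<in>{i<..<n}. om12 (v i - v j))" .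
      have "F s = (\<Prod>i<n. zpow x (v i) (current_exponent l k)) * (A v * (\<Prod>i<n. \<Prod>j\<in>{i<..<n}. om12 (v i - v j))) * matrix_fn n \<phi> \<mu> v *
          snd (charge_prod (map letter_charge ls)) l v"
        unfolding F_def v[symmetric] pf[symmetric] by (subst mero_cont_currents) (simp_all add: v zpow_circ)
      also have "\<dots> = (\<Prod>i<n. zpow x (v i) (current_exponent l k)) * A v * matrix_fn n \<phi> \<mu> v *
          (snd (charge_prod (map letter_charge ls)) l v * (\<Prod>i<n. \<Prod>j\<in>{i<..<n}. om12 (v i - v j)))" by (simp only: mult_ac)
      also have "snd (charge_prod (map letter_charge ls)) l v * (\<Prod>i<n. \<Prod>j\<in>{i<..<n}. om12 (v i - v j)) =
          (\<Prod>i<n. 1 / br L x (v i + 1/2)) * th.kernel (1/2) (map letter_block ls) (\<lambda>i. v i + of_int l / 2)"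
        unfolding n_def by (rule snd_charge_word) (rule om)
      finally show ?thesis unfolding C_def by (simp only: mult_ac)
    qed
    have "F (t \<circ> \<sigma>) = C u * A u * (of_int (sign \<sigma>) * th.kernel (1/2) (map letter_block ls) ((\<lambda>i. u i + of_int l / 2) \<circ> \<sigma>))"
      if \<sigma>: "\<sigma> permutes {..<n}" for \<sigma>
    proof -
      have "C (u \<circ> \<sigma>) = C u"
        using prod.permute[OF \<sigma>, of "\<lambda>i. zpow x (u i) (current_exponent l k)"] prod.permute[OF \<sigma>, of "\<lambda>i. 1 / br L x (u i + 1/2)"]
        unfolding C_def matrix_fn_permute[OF \<sigma>] by (simp only: o_def)
      moreover have "A (u \<circ> \<sigma>) = of_int (sign \<sigma>) * A u"
      proof -
        have "G u j i = - G u i j" for i j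
          unfolding G_def by (rule pair_ratio_antisym) (simp_all add: u_def circ_def)
        from prod_pairs_permute[OF this \<sigma>] show ?thesis unfolding A_def by (simp add: G_def)
      qed
      moreover have "F (t \<circ> \<sigma>) = C (u \<circ> \<sigma>) * A (u \<circ> \<sigma>) * th.kernel (1/2) (map letter_block ls) (\<lambda>i. (u \<circ> \<sigma>) i + of_int l / 2)"
        by (rule Fu) (auto simp: u_def)
      ultimately show ?thesis by (simp add: o_def)
    qed
    then have "(\<Sum>\<sigma> | \<sigma> permutes {..<n}. F (t \<circ> \<sigma>)) = C u * A u * th.N (1/2) (map letter_block ls) (\<lambda>i. u i + of_int l / 2)"
      unfolding th.N_def alt_def n_def[symmetric] sum_distrib_left by (intro sum.cong) auto
    then show ?thesis using N by simp
  qed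
  then have "set_lebesgue_integral (Pi\<^sub>M {..<n} (\<lambda>_. lborel)) (Pi\<^sub>E {..<n} (\<lambda>_. {0..1})) F = 0"
    by (intro cube_integral_zero) blast
  then show "charge_op L x (charge_prod (map letter_charge ls)) l k \<phi> \<mu> = 0"
    unfolding charge_op_def fst_charge_word n_def[symmetric] F_def .
qed

text \<open>The letters of the two charges together are exactly those of \<open>full_word M\<close>
  with M = (L - 1) / 2. For odd l they stand in this order; for even l the part that contains
  \<open>Q1\<close> comes last.\<close>

theorem brst_product_zero:
  assumes l: "1 \<le> l" "l \<le> L - 1"
  shows "charge_op L x (Q L x l \<odot> Q L x (L - l)) l' k \<phi> = (\<lambda>_. 0)"
proof -
  define M where "M = (L - 1) div 2"
  have LM: "L = 2 * M + 1" "M \<ge> 1" using L by (auto simp: M_def elim: oddE)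
  interpret v: vanishing "rpar L - 1" "pi / ln x" "of_real (exp (- (pi\<^sup>2 / ((rpar L - 1) * ln x))))" "br L x" M
  proof
    show "M \<ge> 1" by (rule LM)
    show "br L x (of_nat k) \<noteq> 0" if "1 \<le> k" "k \<le> 2 * M" for k
      using that LM by (intro br_int_nz[of _ k]) auto
    show "br L x (1/2) \<noteq> 0" by (rule br_half_odd_nz[of _ 1]) auto
    show "br L x (3/2) \<noteq> 0" by (rule br_half_odd_nz[of _ 3]) auto
    \<comment> \<open>The number L is L + 2 times the period r - 1.\<close>
    have "real (2 * M + 1) = of_int (int (L + 2)) * (rpar L - 1)"
      unfolding LM(1)[symmetric] rho_eq by (simp add: field_simps)
    then have "of_nat (2 * M + 1) = complex_of_int (int (L + 2)) * of_real (rpar L - 1) + of_int 0 * (\<i> * of_real (pi / ln x))"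
      by (metis add.right_neutral mult_zero_left of_int_0 of_real_mult of_real_of_int_eq of_real_of_nat_eq)
    then show "br L x (of_nat (2 * M + 1)) = 0" unfolding br_zero_iff by blast
  qed
  have main: "charge_op L x (charge_prod (map letter_charge ls) \<odot> charge_prod (map letter_charge ls')) l' k \<phi> = (\<lambda>_. 0)"
    if "\<And>u. th.N (1/2) (map letter_block (ls @ ls')) u = 0" for ls ls'
    using charge_word_zero[OF that, of l' k \<phi>] by (simp add: charge_prod_append)
  have Qo: "Q L x n = charge_prod (map letter_charge (None # map Some [1..<n div 2 + 1]))" if "odd n" for n
    using that by (simp add: Q_def Let_def o_def)
  have Qe: "Q L x n = charge_prod (map letter_charge (map Some [(L + 1) div 2 - n div 2..<(L + 1) div 2]))" if "even n" for n
    using that by (simp add: Q_def Let_def o_def)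
  have fw: "th.full_word M = map letter_block (None # map Some [1..<n div 2 + 1]) @
      map letter_block (map Some [(L + 1) div 2 - (L - n) div 2..<(L + 1) div 2])" if "odd n" "n \<le> L" for n
  proof -
    \<comment> \<open>The indices of the even charge start where those of the odd one end.\<close>
    have d: "(L + 1) div 2 = M + 1" "(L + 1) div 2 - (L - n) div 2 = n div 2 + 1" "n div 2 + 1 \<le> M + 1"
      using that L LM by (auto elim!: oddE)
    have "[1..<n div 2 + 1] @ [n div 2 + 1..<M + 1] = [1..<M + 1]"
      using upt_add_eq_append[of 1 "n div 2 + 1" "M - n div 2"] d(3) by simp
    then show ?thesis unfolding d(2) unfolding d(1) th.full_word_def by (simp only: list.map map_append[symmetric] append_Cons map_map o_def option.case)
  qed
  show ?thesis
  proof (cases "odd l")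
    case True
    then have e: "even (L - l)" using L l by simp
    show ?thesis unfolding Qo[OF True] Qe[OF e]
      by (rule main) (use v.full_word_vanishes fw[of l] True l in simp)
  next
    case False
    then have e: "even l" by simp
    from False have o: "odd (L - l)" using L l by simp
    have "L - (L - l) = l" using l by simp
    then show ?thesis unfolding Qo[OF o] Qe[OF e]
      by (intro main) (use v.split_word_vanishes[OF fw[of "L - l"]] o l in simp)
  qed
qed

end

theorem proposition3p2:
  fixes L l :: nat and l' k :: int and x :: real
  assumes "odd L" and "L \<ge> 3"
    and "0 < x" and "x < 1"
    and "1 \<le> l" and "l \<le> L - 1"
    and "odd l'" and "[l' = int l] (mod int L)"
  shows "\<forall>\<phi> :: fock. charge_op L x (Q L x l \<odot> Q L x (L - l)) l' k \<phi> = (\<lambda>_. 0)"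
proof -
  interpret brst_parameters L x by unfold_locales (rule assms)+
  show ?thesis using brst_product_zero assms(5,6) by blast
qed

end
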